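(* Let $\mathsf T$ be a thermodynamically consistent open continuum thermodynamic system on $\Omega$, let $u$ be a smooth admissible trajectory of $\mathsf T$, and let $G\subseteq\Omega$ be a Lipschitz subdomain. Then $$\frac{d}{dt}\mathcal F_G[u(t)]=-\mathcal D_G[u(t)]+\mathcal B_G^{\mathrm{ext}}[u(t)]+\mathcal B_G^{\mathrm{int}}[u(t)]+\mathcal S_G[u(t)].$$
   Context: Let $\Omega\subset\mathbb R^d$ be a bounded Lipschitz domain with outward unit normal $n$, let $U\subset\mathbb R^m$ be nonempty, open and convex, and let $\psi:\overline\Omega\times U\to\mathbb R$ be a $C^2$ storage density such that $u\mapsto\psi(x,u)$ is convex on $U$ for each $x\in\overline\Omega$. The admissible field space is $\mathcal X:=\{u\in H^1(\Omega;\mathbb R^m): u(x)\in U\text{ for a.e. }x\in\Omega,\ \psi(\cdot,u(\cdot))\in L^1(\Omega)\}$. The free energy is $\mathcal F[u]:=\int_\Omega\psi(x,u(x))\,dx$, and the thermodynamic potential is $\mu[u](x):=D_u\psi(x,u(x))$. An open constitutive structure consists of: a reversible flux $J^{\mathrm{rev}}:\mathcal X\to L^1(\Omega;\mathbb R^{m\times d})$; a dissipative flux $J^{\mathrm{diss}}:\mathcal X\to L^1(\Omega;\mathbb R^{m\times d})$; a source $R:\mathcal X\to L^1(\Omega;\mathbb R^m)$; boundary port spaces $Y_e,Y_f$, trace maps $e:\mathcal X\to Y_e$, $f:\mathcal X\to Y_f$, and a continuous duality pairing $\langle\cdot,\cdot\rangle_Y:Y_e\times Y_f\to\mathbb R$.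 The boundary exchange is $\mathcal B[u]:=\langle e[u],f[u]\rangle_Y$. Divergences of $\mathbb R^{m\times d}$-valued fields are taken row-wise. The structure is thermodynamically admissible if there exist maps $q^{\mathrm{rev}},q^{\mathrm{diss}}:\mathcal X\to L^1(\Omega;\mathbb R^d)$ and $\sigma:\mathcal X\to L^1(\Omega)$ such that for every sufficiently smooth $u\in\mathcal X$: (1) $\mu[u]\cdot\operatorname{div}J^{\mathrm{rev}}[u]=\operatorname{div}q^{\mathrm{rev}}[u]$ in $\mathscr D'(\Omega)$; (2) $\mu[u]\cdot\operatorname{div}J^{\mathrm{diss}}[u]=\operatorname{div}q^{\mathrm{diss}}[u]+\sigma[u]$ in $\mathscr D'(\Omega)$; (3) $\sigma[u](x)\ge0$ for a.e. $x\in\Omega$; (4) $-\int_{\partial\Omega}(q^{\mathrm{rev}}[u]+q^{\mathrm{diss}}[u])\cdot n\,dS=\mathcal B[u]$; and the source contribution $\mathcal S[u]:=\int_\Omega\mu[u]\cdot R[u]\,dx$ is finite. The dissipation is $\mathcal D[u]:=\int_\Omega\sigma[u]\,dx$. Write $q:=q^{\mathrm{rev}}+q^{\mathrm{diss}}$. An open continuum thermodynamic system is a tuple $\mathsf T=(\Omega,U,\mathcal X,\psi,\mu,J^{\mathrm{rev}},J^{\mathrm{diss}},R,Y_e,Y_f,e,f)$ in which $\Omega$ is a bounded Lipschitz domain, $U$ is a nonempty open convex state set, $\psi$ is a $C^2$ storage density convex in its second argument, $\mathcal X$ is the admissible field space and $\mu$ the thermodynamic potential determined by $(\Omega,U,\psi)$,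 and $J^{\mathrm{rev}},J^{\mathrm{diss}},R,Y_e,Y_f,e,f$ (with the pairing $\langle\cdot,\cdot\rangle_Y$) form a thermodynamically admissible open constitutive structure. A smooth admissible trajectory of $\mathsf T$ on $[0,T]$ is a map $u:[0,T]\to\mathcal X$ that is sufficiently regular in space and time for all terms in the evolution equation $\partial_tu+\operatorname{div}(J^{\mathrm{rev}}[u]+J^{\mathrm{diss}}[u])=R[u]$, in the boundary exchange $\mathcal B[u]$, in the thermodynamic admissibility conditions on $q^{\mathrm{rev}}[u],q^{\mathrm{diss}}[u],\sigma[u]$, and in the source contribution $\mathcal S[u]$ to be meaningful, and which satisfies almost everywhere $\partial_tu+\operatorname{div}(J^{\mathrm{rev}}[u]+J^{\mathrm{diss}}[u])=R[u]$ in $\Omega\times(0,T)$. $\mathsf T$ is thermodynamically consistent if every smooth admissible trajectory satisfies $\frac{d}{dt}\mathcal F[u(t)]=-\mathcal D[u(t)]+\mathcal B[u(t)]+\mathcal S[u(t)]$ for all $t\in[0,T]$. For a Lipschitz subdomain $G\subseteq\Omega$ with outward unit normal $n_G$, put $\Gamma_G^{\mathrm{ext}}:=\partial G\cap\partial\Omega$, $\Gamma_G^{\mathrm{int}}:=\partial G\cap\Omega$, and $\mathcal F_G[u(t)]:=\int_G\psi(x,u(x,t))\,dx$, $\mathcal D_G[u(t)]:=\int_G\sigma[u(t)]\,dx$, $\mathcal S_G[u(t)]:=\int_G\mu[u(t)]\cdot R[u(t)]\,dx$, $\mathcal B_G^{\mathrm{ext}}[u(t)]:=-\int_{\Gamma_G^{\mathrm{ext}}}q[u(t)]\cdot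 n_G\,dS$, $\mathcal B_G^{\mathrm{int}}[u(t)]:=-\int_{\Gamma_G^{\mathrm{int}}}q[u(t)]\cdot n_G\,dS$. *)

theory Defs
  imports "HOL-Analysis.Analysis"
begin

section \<open>Smoothness up to the boundary, gradients, distributions\<close>

text \<open>
  For an open set \<open>S\<close> this is the usual class of k times continuously differentiable functions.
  It is also meant for sets such as \<open>closure \<Omega>\<close>, \<open>closure \<Omega> \<times> U\<close> or \<open>{0..\<tau>} \<times> closure \<Omega>\<close> which lie
  in the closure of their interior: then it says that the derivatives up to order k exist in the
  interior and extend continuously to \<open>S\<close>.  Away from the interior \<open>f'\<close> is only constrained
  through its continuity on \<open>S\<close>.
\<close>
primrec Ck_on :: "nat \<Rightarrow> 'a::euclidean_space set \<Rightarrow> ('a \<Rightarrow> 'b::real_normed_vector) \<Rightarrow> bool" where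
  "Ck_on 0 S f \<longleftrightarrow> continuous_on S f"
| "Ck_on (Suc k) S f \<longleftrightarrow> continuous_on S f \<and>
     (\<exists>f'. (\<forall>x\<in>interior S. (f has_derivative f' x) (at x)) \<and>
           (\<forall>b\<in>Basis. Ck_on k S (\<lambda>x. f' x b)))"

definition grad :: "(real^'n::finite \<Rightarrow> real) \<Rightarrow> real^'n \<Rightarrow> real^'n" where
  "grad f x = (\<chi> i. frechet_derivative f (at x) (axis i 1))"

definition test_functions :: "(real^'n::finite) set \<Rightarrow> (real^'n \<Rightarrow> real) set" where
  "test_functions \<Omega> = {\<phi>. (\<forall>k. Ck_on k UNIV \<phi>) \<and>
     compact (closure {x. \<phi> x \<noteq> 0}) \<and> closure {x. \<phi> x \<noteq> 0} \<subseteq> \<Omega>}"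

definition locally_integrable :: "'a::euclidean_space set \<Rightarrow> ('a \<Rightarrow> 'b::euclidean_space) \<Rightarrow> bool" where
  "locally_integrable \<Omega> g \<longleftrightarrow> (\<forall>K. compact K \<and> K \<subseteq> \<Omega> \<longrightarrow> set_integrable lebesgue K g)"

definition distr_fun :: "(real^'n::finite) set \<Rightarrow> (real^'n \<Rightarrow> real) \<Rightarrow> (real^'n \<Rightarrow> real) \<Rightarrow> real" where
  "distr_fun \<Omega> g \<phi> = (LINT x:\<Omega>|lebesgue. g x * \<phi> x)"

definition distr_div :: "(real^'n::finite) set \<Rightarrow> (real^'n \<Rightarrow> real^'n) \<Rightarrow> (real^'n \<Rightarrow> real) \<Rightarrow> real" where
  "distr_div \<Omega> q \<phi> = - (LINT x:\<Omega>|lebesgue. q x \<bullet> grad \<phi> x)"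

definition has_weak_div ::
  "(real^'n::finite) set \<Rightarrow> (real^'n \<Rightarrow> real^'n) \<Rightarrow> (real^'n \<Rightarrow> real) \<Rightarrow> bool" where
  "has_weak_div \<Omega> q g \<longleftrightarrow> locally_integrable \<Omega> g \<and>
     (\<forall>\<phi>\<in>test_functions \<Omega>. distr_div \<Omega> q \<phi> = distr_fun \<Omega> g \<phi>)"

text \<open>A weak divergence is determined up to a null set; every use below is insensitive to the choice.\<close>

definition weak_div :: "(real^'n::finite) set \<Rightarrow> (real^'n \<Rightarrow> real^'n) \<Rightarrow> real^'n \<Rightarrow> real" where
  "weak_div \<Omega> q = (SOME g. has_weak_div \<Omega> q g)"

definition has_row_div :: "(real^'n::finite) set \<Rightarrow> (real^'n \<Rightarrow> real^'n^'m::finite) \<Rightarrow> bool" where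
  "has_row_div \<Omega> J \<longleftrightarrow> (\<forall>i. \<exists>g. has_weak_div \<Omega> (\<lambda>x. J x $ i) g)"

definition row_div :: "(real^'n::finite) set \<Rightarrow> (real^'n \<Rightarrow> real^'n^'m::finite) \<Rightarrow> real^'n \<Rightarrow> real^'m" where
  "row_div \<Omega> J x = (\<chi> i. weak_div \<Omega> (\<lambda>x. J x $ i) x)"

definition ae_eq_on :: "'a::euclidean_space set \<Rightarrow> ('a \<Rightarrow> 'b) \<Rightarrow> ('a \<Rightarrow> 'b) \<Rightarrow> bool" where
  "ae_eq_on \<Omega> u v \<longleftrightarrow> (AE x in lebesgue. x \<in> \<Omega> \<longrightarrow> u x = v x)"

definition square_integrable_on :: "'a::euclidean_space set \<Rightarrow> ('a \<Rightarrow> 'b::euclidean_space) \<Rightarrow> bool" where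
  "square_integrable_on \<Omega> u \<longleftrightarrow> set_borel_measurable lebesgue \<Omega> u \<and>
     set_integrable lebesgue \<Omega> (\<lambda>x. (norm (u x))\<^sup>2)"

definition H1 :: "(real^'n::finite) set \<Rightarrow> (real^'n \<Rightarrow> real^'m::finite) set" where
  "H1 \<Omega> = {u. square_integrable_on \<Omega> u \<and>
     (\<exists>Du :: real^'n \<Rightarrow> real^'n^'m. square_integrable_on \<Omega> Du \<and>
        (\<forall>i j. \<forall>\<phi>\<in>test_functions \<Omega>.
           distr_fun \<Omega> (\<lambda>x. Du x $ i $ j) \<phi> = - (LINT x:\<Omega>|lebesgue. u x $ i * grad \<phi> x $ j)))}"


section \<open>Lipschitz domains, outward normal, surface measure\<close>

text \<open>
  Near each boundary point the domain is, in suitable orthogonal coordinates with vertical unit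
  direction \<open>\<nu>\<close>, the part of an open cylinder strictly below the graph of a Lipschitz function.
\<close>
definition lipschitz_domain :: "'a::euclidean_space set \<Rightarrow> bool" where
  "lipschitz_domain \<Omega> \<longleftrightarrow> open \<Omega> \<and> connected \<Omega> \<and> \<Omega> \<noteq> {} \<and>
     (\<forall>p\<in>frontier \<Omega>. \<exists>\<nu> r h L \<gamma>. norm \<nu> = 1 \<and> r > 0 \<and> h > 0 \<and>
        lipschitz_on L {z. z \<bullet> \<nu> = 0} \<gamma> \<and>
        (\<forall>z s. z \<bullet> \<nu> = 0 \<and> norm z < r \<and> \<bar>s\<bar> < h \<longrightarrow>
           (p + z + s *\<^sub>R \<nu> \<in> \<Omega> \<longleftrightarrow> s < \<gamma> z)))"

text \<open>
  \<open>n\<close> is the outward unit normal at a boundary point if the hyperplane orthogonal to \<open>n\<close> is tangent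
  there and \<open>n\<close> points out of the set.  For a Lipschitz domain this is the normal computed from
  the gradient of \<open>\<gamma>\<close>, and it exists exactly where \<open>\<gamma>\<close> is differentiable, that is, almost
  everywhere on the boundary; such an \<open>n\<close> is unique.
\<close>
definition is_outward_normal :: "'a::euclidean_space set \<Rightarrow> 'a \<Rightarrow> 'a \<Rightarrow> bool" where
  "is_outward_normal G x n \<longleftrightarrow> norm n = 1 \<and>
     (\<forall>\<epsilon>>0. \<exists>r>0. \<forall>y\<in>ball x r.
        ((y - x) \<bullet> n < - \<epsilon> * norm (y - x) \<longrightarrow> y \<in> G) \<and>
        ((y - x) \<bullet> n > \<epsilon> * norm (y - x) \<longrightarrow> y \<notin> G))"

definition outward_normal :: "'a::euclidean_space set \<Rightarrow> 'a \<Rightarrow> 'a" where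
  "outward_normal G x = (THE n. is_outward_normal G x n)"

lemma is_outward_normal_unique:
  assumes "is_outward_normal G x n" "is_outward_normal G x n'"
  shows "n = n'"
proof (rule ccontr)
  assume ne: "n \<noteq> n'"
  define v where "v = n' - n"
  have n: "n \<bullet> n = 1" "n' \<bullet> n' = 1"
    using assms by (auto simp: is_outward_normal_def norm_eq_1)
  have v0: "norm v > 0" using ne by (simp add: v_def)
  have "v \<bullet> v > 0" using v0 by simp
  then have less: "n \<bullet> n' < 1"
    using n by (simp add: v_def inner_diff_left inner_diff_right inner_commute)
  define \<epsilon> where "\<epsilon> = (1 - n \<bullet> n') / (2 * norm v)"
  have \<epsilon>: "\<epsilon> > 0" using less v0 by (simp add: \<epsilon>_def)
  have \<epsilon>v: "\<epsilon> * norm v < 1 - n \<bullet> n'" using less v0 by (simp add: \<epsilon>_def)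
  obtain r1 where r1: "r1 > 0" "\<forall>y\<in>ball x r1. (y - x) \<bullet> n < - \<epsilon> * norm (y - x) \<longrightarrow> y \<in> G"
    using assms(1) \<epsilon> unfolding is_outward_normal_def by meson
  obtain r2 where r2: "r2 > 0" "\<forall>y\<in>ball x r2. (y - x) \<bullet> n' > \<epsilon> * norm (y - x) \<longrightarrow> y \<notin> G"
    using assms(2) \<epsilon> unfolding is_outward_normal_def by meson
  define s where "s = min r1 r2 / (2 * norm v)"
  have s: "s > 0" using r1 r2 v0 by (simp add: s_def)
  define y where "y = x + s *\<^sub>R v"
  have "norm (y - x) = min r1 r2 / 2" using v0 s by (simp add: y_def) (simp add: s_def)
  then have y: "y \<in> ball x r1" "y \<in> ball x r2"
    using r1 r2 by (auto simp: dist_norm norm_minus_commute)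
  have vn: "v \<bullet> n = n \<bullet> n' - 1" "v \<bullet> n' = 1 - n \<bullet> n'"
    using n by (simp_all add: v_def inner_diff_left inner_commute[of n' n])
  have "s * (v \<bullet> n) < s * (- \<epsilon> * norm v)"
    using s \<epsilon>v vn by (intro mult_strict_left_mono) auto
  then have "(y - x) \<bullet> n < - \<epsilon> * norm (y - x)" using s by (simp add: y_def algebra_simps)
  then have "y \<in> G" using r1 y by blast
  have "s * (\<epsilon> * norm v) < s * (v \<bullet> n')"
    using s \<epsilon>v vn by (intro mult_strict_left_mono) auto
  then have "(y - x) \<bullet> n' > \<epsilon> * norm (y - x)" using s by (simp add: y_def algebra_simps)
  then have "y \<notin> G" using r2 y by blast
  with \<open>y \<in> G\<close> show False by blast
qed

text \<open>The empty set gets size 0 separately because \<open>0 ^ 0 = 1\<close> would matter for \<open>s = 0\<close>.\<close>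

definition hausdorff_pre :: "nat \<Rightarrow> real \<Rightarrow> 'a::euclidean_space set \<Rightarrow> ennreal" where
  "hausdorff_pre s \<delta> A =
     (INF C\<in>{C :: nat \<Rightarrow> 'a set. A \<subseteq> (\<Union>i. C i) \<and> (\<forall>i. bounded (C i) \<and> diameter (C i) \<le> \<delta>)}.
        \<Sum>i. if C i = {} then 0 else ennreal (diameter (C i) ^ s))"

definition hausdorff_outer :: "nat \<Rightarrow> 'a::euclidean_space set \<Rightarrow> ennreal" where
  "hausdorff_outer s A = (SUP \<delta>\<in>{0<..}. hausdorff_pre s \<delta> A)"

definition hausdorff_measure :: "nat \<Rightarrow> 'a::euclidean_space measure" where
  "hausdorff_measure s =
     measure_of UNIV (lambda_system UNIV UNIV (hausdorff_outer s)) (hausdorff_outer s)"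

lemma hausdorff_pre_empty: "hausdorff_pre s \<delta> ({} :: 'a::euclidean_space set) = 0" if "\<delta> > 0"
proof -
  have "hausdorff_pre s \<delta> ({} :: 'a set) \<le>
      (\<Sum>i. if (\<lambda>i::nat. {} :: 'a set) i = {} then 0 else ennreal (diameter ((\<lambda>i. {} :: 'a set) i) ^ s))"
    unfolding hausdorff_pre_def using that by (intro INF_lower) auto
  then show ?thesis by simp
qed

lemma hausdorff_pre_mono: "A \<subseteq> B \<Longrightarrow> hausdorff_pre s \<delta> A \<le> hausdorff_pre s \<delta> B"
  unfolding hausdorff_pre_def by (intro INF_superset_mono) auto

lemma hausdorff_pre_subadditive:
  fixes A :: "nat \<Rightarrow> 'a::euclidean_space set"
  shows "hausdorff_pre s \<delta> (\<Union>i. A i) \<le> (\<Sum>i. hausdorff_pre s \<delta> (A i))"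
proof (rule ennreal_le_epsilon)
  fix e :: real assume e: "e > 0" and fin: "(\<Sum>i. hausdorff_pre s \<delta> (A i)) < top"
  define cost where "cost = (\<lambda>E :: 'a set. if E = {} then 0 else ennreal (diameter E ^ s))"
  have "\<exists>C :: nat \<Rightarrow> 'a set. A i \<subseteq> (\<Union>j. C j) \<and> (\<forall>j. bounded (C j) \<and> diameter (C j) \<le> \<delta>) \<and>
      (\<Sum>j. cost (C j)) \<le> hausdorff_pre s \<delta> (A i) + ennreal (e * (1/2) ^ Suc i)" for i
  proof -
    have "hausdorff_pre s \<delta> (A i) < top"
      using fin by (metis ennreal_suminf_lessD)
    then have "hausdorff_pre s \<delta> (A i) < hausdorff_pre s \<delta> (A i) + ennreal (e * (1/2) ^ Suc i)"
      using e by (cases "hausdorff_pre s \<delta> (A i)" rule: ennreal_cases)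
         (auto simp: ennreal_plus[symmetric] ennreal_less_iff simp del: ennreal_plus)
    from this[unfolded hausdorff_pre_def[of s \<delta> "A i"] INF_less_iff]
    show ?thesis unfolding hausdorff_pre_def cost_def by (auto intro: less_imp_le)
  qed
  then obtain C :: "nat \<Rightarrow> nat \<Rightarrow> 'a set" where
    C: "\<And>i. A i \<subseteq> (\<Union>j. C i j)" "\<And>i j. bounded (C i j)" "\<And>i j. diameter (C i j) \<le> \<delta>"
       "\<And>i. (\<Sum>j. cost (C i j)) \<le> hausdorff_pre s \<delta> (A i) + ennreal (e * (1/2) ^ Suc i)"
    by metis
  define D where "D = (\<lambda>k. case_prod C (prod_decode k))"
  have "(\<Union>i. A i) \<subseteq> (\<Union>k. D k)"
  proof
    fix x assume "x \<in> (\<Union>i. A i)"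
    then obtain i j where "x \<in> C i j" using C(1) by blast
    then have "x \<in> D (prod_encode (i, j))" by (simp add: D_def)
    then show "x \<in> (\<Union>k. D k)" by blast
  qed
  moreover have "bounded (D k) \<and> diameter (D k) \<le> \<delta>" for k
    using C by (simp add: D_def split: prod.split)
  ultimately have "hausdorff_pre s \<delta> (\<Union>i. A i) \<le> (\<Sum>k. cost (D k))"
    unfolding hausdorff_pre_def cost_def by (intro INF_lower) auto
  also have "\<dots> = (\<Sum>k. (\<lambda>(i, j). cost (C i j)) (prod_decode k))"
    by (simp add: D_def case_prod_unfold)
  also have "\<dots> = (\<Sum>i. \<Sum>j. cost (C i j))"
    by (rule suminf_ennreal_2dimen) simp
  also have "\<dots> \<le> (\<Sum>i. hausdorff_pre s \<delta> (A i) + ennreal (e * (1/2) ^ Suc i))"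
    using C(4) by (intro suminf_le) auto
  also have "\<dots> = (\<Sum>i. hausdorff_pre s \<delta> (A i)) + (\<Sum>i. ennreal (e * (1/2) ^ Suc i))"
    by (rule suminf_add[symmetric]) auto
  also have "(\<Sum>i. ennreal (e * (1/2) ^ Suc i)) = ennreal e"
    using sums_mult[OF power_half_series, of e] e
    by (intro suminf_ennreal_eq) auto
  finally show "hausdorff_pre s \<delta> (\<Union>i. A i) \<le> (\<Sum>i. hausdorff_pre s \<delta> (A i)) + ennreal e" .
qed

lemma outer_measure_space_hausdorff:
  "outer_measure_space UNIV (hausdorff_outer s :: 'a::euclidean_space set \<Rightarrow> ennreal)"
proof -
  have "hausdorff_outer s (\<Union>i. A i) \<le> (\<Sum>i. hausdorff_outer s (A i))" for A :: "nat \<Rightarrow> 'a set"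
    unfolding hausdorff_outer_def[of s "\<Union>i. A i"]
  proof (rule SUP_least)
    fix \<delta> :: real assume "\<delta> \<in> {0<..}"
    then have "(\<Sum>i. hausdorff_pre s \<delta> (A i)) \<le> (\<Sum>i. hausdorff_outer s (A i))"
      unfolding hausdorff_outer_def by (intro suminf_le SUP_upper) auto
    then show "hausdorff_pre s \<delta> (\<Union>i. A i) \<le> (\<Sum>i. hausdorff_outer s (A i))"
      using hausdorff_pre_subadditive order_trans by blast
  qed
  moreover have "hausdorff_outer s ({} :: 'a set) = 0"
    by (auto simp: hausdorff_outer_def hausdorff_pre_empty intro!: SUP_eq_const)
  moreover have "hausdorff_outer s A \<le> hausdorff_outer s B" if "A \<subseteq> B" for A B :: "'a set"
    unfolding hausdorff_outer_def using that by (intro SUP_mono) (auto intro: hausdorff_pre_mono)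
  ultimately show ?thesis
    by (auto simp: outer_measure_space_def positive_def increasing_def countably_subadditive_def)
qed

lemma hausdorff_measure_space:
  "measure_space UNIV (lambda_system UNIV UNIV (hausdorff_outer s))
     (hausdorff_outer s :: 'a::euclidean_space set \<Rightarrow> ennreal)"
  using sigma_algebra.caratheodory_lemma[OF sigma_algebra_Pow, of UNIV]
    outer_measure_space_hausdorff[of s] by simp

lemma sets_hausdorff_measure:
  "sets (hausdorff_measure s) = lambda_system UNIV UNIV (hausdorff_outer s :: 'a::euclidean_space set \<Rightarrow> ennreal)"
  using hausdorff_measure_space[of s, where 'a='a]
  by (simp add: hausdorff_measure_def measure_space_def sigma_algebra.sets_measure_of_eq
        del: sets_measure_of)

lemma emeasure_hausdorff_measure:
  fixes A :: "'a::euclidean_space set"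
  shows "A \<in> sets (hausdorff_measure s) \<Longrightarrow> emeasure (hausdorff_measure s) A = hausdorff_outer s A"
  using hausdorff_measure_space[of s, where 'a='a]
  by (subst hausdorff_measure_def, intro emeasure_measure_of_sigma)
     (auto simp: measure_space_def sets_hausdorff_measure)

definition flat_unit_cube :: "(real^'n::finite) set" where
  "flat_unit_cube = {x \<in> cbox 0 1. x $ (SOME k. True) = 0}"

text \<open>
  The surface measure \<open>dS\<close>: (d-1)-dimensional Hausdorff measure with the normalisation for which
  it is Lebesgue measure on hyperplanes, that is, unit cubes in hyperplanes have area one.
\<close>
definition surface_measure :: "(real^'n::finite) measure" where
  "surface_measure = scale_measure (1 / hausdorff_outer (CARD('n) - 1) (flat_unit_cube :: (real^'n) set))
     (hausdorff_measure (CARD('n) - 1))"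


section \<open>Open continuum thermodynamic systems\<close>

text \<open>
  The admissible field space and the thermodynamic potential are determined by the other
  components and are therefore defined afterwards instead of being stored.  Fields are functions
  on the whole of space, of which only the values in the relevant domain matter; elements of
  \<open>H\<^sup>1\<close> and \<open>L\<^sup>1\<close> are represented by functions, so maps on them have to respect
  equality almost everywhere.
\<close>
record ('d::finite, 'm::finite, 'ye, 'yf) ct_system =
  region :: "(real^'d) set"
  states :: "(real^'m) set"
  storage :: "real^'d \<Rightarrow> real^'m \<Rightarrow> real"
  flux_rev :: "(real^'d \<Rightarrow> real^'m) \<Rightarrow> real^'d \<Rightarrow> real^'d^'m"
  flux_diss :: "(real^'d \<Rightarrow> real^'m) \<Rightarrow> real^'d \<Rightarrow> real^'d^'m"
  source :: "(real^'d \<Rightarrow> real^'m) \<Rightarrow> real^'d \<Rightarrow> real^'m"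
  effort :: "(real^'d \<Rightarrow> real^'m) \<Rightarrow> 'ye"
  flow :: "(real^'d \<Rightarrow> real^'m) \<Rightarrow> 'yf"
  pairing :: "'ye \<Rightarrow> 'yf \<Rightarrow> real"

definition field_space :: "('d::finite,'m::finite,'ye,'yf) ct_system \<Rightarrow> (real^'d \<Rightarrow> real^'m) set" where
  "field_space T = {u \<in> H1 (region T). (AE x in lebesgue. x \<in> region T \<longrightarrow> u x \<in> states T) \<and>
     set_integrable lebesgue (region T) (\<lambda>x. storage T x (u x))}"

definition potential ::
  "('d::finite,'m::finite,'ye,'yf) ct_system \<Rightarrow> (real^'d \<Rightarrow> real^'m) \<Rightarrow> real^'d \<Rightarrow> real^'m" where
  "potential T u x = grad (storage T x) (u x)"

definition respects_ae ::
  "('d::finite,'m::finite,'ye,'yf) ct_system \<Rightarrow> ((real^'d \<Rightarrow> real^'m) \<Rightarrow> 'b) \<Rightarrow> ('b \<Rightarrow> 'b \<Rightarrow> bool) \<Rightarrow> bool" where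
  "respects_ae T F eq \<longleftrightarrow>
     (\<forall>u\<in>field_space T. \<forall>v\<in>field_space T. ae_eq_on (region T) u v \<longrightarrow> eq (F u) (F v))"

definition L1_map ::
  "('d::finite,'m::finite,'ye,'yf) ct_system \<Rightarrow>
     ((real^'d \<Rightarrow> real^'m) \<Rightarrow> real^'d \<Rightarrow> 'b::euclidean_space) \<Rightarrow> bool" where
  "L1_map T F \<longleftrightarrow> (\<forall>u\<in>field_space T. set_integrable lebesgue (region T) (F u)) \<and>
     respects_ae T F (ae_eq_on (region T))"

definition boundary_exchange ::
  "('d::finite,'m::finite,'ye,'yf) ct_system \<Rightarrow> (real^'d \<Rightarrow> real^'m) \<Rightarrow> real" where
  "boundary_exchange T u = pairing T (effort T u) (flow T u)"

text \<open>
  The maps whose existence admissibility asserts, together with the differentiability order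
  from which on a field counts as sufficiently smooth.
\<close>
record ('d::finite, 'm::finite) ct_witness =
  smoothness :: nat
  q_rev :: "(real^'d \<Rightarrow> real^'m) \<Rightarrow> real^'d \<Rightarrow> real^'d"
  q_diss :: "(real^'d \<Rightarrow> real^'m) \<Rightarrow> real^'d \<Rightarrow> real^'d"
  prod_density :: "(real^'d \<Rightarrow> real^'m) \<Rightarrow> real^'d \<Rightarrow> real"

definition q_total ::
  "('d::finite,'m::finite) ct_witness \<Rightarrow> (real^'d \<Rightarrow> real^'m) \<Rightarrow> real^'d \<Rightarrow> real^'d" where
  "q_total W u x = q_rev W u x + q_diss W u x"

text \<open>
  Smooth up to the boundary, with values in the state set there too (so that the potential is
  bounded and continuous), and with flux divergences that are functions.
\<close>
definition smooth_field ::
  "('d::finite,'m::finite,'ye,'yf) ct_system \<Rightarrow> nat \<Rightarrow> (real^'d \<Rightarrow> real^'m) \<Rightarrow> bool" where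
  "smooth_field T k u \<longleftrightarrow> u \<in> field_space T \<and> Ck_on k (closure (region T)) u \<and>
     u ` closure (region T) \<subseteq> states T \<and>
     has_row_div (region T) (flux_rev T u) \<and> has_row_div (region T) (flux_diss T u)"

text \<open>
  Continuity of the \<open>q\<close> fields up to the boundary is what gives surface integrals of their normal
  components a meaning: the function representing the \<open>L\<^sup>1\<close> class is the continuous one.  It is a
  demand on \<open>W\<close>, not a restriction on the fields \<open>u\<close>.
\<close>
definition admissible_with ::
  "('d::finite,'m::finite,'ye,'yf) ct_system \<Rightarrow> ('d,'m) ct_witness \<Rightarrow> bool" where
  "admissible_with T W \<longleftrightarrow>
     L1_map T (q_rev W) \<and> L1_map T (q_diss W) \<and> L1_map T (prod_density W) \<and>
     (\<forall>u. smooth_field T (smoothness W) u \<longrightarrow>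
        (\<forall>\<phi>\<in>test_functions (region T).
           distr_fun (region T) (\<lambda>x. potential T u x \<bullet> row_div (region T) (flux_rev T u) x) \<phi> =
           distr_div (region T) (q_rev W u) \<phi>) \<and>
        (\<forall>\<phi>\<in>test_functions (region T).
           distr_fun (region T) (\<lambda>x. potential T u x \<bullet> row_div (region T) (flux_diss T u) x) \<phi> =
           distr_div (region T) (q_diss W u) \<phi> + distr_fun (region T) (prod_density W u) \<phi>) \<and>
        (AE x in lebesgue. x \<in> region T \<longrightarrow> prod_density W u x \<ge> 0) \<and>
        continuous_on (closure (region T)) (q_rev W u) \<and>
        continuous_on (closure (region T)) (q_diss W u) \<and>
        - (LINT x:frontier (region T)|surface_measure. q_total W u x \<bullet> outward_normal (region T) x) =
          boundary_exchange T u \<and>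
        set_integrable lebesgue (region T) (\<lambda>x. potential T u x \<bullet> source T u x))"

definition open_ct_system ::
  "('d::finite,'m::finite,'ye::{real_vector,topological_space},'yf::{real_vector,topological_space})
     ct_system \<Rightarrow> bool" where
  "open_ct_system T \<longleftrightarrow>
     bounded (region T) \<and> lipschitz_domain (region T) \<and>
     states T \<noteq> {} \<and> open (states T) \<and> convex (states T) \<and>
     Ck_on 2 (closure (region T) \<times> states T) (\<lambda>(x, v). storage T x v) \<and>
     (\<forall>x\<in>closure (region T). convex_on (states T) (storage T x)) \<and>
     L1_map T (flux_rev T) \<and> L1_map T (flux_diss T) \<and> L1_map T (source T) \<and>
     respects_ae T (effort T) (=) \<and> respects_ae T (flow T) (=) \<and>
     bilinear (pairing T) \<and> continuous_on UNIV (\<lambda>(a, b). pairing T a b) \<and>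
     (\<exists>W. admissible_with T W)"


section \<open>Balance quantities on subdomains\<close>

definition free_energy_on ::
  "('d::finite,'m::finite,'ye,'yf) ct_system \<Rightarrow> (real^'d) set \<Rightarrow> (real^'d \<Rightarrow> real^'m) \<Rightarrow> real" where
  "free_energy_on T G u = (LINT x:G|lebesgue. storage T x (u x))"

definition dissipation_on ::
  "('d::finite,'m::finite) ct_witness \<Rightarrow> (real^'d) set \<Rightarrow> (real^'d \<Rightarrow> real^'m) \<Rightarrow> real" where
  "dissipation_on W G u = (LINT x:G|lebesgue. prod_density W u x)"

definition source_on ::
  "('d::finite,'m::finite,'ye,'yf) ct_system \<Rightarrow> (real^'d) set \<Rightarrow> (real^'d \<Rightarrow> real^'m) \<Rightarrow> real" where
  "source_on T G u = (LINT x:G|lebesgue. potential T u x \<bullet> source T u x)"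

definition exchange_ext ::
  "('d::finite,'m::finite,'ye,'yf) ct_system \<Rightarrow> ('d,'m) ct_witness \<Rightarrow> (real^'d) set \<Rightarrow>
     (real^'d \<Rightarrow> real^'m) \<Rightarrow> real" where
  "exchange_ext T W G u =
     - (LINT x:frontier G \<inter> frontier (region T)|surface_measure. q_total W u x \<bullet> outward_normal G x)"

definition exchange_int ::
  "('d::finite,'m::finite,'ye,'yf) ct_system \<Rightarrow> ('d,'m) ct_witness \<Rightarrow> (real^'d) set \<Rightarrow>
     (real^'d \<Rightarrow> real^'m) \<Rightarrow> real" where
  "exchange_int T W G u =
     - (LINT x:frontier G \<inter> region T|surface_measure. q_total W u x \<bullet> outward_normal G x)"


section \<open>Trajectories and consistency\<close>

definition L1_continuous ::
  "'a::euclidean_space set \<Rightarrow> real \<Rightarrow> (real \<Rightarrow> 'a \<Rightarrow> 'b::euclidean_space) \<Rightarrow> bool" where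
  "L1_continuous \<Omega> \<tau> g \<longleftrightarrow>
     (\<forall>t\<in>{0..\<tau>}. ((\<lambda>s. LINT x:\<Omega>|lebesgue. norm (g s x - g t x)) \<longlongrightarrow> 0) (at t within {0..\<tau>}))"

text \<open>
  The time regularity of the constitutive terms is continuity with values in \<open>L\<^sup>1\<close>: with an
  evolution equation holding only almost everywhere, some such condition is needed to speak of
  the energy balance at every time, including the end points.
  The equation is required for almost all \<open>t\<close> and then almost all \<open>x\<close>: unlike a
  statement about null sets of the product, this does not depend on which representatives of
  the classes \<open>source T (u t)\<close> and of the divergences are chosen at different times.
\<close>
definition smooth_trajectory ::
  "('d::finite,'m::finite,'ye,'yf) ct_system \<Rightarrow> ('d,'m) ct_witness \<Rightarrow> real \<Rightarrow>
     (real \<Rightarrow> real^'d \<Rightarrow> real^'m) \<Rightarrow> bool" where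
  "smooth_trajectory T W \<tau> u \<longleftrightarrow>
     \<tau> > 0 \<and>
     (\<forall>t\<in>{0..\<tau>}. smooth_field T (smoothness W) (u t)) \<and>
     Ck_on 1 ({0..\<tau>} \<times> closure (region T)) (\<lambda>(t, x). u t x) \<and>
     L1_continuous (region T) \<tau> (\<lambda>t. flux_rev T (u t)) \<and>
     L1_continuous (region T) \<tau> (\<lambda>t. flux_diss T (u t)) \<and>
     L1_continuous (region T) \<tau> (\<lambda>t. source T (u t)) \<and>
     (AE t in lebesgue. t \<in> {0<..<\<tau>} \<longrightarrow> (AE x in lebesgue. x \<in> region T \<longrightarrow>
        vector_derivative (\<lambda>s. u s x) (at t) +
        row_div (region T) (\<lambda>x. flux_rev T (u t) x + flux_diss T (u t) x) x = source T (u t) x))"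

definition consistent ::
  "('d::finite,'m::finite,'ye,'yf) ct_system \<Rightarrow> ('d,'m) ct_witness \<Rightarrow> bool" where
  "consistent T W \<longleftrightarrow> (\<forall>\<tau> u. smooth_trajectory T W \<tau> u \<longrightarrow> (\<forall>t\<in>{0..\<tau>}.
     ((\<lambda>s. free_energy_on T (region T) (u s)) has_real_derivative
        - dissipation_on W (region T) (u t) + boundary_exchange T (u t) + source_on T (region T) (u t))
       (at t within {0..\<tau>})))"

end

theory Submission
  imports Defs
begin

text \<open>
  Fix a time, and write \<open>v\<close> for the velocity \<open>\<partial>\<^sub>t u\<close>, \<open>\<mu>\<close> for the potential and \<open>q\<close> for the total energy flux.  The
  energy density changes at the rate \<open>\<mu> \<bullet> v\<close>.  The evolution equation replaces \<open>v\<close> by the source minus the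
  divergences of the two fluxes, and admissibility turns \<open>\<mu>\<close> times these divergences into \<open>div q + \<sigma>\<close>.  So
  \<open>\<mu> \<bullet> v = \<mu> \<bullet> R - \<sigma> - div q\<close>, and the assertion is the integral of this equation over \<open>G\<close>, provided that the
  integral of \<open>div q\<close> is the flux of \<open>q\<close> through the frontier of \<open>G\<close>.  That frontier is the disjoint union of
  its parts in \<open>\<Omega>\<close> and in the frontier of \<open>\<Omega>\<close>, whence the two exchange terms.

  The pointwise part has to cope with the weak regularity.  The evolution equation is given at almost all times
  only; \<open>evolution_equation_everywhere\<close> extends it to all times by the continuity in time of its weak form and the
  uniqueness of weak divergences.  The time derivative of the energy, also at the end points of the time interval,
  is \<open>has_derivative_under_integral\<close>, and the equation for \<open>div q\<close> is \<open>q_total_weakly_divergent\<close>.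

  The main part is the divergence theorem \<open>divergence_theorem\<close>, for a Lipschitz domain, a field that is continuous
  up to the boundary and has an integrable weak divergence, and surface integrals with respect to normalised
  Hausdorff measure.  Bump functions localise it (\<open>green_covered\<close>).  Near a boundary point \<open>G\<close> is the region
  below a Lipschitz graph in the direction \<open>\<nu>\<close>.  There the weak identity is tested with a function \<open>\<eta>\<close> multiplied by
  a ramp in the depth below the graph.  When the ramp gets steep, its gradient, which is concentrated in a thin layer,
  produces the integral of \<open>\<eta> q \<bullet> (\<nu> - \<nabla>g)\<close> over the hyperplane orthogonal to \<open>\<nu>\<close>.  This is the flux of \<open>\<eta> q\<close> through the
  graph, because the unit normal is \<open>(\<nu> - \<nabla>g) / sqrt (1 + |\<nabla>g|\<^sup>2)\<close> (\<open>outward_normal_graph\<close>) and because the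
  denominator is the density of surface measure (\<open>graph_area_formula\<close>).

  The last two facts rest on \<open>rademacher\<close>, which comes from differentiability almost everywhere on lines and the
  weak form of the directional derivatives.  The area formula follows by comparing the graph with graphs of linear
  functions on countably many small pieces; for these it is a statement about hyperplanes, where Hausdorff measure
  is a multiple of Lebesgue measure by invariance under translations (\<open>nn_integral_hyperplane_slices\<close>).  Integrals
  over a hyperplane are written throughout as integrals of functions that are constant in the normal direction over
  a slab of thickness one.
\<close>

section \<open>Hausdorff measure as a metric outer measure\<close>

lemma hausdorff_pre_le:
  fixes C :: "nat \<Rightarrow> 'a::euclidean_space set"
  assumes "A \<subseteq> (\<Union>i. C i)" "\<And>i. bounded (C i)" "\<And>i. diameter (C i) \<le> \<delta>"
  shows "hausdorff_pre s \<delta> A \<le> (\<Sum>i. if C i = {} then 0 else ennreal (diameter (C i) ^ s))"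
  unfolding hausdorff_pre_def using assms by (intro INF_lower) auto

lemma le_hausdorff_preI:
  fixes A :: "'a::euclidean_space set"
  assumes "\<And>C :: nat \<Rightarrow> 'a set. A \<subseteq> (\<Union>i. C i) \<Longrightarrow> (\<And>i. bounded (C i)) \<Longrightarrow> (\<And>i. diameter (C i) \<le> \<delta>) \<Longrightarrow>
    c \<le> (\<Sum>i. if C i = {} then 0 else ennreal (diameter (C i) ^ s))"
  shows "c \<le> hausdorff_pre s \<delta> A"
  unfolding hausdorff_pre_def by (intro INF_greatest) (use assms in auto)

lemma hausdorff_pre_antimono:
  assumes "\<delta> \<le> \<delta>'"
  shows "hausdorff_pre s \<delta>' A \<le> hausdorff_pre s \<delta> A"
  by (rule le_hausdorff_preI, rule hausdorff_pre_le) (use assms in \<open>auto intro: order_trans\<close>)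

lemma hausdorff_pre_le_outer: "\<delta> > 0 \<Longrightarrow> hausdorff_pre s \<delta> A \<le> hausdorff_outer s A"
  unfolding hausdorff_outer_def by (intro SUP_upper) auto

lemma hausdorff_outer_empty [simp]: "hausdorff_outer s ({} :: 'a::euclidean_space set) = 0"
  using outer_measure_space_hausdorff[of s, where 'a='a]
  by (auto simp: outer_measure_space_def positive_def)

lemma hausdorff_outer_mono: "A \<subseteq> B \<Longrightarrow> hausdorff_outer s A \<le> hausdorff_outer s B"
  unfolding hausdorff_outer_def by (intro SUP_mono) (auto intro: hausdorff_pre_mono)

lemma hausdorff_outer_UN_le:
  fixes A :: "nat \<Rightarrow> 'a::euclidean_space set"
  shows "hausdorff_outer s (\<Union>i. A i) \<le> (\<Sum>i. hausdorff_outer s (A i))"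
  unfolding hausdorff_outer_def[of s "\<Union>i. A i"]
proof (rule SUP_least)
  fix \<delta> :: real assume "\<delta> \<in> {0<..}"
  then have "(\<Sum>i. hausdorff_pre s \<delta> (A i)) \<le> (\<Sum>i. hausdorff_outer s (A i))"
    by (intro suminf_le hausdorff_pre_le_outer) auto
  then show "hausdorff_pre s \<delta> (\<Union>i. A i) \<le> (\<Sum>i. hausdorff_outer s (A i))"
    using hausdorff_pre_subadditive order_trans by blast
qed

lemma hausdorff_outer_Un_le:
  fixes A B :: "'a::euclidean_space set"
  shows "hausdorff_outer s (A \<union> B) \<le> hausdorff_outer s A + hausdorff_outer s B"
proof -
  define F where "F = (\<lambda>i::nat. if i = 0 then A else if i = 1 then B else {})"
  have "A = F 0" "B = F 1" by (simp_all add: F_def)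
  then have "A \<union> B \<subseteq> (\<Union>i. F i)" by blast
  then have "hausdorff_outer s (A \<union> B) \<le> (\<Sum>i. hausdorff_outer s (F i))"
    by (rule order_trans[OF hausdorff_outer_mono hausdorff_outer_UN_le])
  also have "\<dots> = (\<Sum>i\<in>{0,1}. hausdorff_outer s (F i))"
    by (rule suminf_finite) (auto simp: F_def)
  finally show ?thesis by (simp add: F_def)
qed

text \<open>A cover of \<open>A\<close> is mapped to a cover of \<open>f ` A\<close> after its sets have been cut down to \<open>A\<close>.\<close>

lemma hausdorff_outer_lipschitz_image:
  fixes f :: "'a::euclidean_space \<Rightarrow> 'b::euclidean_space"
  assumes f: "L-lipschitz_on A f" and L: "L > 0"
  shows "hausdorff_outer s (f ` A) \<le> ennreal (L ^ s) * hausdorff_outer s A"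
  unfolding hausdorff_outer_def[of s "f ` A"]
proof (rule SUP_least)
  fix \<delta> :: real assume "\<delta> \<in> {0<..}"
  then have \<delta>: "\<delta> > 0" by simp
  have "ennreal (inverse (L ^ s)) * hausdorff_pre s \<delta> (f ` A) \<le> hausdorff_pre s (\<delta> / L) A"
  proof (rule le_hausdorff_preI)
    fix C :: "nat \<Rightarrow> 'a set"
    assume C: "A \<subseteq> (\<Union>i. C i)" "\<And>i. bounded (C i)" "\<And>i. diameter (C i) \<le> \<delta> / L"
    let ?D = "\<lambda>i. f ` (A \<inter> C i)"
    have d: "diameter (?D i) \<le> L * diameter (C i)" for i
    proof (rule diameter_le)
      show "?D i \<noteq> {} \<or> 0 \<le> L * diameter (C i)" using L C(2) by (simp add: diameter_ge_0)
      fix x y assume "x \<in> ?D i" "y \<in> ?D i"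
      then obtain a b where ab: "a \<in> A" "b \<in> A" "a \<in> C i" "b \<in> C i" "x = f a" "y = f b" by auto
      then have "dist x y \<le> L * dist a b" using lipschitz_onD[OF f] by auto
      also have "\<dots> \<le> L * diameter (C i)"
        using ab L diameter_bounded_bound[OF C(2)] by simp
      finally show "norm (x - y) \<le> L * diameter (C i)" by (simp add: dist_norm)
    qed
    have "bounded (?D i)" for i
    proof -
      have "L-lipschitz_on (A \<inter> C i) f" using f by (rule lipschitz_on_subset) auto
      then have "uniformly_continuous_on (A \<inter> C i) f" by (rule lipschitz_on_uniformly_continuous)
      then show ?thesis
        by (rule bounded_uniformly_continuous_image) (rule bounded_subset[OF C(2)[of i]], simp)
    qed
    moreover have "diameter (?D i) \<le> \<delta>" for i
      using order_trans[OF d[of i], of \<delta>] C(3)[of i] L by (simp add: field_simps)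
    moreover have "f ` A \<subseteq> (\<Union>i. ?D i)"
    proof
      fix y assume "y \<in> f ` A"
      then obtain a where a: "a \<in> A" "y = f a" by auto
      then obtain i where "a \<in> C i" using C(1) by blast
      with a have "y \<in> ?D i" by blast
      then show "y \<in> (\<Union>i. ?D i)" by (rule UN_I[OF UNIV_I])
    qed
    ultimately have "hausdorff_pre s \<delta> (f ` A) \<le> (\<Sum>i. if ?D i = {} then 0 else ennreal (diameter (?D i) ^ s))"
      by (intro hausdorff_pre_le)
    also have "\<dots> \<le> (\<Sum>i. ennreal (L ^ s) * (if C i = {} then 0 else ennreal (diameter (C i) ^ s)))"
    proof (intro suminf_le)
      fix i
      have "diameter (?D i) ^ s \<le> L ^ s * diameter (C i) ^ s"
        using power_mono[OF d[of i] diameter_ge_0, of s] \<open>bounded (?D i)\<close>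
        by (simp add: power_mult_distrib)
      then show "(if ?D i = {} then 0 else ennreal (diameter (?D i) ^ s)) \<le>
         ennreal (L ^ s) * (if C i = {} then 0 else ennreal (diameter (C i) ^ s))"
        using L C(2) by (auto simp: ennreal_mult[symmetric] diameter_ge_0 intro!: ennreal_leI)
    qed auto
    also have "\<dots> = ennreal (L ^ s) * (\<Sum>i. (if C i = {} then 0 else ennreal (diameter (C i) ^ s)))"
      by simp
    finally have "ennreal (inverse (L ^ s)) * hausdorff_pre s \<delta> (f ` A) \<le>
        ennreal (inverse (L ^ s)) * (ennreal (L ^ s) * (\<Sum>i. (if C i = {} then 0 else ennreal (diameter (C i) ^ s))))"
      by (rule mult_left_mono) simp
    also have "\<dots> = (\<Sum>i. (if C i = {} then 0 else ennreal (diameter (C i) ^ s)))"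
      using L by (simp add: mult.assoc[symmetric] ennreal_mult[symmetric] del: ennreal_suminf_cmult)
    finally show "ennreal (inverse (L ^ s)) * hausdorff_pre s \<delta> (f ` A) \<le>
       (\<Sum>i. if C i = {} then 0 else ennreal (diameter (C i) ^ s))" .
  qed
  also have "\<dots> \<le> hausdorff_outer s A"
    using \<delta> L by (intro hausdorff_pre_le_outer) simp
  finally have "ennreal (L ^ s) * (ennreal (inverse (L ^ s)) * hausdorff_pre s \<delta> (f ` A)) \<le>
      ennreal (L ^ s) * hausdorff_outer s A"
    by (rule mult_left_mono) simp
  moreover have "ennreal (L ^ s) * (ennreal (inverse (L ^ s)) * c) = c" for c
    using L by (simp add: mult.assoc[symmetric] ennreal_mult[symmetric])
  ultimately show "hausdorff_pre s \<delta> (f ` A) \<le> ennreal (L ^ s) * hausdorff_outer s A" by simp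
qed

lemma hausdorff_outer_isometry:
  fixes f :: "'a::euclidean_space \<Rightarrow> 'b::euclidean_space"
  assumes f: "\<And>x y. x \<in> A \<Longrightarrow> y \<in> A \<Longrightarrow> dist (f x) (f y) = dist x y"
  shows "hausdorff_outer s (f ` A) = hausdorff_outer s A"
proof (rule antisym)
  have "1-lipschitz_on A f" using f by (intro lipschitz_onI) auto
  then show "hausdorff_outer s (f ` A) \<le> hausdorff_outer s A"
    using hausdorff_outer_lipschitz_image[of 1 A f s] by simp
  have inj: "inj_on f A" using f by (metis dist_eq_0_iff inj_onI)
  have "1-lipschitz_on (f ` A) (the_inv_into A f)"
    using f inj by (intro lipschitz_onI) (auto simp: the_inv_into_f_f)
  from hausdorff_outer_lipschitz_image[OF this, of s]
  have "hausdorff_outer s (the_inv_into A f ` f ` A) \<le> hausdorff_outer s (f ` A)" by simp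
  moreover have "the_inv_into A f ` f ` A = A" using inj by (auto simp: the_inv_into_f_f image_iff)
  ultimately show "hausdorff_outer s A \<le> hausdorff_outer s (f ` A)" by simp
qed

text \<open>
  A set whose diameter is less than the distance of \<open>A\<close> and \<open>B\<close> cannot meet both, so a fine cover of the
  union splits into covers of \<open>A\<close> and of \<open>B\<close>.
\<close>

lemma hausdorff_outer_separated:
  fixes A B :: "'a::euclidean_space set"
  assumes \<eta>: "\<eta> > 0" and sep: "\<And>a b. a \<in> A \<Longrightarrow> b \<in> B \<Longrightarrow> dist a b \<ge> \<eta>"
  shows "hausdorff_outer s (A \<union> B) = hausdorff_outer s A + hausdorff_outer s B"
proof (rule antisym[OF hausdorff_outer_Un_le])
  have pre: "hausdorff_pre s \<delta> A + hausdorff_pre s \<delta> B \<le> hausdorff_outer s (A \<union> B)"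
    if \<delta>: "\<delta> > 0" "\<delta> < \<eta>" for \<delta>
  proof -
    have "hausdorff_pre s \<delta> A + hausdorff_pre s \<delta> B \<le> hausdorff_pre s \<delta> (A \<union> B)"
    proof (rule le_hausdorff_preI)
      fix C :: "nat \<Rightarrow> 'a set"
      assume C: "A \<union> B \<subseteq> (\<Union>i. C i)" "\<And>i. bounded (C i)" "\<And>i. diameter (C i) \<le> \<delta>"
      let ?c = "\<lambda>E :: 'a set. if E = {} then 0 else ennreal (diameter E ^ s)"
      define CA where "CA = (\<lambda>i. if C i \<inter> A = {} then {} else C i)"
      define CB where "CB = (\<lambda>i. if C i \<inter> B = {} then {} else C i)"
      have disj: "C i \<inter> A = {} \<or> C i \<inter> B = {}" for i
      proof (rule ccontr)
        assume "\<not> ?thesis"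
        then obtain a b where "a \<in> C i" "a \<in> A" "b \<in> C i" "b \<in> B" by blast
        then have "\<eta> \<le> \<delta>"
          using sep[of a b] diameter_bounded_bound[OF C(2), of a i b] C(3)[of i] by linarith
        then show False using \<delta> by simp
      qed
      have "hausdorff_pre s \<delta> A \<le> (\<Sum>i. ?c (CA i))"
      proof (rule hausdorff_pre_le)
        show "A \<subseteq> (\<Union>i. CA i)"
        proof
          fix x assume "x \<in> A"
          then obtain i where "x \<in> C i" using C(1) by blast
          with \<open>x \<in> A\<close> have "x \<in> CA i" by (auto simp: CA_def)
          then show "x \<in> (\<Union>i. CA i)" by blast
        qed
      qed (use C \<delta> in \<open>auto simp: CA_def\<close>)
      moreover have "hausdorff_pre s \<delta> B \<le> (\<Sum>i. ?c (CB i))"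
      proof (rule hausdorff_pre_le)
        show "B \<subseteq> (\<Union>i. CB i)"
        proof
          fix x assume "x \<in> B"
          then obtain i where "x \<in> C i" using C(1) by blast
          with \<open>x \<in> B\<close> have "x \<in> CB i" by (auto simp: CB_def)
          then show "x \<in> (\<Union>i. CB i)" by blast
        qed
      qed (use C \<delta> in \<open>auto simp: CB_def\<close>)
      ultimately have "hausdorff_pre s \<delta> A + hausdorff_pre s \<delta> B \<le> (\<Sum>i. ?c (CA i)) + (\<Sum>i. ?c (CB i))"
        by (rule add_mono)
      also have "\<dots> = (\<Sum>i. ?c (CA i) + ?c (CB i))" by (rule suminf_add) auto
      also have "\<dots> \<le> (\<Sum>i. ?c (C i))"
      proof (intro suminf_le)
        fix i show "?c (CA i) + ?c (CB i) \<le> ?c (C i)"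
          using disj[of i] by (auto simp: CA_def CB_def)
      qed auto
      finally show "hausdorff_pre s \<delta> A + hausdorff_pre s \<delta> B \<le> (\<Sum>i. ?c (C i))" .
    qed
    also have "\<dots> \<le> hausdorff_outer s (A \<union> B)" using \<delta> by (intro hausdorff_pre_le_outer)
    finally show ?thesis .
  qed
  have "hausdorff_outer s A + hausdorff_outer s B =
      (SUP \<delta>\<in>{0<..}. hausdorff_pre s \<delta> A + hausdorff_pre s \<delta> B)"
    unfolding hausdorff_outer_def
  proof (rule SUP_add_directed_ennreal[symmetric])
    fix i j :: real assume ij: "i \<in> {0<..}" "j \<in> {0<..}"
    show "\<exists>k\<in>{0<..}. hausdorff_pre s i A + hausdorff_pre s j B \<le> hausdorff_pre s k A + hausdorff_pre s k B"
      using ij by (intro bexI[of _ "min i j"] add_mono hausdorff_pre_antimono) auto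
  qed
  also have "\<dots> \<le> hausdorff_outer s (A \<union> B)"
  proof (rule SUP_least)
    fix \<delta> :: real assume "\<delta> \<in> {0<..}"
    then have d: "min \<delta> (\<eta>/2) > 0" "min \<delta> (\<eta>/2) < \<eta>" using \<eta> by auto
    have "hausdorff_pre s \<delta> A + hausdorff_pre s \<delta> B \<le>
        hausdorff_pre s (min \<delta> (\<eta>/2)) A + hausdorff_pre s (min \<delta> (\<eta>/2)) B"
      by (intro add_mono hausdorff_pre_antimono) auto
    then show "hausdorff_pre s \<delta> A + hausdorff_pre s \<delta> B \<le> hausdorff_outer s (A \<union> B)"
      using pre[OF d] by (rule order_trans)
  qed
  finally show "hausdorff_outer s A + hausdorff_outer s B \<le> hausdorff_outer s (A \<union> B)" .
qed

lemma hausdorff_lambda_systemI: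
  fixes X :: "'a::euclidean_space set"
  assumes "\<And>A. hausdorff_outer s A < top \<Longrightarrow>
    hausdorff_outer s (A \<inter> X) + hausdorff_outer s (A - X) \<le> hausdorff_outer s A"
  shows "X \<in> sets (hausdorff_measure s)"
  unfolding sets_hausdorff_measure lambda_system_def
proof (intro CollectI conjI ballI)
  fix A :: "'a set"
  have "hausdorff_outer s (A \<inter> X) + hausdorff_outer s (A - X) = hausdorff_outer s A"
  proof (rule antisym)
    show "hausdorff_outer s (A \<inter> X) + hausdorff_outer s (A - X) \<le> hausdorff_outer s A"
      using assms[of A] by (cases "hausdorff_outer s A < top") (auto simp: less_top[symmetric])
    show "hausdorff_outer s A \<le> hausdorff_outer s (A \<inter> X) + hausdorff_outer s (A - X)"
      using hausdorff_outer_Un_le[of s "A \<inter> X" "A - X"] by (simp add: Int_Diff_Un)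
  qed
  moreover have "X \<inter> A = A \<inter> X" "(UNIV - X) \<inter> A = A - X" by auto
  ultimately show "hausdorff_outer s (X \<inter> A) + hausdorff_outer s ((UNIV - X) \<inter> A) = hausdorff_outer s A"
    by simp
qed simp

lemma null_sets_hausdorff_measure:
  fixes N :: "'a::euclidean_space set"
  assumes "hausdorff_outer s N = 0"
  shows "N \<in> null_sets (hausdorff_measure s)"
proof -
  have "N \<in> sets (hausdorff_measure s)"
  proof (rule hausdorff_lambda_systemI)
    fix A :: "'a set"
    have "hausdorff_outer s (A \<inter> N) = 0"
      using hausdorff_outer_mono[of "A \<inter> N" N s] assms by simp
    then show "hausdorff_outer s (A \<inter> N) + hausdorff_outer s (A - N) \<le> hausdorff_outer s A"
      by (simp add: hausdorff_outer_mono)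
  qed
  then show ?thesis using assms by (auto simp: null_sets_def emeasure_hausdorff_measure)
qed

lemma ennreal_suminf_tail_tendsto_0:
  fixes r :: "nat \<Rightarrow> ennreal"
  assumes "(\<Sum>i. r i) < top"
  shows "(\<lambda>n. \<Sum>i. r (i + n)) \<longlonglongrightarrow> 0"
proof -
  define g where "g = (\<lambda>i. enn2real (r i))"
  have r: "r i = ennreal (g i)" for i
    using ennreal_suminf_lessD[OF assms, of i] by (simp add: g_def)
  have g0: "g i \<ge> 0" for i by (simp add: g_def)
  have sg: "summable g"
    using assms g0 by (intro summable_suminf_not_top) (auto simp: r)
  have "(\<lambda>n. \<Sum>i. g (i + n)) \<longlonglongrightarrow> 0" 
    using suminf_exist_split[OF _ sg] by (auto simp: LIMSEQ_iff)
  then have "(\<lambda>n. ennreal (\<Sum>i. g (i + n))) \<longlonglongrightarrow> ennreal 0" by (rule tendsto_ennrealI)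
  moreover have "ennreal (\<Sum>i. g (i + n)) = (\<Sum>i. r (i + n))" for n
    unfolding r using sg g0 by (intro suminf_ennreal2[symmetric]) (auto simp: summable_iff_shift)
  ultimately show ?thesis by simp
qed

text \<open>
  Caratheodory's criterion.  The layers \<open>1 / (m + 2) \<le> f < 1 / (m + 1)\<close> whose indices have the
  same parity are at positive distance from each other, so the outer measures of all the layers
  of a set of finite outer measure form a convergent series; its tails bound the error made
  in replacing the complement of the sublevel set by \<open>{f \<ge> 1 / (n + 1)}\<close>, which is at
  positive distance from the sublevel set.
\<close>

lemma sublevel_in_sets_hausdorff:
  fixes f :: "'a::euclidean_space \<Rightarrow> real"
  assumes f: "\<And>x y. \<bar>f x - f y\<bar> \<le> dist x y"
  shows "{x. f x \<le> 0} \<in> sets (hausdorff_measure s)"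
proof (rule hausdorff_lambda_systemI)
  fix A :: "'a set" assume fin: "hausdorff_outer s A < top"
  let ?H = "hausdorff_outer s :: 'a set \<Rightarrow> ennreal"
  let ?X = "{x. f x \<le> 0}"
  define R where "R = (\<lambda>m::nat. {x\<in>A. 1 / real (m + 2) \<le> f x \<and> f x < 1 / real (m + 1)})"
  have par: "(\<Sum>m<N. ?H (R (2 * m + j))) \<le> ?H (\<Union>m<N. R (2 * m + j))" for N j
  proof (induction N)
    case (Suc N)
    define \<eta> where "\<eta> = 1 / real (2 * N + j) - 1 / real (2 * N + j + 1)"
    show ?case
    proof (cases "N = 0")
      case False
      have \<eta>: "\<eta> > 0" using False by (auto simp: \<eta>_def divide_simps)
      have eq: "?H ((\<Union>m<N. R (2 * m + j)) \<union> R (2 * N + j)) = ?H (\<Union>m<N. R (2 * m + j)) + ?H (R (2 * N + j))"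
      proof (rule hausdorff_outer_separated[OF \<eta>])
        fix a b assume "a \<in> (\<Union>m<N. R (2 * m + j))" "b \<in> R (2 * N + j)"
        then obtain m where m: "m < N" "1 / real (2 * m + j + 2) \<le> f a" "f b < 1 / real (2 * N + j + 1)"
          by (auto simp: R_def)
        have "1 / real (2 * N + j) \<le> 1 / real (2 * m + j + 2)"
          using m(1) by (intro divide_left_mono) auto
        then have "\<eta> \<le> f a - f b" using m by (simp add: \<eta>_def)
        then show "\<eta> \<le> dist a b" using f[of a b] by linarith
      qed
      have "(\<Sum>m<Suc N. ?H (R (2 * m + j))) \<le> ?H (\<Union>m<N. R (2 * m + j)) + ?H (R (2 * N + j))"
        using Suc.IH by (simp add: add_right_mono)
      also have "\<dots> = ?H (\<Union>m<Suc N. R (2 * m + j))"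
        unfolding eq[symmetric] by (simp add: lessThan_Suc Un_commute)
      finally show ?thesis .
    qed (simp add: lessThan_Suc)
  qed simp
  have par': "(\<Sum>m<N. ?H (R (2 * m + j))) \<le> ?H A" for N j
    by (rule order_trans[OF par hausdorff_outer_mono]) (auto simp: R_def)
  have "(\<Sum>m<N. ?H (R m)) \<le> ?H A + ?H A" for N
  proof -
    have "(\<Sum>m<N. ?H (R m)) \<le> (\<Sum>m<2*N. ?H (R m))"
      by (rule sum_mono2) auto
    also have "\<dots> = (\<Sum>m<N. ?H (R (2 * m + 0))) + (\<Sum>m<N. ?H (R (2 * m + 1)))"
      by (induction N) (auto simp: algebra_simps)
    also have "\<dots> \<le> ?H A + ?H A" by (rule add_mono[OF par' par'])
    finally show ?thesis .
  qed
  then have "(\<Sum>m. ?H (R m)) \<le> ?H A + ?H A" by (intro suminf_le_const) auto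
  also have "\<dots> < top" using fin by simp
  finally have tail: "(\<lambda>n. \<Sum>m. ?H (R (m + n))) \<longlonglongrightarrow> 0" by (rule ennreal_suminf_tail_tendsto_0)
  have "?H (A \<inter> ?X) + ?H (A - ?X) \<le> ?H A + (\<Sum>m. ?H (R (m + n)))" for n
  proof -
    define An where "An = {x\<in>A. f x \<ge> 1 / real (n + 1)}"
    have "A - ?X \<subseteq> An \<union> (\<Union>m. R (m + n))"
    proof
      fix x assume x: "x \<in> A - ?X"
      show "x \<in> An \<union> (\<Union>m. R (m + n))"
      proof (cases "x \<in> An")
        case False
        then have fx: "0 < f x" "f x < 1 / real (n + 1)" "x \<in> A" using x by (auto simp: An_def)
        define k where "k = (LEAST k. 1 / real (k + 1) \<le> f x)"
        obtain k0 where "1 / real (k0 + 1) < f x"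
          using reals_Archimedean[OF fx(1)] by (auto simp: inverse_eq_divide)
        then have k: "1 / real (k + 1) \<le> f x"
          unfolding k_def by (rule LeastI[OF less_imp_le])
        have kn: "k > n"
        proof (rule ccontr)
          assume "\<not> k > n"
          then have "1 / real (n + 1) \<le> 1 / real (k + 1)" by (intro divide_left_mono) auto
          then show False using k fx by linarith
        qed
        then obtain m where m: "k = Suc (m + n)" by (metis add.commute less_imp_Suc_add)
        have "\<not> 1 / real ((m + n) + 1) \<le> f x"
          using not_less_Least[of "m + n" "\<lambda>k. 1 / real (k + 1) \<le> f x"] m by (simp add: k_def)
        then have "x \<in> R (m + n)" using k m fx by (simp add: R_def)
        then show ?thesis by blast
      qed simp
    qed
    then have "?H (A - ?X) \<le> ?H (An \<union> (\<Union>m. R (m + n)))" by (rule hausdorff_outer_mono)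
    also have "\<dots> \<le> ?H An + ?H (\<Union>m. R (m + n))" by (rule hausdorff_outer_Un_le)
    also have "\<dots> \<le> ?H An + (\<Sum>m. ?H (R (m + n)))"
      by (rule add_left_mono[OF hausdorff_outer_UN_le])
    finally have "?H (A \<inter> ?X) + ?H (A - ?X) \<le> (?H (A \<inter> ?X) + ?H An) + (\<Sum>m. ?H (R (m + n)))"
      by (simp add: add.assoc add_left_mono)
    also have "?H (A \<inter> ?X) + ?H An = ?H (A \<inter> ?X \<union> An)"
    proof (rule hausdorff_outer_separated[symmetric])
      show "1 / real (n + 1) > 0" by simp
      fix a b assume "a \<in> A \<inter> ?X" "b \<in> An"
      then have "f b - f a \<ge> 1 / real (n + 1)" by (simp add: An_def)
      then show "dist a b \<ge> 1 / real (n + 1)" using f[of a b] by linarith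
    qed
    also have "\<dots> \<le> ?H A" by (intro hausdorff_outer_mono) (auto simp: An_def)
    finally show ?thesis by (simp add: add_right_mono)
  qed
  moreover have "(\<lambda>n. ?H A + (\<Sum>m. ?H (R (m + n)))) \<longlonglongrightarrow> ?H A + 0"
    using tail by (intro tendsto_add) auto
  ultimately show "?H (A \<inter> ?X) + ?H (A - ?X) \<le> ?H A"
    using LIMSEQ_le_const[of _ "?H A" "?H (A \<inter> ?X) + ?H (A - ?X)"] by simp
qed

lemma space_hausdorff_measure [simp]: "space (hausdorff_measure s) = UNIV"
  by (simp add: hausdorff_measure_def)

lemma sets_borel_subset_hausdorff: "sets borel \<subseteq> sets (hausdorff_measure s :: 'a::euclidean_space measure)"
proof -
  have "sets (borel :: 'a measure) =
      sigma_sets UNIV ((\<lambda>(a, i). {x. x \<bullet> i \<le> a}) ` (UNIV \<times> Basis))"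
    by (subst borel_eq_halfspace_le) (simp add: image_def)
  also have "\<dots> \<subseteq> sets (hausdorff_measure s)"
  proof (rule sets.sigma_sets_subset')
    show "UNIV \<in> sets (hausdorff_measure s :: 'a measure)"
      using sets.top[of "hausdorff_measure s :: 'a measure"] by simp
    show "(\<lambda>(a, i). {x. x \<bullet> i \<le> a}) ` (UNIV \<times> (Basis :: 'a set)) \<subseteq> sets (hausdorff_measure s)"
    proof safe
    fix a and i :: 'a assume i: "i \<in> Basis"
    have "\<bar>(x \<bullet> i - a) - (y \<bullet> i - a)\<bar> \<le> dist x y" for x y
      using Basis_le_norm[OF i, of "x - y"] by (simp add: dist_norm inner_diff_left)
    from sublevel_in_sets_hausdorff[of "\<lambda>x. x \<bullet> i - a", OF this, of s]
    show "{x. x \<bullet> i \<le> a} \<in> sets (hausdorff_measure s)" by simp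
    qed
  qed
  finally show ?thesis .
qed

section \<open>Translation-invariant measures and slicing\<close>

lemma nn_integral_lborel_translate:
  fixes f :: "'a::euclidean_space \<Rightarrow> ennreal"
  assumes [measurable]: "f \<in> borel_measurable borel"
  shows "(\<integral>\<^sup>+x. f (x + a) \<partial>lborel) = (\<integral>\<^sup>+x. f x \<partial>lborel)"
proof -
  have "(\<integral>\<^sup>+x. f x \<partial>lborel) = (\<integral>\<^sup>+x. f x \<partial>distr lborel borel ((+) a))"
    by (simp add: lborel_distr_plus)
  also have "\<dots> = (\<integral>\<^sup>+x. f (x + a) \<partial>lborel)"
    by (subst nn_integral_distr) (auto simp: add.commute)
  finally show ?thesis by simp
qed

text \<open>
  Uniqueness of translation-invariant measures: both sides are values of the double integral of
  \<open>indicator A x * indicator B (y - x)\<close>, computed by translating in \<open>y\<close>, respectively in \<open>x\<close>.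
\<close>

lemma translation_invariant_proportional:
  fixes M :: "'a::euclidean_space measure"
  assumes sets: "sets M = sets borel" and sf: "sigma_finite_measure M"
    and inv: "\<And>f a. f \<in> borel_measurable borel \<Longrightarrow> (\<integral>\<^sup>+x. f (x + a) \<partial>M) = (\<integral>\<^sup>+x. f x \<partial>M)"
    and A[measurable]: "A \<in> sets borel" and B[measurable]: "B \<in> sets borel"
  shows "emeasure M A * emeasure lborel B = emeasure lborel A * emeasure M (uminus -` B)"
proof -
  note [measurable_cong] = sets
  interpret M: sigma_finite_measure M by (rule sf)
  interpret pair_sigma_finite M "lborel :: 'a measure" by unfold_locales
  have space: "space M = UNIV" using sets_eq_imp_space_eq[OF sets] by simp
  have B': "uminus -` B \<in> sets M" using measurable_sets[OF borel_measurable_uminus[OF measurable_ident_sets[OF refl]] B] sets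
    by simp
  have "emeasure M A * emeasure lborel B = (\<integral>\<^sup>+x. indicator A x * emeasure lborel B \<partial>M)"
    using A sets by (simp add: nn_integral_multc)
  also have "\<dots> = (\<integral>\<^sup>+x. \<integral>\<^sup>+y. indicator A x * indicator B (y - x) \<partial>lborel \<partial>M)"
  proof (rule nn_integral_cong)
    fix x
    have "emeasure lborel B = (\<integral>\<^sup>+y. indicator B (y + (- x)) \<partial>lborel)"
      by (subst nn_integral_lborel_translate) auto
    then show "indicator A x * emeasure lborel B = (\<integral>\<^sup>+y. indicator A x * indicator B (y - x) \<partial>lborel)"
      by (simp add: nn_integral_cmult)
  qed
  also have "\<dots> = (\<integral>\<^sup>+y. \<integral>\<^sup>+x. indicator A x * indicator B (y - x) \<partial>M \<partial>lborel)"
    by (rule Fubini'[symmetric]) simp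
  also have "\<dots> = (\<integral>\<^sup>+y. \<integral>\<^sup>+x. indicator A (x + y) * indicator B (- x) \<partial>M \<partial>lborel)"
  proof (rule nn_integral_cong)
    fix y :: 'a
    have "(\<lambda>x. indicator A x * indicator B (y - x) :: ennreal) \<in> borel_measurable borel" by measurable
    from inv[OF this, of y]
    show "(\<integral>\<^sup>+x. indicator A x * indicator B (y - x) \<partial>M) = (\<integral>\<^sup>+x. indicator A (x + y) * indicator B (- x) \<partial>M)"
      by simp
  qed
  also have "\<dots> = (\<integral>\<^sup>+x. \<integral>\<^sup>+y. indicator A (x + y) * indicator B (- x) \<partial>lborel \<partial>M)"
    by (rule Fubini') simp
  also have "\<dots> = (\<integral>\<^sup>+x. emeasure lborel A * indicator (uminus -` B) x \<partial>M)"
  proof (rule nn_integral_cong)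
    fix x
    have "(\<integral>\<^sup>+y. indicator A (y + x) \<partial>lborel) = emeasure lborel A"
      by (subst nn_integral_lborel_translate) auto
    then show "(\<integral>\<^sup>+y. indicator A (x + y) * indicator B (- x) \<partial>lborel) = emeasure lborel A * indicator (uminus -` B) x"
      by (simp add: nn_integral_multc add.commute indicator_def)
  qed
  also have "\<dots> = emeasure lborel A * emeasure M (uminus -` B)"
    using B' by (simp add: nn_integral_cmult)
  finally show ?thesis .
qed

definition hproj :: "'a::euclidean_space \<Rightarrow> 'a \<Rightarrow> 'a" where
  "hproj \<nu> x = x - (x \<bullet> \<nu>) *\<^sub>R \<nu>"

text \<open>
  Averaging over \<open>0 < x \<bullet> \<nu> < 1\<close> replaces integration over the hyperplane orthogonal to \<open>\<nu>\<close>: a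
  function of \<open>hproj \<nu> x\<close> has the same integral for both, but no space of smaller dimension
  is needed.
\<close>

definition slab_measure :: "'a::euclidean_space \<Rightarrow> 'a measure" where
  "slab_measure \<nu> = density lborel (\<lambda>x. indicator {0<..<1} (x \<bullet> \<nu>))"

lemma continuous_on_hproj [continuous_intros]:
  "continuous_on S f \<Longrightarrow> continuous_on S (\<lambda>x. hproj \<nu> (f x))"
  unfolding hproj_def by (intro continuous_intros)

lemma borel_measurable_hproj [measurable]: "hproj \<nu> \<in> borel_measurable borel"
  unfolding hproj_def[abs_def] by measurable

lemma linear_hproj: "linear (hproj \<nu>)"
  by (auto simp: hproj_def linear_iff algebra_simps inner_add_left scaleR_add_left)

lemma hproj_inner: "norm \<nu> = 1 \<Longrightarrow> hproj \<nu> x \<bullet> \<nu> = 0"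
  by (simp add: hproj_def inner_diff_left norm_eq_1)

lemma hproj_eq: "z \<bullet> \<nu> = 0 \<Longrightarrow> hproj \<nu> z = z"
  by (simp add: hproj_def)

lemma hproj_hproj: "norm \<nu> = 1 \<Longrightarrow> hproj \<nu> (hproj \<nu> x) = hproj \<nu> x"
  by (simp add: hproj_eq hproj_inner)

lemma hproj_add_normal: "norm \<nu> = 1 \<Longrightarrow> hproj \<nu> (x + t *\<^sub>R \<nu>) = hproj \<nu> x"
  by (simp add: hproj_def inner_add_left norm_eq_1 algebra_simps)

lemma hproj_decomp: "x = hproj \<nu> x + (x \<bullet> \<nu>) *\<^sub>R \<nu>"
  by (simp add: hproj_def)

lemma norm_hproj_sum:
  assumes "norm \<nu> = 1" "z \<bullet> \<nu> = 0"
  shows "(norm (z + t *\<^sub>R \<nu>))\<^sup>2 = (norm z)\<^sup>2 + t\<^sup>2"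
  using assms
  by (simp add: power2_norm_eq_inner inner_add_left inner_add_right norm_eq_1 inner_commute[of \<nu> z])
     (simp add: power2_eq_square)

lemma norm_hproj_le: "norm \<nu> = 1 \<Longrightarrow> norm (hproj \<nu> x) \<le> norm x"
proof -
  assume \<nu>: "norm \<nu> = 1"
  have "(norm x)\<^sup>2 = (norm (hproj \<nu> x))\<^sup>2 + (x \<bullet> \<nu>)\<^sup>2"
    using norm_hproj_sum[OF \<nu> hproj_inner[OF \<nu>], of x "x \<bullet> \<nu>"] hproj_decomp[of x \<nu>] by simp
  then have "(norm (hproj \<nu> x))\<^sup>2 \<le> (norm x)\<^sup>2" by simp
  then show ?thesis by simp
qed

lemma hproj_diff: "hproj \<nu> (x - y) = hproj \<nu> x - hproj \<nu> y"
  by (rule linear_diff[OF linear_hproj])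

lemma sets_slab_measure [measurable_cong]: "sets (slab_measure \<nu>) = sets borel"
  by (simp add: slab_measure_def)

lemma space_slab_measure [simp]: "space (slab_measure \<nu>) = UNIV"
  by (simp add: slab_measure_def)

lemma sigma_finite_slab_measure: "sigma_finite_measure (slab_measure \<nu>)"
  unfolding slab_measure_def
  by (subst sigma_finite_measure.sigma_finite_iff_density_finite[OF sigma_finite_lborel])
     (auto simp: indicator_def)

lemma nn_integral_slab_measure:
  assumes [measurable]: "F \<in> borel_measurable borel"
  shows "(\<integral>\<^sup>+x. F x \<partial>slab_measure \<nu>) = (\<integral>\<^sup>+x. indicator {0<..<1} (x \<bullet> \<nu>) * F x \<partial>lborel)"
  unfolding slab_measure_def by (subst nn_integral_density) auto

text \<open>
  Insert the factor \<open>1 = \<integral> w (x \<bullet> \<nu> + t) dt\<close>, where \<open>w\<close> is the indicator function of the unit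
  interval, and translate \<open>x\<close> by \<open>- t *\<^sub>R \<nu>\<close>.
\<close>

lemma nn_integral_slices:
  fixes F :: "'a::euclidean_space \<Rightarrow> ennreal"
  assumes \<nu>: "norm \<nu> = 1" and [measurable]: "F \<in> borel_measurable borel"
  shows "(\<integral>\<^sup>+x. F x \<partial>lborel) = (\<integral>\<^sup>+x. \<integral>\<^sup>+t. F (hproj \<nu> x + t *\<^sub>R \<nu>) \<partial>lborel \<partial>slab_measure \<nu>)"
proof -
  let ?w = "\<lambda>t. indicator {0<..<1::real} t :: ennreal"
  have w1: "(\<integral>\<^sup>+t. ?w (c + t) \<partial>lborel) = 1" for c :: real
    using nn_integral_lborel_translate[of ?w c] by (simp add: add.commute)
  have "(\<integral>\<^sup>+x. F x \<partial>lborel) = (\<integral>\<^sup>+x. \<integral>\<^sup>+t. F x * ?w (x \<bullet> \<nu> + t) \<partial>lborel \<partial>lborel)"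
    using w1 by (simp add: nn_integral_cmult)
  also have "\<dots> = (\<integral>\<^sup>+t. \<integral>\<^sup>+x. F x * ?w (x \<bullet> \<nu> + t) \<partial>lborel \<partial>lborel)"
    by (rule lborel_pair.Fubini'[symmetric]) simp
  also have "\<dots> = (\<integral>\<^sup>+t. \<integral>\<^sup>+x. F (x - t *\<^sub>R \<nu>) * ?w (x \<bullet> \<nu>) \<partial>lborel \<partial>lborel)"
  proof (rule nn_integral_cong)
    fix t
    show "(\<integral>\<^sup>+x. F x * ?w (x \<bullet> \<nu> + t) \<partial>lborel) = (\<integral>\<^sup>+x. F (x - t *\<^sub>R \<nu>) * ?w (x \<bullet> \<nu>) \<partial>lborel)"
      using nn_integral_lborel_translate[of "\<lambda>x. F x * ?w (x \<bullet> \<nu> + t)" "- t *\<^sub>R \<nu>"] \<nu>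
      by (simp add: inner_diff_left norm_eq_1)
  qed
  also have "\<dots> = (\<integral>\<^sup>+x. \<integral>\<^sup>+t. F (x - t *\<^sub>R \<nu>) * ?w (x \<bullet> \<nu>) \<partial>lborel \<partial>lborel)"
    by (rule lborel_pair.Fubini') simp
  also have "\<dots> = (\<integral>\<^sup>+x. ?w (x \<bullet> \<nu>) * (\<integral>\<^sup>+t. F (hproj \<nu> x + t *\<^sub>R \<nu>) \<partial>lborel) \<partial>lborel)"
  proof (rule nn_integral_cong)
    fix x :: 'a
    have "(\<integral>\<^sup>+t. F (hproj \<nu> x + t *\<^sub>R \<nu>) \<partial>lborel) = (\<integral>\<^sup>+t. F (x - t *\<^sub>R \<nu>) \<partial>lborel)"
      by (subst nn_integral_real_affine[where c="-1" and t="x \<bullet> \<nu>"])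
         (auto simp: hproj_def algebra_simps)
    then show "(\<integral>\<^sup>+t. F (x - t *\<^sub>R \<nu>) * ?w (x \<bullet> \<nu>) \<partial>lborel) = ?w (x \<bullet> \<nu>) * (\<integral>\<^sup>+t. F (hproj \<nu> x + t *\<^sub>R \<nu>) \<partial>lborel)"
      by (simp add: nn_integral_multc mult.commute)
  qed
  also have "\<dots> = (\<integral>\<^sup>+x. \<integral>\<^sup>+t. F (hproj \<nu> x + t *\<^sub>R \<nu>) \<partial>lborel \<partial>slab_measure \<nu>)"
    by (subst nn_integral_slab_measure) simp_all
  finally show ?thesis .
qed

section \<open>Hausdorff measure on hyperplanes\<close>

definition hausdorff_borel :: "nat \<Rightarrow> 'a::euclidean_space measure" where
  "hausdorff_borel s = distr (hausdorff_measure s) borel (\<lambda>x. x)"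

lemma id_measurable_hausdorff:
  "(\<lambda>x. x) \<in> hausdorff_measure s \<rightarrow>\<^sub>M (borel :: 'a::euclidean_space measure)"
  using sets_borel_subset_hausdorff[of s, where 'a='a] by (auto simp: measurable_def)

lemma sets_hausdorff_borel [simp, measurable_cong]: "sets (hausdorff_borel s) = sets borel"
  by (simp add: hausdorff_borel_def)

lemma space_hausdorff_borel [simp]: "space (hausdorff_borel s) = UNIV"
  by (simp add: hausdorff_borel_def)

lemma emeasure_hausdorff_borel:
  "A \<in> sets borel \<Longrightarrow> emeasure (hausdorff_borel s) A = hausdorff_outer s (A :: 'a::euclidean_space set)"
  using sets_borel_subset_hausdorff[of s, where 'a='a]
  by (subst hausdorff_borel_def, subst emeasure_distr[OF id_measurable_hausdorff])
     (auto simp: emeasure_hausdorff_measure)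

lemma hausdorff_pre_le_finite_cover:
  fixes C :: "'i \<Rightarrow> 'a::euclidean_space set"
  assumes I: "finite I" and cov: "A \<subseteq> (\<Union>i\<in>I. C i)" and \<delta>: "\<delta> \<ge> 0"
    and C: "\<And>i. i \<in> I \<Longrightarrow> bounded (C i) \<and> diameter (C i) \<le> \<delta>"
  shows "hausdorff_pre s \<delta> A \<le> of_nat (card I) * ennreal (\<delta> ^ s)"
proof -
  obtain h where h: "bij_betw h {0..<card I} I" using ex_bij_betw_nat_finite[OF I] by blast
  define D where "D = (\<lambda>n. if n < card I then C (h n) else {})"
  have hI: "n < card I \<Longrightarrow> h n \<in> I" for n using h by (auto simp: bij_betw_def)
  have "hausdorff_pre s \<delta> A \<le> (\<Sum>n. if D n = {} then 0 else ennreal (diameter (D n) ^ s))"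
  proof (rule hausdorff_pre_le)
    show "A \<subseteq> (\<Union>n. D n)"
    proof
      fix x assume "x \<in> A"
      then obtain i where i: "i \<in> I" "x \<in> C i" using cov by blast
      then have "i \<in> h ` {0..<card I}" using h by (simp add: bij_betw_def)
      then obtain n where "n < card I" "h n = i" by auto
      then have "x \<in> D n" using i by (simp add: D_def)
      then show "x \<in> (\<Union>n. D n)" by blast
    qed
  qed (use C hI \<delta> in \<open>auto simp: D_def\<close>)
  also have "\<dots> = (\<Sum>n<card I. if D n = {} then 0 else ennreal (diameter (D n) ^ s))"
    by (rule suminf_finite) (auto simp: D_def)
  also have "\<dots> \<le> (\<Sum>n<card I. ennreal (\<delta> ^ s))"
    using C hI by (intro sum_mono) (auto simp: D_def intro!: ennreal_leI power_mono diameter_ge_0)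
  finally show ?thesis by simp
qed

text \<open>The coordinate hyperplane is cut into a grid of cubes of side \<open>2 R / M\<close>.\<close>

lemma hausdorff_outer_flat_cube_finite:
  fixes k :: "'n::finite"
  assumes R: "R > 0"
  shows "hausdorff_outer (CARD('n) - 1) {x :: real^'n. x $ k = 0 \<and> (\<forall>i. \<bar>x $ i\<bar> \<le> R)} < top"
proof -
  let ?d = "CARD('n)" and ?A = "{x :: real^'n. x $ k = 0 \<and> (\<forall>i. \<bar>x $ i\<bar> \<le> R)}"
  have "hausdorff_outer (?d - 1) ?A \<le> ennreal ((2 * R * real ?d) ^ (?d - 1))"
    unfolding hausdorff_outer_def
  proof (rule SUP_least)
    fix \<delta> :: real assume "\<delta> \<in> {0<..}"
    then have \<delta>: "\<delta> > 0" by simp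
    obtain M :: nat where M: "2 * R * real ?d / \<delta> < real M" using reals_Archimedean2 by blast
    have "0 < 2 * R * real ?d / \<delta>" using R \<delta> by simp
    then have M0: "M > 0" using M by (cases M) auto
    define h where "h = 2 * R / real M"
    have h: "h > 0" using R M0 by (simp add: h_def)
    have hd: "real ?d * h \<le> \<delta>" using M M0 \<delta> by (simp add: h_def field_simps)
    define I where "I = Pi\<^sub>E (UNIV - {k}) (\<lambda>_. {..<M})"
    define C where "C = (\<lambda>j. {x :: real^'n. x $ k = 0 \<and> (\<forall>i\<in>UNIV-{k}. real (j i) * h - R \<le> x $ i \<and> x $ i \<le> (real (j i) + 1) * h - R)})"
    have fin: "finite I" unfolding I_def by (intro finite_PiE) auto
    have card: "card I = M ^ (?d - 1)" unfolding I_def by (subst card_PiE) auto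
    have dist: "norm (x - y) \<le> real ?d * h" if "x \<in> C j" "y \<in> C j" for x y j
    proof -
      have "norm (x - y) \<le> (\<Sum>i\<in>UNIV. \<bar>(x - y) $ i\<bar>)" by (rule norm_le_l1_cart)
      also have "\<dots> \<le> (\<Sum>i\<in>(UNIV :: 'n set). h)"
      proof (rule sum_mono)
        fix i :: 'n
        show "\<bar>(x - y) $ i\<bar> \<le> h"
        proof (cases "i = k")
          case False
          then have "real (j i) * h - R \<le> x $ i" "x $ i \<le> (real (j i) + 1) * h - R"
             "real (j i) * h - R \<le> y $ i" "y $ i \<le> (real (j i) + 1) * h - R"
            using that by (auto simp: C_def)
          then show ?thesis by (simp add: algebra_simps abs_le_iff)
        qed (use that h in \<open>auto simp: C_def\<close>)
      qed
      finally show ?thesis by simp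
    qed
    have bdd: "bounded (C j)" for j
    proof (cases "C j = {}")
      case False
      then obtain y where y: "y \<in> C j" by blast
      show ?thesis
        by (rule bounded_subset[OF bounded_cball[of y "real ?d * h"]])
           (use dist[OF _ y] in \<open>auto simp: dist_norm norm_minus_commute\<close>)
    qed simp
    have diam: "diameter (C j) \<le> real ?d * h" for j
      using dist h by (intro diameter_le) auto
    have cov: "?A \<subseteq> (\<Union>j\<in>I. C j)"
    proof
      fix x assume x: "x \<in> ?A"
      define j where "j = restrict (\<lambda>i. if x $ i = R then M - 1 else nat \<lfloor>(x $ i + R) / h\<rfloor>) (UNIV - {k})"
      have b: "j i < M \<and> real (j i) * h - R \<le> x $ i \<and> x $ i \<le> (real (j i) + 1) * h - R" if i: "i \<noteq> k" for i
      proof (cases "x $ i = R")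
        case True
        then show ?thesis using M0 R i by (auto simp: j_def h_def field_simps of_nat_diff)
      next
        case False
        have xi: "- R \<le> x $ i" "x $ i < R" using x False abs_le_D2[of "x $ i" R] abs_le_D1[of "x $ i" R] by (auto simp: order_less_le)
        let ?q = "(x $ i + R) / h"
        have hM: "h * real M = 2 * R" using M0 by (simp add: h_def)
        have q0: "0 \<le> ?q" using xi h by simp
        have "x $ i + R < real M * h" using xi hM by (simp add: mult.commute)
        then have q: "0 \<le> ?q" "?q < real M" using q0 h by (simp_all add: pos_divide_less_eq)
        have fl: "real (nat \<lfloor>?q\<rfloor>) \<le> ?q" "?q \<le> real (nat \<lfloor>?q\<rfloor>) + 1"
          using q by (auto simp: of_nat_nat)
        have "real (nat \<lfloor>?q\<rfloor>) < real M" using fl q by linarith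
        then have "nat \<lfloor>?q\<rfloor> < M" by simp
        moreover have "real (nat \<lfloor>?q\<rfloor>) * h \<le> x $ i + R" "x $ i + R \<le> (real (nat \<lfloor>?q\<rfloor>) + 1) * h"
          using fl h by (simp_all add: field_simps)
        ultimately show ?thesis using False i by (simp add: j_def)
      qed
      have "j \<in> I" using b by (auto simp: I_def j_def PiE_def extensional_def)
      moreover have "x \<in> C j" using x b by (auto simp: C_def)
      ultimately show "x \<in> (\<Union>j\<in>I. C j)" by blast
    qed
    have "hausdorff_pre (?d - 1) \<delta> ?A \<le> hausdorff_pre (?d - 1) (real ?d * h) ?A"
      by (rule hausdorff_pre_antimono[OF hd])
    also have "\<dots> \<le> of_nat (card I) * ennreal ((real ?d * h) ^ (?d - 1))"
      using diam bdd h by (intro hausdorff_pre_le_finite_cover[OF fin cov]) auto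
    also have "\<dots> = ennreal ((real M * (real ?d * h)) ^ (?d - 1))"
      using h unfolding card
      by (simp add: ennreal_of_nat_eq_real_of_nat ennreal_mult'[symmetric] power_mult_distrib del: of_nat_power)
    also have "real M * (real ?d * h) = 2 * R * real ?d" using M0 by (simp add: h_def)
    finally show "hausdorff_pre (?d - 1) \<delta> ?A \<le> ennreal ((2 * R * real ?d) ^ (?d - 1))" .
  qed
  then show ?thesis using ennreal_less_top le_less_trans by blast
qed

text \<open>
  Every covering of the flat unit cube by sets of diameter \<open>d\<^sub>i\<close> yields a covering of the unit cube
  by boxes with sides \<open>2 d\<^sub>i\<close> along the hyperplane and height one.
\<close>

lemma hausdorff_outer_flat_unit_cube_pos:
  fixes k :: "'n::finite"
  shows "0 < hausdorff_outer (CARD('n) - 1) {x :: real^'n. x \<in> cbox 0 1 \<and> x $ k = 0}"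
proof -
  let ?s = "CARD('n) - 1" and ?A = "{x :: real^'n. x \<in> cbox 0 1 \<and> x $ k = 0}"
  have "ennreal ((1/2) ^ ?s) \<le> hausdorff_pre ?s 1 ?A"
  proof (rule le_hausdorff_preI)
    fix C :: "nat \<Rightarrow> (real^'n) set"
    assume C: "?A \<subseteq> (\<Union>i. C i)" "\<And>i. bounded (C i)" "\<And>i. diameter (C i) \<le> 1"
    define c where "c = (\<lambda>i. SOME x. x \<in> C i)"
    have c: "c i \<in> C i" if "C i \<noteq> {}" for i using that unfolding c_def by (simp add: some_in_eq)
    define lo hi where
      "lo = (\<lambda>i. \<chi> j. if j = k then 0 else c i $ j - diameter (C i))" and
      "hi = (\<lambda>i. \<chi> j. if j = k then 1 else c i $ j + diameter (C i))"
    define B where "B = (\<lambda>i. if C i = {} then {} else cbox (lo i) (hi i))"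
    have d0: "diameter (C i) \<ge> 0" for i using C(2) by (rule diameter_ge_0)
    have emB: "emeasure lborel (B i) = ennreal (2 ^ ?s) * (if C i = {} then 0 else ennreal (diameter (C i) ^ ?s))" for i
    proof (cases "C i = {}")
      case False
      have ne: "cbox (lo i) (hi i) \<noteq> {}"
        using d0 by (simp add: interval_ne_empty_cart lo_def hi_def)
      have "measure lborel (cbox (lo i) (hi i)) = (\<Prod>j\<in>UNIV. hi i $ j - lo i $ j)"
        using content_cbox_cart[OF ne] .
      also have "\<dots> = (hi i $ k - lo i $ k) * (\<Prod>j\<in>UNIV - {k}. hi i $ j - lo i $ j)"
        by (rule prod.remove) auto
      also have "\<dots> = (\<Prod>j\<in>UNIV - {k}. 2 * diameter (C i))"
        by (simp add: lo_def hi_def)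
      also have "\<dots> = 2 ^ ?s * diameter (C i) ^ ?s" by (simp add: power_mult_distrib)
      finally have "measure lborel (cbox (lo i) (hi i)) = 2 ^ ?s * diameter (C i) ^ ?s" .
      then show ?thesis using False d0
        by (simp add: B_def emeasure_eq_measure2[OF fmeasurable_cbox] ennreal_mult[symmetric])
    qed (simp add: B_def)
    have "cbox 0 1 \<subseteq> (\<Union>i. B i)"
    proof
      fix x :: "real^'n" assume x: "x \<in> cbox 0 1"
      define y where "y = (\<chi> j. if j = k then 0 else x $ j)"
      have "y \<in> ?A" using x by (auto simp: y_def mem_box_cart)
      then obtain i where i: "y \<in> C i" using C(1) by blast
      have "\<bar>y $ j - c i $ j\<bar> \<le> diameter (C i)" for j
      proof -
        have "\<bar>y $ j - c i $ j\<bar> \<le> norm (y - c i)" using component_le_norm_cart[of "y - c i" j] by simp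
        also have "\<dots> \<le> diameter (C i)"
          using diameter_bounded_bound[OF C(2) i c[of i]] i by (auto simp: dist_norm)
        finally show ?thesis .
      qed
      then have yc: "c i $ j - diameter (C i) \<le> y $ j \<and> y $ j \<le> c i $ j + diameter (C i)" for j
        by (metis abs_diff_le_iff add.commute diff_le_eq)
      have "lo i $ j \<le> x $ j \<and> x $ j \<le> hi i $ j" for j
        using yc[of j] x by (cases "j = k") (auto simp: lo_def hi_def y_def mem_box_cart)
      then have "x \<in> B i" using i by (auto simp: B_def mem_box_cart)
      then show "x \<in> (\<Union>i. B i)" by (rule UN_I[OF UNIV_I])
    qed
    then have "emeasure lborel (cbox 0 (1::real^'n)) \<le> emeasure lborel (\<Union>i. B i)"
      by (rule emeasure_mono) (auto simp: B_def)
    also have "\<dots> \<le> (\<Sum>i. emeasure lborel (B i))"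
      by (rule emeasure_subadditive_countably) (auto simp: B_def)
    also have "emeasure lborel (cbox 0 (1::real^'n)) = 1"
    proof -
      have "measure lborel (cbox 0 (1::real^'n)) = 1"
        by (subst content_cbox_cart) (auto simp: interval_ne_empty_cart)
      then show ?thesis by (simp add: emeasure_eq_measure2[OF fmeasurable_cbox])
    qed
    finally have "1 \<le> ennreal (2 ^ ?s) * (\<Sum>i. if C i = {} then 0 else ennreal (diameter (C i) ^ ?s))"
      unfolding emB by simp
    then have "ennreal ((1/2) ^ ?s) * 1 \<le> ennreal ((1/2) ^ ?s) *
        (ennreal (2 ^ ?s) * (\<Sum>i. if C i = {} then 0 else ennreal (diameter (C i) ^ ?s)))"
      by (rule mult_left_mono) simp
    also have "\<dots> = (\<Sum>i. if C i = {} then 0 else ennreal (diameter (C i) ^ ?s))"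
      by (simp add: mult.assoc[symmetric] ennreal_mult[symmetric] power_mult_distrib[symmetric] del: ennreal_suminf_cmult)
    finally show "ennreal ((1/2) ^ ?s) \<le> (\<Sum>i. if C i = {} then 0 else ennreal (diameter (C i) ^ ?s))"
      by simp
  qed
  also have "\<dots> \<le> hausdorff_outer ?s ?A" by (rule hausdorff_pre_le_outer) simp
  finally show ?thesis by (rule less_le_trans[rotated]) simp
qed

text \<open>The reciprocal of the normalising factor in the surface measure.\<close>

definition flat_const :: "'n::finite itself \<Rightarrow> ennreal" where
  "flat_const _ = hausdorff_outer (CARD('n) - 1) (flat_unit_cube :: (real^'n) set)"

lemma flat_const_pos: "flat_const TYPE('n::finite) > 0"
  unfolding flat_const_def flat_unit_cube_def by (rule hausdorff_outer_flat_unit_cube_pos)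

lemma flat_const_finite: "flat_const TYPE('n::finite) < top"
proof -
  let ?k = "SOME k :: 'n. True"
  have "flat_const TYPE('n) \<le> hausdorff_outer (CARD('n) - 1) {x :: real^'n. x $ ?k = 0 \<and> (\<forall>i. \<bar>x $ i\<bar> \<le> 1)}"
    unfolding flat_const_def flat_unit_cube_def by (intro hausdorff_outer_mono) (auto simp: mem_box_cart)
  also have "\<dots> < top" by (rule hausdorff_outer_flat_cube_finite) simp
  finally show ?thesis .
qed

definition hyperplane_measure :: "real^'n \<Rightarrow> (real^'n::finite) measure" where
  "hyperplane_measure n = density (hausdorff_borel (CARD('n) - 1)) (indicator {x. x \<bullet> n = 0})"

lemma hyperplane_borel [measurable]: "{x :: 'a::euclidean_space. x \<bullet> n = 0} \<in> sets borel"
  by measurable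

lemma sets_hyperplane_measure [simp, measurable_cong]: "sets (hyperplane_measure n) = sets borel"
  by (simp add: hyperplane_measure_def)

lemma space_hyperplane_measure [simp]: "space (hyperplane_measure n) = UNIV"
  by (simp add: hyperplane_measure_def)

lemma nn_integral_hyperplane_measure:
  fixes n :: "real^'n::finite"
  assumes [measurable]: "F \<in> borel_measurable borel"
  shows "(\<integral>\<^sup>+z. F z \<partial>hyperplane_measure n) =
    (\<integral>\<^sup>+z. indicator {x. x \<bullet> n = 0} z * F z \<partial>hausdorff_borel (CARD('n) - 1))"
  unfolding hyperplane_measure_def by (subst nn_integral_density) auto

lemma nn_integral_hyperplane_cong:
  fixes n :: "real^'n::finite"
  assumes [measurable]: "F \<in> borel_measurable borel" "G \<in> borel_measurable borel"
    and eq: "\<And>z. z \<bullet> n = 0 \<Longrightarrow> F z = G z"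
  shows "(\<integral>\<^sup>+z. F z \<partial>hyperplane_measure n) = (\<integral>\<^sup>+z. G z \<partial>hyperplane_measure n)"
  by (simp add: nn_integral_hyperplane_measure)
     (rule nn_integral_cong, use eq in \<open>auto simp: indicator_def\<close>)

lemma emeasure_hyperplane_measure:
  fixes n :: "real^'n::finite"
  assumes [measurable]: "A \<in> sets borel"
  shows "emeasure (hyperplane_measure n) A = hausdorff_outer (CARD('n) - 1) (A \<inter> {x. x \<bullet> n = 0})"
proof -
  have "emeasure (hyperplane_measure n) A =
      (\<integral>\<^sup>+z. indicator ({x. x \<bullet> n = 0} \<inter> A) z \<partial>hausdorff_borel (CARD('n) - 1))"
    unfolding hyperplane_measure_def
    by (subst emeasure_density) (simp_all flip: indicator_inter_arith)
  also have "\<dots> = emeasure (hausdorff_borel (CARD('n) - 1)) ({x. x \<bullet> n = 0} \<inter> A)"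
    by (rule nn_integral_indicator) simp
  also have "\<dots> = hausdorff_outer (CARD('n) - 1) ({x. x \<bullet> n = 0} \<inter> A)"
    by (rule emeasure_hausdorff_borel) simp
  finally show ?thesis by (simp add: Int_commute)
qed

lemma hyperplane_measure_image:
  fixes n m :: "real^'n::finite"
  assumes f: "f \<in> borel_measurable borel" and iso: "\<And>x y. dist (f x) (f y) = dist x y"
    and img: "f ` {x. x \<bullet> n = 0} = {x. x \<bullet> m = 0}"
  shows "distr (hyperplane_measure n) borel f = hyperplane_measure m"
proof (rule measure_eqI)
  fix A assume "A \<in> sets (distr (hyperplane_measure n) borel f)"
  then have A: "A \<in> sets borel" by simp
  have fA: "f -` A \<in> sets borel" using measurable_sets[OF f A] by simp
  have fm: "f \<in> hyperplane_measure n \<rightarrow>\<^sub>M borel" using f by (simp add: measurable_def)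
  have "emeasure (distr (hyperplane_measure n) borel f) A = emeasure (hyperplane_measure n) (f -` A)"
    using A fm by (simp add: emeasure_distr)
  also have "\<dots> = hausdorff_outer (CARD('n) - 1) (f -` A \<inter> {x. x \<bullet> n = 0})"
    by (rule emeasure_hyperplane_measure[OF fA])
  also have "\<dots> = hausdorff_outer (CARD('n) - 1) (f ` (f -` A \<inter> {x. x \<bullet> n = 0}))"
    by (rule hausdorff_outer_isometry[symmetric]) (rule iso)
  also have "f ` (f -` A \<inter> {x. x \<bullet> n = 0}) = A \<inter> {x. x \<bullet> m = 0}"
  proof (intro equalityI subsetI)
    fix y assume y: "y \<in> A \<inter> {x. x \<bullet> m = 0}"
    then have "y \<in> f ` {x. x \<bullet> n = 0}" using img by simp
    then show "y \<in> f ` (f -` A \<inter> {x. x \<bullet> n = 0})" using y by auto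
  next
    fix y assume "y \<in> f ` (f -` A \<inter> {x. x \<bullet> n = 0})"
    then obtain x where x: "y = f x" "f x \<in> A" "x \<bullet> n = 0" by auto
    then have "f x \<in> {x. x \<bullet> m = 0}" unfolding img[symmetric] by simp
    then show "y \<in> A \<inter> {x. x \<bullet> m = 0}" using x by simp
  qed
  finally show "emeasure (distr (hyperplane_measure n) borel f) A = emeasure (hyperplane_measure m) A"
    unfolding emeasure_hyperplane_measure[OF A, of m] .
qed simp

lemma hyperplane_rotation:
  fixes n m :: "real^'n::finite"
  assumes "norm n = 1" "norm m = 1"
  shows "\<exists>f. linear f \<and> (\<forall>x y. f x \<bullet> f y = x \<bullet> y) \<and> f n = m \<and> (\<forall>x y. dist (f x) (f y) = dist x y) \<and>
    f ` {x. x \<bullet> n = 0} = {x. x \<bullet> m = 0} \<and> f \<in> borel_measurable borel"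
proof -
  obtain f where f: "orthogonal_transformation f" "f n = m"
    using orthogonal_transformation_exists[of n m] assms by auto
  have lin: "linear f" and inn: "f x \<bullet> f y = x \<bullet> y" for x y
    using f(1) by (auto simp: orthogonal_transformation_def)
  have dist: "dist (f x) (f y) = dist x y" for x y
    using f(1) orthogonal_transformation_isometry[of f] by blast
  have "f ` {x. x \<bullet> n = 0} = {x. x \<bullet> m = 0}"
  proof (safe)
    fix x assume "x \<bullet> n = 0" then show "f x \<bullet> m = 0" using inn[of x n] f by simp
  next
    fix y assume y: "y \<bullet> m = 0"
    obtain x where x: "y = f x" using surjD[OF orthogonal_transformation_surj[OF f(1)], of y] by blast
    then have "x \<bullet> n = 0" using y inn[of x n] f by simp
    then show "y \<in> f ` {x. x \<bullet> n = 0}" using x by (intro image_eqI[of _ _ x]) simp_all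
  qed
  moreover have "f \<in> borel_measurable borel"
    using linear_continuous_on[of f UNIV] lin
    by (intro borel_measurable_continuous_onI) (simp add: linear_conv_bounded_linear)
  ultimately show ?thesis using lin inn f(2) dist by (intro exI[of _ f]) simp
qed

text \<open>A rotation moves the ball into a cube in a coordinate hyperplane.\<close>

lemma emeasure_hyperplane_cball_finite:
  fixes n :: "real^'n::finite"
  assumes n: "norm n = 1"
  shows "emeasure (hyperplane_measure n) (cball 0 R) < top"
proof -
  let ?k = "SOME k :: 'n. True"
  let ?B = "{x :: real^'n. x $ ?k = 0 \<and> (\<forall>i. \<bar>x $ i\<bar> \<le> \<bar>R\<bar> + 1)}"
  define e where "e = (axis ?k 1 :: real^'n)"
  have e: "norm e = 1" by (simp add: e_def norm_axis_1)
  obtain f where f: "linear f" "\<And>x y. f x \<bullet> f y = x \<bullet> y" "f e = n"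
    "\<And>x y. dist (f x) (f y) = dist x y" "f ` {x. x \<bullet> e = 0} = {x. x \<bullet> n = 0}"
    "f \<in> borel_measurable borel"
    using hyperplane_rotation[OF e n] by blast
  have "cball 0 R \<inter> {x. x \<bullet> n = 0} \<subseteq> f ` ?B"
  proof
    fix y assume y: "y \<in> cball 0 R \<inter> {x. x \<bullet> n = 0}"
    then obtain x where x: "y = f x" "x \<bullet> e = 0" using f(5) by blast
    have "norm x = norm y" using f(2)[of x x] x by (simp add: norm_eq_sqrt_inner)
    moreover have "norm y \<le> R" using y by simp
    ultimately have "norm x \<le> \<bar>R\<bar> + 1" by linarith
    then have "\<bar>x $ i\<bar> \<le> \<bar>R\<bar> + 1" for i using component_le_norm_cart[of x i] by linarith
    then show "y \<in> f ` ?B" using x by (auto simp: inner_axis e_def)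
  qed
  then have "emeasure (hyperplane_measure n) (cball 0 R) \<le> hausdorff_outer (CARD('n) - 1) (f ` ?B)"
    by (subst emeasure_hyperplane_measure) (auto intro: hausdorff_outer_mono)
  also have "\<dots> = hausdorff_outer (CARD('n) - 1) ?B"
    by (rule hausdorff_outer_isometry) (rule f)
  also have "\<dots> < top" by (rule hausdorff_outer_flat_cube_finite) simp
  finally show ?thesis .
qed

lemma sigma_finite_of_cballs:
  fixes M :: "'a::euclidean_space measure"
  assumes "sets M = sets borel" and "\<And>R. emeasure M (cball 0 R) < top"
  shows "sigma_finite_measure M"
proof
  have "space M = UNIV" using sets_eq_imp_space_eq[OF assms(1)] by simp
  moreover have "(\<Union>m::nat. cball 0 (real m)) = (UNIV :: 'a set)"
    using real_arch_simple by (auto simp: set_eq_iff)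
  ultimately show "\<exists>A. countable A \<and> A \<subseteq> sets M \<and> \<Union> A = space M \<and> (\<forall>a\<in>A. emeasure M a \<noteq> \<infinity>)"
    using assms by (intro exI[of _ "range (\<lambda>m::nat. cball 0 (real m))"]) (auto simp: less_top)
qed

lemma sigma_finite_hyperplane_measure:
  "norm n = 1 \<Longrightarrow> sigma_finite_measure (hyperplane_measure (n :: real^'n::finite))"
  by (rule sigma_finite_of_cballs) (auto simp: emeasure_hyperplane_cball_finite)

lemma nn_integral_hyperplane_translate:
  fixes n :: "real^'n::finite"
  assumes a: "a \<bullet> n = 0" and [measurable]: "F \<in> borel_measurable borel"
  shows "(\<integral>\<^sup>+z. F (z + a) \<partial>hyperplane_measure n) = (\<integral>\<^sup>+z. F z \<partial>hyperplane_measure n)"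
proof -
  have "distr (hyperplane_measure n) borel (\<lambda>z. z + a) = hyperplane_measure n"
  proof (rule hyperplane_measure_image)
    show "(\<lambda>z. z + a) ` {x. x \<bullet> n = 0} = {x. x \<bullet> n = 0}"
    proof safe
      fix x assume "x \<bullet> n = 0" 
      then show "x \<in> (\<lambda>z. z + a) ` {x. x \<bullet> n = 0}"
        using a by (intro image_eqI[of _ _ "x - a"]) (auto simp: inner_diff_left)
    qed (use a in \<open>auto simp: inner_add_left\<close>)
  qed auto
  then have "(\<integral>\<^sup>+z. F z \<partial>hyperplane_measure n) = (\<integral>\<^sup>+z. F z \<partial>distr (hyperplane_measure n) borel (\<lambda>z. z + a))"
    by simp
  also have "\<dots> = (\<integral>\<^sup>+z. F (z + a) \<partial>hyperplane_measure n)"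
    by (rule nn_integral_distr) auto
  finally show ?thesis by simp
qed

text \<open>
  The product of the measures on the hyperplane and on its normal, to be identified with a multiple of
  Lebesgue measure by its invariance under translations.
\<close>

definition stacked_measure :: "real^'n \<Rightarrow> (real^'n::finite) measure" where
  "stacked_measure n = distr (hyperplane_measure n \<Otimes>\<^sub>M lborel) borel (\<lambda>(z, t). z + t *\<^sub>R n)"

lemma nn_integral_stacked_measure:
  fixes n :: "real^'n::finite"
  assumes [measurable]: "F \<in> borel_measurable borel"
  shows "(\<integral>\<^sup>+x. F x \<partial>stacked_measure n) = (\<integral>\<^sup>+z. \<integral>\<^sup>+t. F (z + t *\<^sub>R n) \<partial>lborel \<partial>hyperplane_measure n)"
proof -
  have "(\<integral>\<^sup>+x. F x \<partial>stacked_measure n) =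
      (\<integral>\<^sup>+p. F (fst p + snd p *\<^sub>R n) \<partial>(hyperplane_measure n \<Otimes>\<^sub>M lborel))"
    unfolding stacked_measure_def case_prod_unfold by (subst nn_integral_distr) auto
  also have "\<dots> = (\<integral>\<^sup>+z. \<integral>\<^sup>+t. F (z + t *\<^sub>R n) \<partial>lborel \<partial>hyperplane_measure n)"
    by (subst sigma_finite_measure.nn_integral_fst[OF sigma_finite_lborel, symmetric]) auto
  finally show ?thesis .
qed

lemma sets_stacked_measure [simp, measurable_cong]: "sets (stacked_measure n) = sets borel"
  by (simp add: stacked_measure_def)

lemma sigma_finite_stacked_measure:
  fixes n :: "real^'n::finite"
  assumes n: "norm n = 1"
  shows "sigma_finite_measure (stacked_measure n)"
proof (rule sigma_finite_of_cballs)
  fix R :: real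
  let ?R = "\<bar>R\<bar>"
  have [measurable]: "cball 0 r \<in> sets (borel :: (real^'n) measure)" for r
    by (rule borel_closed) simp
  have "emeasure (stacked_measure n) (cball 0 R) = (\<integral>\<^sup>+x. indicator (cball 0 R) x \<partial>stacked_measure n)"
    by simp
  also have "\<dots> = (\<integral>\<^sup>+z. \<integral>\<^sup>+t. indicator (cball 0 R) (z + t *\<^sub>R n) \<partial>lborel \<partial>hyperplane_measure n)"
    by (rule nn_integral_stacked_measure) (auto intro!: borel_measurable_indicator borel_closed)
  also have "\<dots> = (\<integral>\<^sup>+z. indicator {x. x \<bullet> n = 0} z * (\<integral>\<^sup>+t. indicator (cball 0 R) (z + t *\<^sub>R n) \<partial>lborel) \<partial>hausdorff_borel (CARD('n) - 1))"
    by (rule nn_integral_hyperplane_measure) simp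
  also have "\<dots> \<le> (\<integral>\<^sup>+z. indicator {x. x \<bullet> n = 0} z * (indicator (cball 0 ?R) z * ennreal (2 * ?R)) \<partial>hausdorff_borel (CARD('n) - 1))"
  proof (rule nn_integral_mono)
    fix z :: "real^'n"
    have "(\<integral>\<^sup>+t. indicator (cball 0 R) (z + t *\<^sub>R n) \<partial>lborel) \<le> indicator (cball 0 ?R) z * ennreal (2 * ?R)"
      if z: "z \<bullet> n = 0"
    proof -
      have "(\<integral>\<^sup>+t. indicator (cball 0 R) (z + t *\<^sub>R n) \<partial>lborel) \<le> (\<integral>\<^sup>+t. indicator (cball 0 ?R) z * indicator {-?R..?R} t \<partial>lborel)"
      proof (rule nn_integral_mono)
        fix t :: real
        have "norm z \<le> ?R \<and> \<bar>t\<bar> \<le> ?R" if "norm (z + t *\<^sub>R n) \<le> R"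
        proof -
          have "(norm z)\<^sup>2 + t\<^sup>2 \<le> ?R\<^sup>2"
            using norm_hproj_sum[OF n z, of t] power_mono[OF that, of 2] by simp
          moreover have "0 \<le> (norm z)\<^sup>2" "0 \<le> t\<^sup>2" by simp_all
          ultimately have "(norm z)\<^sup>2 \<le> ?R\<^sup>2" "\<bar>t\<bar>\<^sup>2 \<le> ?R\<^sup>2" unfolding power2_abs by linarith+
          then show ?thesis using power2_le_imp_le[of "norm z" ?R] power2_le_imp_le[of "\<bar>t\<bar>" ?R] by simp
        qed
        then show "indicator (cball 0 R) (z + t *\<^sub>R n) \<le> (indicator (cball 0 ?R) z * indicator {-?R..?R} t :: ennreal)"
          by (auto simp: indicator_def abs_le_iff)
      qed
      also have "\<dots> = indicator (cball 0 ?R) z * ennreal (2 * ?R)"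
        by (subst nn_integral_cmult) auto
      finally show ?thesis .
    qed
    then show "indicator {x. x \<bullet> n = 0} z * (\<integral>\<^sup>+t. indicator (cball 0 R) (z + t *\<^sub>R n) \<partial>lborel)
       \<le> indicator {x. x \<bullet> n = 0} z * (indicator (cball 0 ?R) z * ennreal (2 * ?R))"
      by (auto simp: indicator_def)
  qed
  also have "\<dots> = (\<integral>\<^sup>+z. indicator (cball 0 ?R) z * ennreal (2 * ?R) \<partial>hyperplane_measure n)"
    by (rule nn_integral_hyperplane_measure[symmetric]) simp
  also have "\<dots> = emeasure (hyperplane_measure n) (cball 0 ?R) * ennreal (2 * ?R)"
    by (subst nn_integral_multc) auto
  also have "\<dots> < top" using emeasure_hyperplane_cball_finite[OF n, of ?R]
    by (simp add: ennreal_mult_less_top)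
  finally show "emeasure (stacked_measure n) (cball 0 R) < top" .
qed simp

lemma nn_integral_stacked_translate:
  fixes n :: "real^'n::finite"
  assumes n: "norm n = 1" and [measurable]: "F \<in> borel_measurable borel"
  shows "(\<integral>\<^sup>+x. F (x + a) \<partial>stacked_measure n) = (\<integral>\<^sup>+x. F x \<partial>stacked_measure n)"
proof -
  let ?G = "\<lambda>z. \<integral>\<^sup>+t. F (z + t *\<^sub>R n) \<partial>lborel"
  have "(\<integral>\<^sup>+t. F (z + t *\<^sub>R n + a) \<partial>lborel) = ?G (z + hproj n a)" for z
  proof -
    have "z + t *\<^sub>R n + a = z + hproj n a + (t + a \<bullet> n) *\<^sub>R n" for t
      using hproj_decomp[of a n] by (simp add: algebra_simps)
    then have "(\<integral>\<^sup>+t. F (z + t *\<^sub>R n + a) \<partial>lborel) = (\<integral>\<^sup>+t. F (z + hproj n a + (t + a \<bullet> n) *\<^sub>R n) \<partial>lborel)"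
      by presburger
    then show ?thesis
      using nn_integral_lborel_translate[of "\<lambda>t. F (z + hproj n a + t *\<^sub>R n)" "a \<bullet> n"] by simp
  qed
  then have "(\<integral>\<^sup>+x. F (x + a) \<partial>stacked_measure n) = (\<integral>\<^sup>+z. ?G (z + hproj n a) \<partial>hyperplane_measure n)"
    by (subst nn_integral_stacked_measure) auto
  also have "\<dots> = (\<integral>\<^sup>+z. ?G z \<partial>hyperplane_measure n)"
    by (rule nn_integral_hyperplane_translate) (auto simp: hproj_inner n)
  also have "\<dots> = (\<integral>\<^sup>+x. F x \<partial>stacked_measure n)"
    by (rule nn_integral_stacked_measure[symmetric]) simp
  finally show ?thesis .
qed

text \<open>
  Translation invariance leaves one constant for each direction; it does not depend on the
  direction because rotations preserve Hausdorff measure and the unit ball, and for a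
  coordinate direction the unit cube shows that it is the Hausdorff measure of the flat unit cube.
\<close>

lemma nn_integral_hyperplane_slices:
  fixes n :: "real^'n::finite"
  assumes n: "norm n = 1" and [measurable]: "F \<in> borel_measurable borel"
  shows "(\<integral>\<^sup>+z. \<integral>\<^sup>+t. F (z + t *\<^sub>R n) \<partial>lborel \<partial>hyperplane_measure n) =
    flat_const TYPE('n) * (\<integral>\<^sup>+x. F x \<partial>lborel)"
proof -
  let ?b = "emeasure lborel (ball 0 1 :: (real^'n) set)"
  have b: "?b \<noteq> 0" "?b \<noteq> top"
  proof -
    have "?b = ennreal (measure lborel (ball 0 1 :: (real^'n) set))"
      using emeasure_lborel_ball_finite[of "0::real^'n" 1] by (intro emeasure_eq_ennreal_measure) (simp add: less_top)
    moreover have "measure lborel (ball 0 1 :: (real^'n) set) > 0"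
      using content_ball_pos[of 1 "0::real^'n"] by simp
    ultimately show "?b \<noteq> 0" "?b \<noteq> top" by auto
  qed
  have [measurable]: "ball 0 1 \<in> sets (borel :: (real^'n) measure)"
    by (rule borel_open) simp
  define c where "c = (\<lambda>m :: real^'n. emeasure (stacked_measure m) (ball 0 1) / ?b)"
  have proportional: "emeasure (stacked_measure m) A = c m * emeasure lborel A"
    if m: "norm m = 1" and A: "A \<in> sets borel" for m :: "real^'n" and A
  proof -
    have "emeasure (stacked_measure m) A * ?b = emeasure lborel A * emeasure (stacked_measure m) (uminus -` ball 0 1)"
      by (rule translation_invariant_proportional)
         (use A in \<open>auto simp: sigma_finite_stacked_measure m nn_integral_stacked_translate\<close>)
    also have "uminus -` ball 0 1 = (ball 0 1 :: (real^'n) set)" by auto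
    finally have "emeasure (stacked_measure m) A * ?b / ?b =
        emeasure lborel A * emeasure (stacked_measure m) (ball 0 1) / ?b" by simp
    then show ?thesis using b by (simp add: mult_divide_eq_ennreal c_def ennreal_times_divide mult.commute)
  qed
  let ?k = "SOME k :: 'n. True"
  define e where "e = (axis ?k 1 :: real^'n)"
  have e: "norm e = 1" by (simp add: e_def norm_axis_1)
  have "c n = c e"
  proof -
    obtain f where f: "linear f" "\<And>x y. f x \<bullet> f y = x \<bullet> y" "f e = n"
      "\<And>x y. dist (f x) (f y) = dist x y" "f ` {x. x \<bullet> e = 0} = {x. x \<bullet> n = 0}" 
      "f \<in> borel_measurable borel"
      using hyperplane_rotation[OF e n] by blast
    note [measurable] = f(6)
    have nf: "norm (f x) = norm x" for x using f(2)[of x x] by (simp add: norm_eq_sqrt_inner)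
    have "emeasure (stacked_measure n) (ball 0 1) = (\<integral>\<^sup>+x. indicator (ball 0 1) x \<partial>stacked_measure n)" by simp
    also have "\<dots> = (\<integral>\<^sup>+z. \<integral>\<^sup>+t. indicator (ball 0 1) (z + t *\<^sub>R n) \<partial>lborel \<partial>hyperplane_measure n)"
      by (rule nn_integral_stacked_measure) (auto intro!: borel_measurable_indicator borel_closed)
    also have "\<dots> = (\<integral>\<^sup>+z. \<integral>\<^sup>+t. indicator (ball 0 1) (z + t *\<^sub>R n) \<partial>lborel \<partial>distr (hyperplane_measure e) borel f)"
      by (simp add: hyperplane_measure_image[OF f(6) f(4) f(5)])
    also have "\<dots> = (\<integral>\<^sup>+z. \<integral>\<^sup>+t. indicator (ball 0 1) (f z + t *\<^sub>R n) \<partial>lborel \<partial>hyperplane_measure e)"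
      by (rule nn_integral_distr) auto
    also have "\<dots> = (\<integral>\<^sup>+z. \<integral>\<^sup>+t. indicator (ball 0 1) (z + t *\<^sub>R e) \<partial>lborel \<partial>hyperplane_measure e)"
    proof -
      have "f z + t *\<^sub>R n = f (z + t *\<^sub>R e)" for z t
        using f(3) linear_add[OF f(1)] linear_cmul[OF f(1)] by simp
      then have "indicator (ball 0 1) (f z + t *\<^sub>R n) = (indicator (ball 0 1) (z + t *\<^sub>R e) :: ennreal)" for z t
        by (simp add: indicator_def nf)
      then show ?thesis by simp
    qed
    also have "\<dots> = emeasure (stacked_measure e) (ball 0 1)"
      by (subst nn_integral_stacked_measure[symmetric]) auto
    finally show ?thesis by (simp add: c_def)
  qed
  moreover have "c e = flat_const TYPE('n)"
  proof -
    have flatm [measurable]: "(flat_unit_cube :: (real^'n) set) \<in> sets borel"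
      unfolding flat_unit_cube_def by measurable
    have in_box: "z + t *\<^sub>R e \<in> cbox 0 1 \<longleftrightarrow> z \<in> flat_unit_cube \<and> t \<in> {0..1}" if "z \<bullet> e = 0" for z :: "real^'n" and t
    proof -
      have "z $ ?k = 0" using that by (simp add: e_def inner_axis)
      then have comp: "(z + t *\<^sub>R e) $ i = (if i = ?k then t else z $ i)" for i
        by (simp add: e_def axis_def)
      show ?thesis
      proof
        assume *: "z + t *\<^sub>R e \<in> cbox 0 1"
        then have b: "0 \<le> (if i = ?k then t else z $ i) \<and> (if i = ?k then t else z $ i) \<le> 1" for i
          unfolding mem_box_cart comp by simp
        have "0 \<le> z $ i \<and> z $ i \<le> 1" for i
          using b[of i] \<open>z $ ?k = 0\<close> by (cases "i = ?k") auto
        then show "z \<in> flat_unit_cube \<and> t \<in> {0..1}"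
          using b[of ?k] \<open>z $ ?k = 0\<close> by (simp add: flat_unit_cube_def mem_box_cart)
      next
        assume "z \<in> flat_unit_cube \<and> t \<in> {0..1}"
        then show "z + t *\<^sub>R e \<in> cbox 0 1"
          unfolding mem_box_cart comp by (simp add: flat_unit_cube_def mem_box_cart)
      qed
    qed
    have "c e * 1 = c e * emeasure lborel (cbox 0 (1 :: real^'n))"
    proof -
      have "measure lborel (cbox 0 (1::real^'n)) = 1"
        by (subst content_cbox_cart) (auto simp: interval_ne_empty_cart)
      then show ?thesis by (simp add: emeasure_eq_measure2[OF fmeasurable_cbox])
    qed
    also have "\<dots> = emeasure (stacked_measure e) (cbox 0 1)" using proportional[OF e] by simp
    also have "\<dots> = (\<integral>\<^sup>+x. indicator (cbox 0 1) x \<partial>stacked_measure e)" by simp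
    also have "\<dots> = (\<integral>\<^sup>+z. \<integral>\<^sup>+t. indicator (cbox 0 1) (z + t *\<^sub>R e) \<partial>lborel \<partial>hyperplane_measure e)"
      by (rule nn_integral_stacked_measure) (auto intro!: borel_measurable_indicator borel_closed)
    also have "\<dots> = (\<integral>\<^sup>+z. indicator flat_unit_cube z \<partial>hyperplane_measure e)"
    proof (rule nn_integral_hyperplane_cong)
      fix z :: "real^'n" assume z: "z \<bullet> e = 0"
      have "(\<integral>\<^sup>+t. indicator (cbox 0 1) (z + t *\<^sub>R e) \<partial>lborel) =
          (\<integral>\<^sup>+t. indicator flat_unit_cube z * indicator {0..1::real} t \<partial>lborel)"
        by (rule nn_integral_cong) (use in_box[OF z] in \<open>auto simp: indicator_def\<close>)
      also have "\<dots> = indicator flat_unit_cube z" by (subst nn_integral_cmult) auto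
      finally show "(\<integral>\<^sup>+t. indicator (cbox 0 1) (z + t *\<^sub>R e) \<partial>lborel) = indicator flat_unit_cube z" .
    qed auto
    also have "\<dots> = emeasure (hyperplane_measure e) flat_unit_cube" by simp
    also have "\<dots> = hausdorff_outer (CARD('n) - 1) (flat_unit_cube \<inter> {x :: real^'n. x \<bullet> e = 0})"
      by (rule emeasure_hyperplane_measure) simp
    also have "flat_unit_cube \<inter> {x :: real^'n. x \<bullet> e = 0} = flat_unit_cube"
      by (auto simp: flat_unit_cube_def e_def inner_axis)
    finally show ?thesis by (simp add: flat_const_def)
  qed
  ultimately have "stacked_measure n = scale_measure (flat_const TYPE('n)) lborel"
    using proportional[OF n] by (intro measure_eqI) auto
  moreover have "(\<integral>\<^sup>+z. \<integral>\<^sup>+t. F (z + t *\<^sub>R n) \<partial>lborel \<partial>hyperplane_measure n) = (\<integral>\<^sup>+x. F x \<partial>stacked_measure n)"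
    by (rule nn_integral_stacked_measure[symmetric]) simp
  ultimately show ?thesis by (simp add: nn_integral_scale_measure)
qed

text \<open>
  For a direction \<open>\<nu>\<close> that is not normal, the tangential part of \<open>\<nu>\<close> is removed by translating in the
  hyperplane, and the normal part is a change of scale.
\<close>

lemma nn_integral_hyperplane_oblique:
  fixes n \<nu> :: "real^'n::finite"
  assumes n: "norm n = 1" and pos: "n \<bullet> \<nu> > 0" and [measurable]: "F \<in> borel_measurable borel"
  shows "ennreal (n \<bullet> \<nu>) * (\<integral>\<^sup>+z. \<integral>\<^sup>+t. F (z + t *\<^sub>R \<nu>) \<partial>lborel \<partial>hyperplane_measure n) =
    flat_const TYPE('n) * (\<integral>\<^sup>+x. F x \<partial>lborel)"
proof -
  interpret H: sigma_finite_measure "hyperplane_measure n" by (rule sigma_finite_hyperplane_measure[OF n])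
  interpret pair_sigma_finite "hyperplane_measure n" "lborel :: real measure" by unfold_locales
  let ?a = "n \<bullet> \<nu>"
  have "(\<integral>\<^sup>+z. \<integral>\<^sup>+t. F (z + t *\<^sub>R \<nu>) \<partial>lborel \<partial>hyperplane_measure n) =
      (\<integral>\<^sup>+t. \<integral>\<^sup>+z. F (z + t *\<^sub>R \<nu>) \<partial>hyperplane_measure n \<partial>lborel)"
    by (rule Fubini'[symmetric]) simp
  also have "\<dots> = (\<integral>\<^sup>+t. \<integral>\<^sup>+z. F (z + (?a * t) *\<^sub>R n) \<partial>hyperplane_measure n \<partial>lborel)"
  proof (rule nn_integral_cong)
    fix t :: real
    have "t *\<^sub>R \<nu> = t *\<^sub>R hproj n \<nu> + (?a * t) *\<^sub>R n"
      using hproj_decomp[of \<nu> n] by (simp add: hproj_def algebra_simps inner_commute)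
    then have "F (z + t *\<^sub>R \<nu>) = F ((z + t *\<^sub>R hproj n \<nu>) + (?a * t) *\<^sub>R n)" for z
      by (simp add: algebra_simps)
    then show "(\<integral>\<^sup>+z. F (z + t *\<^sub>R \<nu>) \<partial>hyperplane_measure n) = (\<integral>\<^sup>+z. F (z + (?a * t) *\<^sub>R n) \<partial>hyperplane_measure n)"
      using nn_integral_hyperplane_translate[of "t *\<^sub>R hproj n \<nu>" n "\<lambda>z. F (z + (?a * t) *\<^sub>R n)"]
      by (simp add: hproj_inner[OF n])
  qed
  also have "\<dots> = (\<integral>\<^sup>+z. \<integral>\<^sup>+t. F (z + (?a * t) *\<^sub>R n) \<partial>lborel \<partial>hyperplane_measure n)"
    by (rule Fubini') simp
  finally have "ennreal ?a * (\<integral>\<^sup>+z. \<integral>\<^sup>+t. F (z + t *\<^sub>R \<nu>) \<partial>lborel \<partial>hyperplane_measure n) =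
      (\<integral>\<^sup>+z. ennreal ?a * (\<integral>\<^sup>+t. F (z + (?a * t) *\<^sub>R n) \<partial>lborel) \<partial>hyperplane_measure n)"
    by (simp add: nn_integral_cmult)
  also have "\<dots> = (\<integral>\<^sup>+z. \<integral>\<^sup>+t. F (z + t *\<^sub>R n) \<partial>lborel \<partial>hyperplane_measure n)"
  proof (rule nn_integral_cong)
    fix z :: "real^'n"
    show "ennreal ?a * (\<integral>\<^sup>+t. F (z + (?a * t) *\<^sub>R n) \<partial>lborel) = (\<integral>\<^sup>+t. F (z + t *\<^sub>R n) \<partial>lborel)"
      using pos by (subst (2) nn_integral_real_affine[where c="?a" and t=0]) auto
  qed
  also have "\<dots> = flat_const TYPE('n) * (\<integral>\<^sup>+x. F x \<partial>lborel)"
    by (rule nn_integral_hyperplane_slices[OF n]) simp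
  finally show ?thesis .
qed

text \<open>
  The graph spans a hyperplane with unit normal \<open>n\<close>.  The set \<open>B\<close> of the points over \<open>E\<close> less than one unit above
  the graph in the direction \<open>\<nu>\<close> is measured in two ways: over the slab it has the measure of the base, and
  over the hyperplane it has the Hausdorff measure of the graph times \<open>n \<bullet> \<nu> = 1 / sqrt (1 + (norm l)\<^sup>2)\<close>.
\<close>

lemma hausdorff_outer_linear_graph:
  fixes \<nu> l :: "real^'n::finite"
  assumes \<nu>: "norm \<nu> = 1" and l: "l \<bullet> \<nu> = 0" and E[measurable]: "E \<in> sets borel"
  shows "hausdorff_outer (CARD('n) - 1) {z. z \<bullet> \<nu> = l \<bullet> z \<and> hproj \<nu> z \<in> E} =
    flat_const TYPE('n) * ennreal (sqrt (1 + (norm l)\<^sup>2)) * emeasure (slab_measure \<nu>) {x. hproj \<nu> x \<in> E}"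
proof -
  let ?J = "sqrt (1 + (norm l)\<^sup>2)"
  have J: "?J > 0" by (simp add: add_pos_nonneg)
  define n where "n = (1 / ?J) *\<^sub>R (\<nu> - l)"
  have vv: "\<nu> \<bullet> \<nu> = 1" using \<nu> by (simp add: norm_eq_1)
  have "(norm (\<nu> - l))\<^sup>2 = 1 + (norm l)\<^sup>2"
    using vv l by (simp add: power2_norm_eq_inner inner_diff_left inner_diff_right inner_commute)
  then have "norm (\<nu> - l) = ?J" by (metis norm_ge_zero real_sqrt_abs abs_of_nonneg)
  then have n1: "norm n = 1" using J by (simp add: n_def)
  have nv: "n \<bullet> \<nu> = 1 / ?J" using vv l by (simp add: n_def inner_diff_left)
  have hp: "z \<bullet> n = 0 \<longleftrightarrow> z \<bullet> \<nu> = l \<bullet> z" for z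
    using J by (auto simp: n_def inner_diff_right inner_commute)
  have lh: "l \<bullet> hproj \<nu> x = l \<bullet> x" for x using l by (simp add: hproj_def inner_diff_right)
  define B where "B = {x. hproj \<nu> x \<in> E \<and> 0 < x \<bullet> \<nu> - l \<bullet> x \<and> x \<bullet> \<nu> - l \<bullet> x < 1}"
  have Bm [measurable]: "B \<in> sets borel" unfolding B_def by measurable
  have Em [measurable]: "{x. hproj \<nu> x \<in> E} \<in> sets borel" by measurable
  have lborelB: "emeasure lborel B = emeasure (slab_measure \<nu>) {x. hproj \<nu> x \<in> E}"
  proof -
    have "emeasure lborel B = (\<integral>\<^sup>+x. \<integral>\<^sup>+t. indicator B (hproj \<nu> x + t *\<^sub>R \<nu>) \<partial>lborel \<partial>slab_measure \<nu>)"
      using nn_integral_slices[OF \<nu>, of "indicator B"] by simp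
    also have "\<dots> = (\<integral>\<^sup>+x. indicator {x. hproj \<nu> x \<in> E} x \<partial>slab_measure \<nu>)"
    proof (rule nn_integral_cong)
      fix x
      have "(\<integral>\<^sup>+t. indicator B (hproj \<nu> x + t *\<^sub>R \<nu>) \<partial>lborel) =
          (\<integral>\<^sup>+t. indicator {x. hproj \<nu> x \<in> E} x * indicator {l \<bullet> x<..<l \<bullet> x + 1} t \<partial>lborel)"
        by (rule nn_integral_cong)
           (use l vv in \<open>auto simp: indicator_def B_def hproj_add_normal[OF \<nu>] hproj_hproj[OF \<nu>] inner_add_left
              inner_add_right hproj_inner[OF \<nu>] lh\<close>)
      also have "\<dots> = indicator {x. hproj \<nu> x \<in> E} x" by (subst nn_integral_cmult) auto
      finally show "(\<integral>\<^sup>+t. indicator B (hproj \<nu> x + t *\<^sub>R \<nu>) \<partial>lborel) = indicator {x. hproj \<nu> x \<in> E} x" .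
    qed
    also have "\<dots> = emeasure (slab_measure \<nu>) {x. hproj \<nu> x \<in> E}"
      by (rule nn_integral_indicator) (simp add: sets_slab_measure)
    finally show ?thesis .
  qed
  have "(\<integral>\<^sup>+z. \<integral>\<^sup>+t. indicator B (z + t *\<^sub>R \<nu>) \<partial>lborel \<partial>hyperplane_measure n) =
      (\<integral>\<^sup>+z. indicator {x. hproj \<nu> x \<in> E} z \<partial>hyperplane_measure n)"
  proof (rule nn_integral_hyperplane_cong)
    fix z assume "z \<bullet> n = 0"
    then have z: "z \<bullet> \<nu> = l \<bullet> z" by (simp add: hp)
    have "(\<integral>\<^sup>+t. indicator B (z + t *\<^sub>R \<nu>) \<partial>lborel) =
          (\<integral>\<^sup>+t. indicator {x. hproj \<nu> x \<in> E} z * indicator {0<..<1::real} t \<partial>lborel)"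
      by (rule nn_integral_cong)
         (use l vv z in \<open>auto simp: indicator_def B_def hproj_add_normal[OF \<nu>] inner_add_left inner_add_right\<close>)
    also have "\<dots> = indicator {x. hproj \<nu> x \<in> E} z" by (subst nn_integral_cmult) auto
    finally show "(\<integral>\<^sup>+t. indicator B (z + t *\<^sub>R \<nu>) \<partial>lborel) = indicator {x. hproj \<nu> x \<in> E} z" .
  qed auto
  also have "\<dots> = hausdorff_outer (CARD('n) - 1) ({x. hproj \<nu> x \<in> E} \<inter> {x. x \<bullet> n = 0})"
    by (simp add: emeasure_hyperplane_measure)
  also have "{x. hproj \<nu> x \<in> E} \<inter> {x. x \<bullet> n = 0} = {z. z \<bullet> \<nu> = l \<bullet> z \<and> hproj \<nu> z \<in> E}"
    by (auto simp: hp)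
  finally have "ennreal (1 / ?J) * hausdorff_outer (CARD('n) - 1) {z. z \<bullet> \<nu> = l \<bullet> z \<and> hproj \<nu> z \<in> E} =
      flat_const TYPE('n) * emeasure (slab_measure \<nu>) {x. hproj \<nu> x \<in> E}"
    using nn_integral_hyperplane_oblique[OF n1, of \<nu> "indicator B"] nv J lborelB by simp
  then have "ennreal ?J * (ennreal (1 / ?J) * hausdorff_outer (CARD('n) - 1) {z. z \<bullet> \<nu> = l \<bullet> z \<and> hproj \<nu> z \<in> E}) =
      flat_const TYPE('n) * ennreal ?J * emeasure (slab_measure \<nu>) {x. hproj \<nu> x \<in> E}"
    by (simp add: ac_simps)
  moreover have "ennreal ?J * (ennreal (1 / ?J) * y) = y" for y
    using J by (simp add: mult.assoc[symmetric] ennreal_mult[symmetric])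
  ultimately show ?thesis by simp
qed

section \<open>Test functions and mollification\<close>

lemma Ck_on_SucD: "Ck_on (Suc k) S f \<Longrightarrow> Ck_on k S f"
proof (induction k arbitrary: f)
  case (Suc k)
  then obtain f' where f': "continuous_on S f" "\<forall>x\<in>interior S. (f has_derivative f' x) (at x)"
    "\<forall>b\<in>Basis. Ck_on (Suc k) S (\<lambda>x. f' x b)"
    by auto
  then have "\<forall>b\<in>Basis. Ck_on k S (\<lambda>x. f' x b)" using Suc.IH by blast
  with f' show ?case by auto
qed simp

lemma Ck_on_continuous: "Ck_on k S f \<Longrightarrow> continuous_on S f"
  by (cases k) auto

lemma Ck_on_UNIV_SucI:
  assumes "\<And>x. (f has_derivative f' x) (at x)" "\<And>b. b \<in> Basis \<Longrightarrow> Ck_on k UNIV (\<lambda>x. f' x b)"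
  shows "Ck_on (Suc k) UNIV f"
proof -
  have "continuous_on UNIV f"
    using assms(1) by (intro has_derivative_continuous_on) (auto intro: has_derivative_at_withinI)
  then show ?thesis using assms by auto
qed

lemma Ck_on_UNIV_SucE:
  assumes "Ck_on (Suc k) UNIV f"
  obtains f' where "\<And>x. (f has_derivative f' x) (at x)" "\<And>b. b \<in> Basis \<Longrightarrow> Ck_on k UNIV (\<lambda>x. f' x b)"
  using assms by auto

lemma Ck_on_const: "Ck_on k UNIV (\<lambda>x. c)"
proof (induction k arbitrary: c)
  case (Suc k)
  show ?case by (rule Ck_on_UNIV_SucI[of _ "\<lambda>x h. 0"]) (auto intro: Suc)
qed simp

lemma Ck_on_add:
  "Ck_on k UNIV f \<Longrightarrow> Ck_on k UNIV g \<Longrightarrow> Ck_on k UNIV (\<lambda>x. f x + g x)"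
proof (induction k arbitrary: f g)
  case (Suc k)
  obtain f' where
    f': "\<And>x. (f has_derivative f' x) (at x)" "\<And>b. b \<in> Basis \<Longrightarrow> Ck_on k UNIV (\<lambda>x. f' x b)"
    using Ck_on_UNIV_SucE[OF Suc.prems(1)] by blast
  obtain g' where
    g': "\<And>x. (g has_derivative g' x) (at x)" "\<And>b. b \<in> Basis \<Longrightarrow> Ck_on k UNIV (\<lambda>x. g' x b)"
    using Ck_on_UNIV_SucE[OF Suc.prems(2)] by blast
  show ?case
  proof (rule Ck_on_UNIV_SucI)
    show "((\<lambda>x. f x + g x) has_derivative (\<lambda>h. f' x h + g' x h)) (at x)" for x
      by (intro has_derivative_add f' g')
  qed (use Suc.IH f' g' in auto)
qed (simp add: continuous_on_add)

lemma Ck_on_mult: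
  fixes f g :: "'a::euclidean_space \<Rightarrow> real"
  shows "Ck_on k UNIV f \<Longrightarrow> Ck_on k UNIV g \<Longrightarrow> Ck_on k UNIV (\<lambda>x. f x * g x)"
proof (induction k arbitrary: f g)
  case (Suc k)
  obtain f' where
    f': "\<And>x. (f has_derivative f' x) (at x)" "\<And>b. b \<in> Basis \<Longrightarrow> Ck_on k UNIV (\<lambda>x. f' x b)"
    using Ck_on_UNIV_SucE[OF Suc.prems(1)] by blast
  obtain g' where
    g': "\<And>x. (g has_derivative g' x) (at x)" "\<And>b. b \<in> Basis \<Longrightarrow> Ck_on k UNIV (\<lambda>x. g' x b)"
    using Ck_on_UNIV_SucE[OF Suc.prems(2)] by blast
  have fg: "Ck_on k UNIV f" "Ck_on k UNIV g" using Suc.prems by (simp_all only: Ck_on_SucD)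
  show ?case
  proof (rule Ck_on_UNIV_SucI)
    show "((\<lambda>x. f x * g x) has_derivative (\<lambda>h. f x * g' x h + f' x h * g x)) (at x)" for x
      by (intro has_derivative_mult f' g')
    show "Ck_on k UNIV (\<lambda>x. f x * g' x b + f' x b * g x)" if "b \<in> Basis" for b
      using that f' g' fg by (intro Ck_on_add Suc.IH) auto
  qed
qed (simp add: continuous_on_mult)

lemma Ck_on_prod:
  fixes f :: "'i \<Rightarrow> 'a::euclidean_space \<Rightarrow> real"
  assumes "finite I" "\<And>i. i \<in> I \<Longrightarrow> Ck_on k UNIV (f i)"
  shows "Ck_on k UNIV (\<lambda>x. \<Prod>i\<in>I. f i x)"
  using assms by (induction I rule: finite_induct) (simp_all add: Ck_on_const Ck_on_mult)

text \<open>
  The derivatives of \<open>exp (- 1 / t)\<close> have the form \<open>P (1 / t) * exp (- 1 / t)\<close> with polynomials \<open>P\<close>, so all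
  of them tend to zero as \<open>t\<close> decreases to zero.
\<close>

primrec flat_poly :: "nat \<Rightarrow> real poly" where
  "flat_poly 0 = 1"
| "flat_poly (Suc j) = [:0, 0, 1:] * (flat_poly j - pderiv (flat_poly j))"

definition flat_exp :: "nat \<Rightarrow> real \<Rightarrow> real" where
  "flat_exp j t = (if t > 0 then poly (flat_poly j) (1 / t) * exp (- (1 / t)) else 0)"

lemma poly_mult_exp_tendsto_0: "((\<lambda>u. poly p u * exp (- u)) \<longlongrightarrow> 0) (at_top :: real filter)"
proof -
  have "((\<lambda>u. \<Sum>i\<le>degree p. coeff p i * (u ^ i / exp u)) \<longlongrightarrow> (\<Sum>i\<le>degree p. coeff p i * 0)) at_top"
    by (intro tendsto_sum tendsto_mult tendsto_const tendsto_power_div_exp_0)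
  moreover have "(\<lambda>u. \<Sum>i\<le>degree p. coeff p i * (u ^ i / exp u)) = (\<lambda>u. poly p u * exp (- u))"
    by (auto simp: poly_altdef sum_distrib_right exp_minus divide_simps)
  ultimately show ?thesis by simp
qed

lemma flat_exp_has_derivative: "(flat_exp j has_real_derivative flat_exp (Suc j) t) (at t)"
proof -
  consider "t > 0" | "t < 0" | "t = 0" by linarith
  then show ?thesis
  proof cases
    case 1
    have "((\<lambda>t. poly (flat_poly j) (1 / t) * exp (- (1 / t))) has_real_derivative flat_exp (Suc j) t) (at t)"
      using 1 by (auto intro!: derivative_eq_intros poly_DERIV[THEN DERIV_chain2] simp: flat_exp_def)
        (simp add: divide_simps power2_eq_square algebra_simps)
    then show ?thesis
      by (rule has_field_derivative_transform_within_open[of _ _ _ "{0<..}"]) (use 1 in \<open>auto simp: flat_exp_def\<close>)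
  next
    case 2
    have "((\<lambda>t. 0) has_real_derivative 0) (at t)" by simp
    then have "(flat_exp j has_real_derivative 0) (at t)"
      by (rule has_field_derivative_transform_within_open[of _ _ _ "{..<0}"]) (use 2 in \<open>auto simp: flat_exp_def\<close>)
    then show ?thesis using 2 by (simp add: flat_exp_def)
  next
    case 3
    have "((\<lambda>h. flat_exp j h / h) \<longlongrightarrow> 0) (at_right 0)"
    proof -
      have "filterlim (\<lambda>h::real. 1 / h) at_top (at_right 0)"
        using filterlim_inverse_at_top_right by (simp add: inverse_eq_divide)
      from filterlim_compose[OF poly_mult_exp_tendsto_0[of "[:0, 1:] * flat_poly j"] this]
      have "((\<lambda>h. 1 / h * poly (flat_poly j) (1 / h) * exp (- (1 / h))) \<longlongrightarrow> 0) (at_right 0)" by simp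
      then show ?thesis
        by (rule Lim_transform_eventually)
           (auto simp: eventually_at_right_less flat_exp_def intro!: eventually_at_rightI[of 0 1])
    qed
    moreover have "((\<lambda>h. flat_exp j h / h) \<longlongrightarrow> 0) (at_left 0)"
    proof (rule Lim_transform_eventually)
      show "((\<lambda>h::real. 0::real) \<longlongrightarrow> 0) (at_left 0)" by simp
      show "eventually (\<lambda>h. 0 = flat_exp j h / h) (at_left 0)"
        by (auto simp: flat_exp_def intro!: eventually_at_leftI[of "-1"])
    qed
    ultimately have "((\<lambda>h. flat_exp j h / h) \<longlongrightarrow> 0) (at 0)" by (simp add: filterlim_at_split)
    then show ?thesis using 3 by (simp add: DERIV_def flat_exp_def[of _ 0])
  qed
qed

lemma flat_exp_0: "flat_exp 0 t = (if t > 0 then exp (- (1 / t)) else 0)"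
  by (simp add: flat_exp_def)

lemma flat_exp_0_bounds: "0 \<le> flat_exp 0 t" "flat_exp 0 t \<le> 1"
  by (auto simp: flat_exp_0)

lemma flat_exp_0_pos_iff: "flat_exp 0 t > 0 \<longleftrightarrow> t > 0"
  by (auto simp: flat_exp_0)

lemma Ck_on_flat_exp: "Ck_on k UNIV (\<lambda>x :: real^'n::finite. flat_exp j (c * x $ i + d))"
proof (induction k arbitrary: j)
  case 0
  have "continuous_on UNIV (flat_exp j)"
    using flat_exp_has_derivative by (intro DERIV_continuous_on) (auto intro: has_field_derivative_at_within)
  then show ?case
    by (auto intro!: continuous_on_compose2[of UNIV "flat_exp j"] continuous_intros)
next
  case (Suc k)
  show ?case
  proof (rule Ck_on_UNIV_SucI)
    show "((\<lambda>x. flat_exp j (c * x $ i + d)) has_derivative (\<lambda>h. flat_exp (Suc j) (c * x $ i + d) * (c * h $ i))) (at x)"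
      for x :: "real^'n"
    proof -
      have "((\<lambda>x. c * x $ i + d) has_derivative (\<lambda>h. c * h $ i)) (at x)"
        by (auto intro!: derivative_eq_intros bounded_linear_imp_has_derivative bounded_linear_vec_nth)
      from has_derivative_compose[OF this flat_exp_has_derivative[of j "c * x $ i + d", unfolded has_field_derivative_def]]
      show ?thesis .
    qed
    show "Ck_on k UNIV (\<lambda>x. flat_exp (Suc j) (c * x $ i + d) * (c * b $ i))" for b :: "real^'n"
      by (intro Ck_on_mult Suc.IH Ck_on_const)
  qed
qed

text \<open>
  A smooth function, positive exactly on the box, which tends to the indicator function of the box as \<open>c\<close>
  tends to infinity.
\<close>

definition box_bump :: "real \<Rightarrow> real^'n \<Rightarrow> real^'n \<Rightarrow> real^'n::finite \<Rightarrow> real" where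
  "box_bump c a b x = (\<Prod>i\<in>UNIV. flat_exp 0 (c * (x $ i - a $ i)) * flat_exp 0 (c * (b $ i - x $ i)))"

lemma Ck_on_box_bump:
  fixes a b :: "real^'n::finite"
  shows "Ck_on k UNIV (box_bump c a b)"
proof -
  have "Ck_on k UNIV (\<lambda>x :: real^'n. flat_exp 0 (c * x $ i + (- c * a $ i)) * flat_exp 0 ((- c) * x $ i + c * b $ i))" for i
    by (intro Ck_on_mult Ck_on_flat_exp)
  then have "Ck_on k UNIV (\<lambda>x. \<Prod>i\<in>UNIV. flat_exp 0 (c * x $ i + (- c * a $ i)) * flat_exp 0 ((- c) * x $ i + c * b $ i))"
    by (intro Ck_on_prod) auto
  then show ?thesis unfolding box_bump_def[abs_def] by (simp add: algebra_simps)
qed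

lemma continuous_on_box_bump [continuous_intros]:
  "continuous_on S f \<Longrightarrow> continuous_on S (\<lambda>x. box_bump c a b (f x))"
  using continuous_on_compose2[OF Ck_on_continuous[OF Ck_on_box_bump]] by blast

lemma borel_measurable_box_bump [measurable]: "box_bump c a b \<in> borel_measurable borel"
  by (intro borel_measurable_continuous_onI continuous_on_box_bump continuous_on_id)

lemma box_bump_bounds: "0 \<le> box_bump c a b x" "box_bump c a b x \<le> 1"
  unfolding box_bump_def using flat_exp_0_bounds by (auto intro!: prod_nonneg prod_le_1 mult_le_one)

lemma box_bump_pos_iff:
  assumes "c > 0"
  shows "box_bump c a b x > 0 \<longleftrightarrow> x \<in> box a b"
proof
  assume "box_bump c a b x > 0"
  then have "box_bump c a b x \<noteq> 0" by simp
  then have "flat_exp 0 (c * (x $ i - a $ i)) \<noteq> 0 \<and> flat_exp 0 (c * (b $ i - x $ i)) \<noteq> 0" for i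
    by (simp add: box_bump_def)
  then have "flat_exp 0 (c * (x $ i - a $ i)) > 0 \<and> flat_exp 0 (c * (b $ i - x $ i)) > 0" for i
    using flat_exp_0_bounds(1) by (simp add: order_less_le)
  then show "x \<in> box a b" using assms by (simp add: flat_exp_0_pos_iff mem_box_cart zero_less_mult_iff)
next
  assume "x \<in> box a b"
  then show "box_bump c a b x > 0"
    unfolding box_bump_def using assms
    by (intro prod_pos) (auto simp: flat_exp_0_pos_iff mem_box_cart)
qed

lemma box_bump_eq_0: "c > 0 \<Longrightarrow> x \<notin> box a b \<Longrightarrow> box_bump c a b x = 0"
  using box_bump_pos_iff[of c a b x] box_bump_bounds(1)[of c a b x] by linarith

lemma box_bump_test_function:
  assumes "c > 0" "cbox a b \<subseteq> \<Omega>"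
  shows "box_bump c a b \<in> test_functions \<Omega>"
proof -
  have sub: "closure {x. box_bump c a b x \<noteq> 0} \<subseteq> cbox a b"
    using box_bump_eq_0[OF assms(1), of _ a b] box_subset_cbox[of a b]
    by (intro closure_minimal) (auto simp del: box_subset_cbox)
  then have "compact (closure {x. box_bump c a b x \<noteq> 0})"
    using bounded_subset[OF bounded_cbox] by (simp add: compact_eq_bounded_closed)
  then show ?thesis
    unfolding test_functions_def mem_Collect_eq
    by (intro conjI allI Ck_on_box_bump order_trans[OF sub assms(2)])
qed

lemma box_bump_tendsto: "(\<lambda>n. box_bump (real (Suc n)) a b x) \<longlonglongrightarrow> indicator (box a b) x"
proof (cases "x \<in> box a b")
  case True
  have f: "(\<lambda>n. flat_exp 0 (real (Suc n) * s)) \<longlonglongrightarrow> 1" if "s > 0" for s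
  proof -
    have "(\<lambda>n. exp (- (1 / s * inverse (real (Suc n))))) \<longlonglongrightarrow> exp (- (1 / s * 0))"
      by (intro tendsto_intros LIMSEQ_inverse_real_of_nat)
    then show ?thesis using that by (simp add: flat_exp_0 divide_simps inverse_eq_divide mult.commute)
  qed
  have "(\<lambda>n. box_bump (real (Suc n)) a b x) \<longlonglongrightarrow> (\<Prod>i\<in>(UNIV :: 'a set). 1 * 1)"
    unfolding box_bump_def using True by (intro tendsto_prod tendsto_mult f) (auto simp: mem_box_cart)
  then show ?thesis using True by simp
qed (simp add: box_bump_eq_0)

lemma integral_cbox_eq_box:
  fixes g :: "real^'n::finite \<Rightarrow> real"
  assumes "set_integrable lebesgue (cbox a b) g"
  shows "(LINT x:box a b|lebesgue. g x) = integral (cbox a b) g"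
proof -
  have "set_integrable lebesgue (box a b) g"
    by (rule set_integrable_subset[OF assms _ box_subset_cbox]) simp
  then have "(LINT x:box a b|lebesgue. g x) = integral (box a b) g"
    by (rule set_lebesgue_integral_eq_integral(2))
  also have "\<dots> = integral (cbox a b) g" by (rule integral_open_interval)
  finally show ?thesis .
qed

text \<open>
  Testing with the functions \<open>box_bump n\<close> shows that the integrals over all boxes vanish, and
  almost every value is the limit of averages over boxes.
\<close>

lemma fundamental_lemma:
  fixes \<Omega> :: "(real^'n::finite) set"
  assumes \<Omega>: "open \<Omega>" and g: "locally_integrable \<Omega> g"
    and zero: "\<And>\<phi>. \<phi> \<in> test_functions \<Omega> \<Longrightarrow> distr_fun \<Omega> g \<phi> = 0"
  shows "AE x in lebesgue. x \<in> \<Omega> \<longrightarrow> g x = 0"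
proof -
  have box0: "integral (cbox a b) g = 0" if ab: "cbox a b \<subseteq> \<Omega>" for a b
  proof -
    have gi: "set_integrable lebesgue (cbox a b) g"
      using g ab by (auto simp: locally_integrable_def)
    let ?s = "\<lambda>n x. indicator \<Omega> x *\<^sub>R (g x * box_bump (real (Suc n)) a b x)"
    have seq: "?s n x = (indicator (cbox a b) x *\<^sub>R g x) * box_bump (real (Suc n)) a b x" for n x
      using ab box_bump_eq_0[of "real (Suc n)" x a b] box_subset_cbox[of a b]
      by (auto simp: indicator_def)
    have bm: "box_bump c a b \<in> borel_measurable lebesgue" for c
      by (rule measurable_completion) simp
    have gm: "(\<lambda>x. indicator (cbox a b) x *\<^sub>R g x) \<in> borel_measurable lebesgue"
      using gi unfolding set_integrable_def by (rule borel_measurable_integrable)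
    have "(\<lambda>n. LINT x|lebesgue. ?s n x) \<longlonglongrightarrow> (LINT x|lebesgue. indicator (box a b) x *\<^sub>R g x)"
    proof (rule integral_dominated_convergence[where w="\<lambda>x. norm (indicator (cbox a b) x *\<^sub>R g x)"])
      have "(\<lambda>x. indicator (box a b) x *\<^sub>R g x) = (\<lambda>x. indicator (box a b) x *\<^sub>R (indicator (cbox a b) x *\<^sub>R g x))"
        using box_subset_cbox[of a b] by (auto simp: indicator_def fun_eq_iff)
      moreover have "\<dots> \<in> borel_measurable lebesgue"
        by (intro borel_measurable_scaleR borel_measurable_indicator gm) auto
      ultimately show "(\<lambda>x. indicator (box a b) x *\<^sub>R g x) \<in> borel_measurable lebesgue" by simp
      show "?s n \<in> borel_measurable lebesgue" for n
        unfolding seq by (intro borel_measurable_times gm bm)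
      show "integrable lebesgue (\<lambda>x. norm (indicator (cbox a b) x *\<^sub>R g x))"
        using gi unfolding set_integrable_def by (rule integrable_norm)
      show "AE x in lebesgue. (\<lambda>n. ?s n x) \<longlonglongrightarrow> indicator (box a b) x *\<^sub>R g x"
      proof (rule AE_I2)
        fix x
        have "(\<lambda>n. ?s n x) \<longlonglongrightarrow> (indicator (cbox a b) x *\<^sub>R g x) * indicator (box a b) x"
          unfolding seq by (intro tendsto_mult tendsto_const box_bump_tendsto)
        also have "(indicator (cbox a b) x *\<^sub>R g x) * indicator (box a b) x = indicator (box a b) x *\<^sub>R g x"
          using box_subset_cbox[of a b] by (auto simp: indicator_def)
        finally show "(\<lambda>n. ?s n x) \<longlonglongrightarrow> indicator (box a b) x *\<^sub>R g x" .
      qed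
      show "AE x in lebesgue. norm (?s n x) \<le> norm (indicator (cbox a b) x *\<^sub>R g x)" for n
        unfolding seq norm_mult
        by (rule AE_I2, rule mult_left_le) (simp_all add: box_bump_bounds abs_of_nonneg)
    qed
    moreover have "(LINT x|lebesgue. ?s n x) = 0" for n
      using zero[OF box_bump_test_function[of "real (Suc n)" a b \<Omega>]] ab
      by (simp add: distr_fun_def set_lebesgue_integral_def)
    ultimately have "(LINT x|lebesgue. indicator (box a b) x *\<^sub>R g x) = 0"
      using LIMSEQ_unique[OF _ tendsto_const[of 0]] by simp
    then have "(LINT x:box a b|lebesgue. g x) = 0" by (simp add: set_lebesgue_integral_def)
    then show ?thesis using integral_cbox_eq_box[OF gi] by simp
  qed
  have on_box: "negligible {x \<in> cbox p q. g x \<noteq> 0}" if pq: "cbox p q \<subseteq> \<Omega>" for p q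
  proof -
    define f where "f = (\<lambda>x. indicator (cbox p q) x *\<^sub>R g x)"
    have "set_integrable lebesgue (cbox p q) g"
      using g pq by (auto simp: locally_integrable_def)
    then have "integrable lebesgue f" by (simp add: f_def set_integrable_def)
    then have "f integrable_on cbox a b" for a b
      using integrable_on_lebesgue integrable_on_subcbox[of f UNIV] by blast
    from integrable_ccontinuous_explicit[OF this] obtain N where N: "negligible N"
      "\<And>x e. x \<notin> N \<Longrightarrow> 0 < e \<Longrightarrow> \<exists>d>0. \<forall>h. 0 < h \<and> h < d \<longrightarrow>
         norm (integral (cbox x (x + h *\<^sub>R One)) f /\<^sub>R h ^ DIM(real^'n) - f x) < e"
      by blast
    have "{x \<in> cbox p q. g x \<noteq> 0} \<subseteq> N \<union> (cbox p q - box p q)"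
    proof (rule ccontr)
      assume "\<not> ?thesis"
      then obtain x where x: "x \<in> box p q" "x \<notin> N" "g x \<noteq> 0" by blast
      then have fx: "f x = g x" using box_subset_cbox[of p q] by (auto simp: f_def)
      obtain d where d: "d > 0" "\<And>h. 0 < h \<Longrightarrow> h < d \<Longrightarrow>
         norm (integral (cbox x (x + h *\<^sub>R One)) f /\<^sub>R h ^ DIM(real^'n) - f x) < norm (f x)"
        using N(2)[OF x(2), of "norm (f x)"] x(3) fx by auto
      obtain e where e: "e > 0" "ball x e \<subseteq> box p q"
        using open_contains_ball[of "box p q"] x(1) open_box by blast
      define h where "h = min (d / 2) (e / (2 * real DIM(real^'n)))"
      have dim: "real DIM(real^'n) > 0" by simp
      have h: "0 < h" "h < d" using d e dim by (auto simp: h_def)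
      have "cbox x (x + h *\<^sub>R One) \<subseteq> ball x e"
      proof
        fix y assume y: "y \<in> cbox x (x + h *\<^sub>R One)"
        have "norm (y - x) \<le> (\<Sum>b\<in>Basis. \<bar>(y - x) \<bullet> b\<bar>)" by (rule norm_le_l1)
        also have "\<dots> \<le> (\<Sum>b\<in>(Basis :: (real^'n) set). h)"
          using y h by (intro sum_mono) (auto simp: mem_box inner_add_left inner_diff_left abs_le_iff)
        also have "\<dots> = real DIM(real^'n) * h" by simp
        also have "\<dots> \<le> real DIM(real^'n) * (e / (2 * real DIM(real^'n)))"
          using dim by (intro mult_left_mono) (auto simp: h_def)
        also have "\<dots> < e" using dim e by (simp add: field_simps)
        finally show "y \<in> ball x e" by (simp add: dist_norm norm_minus_commute)
      qed
      then have sub: "cbox x (x + h *\<^sub>R One) \<subseteq> cbox p q" using e box_subset_cbox[of p q] by blast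
      have "integral (cbox x (x + h *\<^sub>R One)) f = integral (cbox x (x + h *\<^sub>R One)) g"
        by (rule integral_cong) (use sub in \<open>auto simp: f_def indicator_def\<close>)
      also have "\<dots> = 0" using box0 sub pq by blast
      finally show False using d(2)[OF h] by simp
    qed
    moreover have "negligible (cbox p q - box p q)"
      by (rule negligible_frontier_interval)
    ultimately show ?thesis by (rule negligible_subset[OF negligible_Un[OF N(1)], rotated])
  qed
  obtain \<D> where \<D>: "countable \<D>" "\<D> \<subseteq> Pow \<Omega>" "\<And>X. X \<in> \<D> \<Longrightarrow> \<exists>a b. X = cbox a b" "\<Union>\<D> = \<Omega>"
    using open_countable_Union_open_cbox[OF \<Omega>] by blast
  have "negligible (\<Union>X\<in>\<D>. {x \<in> X. g x \<noteq> 0})"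
  proof (rule negligible_countable_Union[of "(\<lambda>X. {x \<in> X. g x \<noteq> 0}) ` \<D>", simplified])
    show "countable ((\<lambda>X. {x \<in> X. g x \<noteq> 0}) ` \<D>)" using \<D>(1) by simp
    fix S assume "S \<in> (\<lambda>X. {x \<in> X. g x \<noteq> 0}) ` \<D>"
    then obtain X where X: "X \<in> \<D>" "S = {x \<in> X. g x \<noteq> 0}" by blast
    then obtain a b where "X = cbox a b" "cbox a b \<subseteq> \<Omega>" using \<D> by blast
    then show "negligible S" using X on_box by simp
  qed
  also have "(\<Union>X\<in>\<D>. {x \<in> X. g x \<noteq> 0}) = {x\<in>\<Omega>. g x \<noteq> 0}" using \<D>(4) by blast
  finally have "{x\<in>\<Omega>. g x \<noteq> 0} \<in> null_sets lebesgue" by (simp add: negligible_iff_null_sets)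
  then show ?thesis by (rule AE_I') auto
qed

definition convolve :: "(real^'n::finite \<Rightarrow> real) \<Rightarrow> (real^'n \<Rightarrow> real) \<Rightarrow> real^'n \<Rightarrow> real" where
  "convolve \<phi> K x = (LINT z|lborel. \<phi> z * K (x - z))"

lemma convolve_eq_integral:
  fixes \<phi> :: "real^'n::finite \<Rightarrow> real"
  assumes \<phi>: "continuous_on UNIV \<phi>" and K: "continuous_on UNIV K"
    and supp: "\<And>y. norm y \<ge> R \<Longrightarrow> K y = 0" and sub: "cball x R \<subseteq> cbox a b"
  shows "convolve \<phi> K x = integral (cbox a b) (\<lambda>z. \<phi> z * K (x - z))"
proof -
  have "continuous_on (cbox a b) (\<lambda>z. \<phi> z * K (x - z))"
    by (intro continuous_intros continuous_on_subset[OF \<phi>] continuous_on_compose2[OF K]) auto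
  then have int: "set_integrable lborel (cbox a b) (\<lambda>z. \<phi> z * K (x - z))"
    unfolding set_integrable_def by (intro borel_integrable_compact) auto
  have "\<phi> z * K (x - z) = indicator (cbox a b) z *\<^sub>R (\<phi> z * K (x - z))" for z
  proof (cases "z \<in> cbox a b")
    case False
    then have "z \<notin> cball x R" using sub by blast
    then have "norm (x - z) \<ge> R" by (simp add: dist_norm)
    then show ?thesis by (simp add: supp)
  qed simp
  then have "convolve \<phi> K x = (LINT z:cbox a b|lborel. \<phi> z * K (x - z))"
    unfolding convolve_def set_lebesgue_integral_def by presburger
  also have "\<dots> = integral (cbox a b) (\<lambda>z. \<phi> z * K (x - z))"
    by (rule set_borel_integral_eq_integral(2)[OF int])
  finally show ?thesis .
qed

lemma has_derivative_eq_0_outside: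
  fixes K :: "'a::real_normed_vector \<Rightarrow> real"
  assumes "(K has_derivative K') (at y)" "\<And>y. norm y \<ge> R \<Longrightarrow> K y = 0" "norm y > R"
  shows "K' h = 0"
proof -
  have "(K has_derivative (\<lambda>h. 0)) (at y)"
  proof (rule has_derivative_transform_within_open)
    show "((\<lambda>y :: 'a. 0 :: real) has_derivative (\<lambda>h. 0)) (at y)" by (rule has_derivative_const)
    show "open {y :: 'a. norm y > R}" by (intro open_Collect_less continuous_intros)
  qed (simp_all add: assms(2,3))
  from has_derivative_unique[OF assms(1) this] show ?thesis by simp
qed

lemma linear_eq_inner_sum:
  fixes A :: "'a::euclidean_space \<Rightarrow> real"
  assumes "linear A"
  shows "A h = (\<Sum>b\<in>Basis. A b *\<^sub>R b) \<bullet> h"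
proof -
  have "A h = A (\<Sum>b\<in>Basis. (h \<bullet> b) *\<^sub>R b)" by (simp add: euclidean_representation)
  also have "\<dots> = (\<Sum>b\<in>Basis. (h \<bullet> b) * A b)"
    using assms by (simp add: linear_sum linear_cmul)
  also have "\<dots> = (\<Sum>b\<in>Basis. A b *\<^sub>R b) \<bullet> h"
    by (simp add: inner_sum_left inner_commute[of h] mult.commute)
  finally show ?thesis .
qed

text \<open>
  For points near \<open>x\<close> the integrands vanish outside a common box, on which one may differentiate under the
  integral sign.
\<close>

lemma convolve_has_derivative:
  fixes \<phi> K :: "real^'n::finite \<Rightarrow> real"
  assumes \<phi>: "continuous_on UNIV \<phi>"
    and K': "\<And>y. (K has_derivative K' y) (at y)"
    and cont: "\<And>b. b \<in> Basis \<Longrightarrow> continuous_on UNIV (\<lambda>y. K' y b)"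
    and supp: "\<And>y. norm y \<ge> R \<Longrightarrow> K y = 0"
  shows "(convolve \<phi> K has_derivative (\<lambda>h. convolve \<phi> (\<lambda>y. K' y h) x)) (at x)"
proof -
  define G where "G = (\<lambda>y. \<Sum>b\<in>Basis. K' y b *\<^sub>R b)"
  have KG: "K' y h = G y \<bullet> h" for y h
    unfolding G_def using K' by (intro linear_eq_inner_sum has_derivative_linear)
  have contG: "continuous_on UNIV G" unfolding G_def by (intro continuous_intros cont)
  have contK: "continuous_on UNIV K"
    using K' by (intro has_derivative_continuous_on) (auto intro: has_derivative_at_withinI)
  have supp': "norm y \<ge> R + 1 \<Longrightarrow> K' y h = 0" for y h
    using K' supp by (rule has_derivative_eq_0_outside) auto
  obtain c where c: "cball x (R + 3) \<subseteq> cbox (- c) c"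
    using bounded_subset_cbox_symmetric[OF bounded_cball] by blast
  have sub: "cball y r \<subseteq> cbox (- c) c" if "y \<in> ball x 1" "r \<le> R + 1" for y r
  proof
    fix z assume "z \<in> cball y r"
    then have "dist x z \<le> R + 3" using that dist_triangle[of x z y] by simp
    then show "z \<in> cbox (- c) c" using c by auto
  qed
  let ?f = "\<lambda>x z. \<phi> z * K (x - z)"
  let ?fx = "\<lambda>x z. \<phi> z *\<^sub>R blinfun_inner_right (G (x - z))"
  have cont_fx: "continuous_on S (\<lambda>z. ?fx y z)" for S y
    by (intro continuous_intros continuous_on_subset[OF \<phi>] continuous_on_compose2[OF contG]) auto
  have "((\<lambda>y. integral (cbox (- c) c) (?f y)) has_derivative integral (cbox (- c) c) (?fx x)) (at x within ball x 1)"
  proof (rule leibniz_rule)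
    show "((\<lambda>y. ?f y z) has_derivative blinfun_apply (?fx y z)) (at y within ball x 1)" for y z
    proof -
      have "((\<lambda>y. y - z) has_derivative (\<lambda>h. h)) (at y)" by (auto intro!: derivative_eq_intros)
      from has_derivative_compose[OF this K'[of "y - z"]]
      have "((\<lambda>y. K (y - z)) has_derivative K' (y - z)) (at y)" .
      from has_derivative_mult_right[OF this, of "\<phi> z"]
      show ?thesis
        by (rule has_derivative_at_withinI[OF has_derivative_eq_rhs]) (simp add: fun_eq_iff KG blinfun.scaleR_left)
    qed
    show "?f y integrable_on cbox (- c) c" for y
      by (intro integrable_continuous continuous_intros continuous_on_subset[OF \<phi>] continuous_on_compose2[OF contK]) auto
    show "continuous_on (ball x 1 \<times> cbox (- c) c) (\<lambda>(y, z). ?fx y z)"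
      unfolding case_prod_unfold
      by (intro continuous_intros continuous_on_compose2[OF \<phi>] continuous_on_compose2[OF contG]) auto
  qed auto
  moreover have "blinfun_apply (integral (cbox (- c) c) (?fx x)) = (\<lambda>h. convolve \<phi> (\<lambda>y. K' y h) x)"
  proof
    fix h
    have "blinfun_apply (integral (cbox (- c) c) (?fx x)) h = integral (cbox (- c) c) (\<lambda>z. blinfun_apply (?fx x z) h)"
      using integral_linear[OF integrable_continuous[OF cont_fx[of "cbox (- c) c" x]] blinfun.bounded_linear_left[of h]]
      by (simp only: o_def)
    also have "\<dots> = integral (cbox (- c) c) (\<lambda>z. \<phi> z * K' (x - z) h)"
      by (simp add: KG blinfun.scaleR_left)
    also have "\<dots> = convolve \<phi> (\<lambda>y. K' y h) x"
    proof (rule convolve_eq_integral[symmetric, OF \<phi>])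
      show "continuous_on UNIV (\<lambda>y. K' y h)" unfolding KG by (intro continuous_intros contG)
      show "cball x (R + 1) \<subseteq> cbox (- c) c" using sub[of x "R + 1"] by simp
    qed (rule supp')
    finally show "blinfun_apply (integral (cbox (- c) c) (?fx x)) h = convolve \<phi> (\<lambda>y. K' y h) x" .
  qed
  ultimately have "((\<lambda>y. integral (cbox (- c) c) (?f y)) has_derivative (\<lambda>h. convolve \<phi> (\<lambda>y. K' y h) x)) (at x)"
    by (simp add: at_within_open[of x "ball x 1"])
  then show ?thesis
  proof (rule has_derivative_transform_within_open)
    show "integral (cbox (- c) c) (?f y) = convolve \<phi> K y" if "y \<in> ball x 1" for y
      using sub[OF that, of R] by (intro convolve_eq_integral[symmetric, OF \<phi> contK supp]) auto
  qed auto
qed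

lemma Ck_on_convolve:
  fixes \<phi> K :: "real^'n::finite \<Rightarrow> real"
  assumes \<phi>: "continuous_on UNIV \<phi>"
  shows "Ck_on (Suc k) UNIV K \<Longrightarrow> (\<And>y. norm y \<ge> R \<Longrightarrow> K y = 0) \<Longrightarrow> Ck_on k UNIV (convolve \<phi> K)"
proof (induction k arbitrary: K R)
  case 0
  obtain K' where K': "\<And>y. (K has_derivative K' y) (at y)" "\<And>b. b \<in> Basis \<Longrightarrow> Ck_on 0 UNIV (\<lambda>y. K' y b)"
    using Ck_on_UNIV_SucE[OF 0(1)] by blast
  have "(convolve \<phi> K has_derivative (\<lambda>h. convolve \<phi> (\<lambda>y. K' y h) x)) (at x)" for x
    by (rule convolve_has_derivative[OF \<phi> K'(1) _ 0(2)]) (use K'(2) in auto)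
  then have "continuous_on UNIV (convolve \<phi> K)"
    by (intro has_derivative_continuous_on) (rule has_derivative_at_withinI)
  then show ?case by simp
next
  case (Suc k)
  obtain K' where K': "\<And>y. (K has_derivative K' y) (at y)" "\<And>b. b \<in> Basis \<Longrightarrow> Ck_on (Suc k) UNIV (\<lambda>y. K' y b)"
    using Ck_on_UNIV_SucE[OF Suc.prems(1)] by blast
  show ?case
  proof (rule Ck_on_UNIV_SucI)
    show "(convolve \<phi> K has_derivative (\<lambda>h. convolve \<phi> (\<lambda>y. K' y h) x)) (at x)" for x
      by (rule convolve_has_derivative[OF \<phi> K'(1) Ck_on_continuous[OF K'(2)] Suc.prems(2)])
    show "Ck_on k UNIV (\<lambda>x. convolve \<phi> (\<lambda>y. K' y b) x)" if b: "b \<in> Basis" for b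
    proof (rule Suc.IH[OF K'(2)[OF b]])
      fix y :: "real^'n" assume "norm y \<ge> R + 1"
      then show "K' y b = 0" using has_derivative_eq_0_outside[OF K'(1) Suc.prems(2)] by simp
    qed
  qed
qed

lemma lborel_integral_affine:
  fixes F :: "'a::euclidean_space \<Rightarrow> 'b::{banach, second_countable_topology}"
  assumes [measurable]: "F \<in> borel_measurable borel" and c: "c \<noteq> 0"
  shows "(LINT z|lborel. F z) = \<bar>c\<bar> ^ DIM('a) *\<^sub>R (LINT y|lborel. F (t + c *\<^sub>R y))"
proof -
  have "(LINT z|lborel. F z) = (LINT z|density (distr lborel borel (\<lambda>x. t + c *\<^sub>R x)) (\<lambda>_. ennreal (\<bar>c\<bar> ^ DIM('a))). F z)"
    by (subst lborel_affine[OF c, of t]) simp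
  also have "\<dots> = (LINT z|distr lborel borel (\<lambda>x. t + c *\<^sub>R x). \<bar>c\<bar> ^ DIM('a) *\<^sub>R F z)"
    by (rule integral_density) auto
  also have "\<dots> = (LINT y|lborel. \<bar>c\<bar> ^ DIM('a) *\<^sub>R F (t + c *\<^sub>R y))"
    by (rule integral_distr) auto
  finally show ?thesis by simp
qed

definition unit_bump :: "real^'n::finite \<Rightarrow> real" where
  "unit_bump = box_bump 1 (- 1) 1"

definition bump_mass :: "'n::finite itself \<Rightarrow> real" where
  "bump_mass _ = (LINT y|lborel. unit_bump (y :: real^'n))"

text \<open>
  A convolution in form, so that smoothness is inherited from the kernel; the denominator is the integral of
  the kernel.
\<close>

definition mollify :: "real \<Rightarrow> (real^'n::finite \<Rightarrow> real) \<Rightarrow> real^'n \<Rightarrow> real" where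
  "mollify \<delta> \<phi> x =
     convolve \<phi> (box_bump (1 / \<delta>) (- (\<delta> *\<^sub>R 1)) (\<delta> *\<^sub>R 1)) x / (\<delta> ^ CARD('n) * bump_mass TYPE('n))"

lemma unit_bump_eq_0: 
  fixes y :: "real^'n::finite"
  assumes "norm y \<ge> real CARD('n)" shows "unit_bump y = 0"
proof (cases "y \<in> box (-1) 1")
  case True
  then have *: "\<bar>y $ i\<bar> < 1" for i by (auto simp: mem_box_cart abs_less_iff)
  have "norm y \<le> (\<Sum>i\<in>UNIV. \<bar>y $ i\<bar>)" by (rule norm_le_l1_cart)
  also have "\<dots> < (\<Sum>i\<in>(UNIV :: 'n set). 1)" using * by (intro sum_strict_mono) auto
  finally show ?thesis using assms by simp
qed (simp add: unit_bump_def box_bump_eq_0)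

lemma unit_bump_nonneg: "unit_bump y \<ge> 0"
  by (simp add: unit_bump_def box_bump_bounds)

lemma continuous_on_unit_bump: "continuous_on UNIV unit_bump"
  unfolding unit_bump_def by (intro Ck_on_continuous[OF Ck_on_box_bump])

lemma integrable_mult_compact_support:
  fixes f g :: "real^'n::finite \<Rightarrow> real"
  assumes "continuous_on UNIV f" "continuous_on UNIV g" "\<And>y. norm y \<ge> R \<Longrightarrow> g y = 0"
  shows "integrable lborel (\<lambda>y. f y * g y)"
proof -
  have "continuous_on (cball 0 R) (\<lambda>y. f y * g y)"
    by (intro continuous_intros continuous_on_subset[OF assms(1)] continuous_on_subset[OF assms(2)]) auto
  then have "integrable lborel (\<lambda>y. indicator (cball 0 R) y *\<^sub>R (f y * g y))"
    by (intro borel_integrable_compact) auto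
  moreover have "(\<lambda>y. indicator (cball 0 R) y *\<^sub>R (f y * g y)) = (\<lambda>y. f y * g y)"
    using assms(3) by (auto simp: indicator_def fun_eq_iff)
  ultimately show ?thesis by (simp only:)
qed

lemma integrable_unit_bump: "integrable lborel (unit_bump :: real^'n::finite \<Rightarrow> real)"
proof -
  have "integrable lborel (\<lambda>y :: real^'n. 1 * unit_bump y)"
    by (rule integrable_mult_compact_support[OF _ continuous_on_unit_bump unit_bump_eq_0]) simp_all
  then show ?thesis by simp
qed

lemma bump_mass_pos: "bump_mass TYPE('n::finite) > 0"
proof -
  have "bump_mass TYPE('n) \<noteq> 0"
  proof
    assume "bump_mass TYPE('n) = 0"
    then have "AE y in lborel. unit_bump (y :: real^'n) = 0"
      unfolding bump_mass_def
      by (subst (asm) integral_nonneg_eq_0_iff_AE[OF integrable_unit_bump]) (auto simp: unit_bump_nonneg)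
    then have "AE y in lborel. y \<notin> box (-1) (1 :: real^'n)"
    proof eventually_elim
      fix y :: "real^'n" assume "unit_bump y = 0"
      then show "y \<notin> box (-1) 1" using box_bump_pos_iff[of 1 "-1" 1 y] by (simp add: unit_bump_def)
    qed
    then have "box (-1) (1 :: real^'n) \<in> null_sets lborel"
      by (simp add: AE_iff_null_sets)
    then have "negligible (box (-1) (1 :: real^'n))"
      by (simp add: negligible_iff_null_sets null_sets_completionI)
    then show False using open_not_negligible[of "box (-1) (1 :: real^'n)"]
      by (auto simp: interval_ne_empty_cart)
  qed
  moreover have "bump_mass TYPE('n) \<ge> 0"
    unfolding bump_mass_def by (rule integral_nonneg_AE) (simp add: unit_bump_nonneg)
  ultimately show ?thesis by simp
qed

lemma box_bump_scaled:
  assumes "\<delta> > 0"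
  shows "box_bump (1 / \<delta>) (- (\<delta> *\<^sub>R 1)) (\<delta> *\<^sub>R 1) (y :: real^'n::finite) = unit_bump ((1 / \<delta>) *\<^sub>R y)"
  using assms by (simp add: box_bump_def unit_bump_def field_simps)

lemma scaled_bump_eq_0:
  fixes y :: "real^'n::finite"
  assumes "\<delta> > 0" "norm y \<ge> real CARD('n) * \<delta>"
  shows "box_bump (1 / \<delta>) (- (\<delta> *\<^sub>R 1)) (\<delta> *\<^sub>R 1) y = 0"
  using assms unit_bump_eq_0[of "(1 / \<delta>) *\<^sub>R y"] by (simp add: box_bump_scaled field_simps)

lemma convolve_scaled:
  fixes \<phi> K :: "real^'n::finite \<Rightarrow> real"
  assumes "\<delta> > 0" "continuous_on UNIV \<phi>" "continuous_on UNIV K"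
  shows "convolve \<phi> (\<lambda>y. K ((1 / \<delta>) *\<^sub>R y)) x = \<delta> ^ CARD('n) * (LINT y|lborel. \<phi> (x - \<delta> *\<^sub>R y) * K y)"
proof -
  have [measurable]: "\<phi> \<in> borel_measurable borel" "K \<in> borel_measurable borel"
    using assms by (auto intro: borel_measurable_continuous_onI)
  have "convolve \<phi> (\<lambda>y. K ((1 / \<delta>) *\<^sub>R y)) x =
      \<bar>- \<delta>\<bar> ^ DIM(real^'n) *\<^sub>R (LINT y|lborel. \<phi> (x + (- \<delta>) *\<^sub>R y) * K ((1 / \<delta>) *\<^sub>R (x - (x + (- \<delta>) *\<^sub>R y))))"
    unfolding convolve_def using assms(1) by (intro lborel_integral_affine) auto
  then show ?thesis using assms(1) by simp
qed

lemma mollify_eq: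
  fixes \<phi> :: "real^'n::finite \<Rightarrow> real"
  assumes "\<delta> > 0" "continuous_on UNIV \<phi>"
  shows "mollify \<delta> \<phi> x = (LINT y|lborel. \<phi> (x - \<delta> *\<^sub>R y) * unit_bump y) / bump_mass TYPE('n)"
proof -
  have "box_bump (1 / \<delta>) (- (\<delta> *\<^sub>R 1)) (\<delta> *\<^sub>R 1) = (\<lambda>y :: real^'n. unit_bump ((1 / \<delta>) *\<^sub>R y))"
    by (rule ext) (rule box_bump_scaled[OF assms(1)])
  then have "convolve \<phi> (box_bump (1 / \<delta>) (- (\<delta> *\<^sub>R 1)) (\<delta> *\<^sub>R 1)) x =
      \<delta> ^ CARD('n) * (LINT y|lborel. \<phi> (x - \<delta> *\<^sub>R y) * unit_bump y)"
    using convolve_scaled[OF assms continuous_on_unit_bump, of x] by simp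
  then show ?thesis using assms(1) by (simp add: mollify_def)
qed

lemma Ck_on_mollify:
  fixes \<phi> :: "real^'n::finite \<Rightarrow> real"
  assumes "\<delta> > 0" "continuous_on UNIV \<phi>"
  shows "Ck_on k UNIV (mollify \<delta> \<phi>)"
proof -
  have "Ck_on k UNIV (convolve \<phi> (box_bump (1 / \<delta>) (- (\<delta> *\<^sub>R 1)) (\<delta> *\<^sub>R 1)))"
    by (rule Ck_on_convolve[OF assms(2) Ck_on_box_bump scaled_bump_eq_0[OF assms(1)]])
  from Ck_on_mult[OF this Ck_on_const[of k "1 / (\<delta> ^ CARD('n) * bump_mass TYPE('n))"]]
  show ?thesis by (simp add: mollify_def[abs_def])
qed

lemma integrable_mollify:
  fixes \<phi> :: "real^'n::finite \<Rightarrow> real"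
  assumes "continuous_on UNIV \<phi>"
  shows "integrable lborel (\<lambda>y. \<phi> (x - \<delta> *\<^sub>R y) * unit_bump y)"
  by (rule integrable_mult_compact_support[of _ _ "real CARD('n)"])
     (auto simp: unit_bump_eq_0 continuous_on_unit_bump intro!: continuous_on_compose2[OF assms] continuous_intros)

lemma mollify_lipschitz:
  fixes \<phi> :: "real^'n::finite \<Rightarrow> real"
  assumes \<delta>: "\<delta> > 0" and \<phi>: "L-lipschitz_on UNIV \<phi>"
  shows "L-lipschitz_on UNIV (mollify \<delta> \<phi>)"
proof (rule lipschitz_onI)
  fix x x' :: "real^'n"
  have c: "continuous_on UNIV \<phi>" using \<phi> by (rule lipschitz_on_continuous_on)
  let ?m = "bump_mass TYPE('n)"
  have "\<bar>LINT y|lborel. (\<phi> (x - \<delta> *\<^sub>R y) * unit_bump y - \<phi> (x' - \<delta> *\<^sub>R y) * unit_bump y)\<bar> \<le>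
      (LINT y|lborel. \<bar>\<phi> (x - \<delta> *\<^sub>R y) * unit_bump y - \<phi> (x' - \<delta> *\<^sub>R y) * unit_bump y\<bar>)"
    using integral_norm_bound[of lborel "\<lambda>y. \<phi> (x - \<delta> *\<^sub>R y) * unit_bump y - \<phi> (x' - \<delta> *\<^sub>R y) * unit_bump y"] by simp
  also have "\<dots> \<le> (LINT y|lborel. L * dist x x' * unit_bump (y :: real^'n))"
  proof (rule Bochner_Integration.integral_mono)
    fix y :: "real^'n"
    have "\<bar>\<phi> (x - \<delta> *\<^sub>R y) - \<phi> (x' - \<delta> *\<^sub>R y)\<bar> \<le> L * dist x x'"
      using lipschitz_onD[OF \<phi>, of "x - \<delta> *\<^sub>R y" "x' - \<delta> *\<^sub>R y"] by (simp add: dist_real_def dist_norm)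
    then have "\<bar>\<phi> (x - \<delta> *\<^sub>R y) - \<phi> (x' - \<delta> *\<^sub>R y)\<bar> * unit_bump y \<le> L * dist x x' * unit_bump y"
      by (rule mult_right_mono) (rule unit_bump_nonneg)
    then show "\<bar>\<phi> (x - \<delta> *\<^sub>R y) * unit_bump y - \<phi> (x' - \<delta> *\<^sub>R y) * unit_bump y\<bar> \<le> L * dist x x' * unit_bump y"
      by (simp add: left_diff_distrib[symmetric] abs_mult abs_of_nonneg[OF unit_bump_nonneg])
  qed (intro integrable_abs Bochner_Integration.integrable_diff integrable_mollify c integrable_mult_right integrable_unit_bump)+
  also have "\<dots> = L * dist x x' * ?m" by (simp add: bump_mass_def)
  finally have "\<bar>(LINT y|lborel. \<phi> (x - \<delta> *\<^sub>R y) * unit_bump y) - (LINT y|lborel. \<phi> (x' - \<delta> *\<^sub>R y) * unit_bump y)\<bar> \<le> L * dist x x' * ?m"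
    by (subst Bochner_Integration.integral_diff[symmetric]) (auto intro: integrable_mollify c)
  then show "dist (mollify \<delta> \<phi> x) (mollify \<delta> \<phi> x') \<le> L * dist x x'"
    using bump_mass_pos[where 'n='n]
    by (simp add: mollify_eq[OF \<delta> c] dist_real_def diff_divide_distrib[symmetric] abs_div_pos[symmetric] pos_divide_le_eq)
qed (use \<phi> in \<open>auto intro: lipschitz_on_nonneg\<close>)

text \<open>
  The value is an average over a cube of side \<open>2 * \<delta>\<close>, which lies in the ball of radius \<open>CARD('n) * \<delta>\<close>.
\<close>

lemma mollify_close:
  fixes \<phi> :: "real^'n::finite \<Rightarrow> real"
  assumes \<delta>: "\<delta> > 0" and c: "continuous_on UNIV \<phi>"
    and close: "\<And>z. dist x z \<le> real CARD('n) * \<delta> \<Longrightarrow> \<bar>\<phi> z - a\<bar> \<le> e"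
  shows "\<bar>mollify \<delta> \<phi> x - a\<bar> \<le> e"
proof -
  let ?m = "bump_mass TYPE('n)"
  have "\<bar>LINT y|lborel. (\<phi> (x - \<delta> *\<^sub>R y) * unit_bump y - a * unit_bump y)\<bar> \<le>
      (LINT y|lborel. \<bar>\<phi> (x - \<delta> *\<^sub>R y) * unit_bump y - a * unit_bump y\<bar>)"
    using integral_norm_bound[of lborel "\<lambda>y. \<phi> (x - \<delta> *\<^sub>R y) * unit_bump y - a * unit_bump y"] by simp
  also have "\<dots> \<le> (LINT y|lborel. e * unit_bump (y :: real^'n))"
  proof (rule Bochner_Integration.integral_mono)
    fix y :: "real^'n"
    show "\<bar>\<phi> (x - \<delta> *\<^sub>R y) * unit_bump y - a * unit_bump y\<bar> \<le> e * unit_bump y"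
    proof (cases "norm y \<ge> real CARD('n)")
      case False
      then have "\<bar>\<phi> (x - \<delta> *\<^sub>R y) - a\<bar> \<le> e" using \<delta> by (intro close) (simp add: dist_norm)
      then have "\<bar>\<phi> (x - \<delta> *\<^sub>R y) - a\<bar> * unit_bump y \<le> e * unit_bump y"
        by (rule mult_right_mono) (rule unit_bump_nonneg)
      then show ?thesis
        by (simp add: left_diff_distrib[symmetric] abs_mult abs_of_nonneg[OF unit_bump_nonneg])
    qed (simp add: unit_bump_eq_0)
  qed (intro integrable_abs Bochner_Integration.integrable_diff integrable_mollify c integrable_mult_right integrable_unit_bump)+
  also have "\<dots> = e * ?m" by (simp add: bump_mass_def)
  finally have "\<bar>(LINT y|lborel. \<phi> (x - \<delta> *\<^sub>R y) * unit_bump y) - a * ?m\<bar> \<le> e * ?m"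
    unfolding bump_mass_def
    by (subst (asm) Bochner_Integration.integral_diff) (auto intro: integrable_mollify c integrable_unit_bump)
  moreover have "mollify \<delta> \<phi> x - a = ((LINT y|lborel. \<phi> (x - \<delta> *\<^sub>R y) * unit_bump y) - a * ?m) / ?m"
    using bump_mass_pos[where 'n='n] by (simp add: mollify_eq[OF \<delta> c] field_simps)
  ultimately show ?thesis
    using bump_mass_pos[where 'n='n] by (simp add: abs_div_pos[symmetric] pos_divide_le_eq)
qed

text \<open>
  The derivative of \<open>mollify \<delta> \<phi>\<close> is \<open>\<integral> \<phi> (x - \<delta> y) K' (y) dy / (\<delta> m)\<close>.  For affine functions it is
  exact, because their mollifications differ from them by constants; so an error in the affine
  approximation of \<open>\<phi>\<close> that is small compared with \<open>\<delta>\<close> leads to a small error in the derivative.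
\<close>

lemma mollify_derivative_tendsto:
  fixes \<phi> :: "real^'n::finite \<Rightarrow> real"
  assumes c: "continuous_on UNIV \<phi>" and A: "(\<phi> has_derivative (\<lambda>h. A \<bullet> h)) (at x)"
  shows "((\<lambda>\<delta>. frechet_derivative (mollify \<delta> \<phi>) (at x) h) \<longlongrightarrow> A \<bullet> h) (at_right 0)"
proof -
  let ?m = "bump_mass TYPE('n)" and ?N = "real CARD('n)"
  have m: "?m > 0" by (rule bump_mass_pos)
  have "Ck_on (Suc 0) UNIV (unit_bump :: real^'n \<Rightarrow> real)" unfolding unit_bump_def by (rule Ck_on_box_bump)
  then obtain K' where K': "\<And>y :: real^'n. (unit_bump has_derivative K' y) (at y)"
    "\<And>b. b \<in> Basis \<Longrightarrow> continuous_on UNIV (\<lambda>y. K' y b)"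
    by (auto elim!: Ck_on_UNIV_SucE)
  have contK': "continuous_on UNIV (\<lambda>y. K' y h)"
  proof -
    have "K' y h = (\<Sum>b\<in>Basis. K' y b *\<^sub>R b) \<bullet> h" for y
      using K'(1) by (intro linear_eq_inner_sum has_derivative_linear)
    then show ?thesis by (simp only:) (intro continuous_intros K'(2))
  qed
  have K'0: "norm y \<ge> ?N + 1 \<Longrightarrow> K' y h = 0" for y
    using K'(1) unit_bump_eq_0 by (rule has_derivative_eq_0_outside) auto
  have intK': "integrable lborel (\<lambda>y. \<psi> (x - \<delta> *\<^sub>R y) * K' y h)" if "continuous_on UNIV \<psi>" for \<psi> :: "real^'n \<Rightarrow> real" and \<delta>
    using contK' K'0
    by (rule integrable_mult_compact_support[rotated]) (auto intro!: continuous_on_compose2[OF that] continuous_intros)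
  define D where "D = (\<lambda>\<delta> \<psi>. (LINT y|lborel. \<psi> (x - \<delta> *\<^sub>R y) * K' y h) / (\<delta> * ?m))"
  have fd: "frechet_derivative (mollify \<delta> \<psi>) (at x) h = D \<delta> \<psi>"
    if \<delta>: "\<delta> > 0" and \<psi>: "continuous_on UNIV \<psi>" for \<delta> and \<psi> :: "real^'n \<Rightarrow> real"
  proof -
    let ?K = "box_bump (1 / \<delta>) (- (\<delta> *\<^sub>R 1)) (\<delta> *\<^sub>R 1) :: real^'n \<Rightarrow> real"
    have Kd: "(?K has_derivative (\<lambda>h. K' ((1 / \<delta>) *\<^sub>R y) ((1 / \<delta>) *\<^sub>R h))) (at y)" for y
    proof -
      have "((\<lambda>y :: real^'n. (1 / \<delta>) *\<^sub>R y) has_derivative (\<lambda>h. (1 / \<delta>) *\<^sub>R h)) (at y)"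
        by (auto intro!: derivative_eq_intros)
      from has_derivative_compose[OF this K'(1)[of "(1 / \<delta>) *\<^sub>R y"]] show ?thesis
        by (simp add: box_bump_scaled[OF \<delta>, symmetric])
    qed
    have lin: "K' y (t *\<^sub>R h) = t * K' y h" for y t h
      using linear_cmul[OF has_derivative_linear[OF K'(1)]] by simp
    have "continuous_on UNIV (\<lambda>y. K' ((1 / \<delta>) *\<^sub>R y) ((1 / \<delta>) *\<^sub>R b))" if "b \<in> Basis" for b
      unfolding lin by (intro continuous_intros continuous_on_compose2[OF K'(2)[OF that]]) auto
    from convolve_has_derivative[OF \<psi> Kd this scaled_bump_eq_0[OF \<delta>], where x = x]
    have "(convolve \<psi> ?K has_derivative (\<lambda>h. convolve \<psi> (\<lambda>y. K' ((1 / \<delta>) *\<^sub>R y) ((1 / \<delta>) *\<^sub>R h)) x)) (at x)" .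
    from has_derivative_mult_left[OF this, of "1 / (\<delta> ^ CARD('n) * ?m)"]
    have "(mollify \<delta> \<psi> has_derivative (\<lambda>h. convolve \<psi> (\<lambda>y. K' ((1 / \<delta>) *\<^sub>R y) ((1 / \<delta>) *\<^sub>R h)) x / (\<delta> ^ CARD('n) * ?m))) (at x)"
      by (simp add: mollify_def[abs_def])
    from frechet_derivative_at[OF this, symmetric]
    have "frechet_derivative (mollify \<delta> \<psi>) (at x) h = convolve \<psi> (\<lambda>y. (1 / \<delta>) * K' ((1 / \<delta>) *\<^sub>R y) h) x / (\<delta> ^ CARD('n) * ?m)"
      by (simp only: lin)
    also have "convolve \<psi> (\<lambda>y. (1 / \<delta>) * K' ((1 / \<delta>) *\<^sub>R y) h) x =
        \<delta> ^ CARD('n) * (LINT y|lborel. \<psi> (x - \<delta> *\<^sub>R y) * ((1 / \<delta>) * K' y h))"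
      by (rule convolve_scaled[OF \<delta> \<psi>]) (intro continuous_intros contK')
    also have "(LINT y|lborel. \<psi> (x - \<delta> *\<^sub>R y) * ((1 / \<delta>) * K' y h)) = (1 / \<delta>) * (LINT y|lborel. \<psi> (x - \<delta> *\<^sub>R y) * K' y h)"
      by (subst integral_mult_right_zero[symmetric]) (simp add: ac_simps)
    finally show ?thesis using \<delta> by (simp add: D_def)
  qed
  have affine: "D \<delta> (\<lambda>z. a + A \<bullet> z) = A \<bullet> h" if \<delta>: "\<delta> > 0" for \<delta> a
  proof -
    have cA: "continuous_on UNIV (\<lambda>z. a + A \<bullet> z)" by (intro continuous_intros)
    have "mollify \<delta> (\<lambda>z. a + A \<bullet> z) x' = A \<bullet> x' + mollify \<delta> (\<lambda>z. a + A \<bullet> z) 0" for x'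
    proof -
      have "(LINT y|lborel. (a + A \<bullet> (x' - \<delta> *\<^sub>R y)) * unit_bump y) =
          (LINT y|lborel. (A \<bullet> x') * unit_bump y + (a + A \<bullet> (0 - \<delta> *\<^sub>R y)) * unit_bump y)"
        by (rule Bochner_Integration.integral_cong) (auto simp: inner_diff_right algebra_simps)
      also have "\<dots> = (A \<bullet> x') * ?m + (LINT y|lborel. (a + A \<bullet> (0 - \<delta> *\<^sub>R y)) * unit_bump y)"
        unfolding bump_mass_def
        by (subst Bochner_Integration.integral_add)
           (auto intro!: integrable_unit_bump integrable_mollify[OF cA, of 0 \<delta>, simplified])
      finally have eq: "(LINT y|lborel. (a + A \<bullet> (x' - \<delta> *\<^sub>R y)) * unit_bump y) =
          (A \<bullet> x') * ?m + (LINT y|lborel. (a + A \<bullet> (0 - \<delta> *\<^sub>R y)) * unit_bump y)" .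
      show ?thesis
        unfolding mollify_eq[OF \<delta> cA] eq add_divide_distrib using m by simp
    qed
    note shift = this
    have "(mollify \<delta> (\<lambda>z. a + A \<bullet> z) has_derivative (\<lambda>h. A \<bullet> h)) (at x)"
    proof (rule has_derivative_transform_within_open[OF _ open_UNIV UNIV_I])
      show "((\<lambda>x'. A \<bullet> x' + mollify \<delta> (\<lambda>z. a + A \<bullet> z) 0) has_derivative (\<lambda>h. A \<bullet> h)) (at x)"
        by (auto intro!: derivative_eq_intros)
      show "A \<bullet> x' + mollify \<delta> (\<lambda>z. a + A \<bullet> z) 0 = mollify \<delta> (\<lambda>z. a + A \<bullet> z) x'" for x'
        by (rule shift[symmetric])
    qed
    from fun_cong[OF frechet_derivative_at[OF this], of h]
    show ?thesis unfolding fd[OF \<delta> cA] by (rule sym)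
  qed
  define I where "I = (LINT y|lborel. (?N + 1) * \<bar>K' y h\<bar>)"
  have "integrable lborel (\<lambda>y. (1::real) * K' y h)" using intK'[of "\<lambda>_. 1" 0] by simp
  then have intabs: "integrable lborel (\<lambda>y. (?N + 1) * \<bar>K' y h\<bar>)" by (intro integrable_mult_right integrable_abs) simp
  have I0: "I \<ge> 0" unfolding I_def by (rule integral_nonneg_AE) simp
  show ?thesis
  proof (rule tendstoI)
    fix e :: real assume e: "e > 0"
    define \<eta> where "\<eta> = e * ?m / (2 * (I + 1))"
    have \<eta>: "\<eta> > 0" using e m I0 by (simp add: \<eta>_def)
    obtain d where d: "d > 0" "\<And>z. norm (z - x) < d \<Longrightarrow> norm (\<phi> z - \<phi> x - A \<bullet> (z - x)) \<le> \<eta> * norm (z - x)"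
      using A \<eta> unfolding has_derivative_at_alt by blast
    have "dist (frechet_derivative (mollify \<delta> \<phi>) (at x) h) (A \<bullet> h) < e" if \<delta>: "0 < \<delta>" "\<delta> < d / (?N + 2)" for \<delta>
    proof -
      let ?l = "\<lambda>z. (\<phi> x - A \<bullet> x) + A \<bullet> z"
      have cl: "continuous_on UNIV ?l" by (intro continuous_intros)
      have "D \<delta> \<phi> - A \<bullet> h = D \<delta> \<phi> - D \<delta> ?l" using affine[OF \<delta>(1)] by simp
      also have "\<dots> = (LINT y|lborel. (\<phi> (x - \<delta> *\<^sub>R y) - ?l (x - \<delta> *\<^sub>R y)) * K' y h) / (\<delta> * ?m)"
        unfolding D_def using intK'[OF c, of \<delta>] intK'[OF cl, of \<delta>]
        by (simp add: diff_divide_distrib[symmetric] left_diff_distrib)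
      finally have eq: "\<bar>D \<delta> \<phi> - A \<bullet> h\<bar> = \<bar>LINT y|lborel. (\<phi> (x - \<delta> *\<^sub>R y) - ?l (x - \<delta> *\<^sub>R y)) * K' y h\<bar> / (\<delta> * ?m)"
        using \<delta> m by (simp add: abs_mult)
      have "\<bar>LINT y|lborel. (\<phi> (x - \<delta> *\<^sub>R y) - ?l (x - \<delta> *\<^sub>R y)) * K' y h\<bar> \<le>
          (LINT y|lborel. \<eta> * \<delta> * ((?N + 1) * \<bar>K' y h\<bar>))"
      proof (rule order_trans[OF integral_abs_bound Bochner_Integration.integral_mono])
        show "integrable lborel (\<lambda>y. \<bar>(\<phi> (x - \<delta> *\<^sub>R y) - ?l (x - \<delta> *\<^sub>R y)) * K' y h\<bar>)"
          by (intro integrable_abs) (use intK'[OF continuous_on_diff[OF c cl], of \<delta>] in simp)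
        show "integrable lborel (\<lambda>y. \<eta> * \<delta> * ((?N + 1) * \<bar>K' y h\<bar>))" by (intro integrable_mult_right intabs)
        fix y :: "real^'n"
        show "\<bar>(\<phi> (x - \<delta> *\<^sub>R y) - ?l (x - \<delta> *\<^sub>R y)) * K' y h\<bar> \<le> \<eta> * \<delta> * ((?N + 1) * \<bar>K' y h\<bar>)"
        proof (cases "norm y \<ge> ?N + 1")
          case False
          have "norm (\<delta> *\<^sub>R y) \<le> \<delta> * (?N + 1)" using False \<delta> by simp
          also have "\<dots> < d" using \<delta> by (simp add: field_simps)
          finally have "norm ((x - \<delta> *\<^sub>R y) - x) < d" by simp
          from d(2)[OF this]
          have "\<bar>\<phi> (x - \<delta> *\<^sub>R y) - ?l (x - \<delta> *\<^sub>R y)\<bar> \<le> \<eta> * (\<delta> * norm y)"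
            using \<delta> by (simp add: inner_diff_right algebra_simps)
          also have "\<dots> \<le> \<eta> * (\<delta> * (?N + 1))" using False \<delta> \<eta> by (intro mult_left_mono) auto
          finally have "\<bar>\<phi> (x - \<delta> *\<^sub>R y) - ?l (x - \<delta> *\<^sub>R y)\<bar> \<le> \<eta> * (\<delta> * (?N + 1))" .
          from mult_right_mono[OF this abs_ge_zero[of "K' y h"]]
          show ?thesis by (simp add: abs_mult ac_simps)
        qed (use \<delta> \<eta> K'0 in simp)
      qed
      also have "\<dots> = \<eta> * \<delta> * I" by (simp add: I_def)
      finally have "\<bar>D \<delta> \<phi> - A \<bullet> h\<bar> \<le> \<eta> * \<delta> * I / (\<delta> * ?m)"
        unfolding eq using \<delta> m by (intro divide_right_mono) auto
      also have "\<dots> = e * (I / (2 * (I + 1)))" using \<delta> m by (simp add: \<eta>_def)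
      also have "\<dots> < e * 1" using e I0 by (intro mult_strict_left_mono) auto
      finally show ?thesis using fd[OF \<delta>(1) c] by (simp add: dist_real_def)
    qed
    then show "eventually (\<lambda>\<delta>. dist (frechet_derivative (mollify \<delta> \<phi>) (at x) h) (A \<bullet> h) < e) (at_right 0)"
      using d(1) by (intro eventually_at_rightI[of 0 "d / (?N + 2)"]) auto
  qed
qed

section \<open>Rademacher's theorem\<close>

text \<open>
  After a linear function has been added, \<open>f\<close> becomes a bi-Lipschitz bijection \<open>F\<close> of the real line.
  The image of Lebesgue measure under the inverse of \<open>F\<close> assigns to an interval the increment of
  \<open>F\<close>, and it is absolutely continuous because \<open>F\<close> maps null sets to null sets.  So \<open>F\<close> is an
  indefinite integral, whose difference quotients converge almost everywhere.
\<close>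

lemma lipschitz_right_derivative:
  fixes f :: "real \<Rightarrow> real"
  assumes f: "L-lipschitz_on UNIV f"
  shows "AE x in lborel. convergent (\<lambda>n. real (Suc n) * (f (x + 1 / real (Suc n)) - f x))"
proof -
  have L: "L \<ge> 0" using f by (rule lipschitz_on_nonneg)
  have fL: "\<bar>f x - f y\<bar> \<le> L * \<bar>x - y\<bar>" for x y
    using lipschitz_onD[OF f, of x y] by (simp add: dist_real_def)
  define F where "F = (\<lambda>x. f x + (L + 1) * x)"
  have F_lo: "y - x \<le> F y - F x" if "x \<le> y" for x y
    using fL[of y x] that L by (simp add: F_def algebra_simps abs_le_iff)
  have F_mono: "x < y \<Longrightarrow> F x < F y" for x y using F_lo[of x y] by simp
  have F_le_iff: "F x \<le> F y \<longleftrightarrow> x \<le> y" for x y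
    using F_mono[of x y] F_mono[of y x] by (cases x y rule: linorder_cases) auto
  have F_lip: "(2 * L + 1)-lipschitz_on UNIV F"
  proof (rule lipschitz_onI)
    fix x y
    have "F x - F y = (f x - f y) + (L + 1) * (x - y)" by (simp add: F_def algebra_simps)
    then have "\<bar>F x - F y\<bar> \<le> L * \<bar>x - y\<bar> + \<bar>(L + 1) * (x - y)\<bar>"
      using fL[of x y] abs_triangle_ineq[of "f x - f y" "(L + 1) * (x - y)"] by linarith
    also have "\<bar>(L + 1) * (x - y)\<bar> = (L + 1) * \<bar>x - y\<bar>" using L by (simp add: abs_mult)
    finally show "dist (F x) (F y) \<le> (2 * L + 1) * dist x y" by (simp add: dist_real_def algebra_simps)
  qed (use L in simp)
  have F_cont: "continuous_on UNIV F" by (rule lipschitz_on_continuous_on[OF F_lip])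
  have "inj F"
  proof (rule injI)
    fix x y assume "F x = F y"
    then show "x = y" using F_mono[of x y] F_mono[of y x] by (cases x y rule: linorder_cases) auto
  qed
  have "surj F"
  proof -
    have "\<exists>x. F x = y" for y
    proof -
      let ?r = "\<bar>y - F 0\<bar>"
      have "F (- ?r) \<le> y" "y \<le> F ?r" using F_lo[of "- ?r" 0] F_lo[of 0 ?r] by auto
      moreover have "\<forall>x. - ?r \<le> x \<and> x \<le> ?r \<longrightarrow> isCont F x"
        using F_cont by (simp add: continuous_on_eq_continuous_at)
      ultimately show ?thesis using IVT[of F "- ?r" y ?r] by auto
    qed
    then show ?thesis unfolding surj_def by (metis (no_types))
  qed
  define G where "G = inv F"
  have FG: "F (G y) = y" and GF: "G (F x) = x" for x y
    using \<open>surj F\<close> \<open>inj F\<close> by (simp_all add: G_def surj_f_inv_f)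
  have "1-lipschitz_on UNIV G"
  proof (rule lipschitz_onI)
    fix x y
    have "\<bar>G x - G y\<bar> \<le> \<bar>x - y\<bar>"
      using F_lo[of "G x" "G y"] F_lo[of "G y" "G x"] by (cases "G x \<le> G y") (auto simp: FG)
    then show "dist (G x) (G y) \<le> 1 * dist x y" by (simp add: dist_real_def)
  qed simp
  then have Gm [measurable]: "G \<in> borel_measurable borel"
    by (intro borel_measurable_continuous_onI lipschitz_on_continuous_on)
  have vimage: "G -` A = F ` A" for A
  proof
    show "G -` A \<subseteq> F ` A" by (rule subsetI, rule image_eqI[of _ F "G _"]) (simp_all add: FG)
    show "F ` A \<subseteq> G -` A" by (auto simp: GF)
  qed
  define M where "M = distr lborel borel G"
  have sets_M: "sets M = sets borel" by (simp add: M_def)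
  have M_Icc: "emeasure M {a..b} = ennreal (F b - F a)" if "a \<le> b" for a b
  proof -
    have "a \<le> G y \<longleftrightarrow> F a \<le> y" "G y \<le> b \<longleftrightarrow> y \<le> F b" for y
      using F_le_iff[of a "G y"] F_le_iff[of "G y" b] by (simp_all add: FG)
    then have "G -` {a..b} = {F a..F b}" by auto
    then show ?thesis using that F_le_iff[of a b] by (simp add: M_def emeasure_distr)
  qed
  have "absolutely_continuous lborel M"
  proof -
    have "N \<in> null_sets M" if N: "N \<in> null_sets lborel" for N
    proof -
      have Nb: "N \<in> sets borel" using N by auto
      have "negligible N" using N by (simp add: negligible_iff_null_sets null_sets_completionI)
      then have "negligible (F ` N)"
      proof (rule negligible_locally_Lipschitz_image[rotated])
        show "DIM(real) \<le> DIM(real)" by simp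
        show "\<exists>T B. open T \<and> x \<in> T \<and> (\<forall>y\<in>N \<inter> T. norm (F y - F x) \<le> B * norm (y - x))" for x
          using lipschitz_onD[OF F_lip] by (intro exI[of _ UNIV] exI[of _ "2 * L + 1"]) (auto simp: dist_norm)
      qed
      moreover have "F ` N \<in> sets borel" using measurable_sets[OF Gm Nb] by (simp add: vimage)
      ultimately have "emeasure lborel (F ` N) = 0"
        by (simp add: negligible_iff_emeasure0)
      then show ?thesis using Nb by (simp add: null_sets_def M_def emeasure_distr vimage)
    qed
    then show ?thesis by (auto simp: absolutely_continuous_def)
  qed
  then obtain g where gm [measurable]: "g \<in> borel_measurable lborel" and g: "density lborel g = M"
    using sigma_finite_measure.Radon_Nikodym[OF sigma_finite_lborel, of M] sets_M by auto
  have g_int: "(\<integral>\<^sup>+x. g x * indicator {a..b} x \<partial>lborel) = ennreal (F b - F a)" if "a \<le> b" for a b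
    using M_Icc[OF that] unfolding g[symmetric] by (simp add: emeasure_density)
  have g_fin: "AE x in lborel. g x \<noteq> \<infinity>"
  proof -
    have "AE x in lborel. g x * indicator {- real n..real n} x \<noteq> \<infinity>" for n
      by (rule nn_integral_PInf_AE) (auto simp: g_int)
    then have "AE x in lborel. \<forall>n. g x * indicator {- real n..real n} x \<noteq> \<infinity>" by (simp add: AE_all_countable)
    then show ?thesis
    proof eventually_elim
      fix x assume *: "\<forall>n. g x * indicator {- real n..real n} x \<noteq> \<infinity>"
      obtain n where "\<bar>x\<bar> \<le> real n" using real_arch_simple by blast
      then have "x \<in> {- real n..real n}" by auto
      then show "g x \<noteq> \<infinity>" using *[rule_format, of n] by simp
    qed
  qed
  define h where "h = (\<lambda>x. enn2real (g x))"
  have hm [measurable]: "h \<in> borel_measurable borel" using gm by (simp add: h_def)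
  have h_int: "(h has_integral (F b - F a)) {a..b}" if ab: "a \<le> b" for a b
  proof -
    have "(\<integral>\<^sup>+x. ennreal (h x * indicator {a..b} x) \<partial>lborel) = (\<integral>\<^sup>+x. g x * indicator {a..b} x \<partial>lborel)"
      by (rule nn_integral_cong_AE) (use g_fin in eventually_elim, auto simp: h_def indicator_def less_top)
    also have "\<dots> = ennreal (F b - F a)" by (rule g_int[OF ab])
    finally have "((\<lambda>x. h x * indicator {a..b} x) has_integral (F b - F a)) UNIV"
      using F_le_iff[of a b] ab by (intro nn_integral_has_integral) (auto simp: h_def)
    moreover have "(\<lambda>x. h x * indicator {a..b} x) = (\<lambda>x. if x \<in> {a..b} then h x else 0)"
      by (auto simp: indicator_def)
    ultimately show ?thesis by (simp only: has_integral_restrict_UNIV)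
  qed
  have "h integrable_on cbox a b" for a b
    using h_int[of a b] by (cases "a \<le> b") (auto simp: integrable_on_def)
  from integrable_ccontinuous_explicit[OF this] obtain N where N: "negligible N"
    "\<And>x e. x \<notin> N \<Longrightarrow> 0 < e \<Longrightarrow> \<exists>d>0. \<forall>k. 0 < k \<and> k < d \<longrightarrow>
       norm (integral (cbox x (x + k *\<^sub>R One)) h /\<^sub>R k ^ DIM(real) - h x) < e"
    by blast
  have lim: "convergent (\<lambda>n. real (Suc n) * (f (x + 1 / real (Suc n)) - f x))" if x: "x \<notin> N" for x
  proof -
    have "(\<lambda>n. real (Suc n) * (F (x + 1 / real (Suc n)) - F x)) \<longlonglongrightarrow> h x"
    proof (rule LIMSEQ_I)
      fix e :: real assume "e > 0"
      from N(2)[OF x this] obtain d where d: "d > 0" "\<And>k. 0 < k \<Longrightarrow> k < d \<Longrightarrow>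
         norm (integral (cbox x (x + k *\<^sub>R One)) h /\<^sub>R k ^ DIM(real) - h x) < e" by blast
      obtain n0 where n0: "1 / real (Suc n0) < d" using d(1) nat_approx_posE by blast
      have "norm (real (Suc n) * (F (x + 1 / real (Suc n)) - F x) - h x) < e" if n: "n \<ge> n0" for n
      proof -
        let ?k = "1 / real (Suc n)"
        have "?k \<le> 1 / real (Suc n0)" using n by (intro divide_left_mono) auto
        then have k: "0 < ?k" "?k < d" using n0 by simp_all
        have "integral (cbox x (x + ?k *\<^sub>R One)) h = F (x + ?k) - F x"
          using h_int[of x "x + ?k"] by (simp add: integral_unique)
        then show ?thesis using d(2)[OF k] by (simp add: mult.commute)
      qed
      then show "\<exists>n0. \<forall>n\<ge>n0. norm (real (Suc n) * (F (x + 1 / real (Suc n)) - F x) - h x) < e" by blast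
    qed
    then have "(\<lambda>n. real (Suc n) * (F (x + 1 / real (Suc n)) - F x) - (L + 1)) \<longlonglongrightarrow> h x - (L + 1)"
      by (intro tendsto_intros)
    moreover have "real (Suc n) * (F (x + 1 / real (Suc n)) - F x) - (L + 1) =
        real (Suc n) * (f (x + 1 / real (Suc n)) - f x)" for n
    proof -
      have "F (x + 1 / real (Suc n)) - F x = (f (x + 1 / real (Suc n)) - f x) + (L + 1) * (1 / real (Suc n))"
        by (simp add: F_def distrib_left distrib_right add_divide_distrib del: of_nat_Suc)
      then show ?thesis by (simp only: distrib_left) simp
    qed
    ultimately show ?thesis by (auto simp: convergent_def)
  qed
  obtain N' where N': "N \<subseteq> N'" "N' \<in> null_sets lborel"
    using N(1) by (auto simp: negligible_iff_null_sets null_sets_completion_iff2)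
  show ?thesis
    by (rule AE_I'[OF N'(2)]) (use lim N'(1) in blast)
qed

text \<open>A sequence of step sizes keeps the set of convergence Borel.\<close>

definition diff_quot :: "('a::real_normed_vector \<Rightarrow> real) \<Rightarrow> 'a \<Rightarrow> nat \<Rightarrow> 'a \<Rightarrow> real" where
  "diff_quot f v n x = real (Suc n) * (f (x + (1 / real (Suc n)) *\<^sub>R v) - f x)"

definition dir_deriv :: "('a::real_normed_vector \<Rightarrow> real) \<Rightarrow> 'a \<Rightarrow> 'a \<Rightarrow> real" where
  "dir_deriv f v x = lim (\<lambda>n. diff_quot f v n x)"

text \<open>A gradient that is defined everywhere and Borel measurable, for use at points of differentiability.\<close>

definition lip_grad :: "('a::euclidean_space \<Rightarrow> real) \<Rightarrow> 'a \<Rightarrow> 'a" where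
  "lip_grad f x = (\<Sum>b\<in>Basis. dir_deriv f b x *\<^sub>R b)"

lemma borel_measurable_lipschitz:
  "L-lipschitz_on UNIV f \<Longrightarrow> f \<in> borel_measurable borel"
  by (intro borel_measurable_continuous_onI lipschitz_on_continuous_on)

lemma borel_measurable_diff_quot [measurable (raw)]:
  assumes [measurable]: "f \<in> borel_measurable borel"
  shows "diff_quot f v n \<in> borel_measurable (borel :: 'a::euclidean_space measure)"
  unfolding diff_quot_def[abs_def] by measurable

lemma borel_measurable_dir_deriv [measurable (raw)]:
  assumes [measurable]: "f \<in> borel_measurable borel"
  shows "dir_deriv f v \<in> borel_measurable (borel :: 'a::euclidean_space measure)"
  unfolding dir_deriv_def[abs_def] by (intro borel_measurable_lim_metric borel_measurable_diff_quot assms)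

lemma borel_measurable_lip_grad [measurable (raw)]:
  assumes [measurable]: "f \<in> borel_measurable borel"
  shows "lip_grad f \<in> borel_measurable (borel :: 'a::euclidean_space measure)"
  unfolding lip_grad_def[abs_def] by measurable

lemma diff_quot_bound:
  assumes "L-lipschitz_on UNIV f"
  shows "\<bar>diff_quot f v n x\<bar> \<le> L * norm v"
proof -
  have "\<bar>f (x + (1 / real (Suc n)) *\<^sub>R v) - f x\<bar> \<le> L * (1 / real (Suc n) * norm v)"
    using lipschitz_onD[OF assms, of "x + (1 / real (Suc n)) *\<^sub>R v" x] by (simp add: dist_norm)
  then have "real (Suc n) * \<bar>f (x + (1 / real (Suc n)) *\<^sub>R v) - f x\<bar> \<le> real (Suc n) * (L * (1 / real (Suc n) * norm v))"
    by (rule mult_left_mono) simp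
  also have "\<dots> = L * norm v" by simp
  finally show ?thesis by (simp add: diff_quot_def abs_mult)
qed

lemma dir_deriv_eqI: "(\<lambda>n. diff_quot f v n x) \<longlonglongrightarrow> l \<Longrightarrow> dir_deriv f v x = l"
  unfolding dir_deriv_def by (rule limI)

lemma diff_quot_tendsto_dir_deriv:
  "convergent (\<lambda>n. diff_quot f v n x) \<Longrightarrow> (\<lambda>n. diff_quot f v n x) \<longlonglongrightarrow> dir_deriv f v x"
  unfolding dir_deriv_def convergent_LIMSEQ_iff .

text \<open>
  The exceptional set meets every line in the direction \<open>v\<close> in a null set, so it is null: translate it by
  \<open>t *\<^sub>R v\<close> and average over \<open>t\<close>.
\<close>

lemma AE_convergent_diff_quot:
  fixes f :: "'a::euclidean_space \<Rightarrow> real"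
  assumes f: "L-lipschitz_on UNIV f"
  shows "AE x in lborel. convergent (\<lambda>n. diff_quot f v n x)"
proof -
  have [measurable]: "f \<in> borel_measurable borel" using f by (rule borel_measurable_lipschitz)
  define N where "N = {x. \<not> convergent (\<lambda>n. diff_quot f v n x)}"
  have "{x\<in>space borel. convergent (\<lambda>n. diff_quot f v n x)} \<in> sets borel"
    unfolding Cauchy_convergent_iff[symmetric] by (intro sets_Collect_Cauchy borel_measurable_diff_quot) measurable
  then have "space borel - {x\<in>space borel. convergent (\<lambda>n. diff_quot f v n x)} \<in> sets borel"
    by (rule sets.compl_sets)
  also have "space borel - {x\<in>space borel. convergent (\<lambda>n. diff_quot f v n x)} = N"
    by (auto simp: N_def)
  finally have [measurable]: "N \<in> sets borel" .
  have "emeasure lborel N = (\<integral>\<^sup>+t. indicator {0..1} t * emeasure lborel N \<partial>(lborel :: real measure))"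
    by (simp add: nn_integral_multc)
  also have "\<dots> = (\<integral>\<^sup>+t. \<integral>\<^sup>+x. indicator {0..1} t * indicator N (x + t *\<^sub>R v) \<partial>lborel \<partial>(lborel :: real measure))"
  proof (rule nn_integral_cong)
    fix t :: real
    have "emeasure lborel N = (\<integral>\<^sup>+x. indicator N (x + t *\<^sub>R v) \<partial>lborel)"
    proof -
      have "(\<integral>\<^sup>+x. indicator N x \<partial>lborel) = (\<integral>\<^sup>+x. indicator N x \<partial>distr lborel borel ((+) (t *\<^sub>R v)))"
        by (simp add: lborel_distr_plus)
      also have "\<dots> = (\<integral>\<^sup>+x. indicator N (x + t *\<^sub>R v) \<partial>lborel)"
        by (subst nn_integral_distr) (auto simp: add.commute)
      finally show ?thesis by simp
    qed
    then show "indicator {0..1} t * emeasure lborel N = (\<integral>\<^sup>+x. indicator {0..1} t * indicator N (x + t *\<^sub>R v) \<partial>lborel)"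
      by (simp add: nn_integral_cmult)
  qed
  also have "\<dots> = (\<integral>\<^sup>+x. \<integral>\<^sup>+t. indicator {0..1} t * indicator N (x + t *\<^sub>R v) \<partial>(lborel :: real measure) \<partial>lborel)"
    by (rule lborel_pair.Fubini') simp
  also have "\<dots> = (\<integral>\<^sup>+x. 0 \<partial>(lborel :: 'a measure))"
  proof (rule nn_integral_cong)
    fix x :: 'a
    have "(L * norm v)-lipschitz_on UNIV (\<lambda>t::real. f (x + t *\<^sub>R v))"
    proof (rule lipschitz_onI)
      fix s t :: real
      have "dist (f (x + s *\<^sub>R v)) (f (x + t *\<^sub>R v)) \<le> L * dist (x + s *\<^sub>R v) (x + t *\<^sub>R v)"
        by (rule lipschitz_onD[OF f]) auto
      also have "dist (x + s *\<^sub>R v) (x + t *\<^sub>R v) = norm v * dist s t"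
        by (simp add: dist_norm scaleR_diff_left[symmetric] mult.commute)
      finally show "dist (f (x + s *\<^sub>R v)) (f (x + t *\<^sub>R v)) \<le> L * norm v * dist s t" by (simp add: ac_simps)
    qed (use lipschitz_on_nonneg[OF f] in simp)
    from lipschitz_right_derivative[OF this]
    have "AE t in lborel. x + t *\<^sub>R v \<notin> N"
      by eventually_elim (simp add: N_def diff_quot_def algebra_simps del: of_nat_Suc)
    then have "AE t in lborel. indicator {0..1} t * indicator N (x + t *\<^sub>R v) = (0::ennreal)"
      by eventually_elim simp
    then show "(\<integral>\<^sup>+t. indicator {0..1} t * indicator N (x + t *\<^sub>R v) \<partial>(lborel :: real measure)) = 0"
      by (subst nn_integral_0_iff_AE) auto
  qed
  finally have "N \<in> null_sets lborel" by (simp add: null_sets_def)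
  then show ?thesis by (rule AE_I') (auto simp: N_def)
qed

lemma test_function_bounded_support:
  assumes "\<phi> \<in> test_functions \<Omega>"
  obtains R where "\<And>x. norm x \<ge> R \<Longrightarrow> \<phi> x = 0"
proof -
  have "bounded (closure {x. \<phi> x \<noteq> 0})"
    using assms by (auto simp: test_functions_def intro: compact_imp_bounded)
  then obtain B where B: "\<And>x. x \<in> closure {x. \<phi> x \<noteq> 0} \<Longrightarrow> norm x \<le> B" by (auto simp: bounded_iff)
  have "\<phi> x = 0" if "norm x \<ge> B + 1" for x
    using B[of x] closure_subset[of "{x. \<phi> x \<noteq> 0}"] that by fastforce
  then show thesis by (rule that)
qed

lemma test_function_has_derivative:
  assumes "\<phi> \<in> test_functions \<Omega>"
  obtains \<phi>' where "\<And>x. (\<phi> has_derivative \<phi>' x) (at x)" "\<And>h. continuous_on UNIV (\<lambda>x. \<phi>' x h)"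
proof -
  have "Ck_on (Suc 0) UNIV \<phi>" using assms by (auto simp: test_functions_def)
  then obtain \<phi>' where p: "\<And>x. (\<phi> has_derivative \<phi>' x) (at x)" "\<And>b. b \<in> Basis \<Longrightarrow> Ck_on 0 UNIV (\<lambda>x. \<phi>' x b)"
    using Ck_on_UNIV_SucE by blast
  have "continuous_on UNIV (\<lambda>x. \<phi>' x h)" for h
  proof -
    have "\<phi>' y h = (\<Sum>b\<in>Basis. \<phi>' y b *\<^sub>R b) \<bullet> h" for y
      using p(1) by (intro linear_eq_inner_sum has_derivative_linear)
    moreover have "continuous_on UNIV (\<lambda>y. (\<Sum>b\<in>Basis. \<phi>' y b *\<^sub>R b) \<bullet> h)"
      using p(2) by (intro continuous_intros) simp
    ultimately show ?thesis by (simp only:)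
  qed
  with p(1) show thesis by (rule that)
qed

lemma test_function_lipschitz:
  assumes "\<phi> \<in> test_functions \<Omega>"
  obtains C where "C-lipschitz_on UNIV \<phi>"
proof -
  obtain R where R: "\<And>x. norm x \<ge> R \<Longrightarrow> \<phi> x = 0" using test_function_bounded_support[OF assms] by blast
  obtain \<phi>' where p: "\<And>x. (\<phi> has_derivative \<phi>' x) (at x)" "\<And>h. continuous_on UNIV (\<lambda>x. \<phi>' x h)"
    using test_function_has_derivative[OF assms] by blast
  have "\<exists>B. \<forall>x. \<bar>\<phi>' x b\<bar> \<le> B" for b
  proof -
    have "compact ((\<lambda>x. \<phi>' x b) ` cball 0 (R + 1))"
      by (intro compact_continuous_image continuous_on_subset[OF p(2)]) auto
    then obtain B where B: "\<forall>y\<in>(\<lambda>x. \<phi>' x b) ` cball 0 (R + 1). norm y \<le> B"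
      using compact_imp_bounded bounded_iff by metis
    have "\<bar>\<phi>' x b\<bar> \<le> max B 0" for x
    proof (cases "norm x > R")
      case True
      then show ?thesis using has_derivative_eq_0_outside[OF p(1) R True, of b] by simp
    next
      case False
      then have "x \<in> cball 0 (R + 1)" by simp
      then have "norm (\<phi>' x b) \<le> B" using B by blast
      then show ?thesis by simp
    qed
    then show ?thesis by blast
  qed
  then obtain B where B: "\<And>b x. \<bar>\<phi>' x b\<bar> \<le> B b" by metis
  have "(\<Sum>b\<in>Basis. B b)-lipschitz_on UNIV \<phi>"
  proof (rule bounded_derivative_imp_lipschitz)
    show "(\<phi> has_derivative \<phi>' x) (at x within UNIV)" for x using p(1) by simp
    show "onorm (\<phi>' x) \<le> (\<Sum>b\<in>Basis. B b)" for x
    proof (rule onorm_le)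
      fix h
      have "\<phi>' x h = (\<Sum>b\<in>Basis. \<phi>' x b *\<^sub>R b) \<bullet> h"
        using p(1) by (intro linear_eq_inner_sum has_derivative_linear)
      also have "\<dots> = (\<Sum>b\<in>Basis. \<phi>' x b * (b \<bullet> h))" by (simp add: inner_sum_left)
      finally have "norm (\<phi>' x h) \<le> (\<Sum>b\<in>Basis. \<bar>\<phi>' x b * (b \<bullet> h)\<bar>)" by (simp add: sum_abs)
      also have "\<dots> \<le> (\<Sum>b\<in>Basis. B b * norm h)"
      proof (rule sum_mono)
        fix b :: "real^'a" assume "b \<in> Basis"
        then show "\<bar>\<phi>' x b * (b \<bullet> h)\<bar> \<le> B b * norm h"
          unfolding abs_mult using B Basis_le_norm[of b h] by (intro mult_mono) (auto simp: inner_commute intro: order_trans[OF abs_ge_zero])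
      qed
      finally show "norm (\<phi>' x h) \<le> (\<Sum>b\<in>Basis. B b) * norm h" by (simp add: sum_distrib_right)
    qed
    have "0 \<le> B b" for b using B[of 0 b] by (rule order_trans[OF abs_ge_zero])
    then show "0 \<le> (\<Sum>b\<in>Basis. B b)" by (intro sum_nonneg) auto
  qed auto
  then show thesis by (rule that)
qed

text \<open>
  Tested against a smooth function, the directional derivative is linear in the direction: transfer
  the difference quotients to the test function.
\<close>

lemma integral_dir_deriv:
  fixes f :: "real^'n::finite \<Rightarrow> real"
  assumes f: "L-lipschitz_on UNIV f" and \<phi>: "\<phi> \<in> test_functions UNIV"
    and \<phi>': "\<And>x. (\<phi> has_derivative \<phi>' x) (at x)"
  shows "integrable lborel (\<lambda>x. dir_deriv f v x * \<phi> x)" (is ?A)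
    and "integrable lborel (\<lambda>x. f x * \<phi>' x v)" (is ?B)
    and "(LINT x|lborel. dir_deriv f v x * \<phi> x) = - (LINT x|lborel. f x * \<phi>' x v)" (is ?C)
proof -
  have fc: "continuous_on UNIV f" using f by (rule lipschitz_on_continuous_on)
  have fm [measurable]: "f \<in> borel_measurable borel" using f by (rule borel_measurable_lipschitz)
  obtain R where R: "\<And>x. norm x \<ge> R \<Longrightarrow> \<phi> x = 0" using test_function_bounded_support[OF \<phi>] by blast
  obtain C where C: "C-lipschitz_on UNIV \<phi>" using test_function_lipschitz[OF \<phi>] by blast
  have \<phi>c: "continuous_on UNIV \<phi>" using C by (rule lipschitz_on_continuous_on)
  have \<phi>m [measurable]: "\<phi> \<in> borel_measurable borel" using C by (rule borel_measurable_lipschitz)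
  have "bounded (\<phi> ` cball 0 R)"
    by (intro compact_imp_bounded compact_continuous_image continuous_on_subset[OF \<phi>c]) auto
  then obtain M0 where M0: "\<And>y. y \<in> \<phi> ` cball 0 R \<Longrightarrow> norm y \<le> M0" unfolding bounded_iff by blast
  define M where "M = max M0 0"
  have M: "\<bar>\<phi> x\<bar> \<le> M" for x
    using M0[of "\<phi> x"] R[of x] by (cases "norm x \<le> R") (auto simp: M_def)
  have qb: "\<bar>diff_quot f v n x\<bar> \<le> L * norm v" for n x by (rule diff_quot_bound[OF f])
  have L0: "0 \<le> L * norm v" using lipschitz_on_nonneg[OF f] by simp
  have M00: "0 \<le> M" by (simp add: M_def)
  let ?w = "\<lambda>x :: real^'n. L * norm v * M * indicator (cball 0 R) x"
  have wi: "integrable lborel ?w"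
    using emeasure_lborel_cball_finite[of "0 :: real^'n" R]
    by (intro integrable_mult_right integrable_real_indicator) auto
  have bound: "\<bar>diff_quot f v n x * \<phi> x\<bar> \<le> ?w x" for n x
    using mult_mono[OF qb[of n x] M[of x] L0] R[of x] by (cases "norm x \<le> R") (auto simp: abs_mult)
  have lim: "AE x in lborel. (\<lambda>n. diff_quot f v n x * \<phi> x) \<longlonglongrightarrow> dir_deriv f v x * \<phi> x"
    using AE_convergent_diff_quot[OF f, of v]
  proof eventually_elim
    case (elim x)
    then show ?case by (intro tendsto_mult tendsto_const diff_quot_tendsto_dir_deriv)
  qed
  show ?A
    by (rule integrable_dominated_convergence[OF _ _ wi lim]) (use bound in auto)
  have lim1: "(\<lambda>n. LINT x|lborel. diff_quot f v n x * \<phi> x) \<longlonglongrightarrow> (LINT x|lborel. dir_deriv f v x * \<phi> x)"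
    by (rule integral_dominated_convergence[OF _ _ wi lim]) (use bound in auto)
  let ?R = "R + norm v"
  have q\<phi>: "(\<lambda>n. diff_quot \<phi> (- v) n x) \<longlonglongrightarrow> - \<phi>' x v" for x
  proof -
    have "((\<lambda>t. \<phi> (x + t *\<^sub>R (- v))) has_derivative (\<lambda>t. \<phi>' x (t *\<^sub>R (- v)))) (at 0)"
    proof -
      have "((\<lambda>t. x + t *\<^sub>R (- v)) has_derivative (\<lambda>t. t *\<^sub>R (- v))) (at 0)"
        by (auto intro!: derivative_eq_intros)
      moreover have "(\<phi> has_derivative \<phi>' x) (at (x + 0 *\<^sub>R (- v)))" using \<phi>' by simp
      ultimately show ?thesis by (rule has_derivative_compose)
    qed
    moreover have "(\<lambda>t. \<phi>' x (t *\<^sub>R (- v))) = times (- \<phi>' x v)"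
      using has_derivative_linear[OF \<phi>'] by (simp add: linear_cmul linear_neg fun_eq_iff)
    ultimately have "((\<lambda>t. \<phi> (x + t *\<^sub>R (- v))) has_real_derivative - \<phi>' x v) (at 0)"
      by (simp only: has_field_derivative_def)
    then have "((\<lambda>t. (\<phi> (x + t *\<^sub>R (- v)) - \<phi> x) / t) \<longlongrightarrow> - \<phi>' x v) (at 0)"
      by (simp add: DERIV_def)
    moreover have "filterlim (\<lambda>n. 1 / real (Suc n)) (at 0) sequentially"
      using LIMSEQ_inverse_real_of_nat by (auto simp: filterlim_at inverse_eq_divide)
    ultimately have "(\<lambda>n. (\<phi> (x + (1 / real (Suc n)) *\<^sub>R (- v)) - \<phi> x) / (1 / real (Suc n))) \<longlonglongrightarrow> - \<phi>' x v"
      by (rule filterlim_compose)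
    then show ?thesis unfolding diff_quot_def by (simp add: mult.commute del: of_nat_Suc)
  qed
  have q0: "diff_quot \<phi> (- v) n x = 0" if "norm x \<ge> ?R" for n x
  proof -
    have "(1 / real (Suc n)) * norm v \<le> 1 * norm v" by (intro mult_right_mono) auto
    then have "norm x - norm ((1 / real (Suc n)) *\<^sub>R v) \<ge> R" using that by simp
    then have "norm (x - (1 / real (Suc n)) *\<^sub>R v) \<ge> R" using norm_triangle_ineq2[of x "(1 / real (Suc n)) *\<^sub>R v"] by linarith
    moreover have "norm x \<ge> R" using that norm_ge_zero[of v] by linarith
    ultimately show ?thesis by (simp add: diff_quot_def R)
  qed
  have "bounded (f ` cball 0 ?R)"
    by (intro compact_imp_bounded compact_continuous_image continuous_on_subset[OF fc]) auto
  then obtain F where F: "\<And>y. y \<in> f ` cball 0 ?R \<Longrightarrow> norm y \<le> F" unfolding bounded_iff by blast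
  let ?w' = "\<lambda>x :: real^'n. \<bar>F\<bar> * (C * norm v) * indicator (cball 0 ?R) x"
  have wi': "integrable lborel ?w'"
    using emeasure_lborel_cball_finite[of "0 :: real^'n" ?R]
    by (intro integrable_mult_right integrable_real_indicator) auto
  have bound': "\<bar>f x * diff_quot \<phi> (- v) n x\<bar> \<le> ?w' x" for n x
  proof (cases "norm x \<le> ?R")
    case True
    have "\<bar>f x\<bar> \<le> \<bar>F\<bar>" using F[of "f x"] True by auto
    moreover have "\<bar>diff_quot \<phi> (- v) n x\<bar> \<le> C * norm v" using diff_quot_bound[OF C, of "- v" n x] by simp
    ultimately show ?thesis using True by (simp add: abs_mult mult_mono)
  qed (simp add: q0)
  have lim': "AE x in lborel. (\<lambda>n. f x * diff_quot \<phi> (- v) n x) \<longlonglongrightarrow> f x * - \<phi>' x v"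
    by (intro AE_I2 tendsto_mult tendsto_const q\<phi>)
  have m': "(\<lambda>x. \<phi>' x v) \<in> borel_measurable borel"
  proof -
    obtain \<psi>' where p: "\<And>x. (\<phi> has_derivative \<psi>' x) (at x)" "\<And>h. continuous_on UNIV (\<lambda>x. \<psi>' x h)"
      using test_function_has_derivative[OF \<phi>] by blast
    have "\<phi>' = \<psi>'" using has_derivative_unique[OF \<phi>' p(1)] by blast
    then show ?thesis using p(2)[of v] by (intro borel_measurable_continuous_onI) simp
  qed
  have "integrable lborel (\<lambda>x. f x * - \<phi>' x v)"
    by (rule integrable_dominated_convergence[OF _ _ wi' lim']) (use bound' m' in auto)
  then show ?B by simp
  have lim2: "(\<lambda>n. LINT x|lborel. f x * diff_quot \<phi> (- v) n x) \<longlonglongrightarrow> (LINT x|lborel. f x * - \<phi>' x v)"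
    by (rule integral_dominated_convergence[OF _ _ wi' lim']) (use bound' m' in auto)
  have "(LINT x|lborel. diff_quot f v n x * \<phi> x) = (LINT x|lborel. f x * diff_quot \<phi> (- v) n x)" for n
  proof -
    let ?h = "(1 / real (Suc n)) *\<^sub>R v"
    have i1: "integrable lborel (\<lambda>x. f (x + ?h) * \<phi> x)"
      by (rule integrable_mult_compact_support[OF _ \<phi>c R]) (auto intro!: continuous_on_compose2[OF fc] continuous_intros)
    have i2: "integrable lborel (\<lambda>x. f x * \<phi> x)"
      by (rule integrable_mult_compact_support[OF fc \<phi>c R])
    have i3: "integrable lborel (\<lambda>x. f x * \<phi> (x - ?h))"
    proof (rule integrable_mult_compact_support[OF fc])
      show "continuous_on UNIV (\<lambda>x. \<phi> (x - ?h))" by (auto intro!: continuous_on_compose2[OF \<phi>c] continuous_intros)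
      fix y :: "real^'n" assume "norm y \<ge> R + norm ?h"
      then have "norm (y - ?h) \<ge> R" using norm_triangle_ineq2[of y ?h] by linarith
      then show "\<phi> (y - ?h) = 0" by (rule R)
    qed
    have "(LINT x|lborel. diff_quot f v n x * \<phi> x) = (LINT x|lborel. real (Suc n) * (f (x + ?h) * \<phi> x - f x * \<phi> x))"
      by (simp add: diff_quot_def algebra_simps)
    also have "\<dots> = real (Suc n) * ((LINT x|lborel. f (x + ?h) * \<phi> x) - (LINT x|lborel. f x * \<phi> x))"
      using i1 i2 by simp
    also have "(LINT x|lborel. f (x + ?h) * \<phi> x) = (LINT x|lborel. f x * \<phi> (x - ?h))"
      using lborel_integral_affine[of "\<lambda>x. f x * \<phi> (x - ?h)" 1 ?h] by (simp add: add.commute)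
    also have "real (Suc n) * ((LINT x|lborel. f x * \<phi> (x - ?h)) - (LINT x|lborel. f x * \<phi> x)) =
        (LINT x|lborel. real (Suc n) * (f x * \<phi> (x - ?h) - f x * \<phi> x))"
      using i2 i3 by simp
    also have "\<dots> = (LINT x|lborel. f x * diff_quot \<phi> (- v) n x)"
      by (simp add: diff_quot_def algebra_simps)
    finally show ?thesis .
  qed
  then have "(LINT x|lborel. dir_deriv f v x * \<phi> x) = (LINT x|lborel. f x * - \<phi>' x v)"
    using LIMSEQ_unique[OF lim1] lim2 by simp
  then show ?C by simp
qed

text \<open>
  Both sides have the same integral against every test function, since derivatives of test functions are
  linear in the direction.
\<close>

lemma AE_dir_deriv_linear:
  fixes f :: "real^'n::finite \<Rightarrow> real"
  assumes f: "L-lipschitz_on UNIV f"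
  shows "AE x in lborel. dir_deriv f v x = lip_grad f x \<bullet> v"
proof -
  have [measurable]: "f \<in> borel_measurable borel" using f by (rule borel_measurable_lipschitz)
  define g where "g = (\<lambda>x. dir_deriv f v x - lip_grad f x \<bullet> v)"
  have gm [measurable]: "g \<in> borel_measurable borel" unfolding g_def by measurable
  have lg: "lip_grad f x \<bullet> v = (\<Sum>b\<in>Basis. (b \<bullet> v) * dir_deriv f b x)" for x
    by (simp add: lip_grad_def inner_sum_left mult.commute)
  have bnd: "AE x in lborel. \<bar>dir_deriv f w x\<bar> \<le> L * norm w" for w
    using AE_convergent_diff_quot[OF f, of w]
  proof eventually_elim
    case (elim x)
    have "(\<lambda>n. \<bar>diff_quot f w n x\<bar>) \<longlonglongrightarrow> \<bar>dir_deriv f w x\<bar>"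
      by (intro tendsto_rabs diff_quot_tendsto_dir_deriv elim)
    then show ?case by (rule LIMSEQ_le_const2) (use diff_quot_bound[OF f] in auto)
  qed
  define B where "B = L * norm v + (\<Sum>b\<in>(Basis :: (real^'n) set). \<bar>b \<bullet> v\<bar> * (L * norm b))"
  have gb: "AE x in lborel. \<bar>g x\<bar> \<le> B"
  proof -
    have "AE x in lborel. \<forall>b\<in>Basis. \<bar>dir_deriv f b x\<bar> \<le> L * norm b"
      by (rule AE_finite_allI[OF finite_Basis bnd])
    with bnd[of v] show ?thesis
    proof eventually_elim
      case (elim x)
      have "\<bar>\<Sum>b\<in>Basis. (b \<bullet> v) * dir_deriv f b x\<bar> \<le> (\<Sum>b\<in>Basis. \<bar>(b \<bullet> v) * dir_deriv f b x\<bar>)"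
        by (rule sum_abs)
      also have "\<dots> \<le> (\<Sum>b\<in>(Basis :: (real^'n) set). \<bar>b \<bullet> v\<bar> * (L * norm b))"
        unfolding abs_mult using elim(2) by (intro sum_mono mult_left_mono) auto
      finally show ?case
        using elim(1) unfolding g_def lg B_def by linarith
    qed
  qed
  have "AE x in lebesgue. x \<in> UNIV \<longrightarrow> g x = 0"
  proof (rule fundamental_lemma)
    show "locally_integrable UNIV g"
      unfolding locally_integrable_def
    proof (intro allI impI)
      fix K :: "(real^'n) set" assume K: "compact K \<and> K \<subseteq> UNIV"
      have "set_integrable lborel K g"
        unfolding set_integrable_def
      proof (rule Bochner_Integration.integrable_bound)
        show "integrable lborel (\<lambda>x. B * indicator K x :: real)"
          using emeasure_compact_finite[of K] K by (intro integrable_mult_right integrable_real_indicator) (auto dest: compact_imp_closed)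
        show "(\<lambda>x. indicator K x *\<^sub>R g x) \<in> borel_measurable lborel" using K
          by (intro borel_measurable_scaleR borel_measurable_indicator) (auto dest: compact_imp_closed)
        show "AE x in lborel. norm (indicator K x *\<^sub>R g x) \<le> norm (B * indicator K x :: real)"
          using gb by eventually_elim (auto simp: indicator_def)
      qed
      then show "set_integrable lebesgue K g"
        unfolding set_integrable_def by (simp add: integrable_completion borel_measurable_integrable)
    qed
  next
    fix \<phi> :: "real^'n \<Rightarrow> real" assume \<phi>: "\<phi> \<in> test_functions UNIV"
    obtain \<phi>' where \<phi>': "\<And>x. (\<phi> has_derivative \<phi>' x) (at x)" "\<And>h. continuous_on UNIV (\<lambda>x. \<phi>' x h)"
      using test_function_has_derivative[OF \<phi>] by blast
    note I = integral_dir_deriv[OF f \<phi> \<phi>'(1)]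
    have \<phi>m [measurable]: "\<phi> \<in> borel_measurable borel"
      using \<phi> by (intro borel_measurable_continuous_onI Ck_on_continuous[of 0]) (auto simp: test_functions_def)
    have lin: "\<phi>' x v = (\<Sum>b\<in>Basis. (b \<bullet> v) * \<phi>' x b)" for x
      by (subst linear_eq_inner_sum[OF has_derivative_linear[OF \<phi>'(1)]]) (simp add: inner_sum_left mult.commute)
    have "(LINT x|lborel. g x * \<phi> x) = (LINT x|lborel. dir_deriv f v x * \<phi> x - (\<Sum>b\<in>Basis. (b \<bullet> v) * (dir_deriv f b x * \<phi> x)))"
      by (simp add: g_def lg left_diff_distrib sum_distrib_right mult.assoc)
    also have "\<dots> = (LINT x|lborel. dir_deriv f v x * \<phi> x) - (\<Sum>b\<in>Basis. (b \<bullet> v) * (LINT x|lborel. dir_deriv f b x * \<phi> x))"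
      using I(1) by (subst Bochner_Integration.integral_diff) auto
    also have "\<dots> = - (LINT x|lborel. f x * \<phi>' x v) + (\<Sum>b\<in>Basis. (b \<bullet> v) * (LINT x|lborel. f x * \<phi>' x b))"
      unfolding I(3) by (simp add: sum_negf)
    also have "(\<Sum>b\<in>Basis. (b \<bullet> v) * (LINT x|lborel. f x * \<phi>' x b)) = (LINT x|lborel. (\<Sum>b\<in>Basis. (b \<bullet> v) * (f x * \<phi>' x b)))"
      using I(2) by (subst Bochner_Integration.integral_sum) auto
    also have "\<dots> = (LINT x|lborel. f x * \<phi>' x v)"
      by (simp add: lin sum_distrib_left ac_simps)
    finally have "(LINT x|lborel. g x * \<phi> x) = 0" by simp
    then show "distr_fun UNIV g \<phi> = 0"
      unfolding distr_fun_def set_lebesgue_integral_def by (simp add: integral_completion)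
  qed simp
  then have "AE x in lborel. g x = 0" by (simp add: AE_completion_iff)
  then show ?thesis by eventually_elim (simp add: g_def)
qed

text \<open>
  Convergence of the difference quotients for a dense set of directions suffices: the unit sphere
  is covered by finitely many small balls around such directions, and the Lipschitz condition
  controls the passage from a nearby direction and from a nearby step size \<open>1 / (n + 1)\<close>.
\<close>

lemma lipschitz_differentiable:
  fixes f :: "'a::euclidean_space \<Rightarrow> real"
  assumes f: "L-lipschitz_on UNIV f"
    and dense: "\<And>X :: 'a set. open X \<Longrightarrow> X \<noteq> {} \<Longrightarrow> \<exists>d\<in>D. d \<in> X"
    and lim: "\<And>v. v \<in> D \<Longrightarrow> (\<lambda>n. diff_quot f v n x) \<longlonglongrightarrow> g \<bullet> v"
  shows "(f has_derivative (\<lambda>h. g \<bullet> h)) (at x)"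
  unfolding has_derivative_at_alt
proof (intro conjI allI impI)
  show "bounded_linear ((\<bullet>) g)" by (rule bounded_linear_inner_right)
  fix e :: real assume e: "e > 0"
  define C where "C = L + norm g + 1"
  have L0: "L \<ge> 0" using f by (rule lipschitz_on_nonneg)
  have C: "C > 0" using L0 norm_ge_zero[of g] unfolding C_def by linarith
  define \<eta> where "\<eta> = min 1 (e / (4 * C))"
  have \<eta>: "\<eta> > 0" "\<eta> \<le> 1" "C * \<eta> \<le> e / 4"
  proof -
    show "\<eta> > 0" "\<eta> \<le> 1" using e C by (auto simp: \<eta>_def)
    have "C * \<eta> \<le> C * (e / (4 * C))" using C by (intro mult_left_mono) (auto simp: \<eta>_def)
    then show "C * \<eta> \<le> e / 4" using C by simp
  qed
  have "sphere 0 1 \<subseteq> (\<Union>v\<in>D. ball v \<eta>)"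
  proof
    fix w :: 'a
    obtain v where "v \<in> D" "v \<in> ball w \<eta>" using dense[of "ball w \<eta>"] \<eta> by auto
    then show "w \<in> (\<Union>v\<in>D. ball v \<eta>)" by (auto simp: dist_commute)
  qed
  then obtain F where F: "F \<subseteq> D" "finite F" "sphere 0 1 \<subseteq> (\<Union>v\<in>F. ball v \<eta>)"
    using compactE_image[OF compact_sphere, of D "\<lambda>v. ball v \<eta>" 0 1] by auto
  have "eventually (\<lambda>n. \<forall>v\<in>F. \<bar>diff_quot f v n x - g \<bullet> v\<bar> < e / 8) sequentially"
    unfolding eventually_ball_finite_distrib[OF F(2)]
  proof
    fix v assume "v \<in> F"
    then have "(\<lambda>n. diff_quot f v n x) \<longlonglongrightarrow> g \<bullet> v" using lim F(1) by blast
    from tendstoD[OF this, of "e / 8"] e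
    show "eventually (\<lambda>n. \<bar>diff_quot f v n x - g \<bullet> v\<bar> < e / 8) sequentially" by (simp add: dist_real_def)
  qed
  moreover have "eventually (\<lambda>n. 2 * C * (1 / real (Suc n)) < e / 4) sequentially"
  proof -
    have "(\<lambda>n. 2 * C * inverse (real (Suc n))) \<longlonglongrightarrow> 2 * C * 0"
      by (intro tendsto_mult tendsto_const LIMSEQ_inverse_real_of_nat)
    from order_tendstoD(2)[OF this, of "e / 4"] e show ?thesis by (simp add: inverse_eq_divide)
  qed
  ultimately have "eventually (\<lambda>n. (\<forall>v\<in>F. \<bar>diff_quot f v n x - g \<bullet> v\<bar> < e / 8) \<and> 2 * C * (1 / real (Suc n)) < e / 4) sequentially"
    by (rule eventually_conj)
  then obtain n0 where n0: "\<And>n v. n \<ge> n0 \<Longrightarrow> v \<in> F \<Longrightarrow> \<bar>diff_quot f v n x - g \<bullet> v\<bar> < e / 8"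
     "\<And>n. n \<ge> n0 \<Longrightarrow> 2 * C * (1 / real (Suc n)) < e / 4"
    unfolding eventually_sequentially by blast
  have "norm (f y - f x - g \<bullet> (y - x)) \<le> e * norm (y - x)" if y: "norm (y - x) < 1 / real (Suc n0)" for y
  proof (cases "y = x")
    case False
    define t where "t = norm (y - x)"
    have t: "t > 0" "t < 1 / real (Suc n0)" using False y by (auto simp: t_def)
    define w where "w = (1 / t) *\<^sub>R (y - x)"
    have yx: "y = x + t *\<^sub>R w" using t by (simp add: w_def)
    have w1: "norm w = 1" using t by (simp add: w_def t_def[symmetric])
    then obtain v where v: "v \<in> F" "norm (v - w) < \<eta>" using F(3) by (auto simp: dist_norm subset_iff)
    have nv: "norm v \<le> 2" using norm_triangle_ineq[of "v - w" w] v(2) w1 \<eta>(2) by simp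
    \<comment> \<open>\<open>1 / real (Suc n)\<close> is the smallest step size not below \<open>t\<close>.\<close>
    define n where "n = nat \<lfloor>1 / t\<rfloor> - 1"
    have "1 / t > real (Suc n0)" using t by (simp add: field_simps)
    then have fl: "\<lfloor>1 / t\<rfloor> \<ge> int (Suc n0)" by (simp add: le_floor_iff)
    then have sn: "real (Suc n) = of_int \<lfloor>1 / t\<rfloor>" and nn0: "n \<ge> n0" by (auto simp: n_def of_nat_nat)
    have "real (Suc n) \<le> 1 / t" "1 / t < real (Suc n) + 1"
      unfolding sn by linarith+
    define s where "s = 1 / real (Suc n)"
    have s0: "s > 0" by (simp add: s_def)
    have ts: "t \<le> s" using \<open>real (Suc n) \<le> 1 / t\<close> t by (simp add: s_def field_simps)
    have "1 < t * (real (Suc n) + 1)" using \<open>1 / t < real (Suc n) + 1\<close> t by (simp add: field_simps)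
    then have "s * 1 < s * (t * (real (Suc n) + 1))" using s0 by (intro mult_strict_left_mono)
    also have "\<dots> = t + s * t" by (simp add: s_def field_simps)
    finally have st: "s - t < s * t" by simp
    have s1: "s \<le> 1" by (simp add: s_def)
    have "s * t \<le> 1 * t" using s1 t by (intro mult_right_mono) auto
    then have s2t: "s \<le> 2 * t" using st by linarith
    have dist_tw: "norm (t *\<^sub>R w - s *\<^sub>R v) \<le> t * (\<eta> + 2 * s)"
    proof -
      have "t *\<^sub>R w - s *\<^sub>R v = t *\<^sub>R (w - v) - (s - t) *\<^sub>R v" by (simp add: algebra_simps)
      then have "norm (t *\<^sub>R w - s *\<^sub>R v) \<le> t * norm (w - v) + (s - t) * norm v"
        using norm_triangle_ineq4[of "t *\<^sub>R (w - v)" "(s - t) *\<^sub>R v"] t ts by simp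
      also have "\<dots> \<le> t * \<eta> + (s * t) * 2"
        using v(2) t st ts nv s0 by (intro add_mono mult_mono) (auto simp: norm_minus_commute)
      finally show ?thesis by (simp add: algebra_simps)
    qed
    have A: "\<bar>f (x + t *\<^sub>R w) - f (x + s *\<^sub>R v)\<bar> \<le> L * (t * (\<eta> + 2 * s))"
    proof -
      have "\<bar>f (x + t *\<^sub>R w) - f (x + s *\<^sub>R v)\<bar> \<le> L * norm (t *\<^sub>R w - s *\<^sub>R v)"
        using lipschitz_onD[OF f, of "x + t *\<^sub>R w" "x + s *\<^sub>R v"] by (simp add: dist_norm)
      also have "\<dots> \<le> L * (t * (\<eta> + 2 * s))" using dist_tw L0 by (rule mult_left_mono)
      finally show ?thesis .
    qed
    have B: "\<bar>f (x + s *\<^sub>R v) - f x - s * (g \<bullet> v)\<bar> \<le> 2 * t * (e / 8)"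
    proof -
      have "f (x + s *\<^sub>R v) - f x - s * (g \<bullet> v) = s * (diff_quot f v n x - g \<bullet> v)"
        by (simp add: diff_quot_def s_def right_diff_distrib del: of_nat_Suc)
      then have "\<bar>f (x + s *\<^sub>R v) - f x - s * (g \<bullet> v)\<bar> \<le> s * (e / 8)"
        using n0(1)[OF nn0 v(1)] s0 by (simp add: abs_mult)
      also have "\<dots> \<le> 2 * t * (e / 8)" using s2t e by (intro mult_right_mono) auto
      finally show ?thesis .
    qed
    have D: "\<bar>s * (g \<bullet> v) - t * (g \<bullet> w)\<bar> \<le> norm g * (t * (\<eta> + 2 * s))"
    proof -
      have "s * (g \<bullet> v) - t * (g \<bullet> w) = - (g \<bullet> (t *\<^sub>R w - s *\<^sub>R v))" by (simp add: inner_diff_right)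
      then have "\<bar>s * (g \<bullet> v) - t * (g \<bullet> w)\<bar> \<le> norm g * norm (t *\<^sub>R w - s *\<^sub>R v)"
        using Cauchy_Schwarz_ineq2[of g "t *\<^sub>R w - s *\<^sub>R v"] by simp
      also have "\<dots> \<le> norm g * (t * (\<eta> + 2 * s))" using dist_tw by (rule mult_left_mono) simp
      finally show ?thesis .
    qed
    have "L * (t * (\<eta> + 2 * s)) + norm g * (t * (\<eta> + 2 * s)) = (L + norm g) * (t * (\<eta> + 2 * s))"
      by (simp add: algebra_simps)
    also have "\<dots> \<le> C * (t * (\<eta> + 2 * s))"
      using t \<eta> s0 by (intro mult_right_mono) (auto simp: C_def)
    also have "\<dots> = t * (C * \<eta> + 2 * C * s)" by (simp add: algebra_simps)
    also have "\<dots> \<le> t * (e / 4 + e / 4)"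
      using \<eta>(3) n0(2)[OF nn0] t unfolding s_def[symmetric] by (intro mult_left_mono add_mono) auto
    finally have E: "L * (t * (\<eta> + 2 * s)) + norm g * (t * (\<eta> + 2 * s)) \<le> t * (e / 4 + e / 4)" .
    have "f y - f x - g \<bullet> (y - x) = (f (x + t *\<^sub>R w) - f (x + s *\<^sub>R v)) +
        (f (x + s *\<^sub>R v) - f x - s * (g \<bullet> v)) + (s * (g \<bullet> v) - t * (g \<bullet> w))"
      by (simp add: yx)
    also have "\<bar>\<dots>\<bar> \<le> L * (t * (\<eta> + 2 * s)) + 2 * t * (e / 8) + norm g * (t * (\<eta> + 2 * s))"
      by (rule order_trans[OF abs_triangle_ineq add_mono[OF order_trans[OF abs_triangle_ineq add_mono[OF A B]] D]])
    also have "\<dots> \<le> t * (e / 4 + e / 4) + 2 * t * (e / 8)" using E by linarith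
    also have "\<dots> \<le> e * t" using t e by (simp add: algebra_simps)
    finally show ?thesis by (simp add: t_def)
  qed simp
  then show "\<exists>d>0. \<forall>y. norm (y - x) < d \<longrightarrow> norm (f y - f x - g \<bullet> (y - x)) \<le> e * norm (y - x)"
    by (intro exI[of _ "1 / real (Suc n0)"]) auto
qed

theorem rademacher:
  fixes f :: "real^'n::finite \<Rightarrow> real"
  assumes f: "L-lipschitz_on UNIV f"
  shows "AE x in lborel. (f has_derivative (\<lambda>h. lip_grad f x \<bullet> h)) (at x)"
proof -
  obtain D :: "(real^'n) set" where D: "countable D" "\<And>X. open X \<Longrightarrow> X \<noteq> {} \<Longrightarrow> \<exists>d\<in>D. d \<in> X"
    using countable_dense_setE by blast
  have "AE x in lborel. \<forall>v\<in>D. convergent (\<lambda>n. diff_quot f v n x) \<and> dir_deriv f v x = lip_grad f x \<bullet> v"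
    unfolding AE_ball_countable[OF D(1)]
    using AE_convergent_diff_quot[OF f] AE_dir_deriv_linear[OF f] by (auto simp: AE_conj_iff)
  then show ?thesis
  proof eventually_elim
    case (elim x)
    show ?case
    proof (rule lipschitz_differentiable[OF f D(2)])
      fix v assume "v \<in> D"
      then show "(\<lambda>n. diff_quot f v n x) \<longlonglongrightarrow> lip_grad f x \<bullet> v"
        using elim diff_quot_tendsto_dir_deriv[of f v x] by auto
    qed
  qed
qed

lemma lip_grad_eqI:
  assumes "(f has_derivative (\<lambda>h. g \<bullet> h)) (at x)"
  shows "lip_grad f x = g"
proof -
  have "dir_deriv f v x = g \<bullet> v" for v
  proof (rule dir_deriv_eqI)
    have "((\<lambda>t. f (x + t *\<^sub>R v)) has_derivative (\<lambda>t. g \<bullet> (t *\<^sub>R v))) (at 0)"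
    proof -
      have "((\<lambda>t. x + t *\<^sub>R v) has_derivative (\<lambda>t. t *\<^sub>R v)) (at 0)"
        by (auto intro!: derivative_eq_intros)
      moreover have "(f has_derivative (\<lambda>h. g \<bullet> h)) (at (x + 0 *\<^sub>R v))" using assms by simp
      ultimately show ?thesis by (rule has_derivative_compose)
    qed
    then have "((\<lambda>t. f (x + t *\<^sub>R v)) has_real_derivative g \<bullet> v) (at 0)"
      by (simp add: has_field_derivative_def mult_commute_abs)
    then have "((\<lambda>t. (f (x + t *\<^sub>R v) - f x) / t) \<longlongrightarrow> g \<bullet> v) (at 0)"
      by (simp add: DERIV_def)
    moreover have "filterlim (\<lambda>n. 1 / real (Suc n)) (at 0) sequentially"
      using LIMSEQ_inverse_real_of_nat by (auto simp: filterlim_at inverse_eq_divide)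
    ultimately have "(\<lambda>n. (f (x + (1 / real (Suc n)) *\<^sub>R v) - f x) / (1 / real (Suc n))) \<longlonglongrightarrow> g \<bullet> v"
      by (rule filterlim_compose)
    then show "(\<lambda>n. diff_quot f v n x) \<longlonglongrightarrow> g \<bullet> v"
      unfolding diff_quot_def by (simp add: mult.commute del: of_nat_Suc)
  qed
  then show ?thesis by (simp add: lip_grad_def euclidean_representation)
qed

section \<open>The area formula for Lipschitz graphs\<close>

lemma norm_gradient_le:
  fixes f :: "'a::euclidean_space \<Rightarrow> real"
  assumes f: "L-lipschitz_on UNIV f" and a: "(f has_derivative (\<lambda>h. a \<bullet> h)) (at x)"
  shows "norm a \<le> L"
proof (rule field_le_epsilon)
  fix e :: real assume e: "e > 0"
  obtain d where d: "d > 0" "\<And>y. norm (y - x) < d \<Longrightarrow> norm (f y - f x - a \<bullet> (y - x)) \<le> e * norm (y - x)"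
    using a e unfolding has_derivative_at_alt by blast
  show "norm a \<le> L + e"
  proof (cases "a = 0")
    case False
    define t where "t = d / (2 * norm a)"
    have t: "t > 0" using d False by (simp add: t_def)
    have nt: "norm (t *\<^sub>R a) < d" using d False by (simp add: t_def)
    have 1: "\<bar>f (x + t *\<^sub>R a) - f x - a \<bullet> (t *\<^sub>R a)\<bar> \<le> e * norm (t *\<^sub>R a)"
      using d(2)[of "x + t *\<^sub>R a"] nt by simp
    have 2: "\<bar>f (x + t *\<^sub>R a) - f x\<bar> \<le> L * norm (t *\<^sub>R a)"
      using lipschitz_onD[OF f, of "x + t *\<^sub>R a" x] by (simp add: dist_norm)
    have "norm a * norm (t *\<^sub>R a) = a \<bullet> (t *\<^sub>R a)"
      using t by (simp add: power2_norm_eq_inner[symmetric] power2_eq_square)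
    also have "\<dots> \<le> (L + e) * norm (t *\<^sub>R a)" unfolding distrib_right using 1 2 by linarith
    finally show ?thesis
      by (rule mult_right_le_imp_le) (use t False in simp)
  qed (use e lipschitz_on_nonneg[OF f] in simp)
qed

text \<open>
  The graph \<open>{y. y \<bullet> \<nu> = g y}\<close> is described by a function on the whole space that does not depend
  on the coordinate in the direction \<open>\<nu>\<close>.
\<close>

locale lipschitz_graph =
  fixes \<nu> :: "real^'n::finite" and L :: real and g :: "real^'n \<Rightarrow> real"
  assumes nu: "norm \<nu> = 1" and lip: "L-lipschitz_on UNIV g" and inv: "\<And>x. g (hproj \<nu> x) = g x"
begin

definition lift :: "real^'n \<Rightarrow> real^'n" where
  "lift x = hproj \<nu> x + g x *\<^sub>R \<nu>"

text \<open>Cutting off at the Lipschitz constant makes the bound hold everywhere.\<close>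

definition slope :: "real^'n \<Rightarrow> real^'n" where
  "slope x = (if norm (lip_grad g x) \<le> L then lip_grad g x else 0)"

definition area :: "real^'n \<Rightarrow> real" where
  "area x = sqrt (1 + (norm (slope x))\<^sup>2)"

lemma nu_nu: "\<nu> \<bullet> \<nu> = 1"
  using nu by (simp add: norm_eq_1)

lemma continuous_g: "continuous_on UNIV g"
  using lip by (rule lipschitz_on_continuous_on)

lemma measurable_g [measurable]: "g \<in> borel_measurable borel"
  using lip by (rule borel_measurable_lipschitz)

lemma measurable_lift [measurable]: "lift \<in> borel_measurable borel"
  unfolding lift_def[abs_def] by measurable

lemma measurable_slope [measurable]: "slope \<in> borel_measurable borel"
  unfolding slope_def[abs_def] by measurable

lemma measurable_area [measurable]: "area \<in> borel_measurable borel"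
  unfolding area_def[abs_def] by measurable

lemma graph_borel [measurable]: "{y. y \<bullet> \<nu> = g y} \<in> sets borel"
  by measurable

lemma g_cong: "hproj \<nu> x = hproj \<nu> y \<Longrightarrow> g x = g y"
  using inv[of x] inv[of y] by simp

lemma g_add_normal: "g (x + t *\<^sub>R \<nu>) = g x"
  by (rule g_cong) (simp add: hproj_add_normal nu)

lemma hproj_lift: "hproj \<nu> (lift x) = hproj \<nu> x"
  by (simp add: lift_def hproj_add_normal nu hproj_hproj)

lemma g_lift: "g (lift x) = g x"
  by (rule g_cong[OF hproj_lift])

lemma lift_in_graph: "lift x \<bullet> \<nu> = g (lift x)"
  by (simp add: g_lift) (simp add: lift_def inner_add_left hproj_inner nu nu_nu)

lemma lift_graph: "y \<bullet> \<nu> = g y \<Longrightarrow> lift y = y"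
  using hproj_decomp[of y \<nu>] by (simp add: lift_def)

lemma lift_hproj: "lift (hproj \<nu> x) = lift x"
  by (simp add: lift_def inv hproj_hproj nu)

lemma area_ge_1: "area x \<ge> 1"
  by (simp add: area_def)

lemma norm_slope_le: "norm (slope x) \<le> L"
  using lipschitz_on_nonneg[OF lip] by (simp add: slope_def)

lemma slope_eq:
  assumes a: "(g has_derivative (\<lambda>h. a \<bullet> h)) (at x)"
  shows "slope x = a"
proof -
  have "norm (lip_grad g x) \<le> L"
    unfolding lip_grad_eqI[OF a] by (rule norm_gradient_le[OF lip a])
  then show ?thesis by (simp add: slope_def lip_grad_eqI[OF a])
qed

lemma AE_slope: "AE x in lborel. (g has_derivative (\<lambda>h. slope x \<bullet> h)) (at x)"
  using rademacher[OF lip]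
proof eventually_elim
  case (elim x)
  then show ?case by (simp add: slope_eq[OF elim])
qed

lemma slope_cong: "hproj \<nu> x = hproj \<nu> y \<Longrightarrow> slope x = slope y"
proof -
  assume "hproj \<nu> x = hproj \<nu> y"
  then have "g (x + w) = g (y + w)" for w
    by (intro g_cong) (simp add: linear_add[OF linear_hproj])
  moreover from this[of 0] have "g x = g y" by simp
  ultimately have "lip_grad g x = lip_grad g y"
    by (simp add: lip_grad_def dir_deriv_def diff_quot_def)
  then show ?thesis by (simp add: slope_def)
qed

lemma gradient_tangential:
  assumes "(g has_derivative (\<lambda>h. a \<bullet> h)) (at x)"
  shows "a \<bullet> \<nu> = 0"
proof -
  have "((\<lambda>t::real. x + t *\<^sub>R \<nu>) has_derivative (\<lambda>t. t *\<^sub>R \<nu>)) (at 0)"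
    by (auto intro!: derivative_eq_intros)
  moreover have "(g has_derivative (\<lambda>h. a \<bullet> h)) (at (x + 0 *\<^sub>R \<nu>))" using assms by simp
  ultimately have "((\<lambda>t::real. g (x + t *\<^sub>R \<nu>)) has_derivative (\<lambda>t. a \<bullet> (t *\<^sub>R \<nu>))) (at 0)"
    by (rule has_derivative_compose)
  then have "((\<lambda>t::real. g x) has_derivative (\<lambda>t. a \<bullet> (t *\<^sub>R \<nu>))) (at 0)"
    by (simp only: g_add_normal)
  from has_derivative_unique[OF this has_derivative_const] have "a \<bullet> (1 *\<^sub>R \<nu>) = 0" by (rule fun_cong)
  then show ?thesis by simp
qed

text \<open>
  On the pieces introduced here the graph is, up to a factor \<open>1 + \<epsilon>\<close> in all distances, the graph of
  the linear function given by \<open>l\<close>.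
\<close>

definition flat_piece :: "real \<Rightarrow> nat \<Rightarrow> real^'n \<Rightarrow> real^'n \<Rightarrow> (real^'n) set" where
  "flat_piece \<epsilon> j l c =
     {x. \<forall>w. w \<bullet> \<nu> = 0 \<and> norm w < 1 / real (Suc j) \<longrightarrow> \<bar>g (x + w) - g x - l \<bullet> w\<bar> \<le> \<epsilon> * norm w} \<inter>
     {x. norm (hproj \<nu> x - c) < 1 / (2 * real (Suc j))}"

lemma flat_piece_borel: "flat_piece \<epsilon> j l c \<in> sets borel"
proof -
  have "closed {x. \<bar>g (x + w) - g x - l \<bullet> w\<bar> \<le> \<epsilon> * norm w}" for w
    by (intro closed_Collect_le continuous_intros continuous_on_compose2[OF continuous_g] continuous_on_subset[OF continuous_g]) auto
  then have "closed (\<Inter>w\<in>{w. w \<bullet> \<nu> = 0 \<and> norm w < 1 / real (Suc j)}. {x. \<bar>g (x + w) - g x - l \<bullet> w\<bar> \<le> \<epsilon> * norm w})"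
    by (intro closed_INT) auto
  also have "(\<Inter>w\<in>{w. w \<bullet> \<nu> = 0 \<and> norm w < 1 / real (Suc j)}. {x. \<bar>g (x + w) - g x - l \<bullet> w\<bar> \<le> \<epsilon> * norm w}) =
      {x. \<forall>w. w \<bullet> \<nu> = 0 \<and> norm w < 1 / real (Suc j) \<longrightarrow> \<bar>g (x + w) - g x - l \<bullet> w\<bar> \<le> \<epsilon> * norm w}"
    by auto
  finally have "{x. \<forall>w. w \<bullet> \<nu> = 0 \<and> norm w < 1 / real (Suc j) \<longrightarrow> \<bar>g (x + w) - g x - l \<bullet> w\<bar> \<le> \<epsilon> * norm w} \<in> sets borel"
    by (rule borel_closed)
  moreover have "{x. norm (hproj \<nu> x - c) < 1 / (2 * real (Suc j))} \<in> sets borel"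
    by measurable
  ultimately show ?thesis unfolding flat_piece_def by (rule sets.Int)
qed

lemma hproj_in_flat_piece: "hproj \<nu> x \<in> flat_piece \<epsilon> j l c \<longleftrightarrow> x \<in> flat_piece \<epsilon> j l c"
proof -
  have "g (hproj \<nu> x + w) = g (x + w)" for w
    by (rule g_cong) (simp add: linear_add[OF linear_hproj] hproj_hproj nu)
  then show ?thesis by (simp add: flat_piece_def inv hproj_hproj nu)
qed

lemma lift_in_flat_piece: "lift x \<in> flat_piece \<epsilon> j l c \<longleftrightarrow> x \<in> flat_piece \<epsilon> j l c"
  using hproj_in_flat_piece[of "lift x"] hproj_in_flat_piece[of x] by (simp add: hproj_lift)

lemma flat_piece_diff:
  assumes x: "x \<in> flat_piece \<epsilon> j l c" and y: "y \<in> flat_piece \<epsilon> j l c" and l: "l \<bullet> \<nu> = 0"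
  shows "\<bar>(g y - g x) - l \<bullet> hproj \<nu> (y - x)\<bar> \<le> \<epsilon> * norm (hproj \<nu> (y - x))"
proof -
  let ?w = "hproj \<nu> (y - x)"
  have "norm ?w \<le> norm (hproj \<nu> y - c) + norm (hproj \<nu> x - c)"
    using norm_triangle_ineq4[of "hproj \<nu> y - c" "hproj \<nu> x - c"] by (simp add: hproj_diff)
  also have "\<dots> < 1 / (2 * real (Suc j)) + 1 / (2 * real (Suc j))"
    using x y by (intro add_strict_mono) (auto simp: flat_piece_def)
  also have "\<dots> = 1 / real (Suc j)" by (simp add: field_simps)
  finally have "norm ?w < 1 / real (Suc j)" .
  moreover have "?w \<bullet> \<nu> = 0" by (rule hproj_inner[OF nu])
  ultimately have "\<bar>g (x + ?w) - g x - l \<bullet> ?w\<bar> \<le> \<epsilon> * norm ?w"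
    using x by (simp add: flat_piece_def)
  moreover have "g (x + ?w) = g y"
    by (rule g_cong) (simp add: linear_add[OF linear_hproj] hproj_hproj nu hproj_diff)
  ultimately show ?thesis by simp
qed

lemma flat_piece_gradient:
  assumes x: "x \<in> flat_piece \<epsilon> j l c" and a: "(g has_derivative (\<lambda>h. a \<bullet> h)) (at x)"
    and l: "l \<bullet> \<nu> = 0" and \<epsilon>: "\<epsilon> > 0"
  shows "norm (a - l) \<le> \<epsilon>"
proof (cases "a = l")
  case True
  then show ?thesis using \<epsilon> by simp
next
  case False
  define h where "h = a - l"
  have h: "h \<noteq> 0" "h \<bullet> \<nu> = 0"
    using False gradient_tangential[OF a] l by (auto simp: h_def inner_diff_left)
  show ?thesis
  proof (rule field_le_epsilon)
    fix e :: real assume e: "e > 0"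
    obtain d where d: "d > 0" "\<And>y. norm (y - x) < d \<Longrightarrow> norm (g y - g x - a \<bullet> (y - x)) \<le> e * norm (y - x)"
      using a e unfolding has_derivative_at_alt by blast
    define m where "m = min d (1 / real (Suc j))"
    have m: "0 < m" "m \<le> d" "m \<le> 1 / real (Suc j)" using d(1) by (simp_all add: m_def)
    define t where "t = m / (2 * norm h)"
    have t: "t > 0" using m h by (simp add: t_def)
    have "norm (t *\<^sub>R h) = m / 2" using m h by (simp add: t_def abs_of_pos)
    then have small: "norm (t *\<^sub>R h) < d \<and> norm (t *\<^sub>R h) < 1 / real (Suc j)"
      using m by linarith
    have 1: "\<bar>g (x + t *\<^sub>R h) - g x - a \<bullet> (t *\<^sub>R h)\<bar> \<le> e * norm (t *\<^sub>R h)"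
      using d(2)[of "x + t *\<^sub>R h"] small by simp
    have 2: "\<bar>g (x + t *\<^sub>R h) - g x - l \<bullet> (t *\<^sub>R h)\<bar> \<le> \<epsilon> * norm (t *\<^sub>R h)"
    proof -
      have "(t *\<^sub>R h) \<bullet> \<nu> = 0" using h(2) by simp
      then show ?thesis using x small unfolding flat_piece_def by blast
    qed
    have "norm h * norm (t *\<^sub>R h) = h \<bullet> (t *\<^sub>R h)"
      using t by (simp add: dot_square_norm power2_eq_square)
    also have "\<dots> = a \<bullet> (t *\<^sub>R h) - l \<bullet> (t *\<^sub>R h)"
      by (subst (1) h_def) (rule inner_diff_left)
    also have "\<dots> \<le> e * norm (t *\<^sub>R h) + \<epsilon> * norm (t *\<^sub>R h)" using 1 2 by linarith
    finally have "norm h * norm (t *\<^sub>R h) \<le> (\<epsilon> + e) * norm (t *\<^sub>R h)" by (simp add: algebra_simps)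
    moreover have "norm (t *\<^sub>R h) > 0" using t h by simp
    ultimately show "norm (a - l) \<le> \<epsilon> + e" unfolding h_def[symmetric] by (rule mult_right_le_imp_le)
  qed
qed

text \<open>
  Near a point of differentiability \<open>g\<close> is close to its linear part; the gradient and the point are then moved
  into the dense set \<open>D\<close>, which will be countable.
\<close>

lemma flat_pieces_cover:
  assumes a: "(g has_derivative (\<lambda>h. a \<bullet> h)) (at x)" and \<epsilon>: "\<epsilon> > 0"
    and dense: "\<And>X :: (real^'n) set. open X \<Longrightarrow> X \<noteq> {} \<Longrightarrow> \<exists>d\<in>D. d \<in> X"
  shows "\<exists>j. \<exists>d\<in>D. \<exists>c\<in>D. x \<in> flat_piece \<epsilon> j (hproj \<nu> d) c"
proof -
  have a\<nu>: "a \<bullet> \<nu> = 0" by (rule gradient_tangential[OF a])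
  obtain d where d: "d \<in> D" "d \<in> ball a (\<epsilon> / 2)" using dense[of "ball a (\<epsilon> / 2)"] \<epsilon> by auto
  have da: "norm (hproj \<nu> d - a) \<le> \<epsilon> / 2"
  proof -
    have "hproj \<nu> d - a = hproj \<nu> (d - a)" by (simp add: hproj_diff hproj_eq[OF a\<nu>])
    then show ?thesis using norm_hproj_le[OF nu, of "d - a"] d(2) by (simp add: dist_norm norm_minus_commute)
  qed
  have "\<epsilon> / 2 > 0" using \<epsilon> by simp
  then obtain e where e: "e > 0" "\<And>y. norm (y - x) < e \<Longrightarrow> norm (g y - g x - a \<bullet> (y - x)) \<le> \<epsilon> / 2 * norm (y - x)"
    using a unfolding has_derivative_at_alt by blast
  obtain j where j: "1 / real (Suc j) < e" using nat_approx_posE[OF e(1)] by blast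
  obtain c where c: "c \<in> D" "c \<in> ball (hproj \<nu> x) (1 / (2 * real (Suc j)))"
    using dense[of "ball (hproj \<nu> x) (1 / (2 * real (Suc j)))"] by auto
  have "\<bar>g (x + w) - g x - hproj \<nu> d \<bullet> w\<bar> \<le> \<epsilon> * norm w" if w: "w \<bullet> \<nu> = 0 \<and> norm w < 1 / real (Suc j)" for w
  proof -
    have "\<bar>g (x + w) - g x - a \<bullet> w\<bar> \<le> \<epsilon> / 2 * norm w"
      using e(2)[of "x + w"] w j by simp
    moreover have "\<bar>a \<bullet> w - hproj \<nu> d \<bullet> w\<bar> \<le> \<epsilon> / 2 * norm w"
    proof -
      have "\<bar>(a - hproj \<nu> d) \<bullet> w\<bar> \<le> norm (a - hproj \<nu> d) * norm w" by (rule Cauchy_Schwarz_ineq2)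
      also have "\<dots> \<le> \<epsilon> / 2 * norm w" using da by (intro mult_right_mono) (auto simp: norm_minus_commute)
      finally show ?thesis by (simp add: inner_diff_left)
    qed
    ultimately show ?thesis by linarith
  qed
  then have "x \<in> flat_piece \<epsilon> j (hproj \<nu> d) c"
    using c(2) by (auto simp: flat_piece_def dist_norm norm_minus_commute)
  then show ?thesis using d(1) c(1) by blast
qed

definition graph_measure :: "(real^'n) measure" where
  "graph_measure = density (hausdorff_borel (CARD('n) - 1)) (indicator {y. y \<bullet> \<nu> = g y})"

definition lifted_measure :: "(real^'n) measure" where
  "lifted_measure = distr (density (slab_measure \<nu>) (\<lambda>x. ennreal (area x))) borel lift"

lemma sets_graph_measure [simp, measurable_cong]: "sets graph_measure = sets borel"
  by (simp add: graph_measure_def)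

lemma sets_lifted_measure [simp, measurable_cong]: "sets lifted_measure = sets borel"
  by (simp add: lifted_measure_def)

lemma emeasure_graph_measure:
  assumes [measurable]: "B \<in> sets borel"
  shows "emeasure graph_measure B = hausdorff_outer (CARD('n) - 1) (B \<inter> {y. y \<bullet> \<nu> = g y})"
proof -
  have "emeasure graph_measure B =
      (\<integral>\<^sup>+z. indicator ({y. y \<bullet> \<nu> = g y} \<inter> B) z \<partial>hausdorff_borel (CARD('n) - 1))"
    unfolding graph_measure_def
    by (subst emeasure_density) (simp_all flip: indicator_inter_arith)
  also have "\<dots> = emeasure (hausdorff_borel (CARD('n) - 1)) ({y. y \<bullet> \<nu> = g y} \<inter> B)"
    by (rule nn_integral_indicator) simp
  also have "\<dots> = hausdorff_outer (CARD('n) - 1) ({y. y \<bullet> \<nu> = g y} \<inter> B)"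
    by (rule emeasure_hausdorff_borel) simp
  finally show ?thesis by (simp add: Int_commute)
qed

lemma emeasure_lifted_measure:
  assumes [measurable]: "B \<in> sets borel"
  shows "emeasure lifted_measure B = (\<integral>\<^sup>+x. ennreal (area x) * indicator B (lift x) \<partial>slab_measure \<nu>)"
proof -
  have lm: "lift \<in> density (slab_measure \<nu>) (\<lambda>x. ennreal (area x)) \<rightarrow>\<^sub>M borel"
    by measurable
  have "emeasure lifted_measure B = emeasure (density (slab_measure \<nu>) (\<lambda>x. ennreal (area x))) (lift -` B)"
    unfolding lifted_measure_def by (subst emeasure_distr[OF lm]) simp_all
  also have "\<dots> = (\<integral>\<^sup>+x. ennreal (area x) * indicator (lift -` B) x \<partial>slab_measure \<nu>)"
  proof (rule emeasure_density)
    have "lift -` B \<inter> space borel \<in> sets borel" by (rule measurable_sets[OF measurable_lift assms])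
    then show "lift -` B \<in> sets (slab_measure \<nu>)" by (simp add: sets_slab_measure)
  qed measurable
  finally show ?thesis by (simp add: indicator_vimage[unfolded o_def])
qed

lemma AE_slab: "AE x in lborel. P x \<Longrightarrow> AE x in slab_measure \<nu>. P x"
  unfolding slab_measure_def by (subst AE_density) auto

text \<open>
  The triangle inequality for the vectors \<open>(1, a)\<close> and \<open>(1, l)\<close>, whose norms the square roots are.
\<close>

lemma sqrt_one_plus_close:
  fixes a l :: "real^'n"
  assumes "norm (a - l) \<le> \<epsilon>"
  shows "sqrt (1 + (norm a)\<^sup>2) \<le> (1 + \<epsilon>) * sqrt (1 + (norm l)\<^sup>2)"
proof -
  have \<epsilon>: "\<epsilon> \<ge> 0" using assms norm_ge_zero order_trans by blast
  have "norm (1 :: real, a) \<le> norm (1 :: real, l) + norm (0 :: real, a - l)"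
    using norm_triangle_ineq[of "(1 :: real, l)" "(0 :: real, a - l)"] by simp
  also have "\<dots> \<le> norm (1 :: real, l) + \<epsilon> * norm (1 :: real, l)"
  proof -
    have "1 \<le> norm (1 :: real, l)" by (simp add: norm_Pair)
    then have "\<epsilon> * 1 \<le> \<epsilon> * norm (1 :: real, l)" using \<epsilon> by (rule mult_left_mono)
    then show ?thesis using assms by (simp add: norm_Pair)
  qed
  finally show ?thesis by (simp add: norm_Pair algebra_simps)
qed

text \<open>
  Replacing \<open>g\<close> by the linear function \<open>l\<close> changes distances on this part of the graph by a factor of at most
  \<open>1 + \<epsilon>\<close>, and \<open>area\<close> differs from its value for \<open>l\<close> by no more than such a factor; for the graph of \<open>l\<close> the two
  measures agree.
\<close>

lemma measures_on_flat_piece: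
  fixes j :: nat and l c :: "real^'n"
  assumes \<epsilon>: "\<epsilon> > 0" and l: "l \<bullet> \<nu> = 0" and B[measurable]: "B \<in> sets borel"
  defines "X \<equiv> B \<inter> flat_piece \<epsilon> j l c"
  shows "emeasure graph_measure X \<le> ennreal ((1 + \<epsilon>) ^ CARD('n)) * (flat_const TYPE('n) * emeasure lifted_measure X)"
    and "flat_const TYPE('n) * emeasure lifted_measure X \<le> ennreal ((1 + \<epsilon>) ^ CARD('n)) * emeasure graph_measure X"
proof -
  let ?s = "CARD('n) - 1" and ?P = "flat_piece \<epsilon> j l c" and ?J = "sqrt (1 + (norm l)\<^sup>2)"
  note Pm [measurable] = flat_piece_borel[of \<epsilon> j l c]
  define E where "E = {x. lift x \<in> X}"
  have Xm [measurable]: "X \<in> sets borel" unfolding X_def by measurable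
  have Em [measurable]: "E \<in> sets borel" unfolding E_def by measurable
  have EP: "x \<in> ?P" if "x \<in> E" for x using that by (simp add: E_def X_def lift_in_flat_piece)
  have Eh: "{x. hproj \<nu> x \<in> E} = E" by (simp add: E_def lift_hproj)
  define Y where "Y = X \<inter> {y. y \<bullet> \<nu> = g y}"
  define f where "f = (\<lambda>y. hproj \<nu> y + (l \<bullet> y) *\<^sub>R \<nu>)"
  have lh: "l \<bullet> hproj \<nu> y = l \<bullet> y" for y using l by (simp add: hproj_def inner_diff_right)
  have fY: "f ` Y = {z. z \<bullet> \<nu> = l \<bullet> z \<and> hproj \<nu> z \<in> E}"
  proof (intro equalityI subsetI)
    fix z assume "z \<in> f ` Y"
    then obtain y where y: "z = f y" "y \<in> X" "y \<bullet> \<nu> = g y" by (auto simp: Y_def)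
    have hz: "hproj \<nu> z = hproj \<nu> y" by (simp add: y(1) f_def hproj_add_normal nu hproj_hproj)
    have "z \<bullet> \<nu> = l \<bullet> y" by (simp add: y(1) f_def inner_add_left hproj_inner nu nu_nu)
    also have "l \<bullet> y = l \<bullet> z" using lh[of y] lh[of z] hz by simp
    finally have "z \<bullet> \<nu> = l \<bullet> z" .
    moreover have "lift z = y"
      using lift_hproj[of z] lift_hproj[of y] lift_graph[OF y(3)] hz by simp
    ultimately show "z \<in> {z. z \<bullet> \<nu> = l \<bullet> z \<and> hproj \<nu> z \<in> E}"
      using y(2) by (simp add: E_def lift_hproj)
  next
    fix z assume "z \<in> {z. z \<bullet> \<nu> = l \<bullet> z \<and> hproj \<nu> z \<in> E}"
    then have z: "z \<bullet> \<nu> = l \<bullet> z" "lift z \<in> X" by (auto simp: E_def lift_hproj)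
    have "f (lift z) = hproj \<nu> z + (l \<bullet> z) *\<^sub>R \<nu>"
      using lh[of "lift z"] lh[of z] by (simp add: f_def hproj_lift)
    also have "\<dots> = z" using hproj_decomp[of z \<nu>] z(1) by simp
    finally show "z \<in> f ` Y" using z(2) lift_in_graph[of z] by (intro image_eqI[of _ _ "lift z"]) (auto simp: Y_def)
  qed
  have dist_f: "norm ((f y - f x) - (y - x)) \<le> \<epsilon> * norm (y - x)"
    "norm ((f y - f x) - (y - x)) \<le> \<epsilon> * norm (f y - f x)" if "x \<in> Y" "y \<in> Y" for x y
  proof -
    let ?w = "hproj \<nu> (y - x)"
    have yx: "y - x = ?w + (g y - g x) *\<^sub>R \<nu>"
      using hproj_decomp[of "y - x" \<nu>] that by (simp add: Y_def inner_diff_left)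
    have fyx: "f y - f x = ?w + (l \<bullet> ?w) *\<^sub>R \<nu>"
      by (simp add: f_def hproj_diff inner_diff_right lh scaleR_diff_left)
    have "(f y - f x) - (y - x) = (l \<bullet> ?w - (g y - g x)) *\<^sub>R \<nu>"
      by (subst yx, subst fyx) (simp add: algebra_simps)
    then have "norm ((f y - f x) - (y - x)) = \<bar>(g y - g x) - l \<bullet> ?w\<bar>" using nu by (simp add: abs_minus_commute)
    also have "\<dots> \<le> \<epsilon> * norm ?w"
      using that by (intro flat_piece_diff l) (auto simp: Y_def X_def)
    finally have *: "norm ((f y - f x) - (y - x)) \<le> \<epsilon> * norm ?w" .
    have "norm ?w \<le> norm (y - x)" by (rule norm_hproj_le[OF nu])
    then have "\<epsilon> * norm ?w \<le> \<epsilon> * norm (y - x)" using \<epsilon> by simp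
    with * show "norm ((f y - f x) - (y - x)) \<le> \<epsilon> * norm (y - x)" by (rule order_trans)
    have "hproj \<nu> (f y - f x) = ?w" by (simp add: fyx hproj_add_normal nu hproj_hproj)
    then have "norm ?w \<le> norm (f y - f x)" using norm_hproj_le[OF nu, of "f y - f x"] by simp
    then have "\<epsilon> * norm ?w \<le> \<epsilon> * norm (f y - f x)" using \<epsilon> by simp
    with * show "norm ((f y - f x) - (y - x)) \<le> \<epsilon> * norm (f y - f x)" by (rule order_trans)
  qed
  have "(1 + \<epsilon>)-lipschitz_on Y f"
  proof (rule lipschitz_onI)
    fix x y assume xy: "x \<in> Y" "y \<in> Y"
    have "norm (f x - f y) \<le> norm (x - y) + norm ((f x - f y) - (x - y))"
      using norm_triangle_ineq[of "x - y" "(f x - f y) - (x - y)"] by simp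
    then show "dist (f x) (f y) \<le> (1 + \<epsilon>) * dist x y"
      using dist_f(1)[OF xy(2,1)] by (simp add: dist_norm algebra_simps)
  qed (use \<epsilon> in simp)
  from hausdorff_outer_lipschitz_image[OF this, of ?s]
  have H1: "hausdorff_outer ?s (f ` Y) \<le> ennreal ((1 + \<epsilon>) ^ ?s) * hausdorff_outer ?s Y" using \<epsilon> by simp
  have lower: "norm (x - y) \<le> (1 + \<epsilon>) * norm (f x - f y)" if xy: "x \<in> Y" "y \<in> Y" for x y
    using norm_triangle_ineq4[of "f x - f y" "(f x - f y) - (x - y)"] dist_f(2)[OF xy(2,1)] by (simp add: algebra_simps)
  have inj: "inj_on f Y"
  proof (rule inj_onI)
    fix x y assume xy: "x \<in> Y" "y \<in> Y" "f x = f y"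
    then show "x = y" using lower[OF xy(1,2)] by simp
  qed
  have "(1 + \<epsilon>)-lipschitz_on (f ` Y) (the_inv_into Y f)"
  proof (rule lipschitz_onI)
    fix u v assume "u \<in> f ` Y" "v \<in> f ` Y"
    then obtain x y where "u = f x" "v = f y" "x \<in> Y" "y \<in> Y" by auto
    then show "dist (the_inv_into Y f u) (the_inv_into Y f v) \<le> (1 + \<epsilon>) * dist u v"
      using lower by (simp add: the_inv_into_f_f[OF inj] dist_norm)
  qed (use \<epsilon> in simp)
  from hausdorff_outer_lipschitz_image[OF this, of ?s]
  have H2: "hausdorff_outer ?s Y \<le> ennreal ((1 + \<epsilon>) ^ ?s) * hausdorff_outer ?s (f ` Y)"
    using \<epsilon> the_inv_into_onto[OF inj] by simp
  have Hf: "hausdorff_outer ?s (f ` Y) = flat_const TYPE('n) * (ennreal ?J * emeasure (slab_measure \<nu>) E)"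
    unfolding fY using hausdorff_outer_linear_graph[OF nu l Em] by (simp add: Eh mult.assoc)
  have HY: "emeasure graph_measure X = hausdorff_outer ?s Y" unfolding Y_def by (rule emeasure_graph_measure) simp
  have ME: "emeasure lifted_measure X = (\<integral>\<^sup>+x. ennreal (area x) * indicator E x \<partial>slab_measure \<nu>)"
    by (simp add: emeasure_lifted_measure E_def indicator_def)
  have AE: "AE x in slab_measure \<nu>. (g has_derivative (\<lambda>h. slope x \<bullet> h)) (at x)"
    by (rule AE_slab[OF AE_slope])
  have JE: "(\<integral>\<^sup>+x. ennreal ?J * indicator E x \<partial>slab_measure \<nu>) = ennreal ?J * emeasure (slab_measure \<nu>) E"
    by (rule nn_integral_cmult_indicator) (simp add: sets_slab_measure)
  have M1: "emeasure lifted_measure X \<le> ennreal (1 + \<epsilon>) * (ennreal ?J * emeasure (slab_measure \<nu>) E)"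
  proof -
    have "emeasure lifted_measure X \<le> (\<integral>\<^sup>+x. ennreal (1 + \<epsilon>) * (ennreal ?J * indicator E x) \<partial>slab_measure \<nu>)"
      unfolding ME
    proof (rule nn_integral_mono_AE)
      show "AE x in slab_measure \<nu>. ennreal (area x) * indicator E x \<le> ennreal (1 + \<epsilon>) * (ennreal ?J * indicator E x)"
        using AE
      proof eventually_elim
        case (elim x)
        have "area x \<le> (1 + \<epsilon>) * ?J" if "x \<in> E"
          unfolding area_def by (rule sqrt_one_plus_close[OF flat_piece_gradient[OF EP[OF that] elim l \<epsilon>]])
        then show ?case using \<epsilon>
          by (auto simp: indicator_def ennreal_mult[symmetric] simp del: ennreal_plus intro!: ennreal_leI)
      qed
    qed
    also have "\<dots> = ennreal (1 + \<epsilon>) * (\<integral>\<^sup>+x. ennreal ?J * indicator E x \<partial>slab_measure \<nu>)"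
      by (rule nn_integral_cmult) measurable
    finally show ?thesis unfolding JE .
  qed
  have M2: "ennreal ?J * emeasure (slab_measure \<nu>) E \<le> ennreal (1 + \<epsilon>) * emeasure lifted_measure X"
  proof -
    have "ennreal ?J * emeasure (slab_measure \<nu>) E \<le> (\<integral>\<^sup>+x. ennreal (1 + \<epsilon>) * (ennreal (area x) * indicator E x) \<partial>slab_measure \<nu>)"
      unfolding JE[symmetric]
    proof (rule nn_integral_mono_AE)
      show "AE x in slab_measure \<nu>. ennreal ?J * indicator E x \<le> ennreal (1 + \<epsilon>) * (ennreal (area x) * indicator E x)"
        using AE
      proof eventually_elim
        case (elim x)
        have "?J \<le> (1 + \<epsilon>) * area x" if "x \<in> E"
          unfolding area_def using flat_piece_gradient[OF EP[OF that] elim l \<epsilon>]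
          by (intro sqrt_one_plus_close) (simp add: norm_minus_commute)
        then show ?case using \<epsilon> area_ge_1[of x]
          by (auto simp: indicator_def ennreal_mult[symmetric] simp del: ennreal_plus intro!: ennreal_leI)
      qed
    qed
    also have "\<dots> = ennreal (1 + \<epsilon>) * (\<integral>\<^sup>+x. ennreal (area x) * indicator E x \<partial>slab_measure \<nu>)"
      by (rule nn_integral_cmult) measurable
    finally show ?thesis unfolding ME .
  qed
  have pow: "ennreal ((1 + \<epsilon>) ^ ?s) * (ennreal (1 + \<epsilon>) * y) = ennreal ((1 + \<epsilon>) ^ CARD('n)) * y" for y
  proof -
    have "(1 + \<epsilon>) ^ CARD('n) = (1 + \<epsilon>) ^ ?s * (1 + \<epsilon>)"
      using zero_less_card_finite[where 'a='n] by (metis power_minus_mult)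
    then show ?thesis using \<epsilon> by (simp add: ennreal_mult mult.assoc)
  qed
  have "emeasure graph_measure X \<le> ennreal ((1 + \<epsilon>) ^ ?s) * (flat_const TYPE('n) * (ennreal ?J * emeasure (slab_measure \<nu>) E))"
    using H2 unfolding HY Hf .
  also have "\<dots> \<le> ennreal ((1 + \<epsilon>) ^ ?s) * (flat_const TYPE('n) * (ennreal (1 + \<epsilon>) * emeasure lifted_measure X))"
    by (intro mult_left_mono M2) auto
  also have "\<dots> = ennreal ((1 + \<epsilon>) ^ CARD('n)) * (flat_const TYPE('n) * emeasure lifted_measure X)"
    unfolding pow[symmetric] by (simp add: ac_simps)
  finally show "emeasure graph_measure X \<le> ennreal ((1 + \<epsilon>) ^ CARD('n)) * (flat_const TYPE('n) * emeasure lifted_measure X)" .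
  have "flat_const TYPE('n) * emeasure lifted_measure X \<le> flat_const TYPE('n) * (ennreal (1 + \<epsilon>) * (ennreal ?J * emeasure (slab_measure \<nu>) E))"
    by (intro mult_left_mono M1) auto
  also have "\<dots> = ennreal (1 + \<epsilon>) * hausdorff_outer ?s (f ` Y)" unfolding Hf by (simp add: ac_simps)
  also have "\<dots> \<le> ennreal (1 + \<epsilon>) * (ennreal ((1 + \<epsilon>) ^ ?s) * hausdorff_outer ?s Y)"
    by (intro mult_left_mono H1) auto
  also have "\<dots> = ennreal ((1 + \<epsilon>) ^ CARD('n)) * emeasure graph_measure X"
    unfolding HY pow[symmetric] by (simp add: ac_simps)
  finally show "flat_const TYPE('n) * emeasure lifted_measure X \<le> ennreal ((1 + \<epsilon>) ^ CARD('n)) * emeasure graph_measure X" .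
qed

lemma lift_lipschitz: "(1 + L)-lipschitz_on UNIV lift"
proof (rule lipschitz_onI)
  fix x y
  have "norm (lift x - lift y) = norm (hproj \<nu> (x - y) + (g x - g y) *\<^sub>R \<nu>)"
    by (simp add: lift_def hproj_diff algebra_simps)
  also have "\<dots> \<le> norm (hproj \<nu> (x - y)) + \<bar>g x - g y\<bar>"
    using norm_triangle_ineq[of "hproj \<nu> (x - y)" "(g x - g y) *\<^sub>R \<nu>"] nu by simp
  also have "\<dots> \<le> norm (x - y) + L * norm (x - y)"
    using norm_hproj_le[OF nu, of "x - y"] lipschitz_onD[OF lip, of x y] by (intro add_mono) (auto simp: dist_norm)
  finally show "dist (lift x) (lift y) \<le> (1 + L) * dist x y" by (simp add: dist_norm algebra_simps)
qed (use lipschitz_on_nonneg[OF lip] in simp)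

text \<open>The part of the graph over a null set of the hyperplane is a Lipschitz image of that set.\<close>

lemma null_set_of_graph:
  assumes [measurable]: "Z \<in> sets borel" and Z: "\<And>x. hproj \<nu> x \<in> Z \<longleftrightarrow> x \<in> Z" and null: "emeasure lborel Z = 0"
  shows "emeasure graph_measure Z = 0" and "emeasure lifted_measure Z = 0"
proof -
  let ?s = "CARD('n) - 1"
  have slab0: "emeasure (slab_measure \<nu>) Z = 0"
  proof -
    have "AE x in lborel. x \<notin> Z" using null by (intro AE_not_in) (simp add: null_sets_def)
    from AE_slab[OF this] show ?thesis by (simp add: AE_iff_null_sets[symmetric] sets_slab_measure null_setsD1)
  qed
  have hZ: "{x. hproj \<nu> x \<in> Z} = Z" using Z by auto
  have H0: "hausdorff_outer ?s {z. z \<bullet> \<nu> = 0 \<and> hproj \<nu> z \<in> Z} = 0"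
    using hausdorff_outer_linear_graph[OF nu, of 0 Z] slab0 by (simp add: hZ)
  have "Z \<inter> {y. y \<bullet> \<nu> = g y} \<subseteq> lift ` {z. z \<bullet> \<nu> = 0 \<and> hproj \<nu> z \<in> Z}"
  proof
    fix y assume y: "y \<in> Z \<inter> {y. y \<bullet> \<nu> = g y}"
    then have "y = lift (hproj \<nu> y)" by (simp add: lift_hproj lift_graph)
    then show "y \<in> lift ` {z. z \<bullet> \<nu> = 0 \<and> hproj \<nu> z \<in> Z}"
      using y Z by (intro image_eqI[of _ _ "hproj \<nu> y"]) (auto simp: hproj_inner nu hproj_hproj)
  qed
  then have "emeasure graph_measure Z \<le> hausdorff_outer ?s (lift ` {z. z \<bullet> \<nu> = 0 \<and> hproj \<nu> z \<in> Z})"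
    by (subst emeasure_graph_measure) (auto intro: hausdorff_outer_mono)
  also have "\<dots> \<le> ennreal ((1 + L) ^ ?s) * hausdorff_outer ?s {z. z \<bullet> \<nu> = 0 \<and> hproj \<nu> z \<in> Z}"
    using lipschitz_on_nonneg[OF lip]
    by (intro hausdorff_outer_lipschitz_image lipschitz_on_subset[OF lift_lipschitz]) auto
  finally show "emeasure graph_measure Z = 0" using H0 by simp
  have "lift x \<in> Z \<longleftrightarrow> x \<in> Z" for x using Z[of "lift x"] Z[of x] by (simp add: hproj_lift)
  then have "emeasure lifted_measure Z = (\<integral>\<^sup>+x. ennreal (area x) * indicator Z x \<partial>slab_measure \<nu>)"
    by (simp add: emeasure_lifted_measure indicator_def)
  also have "\<dots> = 0"
  proof (subst nn_integral_0_iff_AE)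
    have "AE x in slab_measure \<nu>. x \<notin> Z" using slab0 by (intro AE_not_in) (simp add: null_sets_def sets_slab_measure)
    then show "AE x in slab_measure \<nu>. ennreal (area x) * indicator Z x = 0" by eventually_elim simp
  qed measurable
  finally show "emeasure lifted_measure Z = 0" .
qed

lemma emeasure_le_by_pieces:
  assumes sets: "sets M = sets (borel :: 'a::topological_space measure)" "sets N = sets (borel :: 'a measure)"
    and A[measurable]: "\<And>i::nat. A i \<in> sets borel"
    and le: "\<And>i B. B \<in> sets borel \<Longrightarrow> emeasure M (B \<inter> A i) \<le> c * emeasure N (B \<inter> A i)"
    and null: "emeasure M (- (\<Union>i. A i)) = 0" and B[measurable]: "B \<in> sets borel"
  shows "emeasure M B \<le> c * emeasure N B"
proof -
  let ?D = "disjointed A"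
  have D[measurable]: "?D i \<in> sets borel" for i
    using sets.range_disjointed_sets[of A borel] A by (auto simp: image_subset_iff)
  have sub: "?D i \<subseteq> A i" for i by (rule disjointed_subset)
  have dis: "disjoint_family (\<lambda>i. B \<inter> ?D i)"
    using disjoint_family_disjointed[of A] by (auto simp: disjoint_family_on_def)
  have U: "(\<Union>i. ?D i) = (\<Union>i. A i)" by (rule UN_disjointed_eq)
  have Un[measurable]: "- (\<Union>i. A i) \<in> sets borel" by (intro borel_comp sets.countable_UN) auto
  have "B \<subseteq> (\<Union>i. B \<inter> ?D i) \<union> - (\<Union>i. A i)" unfolding U[symmetric] by auto
  then have "emeasure M B \<le> emeasure M ((\<Union>i. B \<inter> ?D i) \<union> - (\<Union>i. A i))"
    by (rule emeasure_mono) (simp add: sets)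
  also have "\<dots> \<le> emeasure M (\<Union>i. B \<inter> ?D i) + emeasure M (- (\<Union>i. A i))"
    by (rule emeasure_subadditive) (simp_all add: sets)
  also have "\<dots> = (\<Sum>i. emeasure M (B \<inter> ?D i))"
    unfolding null add_0_right by (rule suminf_emeasure[symmetric]) (auto simp: sets dis)
  also have "\<dots> \<le> (\<Sum>i. c * emeasure N (B \<inter> ?D i))"
  proof (intro suminf_le)
    fix i
    have "(B \<inter> ?D i) \<inter> A i = B \<inter> ?D i" using sub by auto
    then show "emeasure M (B \<inter> ?D i) \<le> c * emeasure N (B \<inter> ?D i)"
      using le[of "B \<inter> ?D i" i] by simp
  qed auto
  also have "\<dots> = c * (\<Sum>i. emeasure N (B \<inter> ?D i))" by (rule ennreal_suminf_cmult)
  also have "(\<Sum>i. emeasure N (B \<inter> ?D i)) = emeasure N (\<Union>i. B \<inter> ?D i)"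
    by (rule suminf_emeasure) (auto simp: sets dis)
  also have "c * emeasure N (\<Union>i. B \<inter> ?D i) \<le> c * emeasure N B"
    by (intro mult_left_mono emeasure_mono) (auto simp: sets)
  finally show ?thesis .
qed

lemma ennreal_le_of_power_factor:
  fixes a b :: ennreal
  assumes "\<And>\<epsilon>. \<epsilon> > 0 \<Longrightarrow> a \<le> ennreal ((1 + \<epsilon>) ^ k) * b"
  shows "a \<le> b"
proof (cases "b = top")
  case False
  have "(\<lambda>n. ennreal ((1 + inverse (real (Suc n))) ^ k) * b) \<longlonglongrightarrow> ennreal ((1 + 0) ^ k) * b"
    using False by (intro tendsto_mult_ennreal tendsto_ennrealI tendsto_power tendsto_add tendsto_const LIMSEQ_inverse_real_of_nat) auto
  then have "(\<lambda>n. ennreal ((1 + inverse (real (Suc n))) ^ k) * b) \<longlonglongrightarrow> b" by simp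
  then show ?thesis
    by (rule LIMSEQ_le_const) (use assms in auto)
qed simp

text \<open>
  By Rademacher's theorem countably many flat pieces cover the graph up to a null set, and \<open>\<epsilon>\<close> is arbitrary.
\<close>

theorem graph_area_formula: "graph_measure = scale_measure (flat_const TYPE('n)) lifted_measure"
proof (rule measure_eqI)
  fix B assume "B \<in> sets graph_measure"
  then have B: "B \<in> sets borel" by simp
  let ?N = "scale_measure (flat_const TYPE('n)) lifted_measure"
  obtain D :: "(real^'n) set" where D: "countable D" "\<And>X. open X \<Longrightarrow> X \<noteq> {} \<Longrightarrow> \<exists>d\<in>D. d \<in> X"
    using countable_dense_setE by blast
  have pieces: "emeasure graph_measure B \<le> ennreal ((1 + \<epsilon>) ^ CARD('n)) * emeasure ?N B \<and>
      emeasure ?N B \<le> ennreal ((1 + \<epsilon>) ^ CARD('n)) * emeasure graph_measure B" if \<epsilon>: "\<epsilon> > 0" for \<epsilon>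
  proof -
    define I where "I = (UNIV :: nat set) \<times> D \<times> D"
    have "D \<noteq> {}" using D(2)[of UNIV] by auto
    then have I: "countable I" "I \<noteq> {}" using D(1) by (auto simp: I_def)
    define A where "A = (\<lambda>i. case from_nat_into I i of (j, d, c) \<Rightarrow> flat_piece \<epsilon> j (hproj \<nu> d) c)"
    have A: "\<exists>j d c. A i = flat_piece \<epsilon> j (hproj \<nu> d) c" for i
      by (auto simp: A_def split: prod.split)
    have Am: "A i \<in> sets borel" for i using A[of i] flat_piece_borel by auto
    have l: "hproj \<nu> d \<bullet> \<nu> = 0" for d by (rule hproj_inner[OF nu])
    let ?Z = "- (\<Union>i. A i)"
    have Zm: "?Z \<in> sets borel" by (intro borel_comp sets.countable_UN) (use Am in auto)
    have Z: "hproj \<nu> x \<in> ?Z \<longleftrightarrow> x \<in> ?Z" for x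
    proof -
      have "hproj \<nu> x \<in> A i \<longleftrightarrow> x \<in> A i" for i using A[of i] hproj_in_flat_piece by auto
      then show ?thesis by simp
    qed
    have AE: "AE x in lborel. x \<notin> ?Z"
      using rademacher[OF lip]
    proof eventually_elim
      case (elim x)
      obtain j d c where jdc: "d \<in> D" "c \<in> D" "x \<in> flat_piece \<epsilon> j (hproj \<nu> d) c"
        using flat_pieces_cover[OF elim \<epsilon> D(2)] by blast
      then have "(j, d, c) \<in> I" by (simp add: I_def)
      then obtain i where "from_nat_into I i = (j, d, c)" using from_nat_into_surj[OF I(1)] by blast
      then have "x \<in> A i" using jdc by (simp add: A_def)
      then show ?case by blast
    qed
    have "(AE x in lborel. x \<notin> ?Z) \<longleftrightarrow> emeasure lborel ?Z = 0"
      by (rule AE_iff_measurable) (use Zm in auto)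
    note Z0 = null_set_of_graph[OF Zm Z iffD1[OF this AE]]
    show ?thesis
    proof
      show "emeasure graph_measure B \<le> ennreal ((1 + \<epsilon>) ^ CARD('n)) * emeasure ?N B"
      proof (rule emeasure_le_by_pieces[of _ _ A])
        fix i C assume "C \<in> sets (borel :: (real^'n) measure)"
        then show "emeasure graph_measure (C \<inter> A i) \<le> ennreal ((1 + \<epsilon>) ^ CARD('n)) * emeasure ?N (C \<inter> A i)"
          using A[of i] measures_on_flat_piece(1)[OF \<epsilon> l] by auto
      qed (use Am Z0 B in simp_all)
      show "emeasure ?N B \<le> ennreal ((1 + \<epsilon>) ^ CARD('n)) * emeasure graph_measure B"
      proof (rule emeasure_le_by_pieces[of _ _ A])
        fix i C assume "C \<in> sets (borel :: (real^'n) measure)"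
        then show "emeasure ?N (C \<inter> A i) \<le> ennreal ((1 + \<epsilon>) ^ CARD('n)) * emeasure graph_measure (C \<inter> A i)"
          using A[of i] measures_on_flat_piece(2)[OF \<epsilon> l] by auto
      qed (use Am Z0 B in simp_all)
    qed
  qed
  show "emeasure graph_measure B = emeasure ?N B"
    by (rule antisym; rule ennreal_le_of_power_factor) (use pieces in auto)
qed simp

end

section \<open>Surface integrals over Lipschitz graphs\<close>

definition surface_borel :: "(real^'n::finite) measure" where
  "surface_borel = distr surface_measure borel (\<lambda>x. x)"

lemma sets_borel_subset_surface: "sets borel \<subseteq> sets (surface_measure :: (real^'n::finite) measure)"
  by (simp add: surface_measure_def sets_borel_subset_hausdorff)

lemma space_surface_measure [simp]: "space surface_measure = UNIV"
  by (simp add: surface_measure_def space_scale_measure)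

lemma id_measurable_surface: "(\<lambda>x. x) \<in> surface_measure \<rightarrow>\<^sub>M (borel :: (real^'n::finite) measure)"
  using sets_borel_subset_surface[where 'n='n] by (auto simp: measurable_def)

lemma borel_measurable_surface:
  "f \<in> borel_measurable borel \<Longrightarrow> f \<in> borel_measurable (surface_measure :: (real^'n::finite) measure)"
  by (rule measurable_compose[OF id_measurable_surface])

lemma sets_surface_borel [simp, measurable_cong]: "sets surface_borel = sets borel"
  by (simp add: surface_borel_def)

lemma emeasure_surface_measure:
  fixes A :: "(real^'n::finite) set"
  assumes "A \<in> sets borel"
  shows "emeasure surface_measure A = (1 / flat_const TYPE('n)) * hausdorff_outer (CARD('n) - 1) A"
  using assms sets_borel_subset_hausdorff[of "CARD('n) - 1", where 'a="real^'n"]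
  by (auto simp: surface_measure_def emeasure_hausdorff_measure flat_const_def)

lemma emeasure_surface_borel:
  fixes A :: "(real^'n::finite) set"
  assumes "A \<in> sets borel"
  shows "emeasure surface_borel A = (1 / flat_const TYPE('n)) * hausdorff_outer (CARD('n) - 1) A"
  unfolding surface_borel_def using assms
  by (subst emeasure_distr[OF id_measurable_surface]) (simp_all add: emeasure_surface_measure)

lemma null_sets_surface:
  fixes N :: "(real^'n::finite) set"
  assumes "hausdorff_outer (CARD('n) - 1) N = 0"
  shows "N \<in> null_sets surface_measure"
  using null_sets_hausdorff_measure[OF assms]
  by (auto simp: surface_measure_def null_sets_def)

text \<open>
  Surface measure is complete.  This spares a proof that the outward normal depends measurably on the point.
\<close>

lemma measurable_surface_AE_eq:
  fixes f h :: "real^'n::finite \<Rightarrow> real"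
  assumes h: "h \<in> borel_measurable borel" and N: "hausdorff_outer (CARD('n) - 1) N = 0"
    and eq: "\<And>x. x \<notin> N \<Longrightarrow> f x = h x"
  shows "f \<in> borel_measurable surface_measure" and "AE x in surface_measure. f x = h x"
proof -
  show "AE x in surface_measure. f x = h x"
    by (rule AE_I'[OF null_sets_surface[OF N]]) (use eq in auto)
  show "f \<in> borel_measurable surface_measure"
  proof (rule borel_measurableI)
    fix S :: "real set" assume S: "open S"
    have small: "X \<in> sets surface_measure" if "X \<subseteq> N" for X :: "(real^'n) set"
    proof -
      have "hausdorff_outer (CARD('n) - 1) X = 0"
        using hausdorff_outer_mono[OF that, of "CARD('n) - 1"] N by simp
      then show ?thesis by (rule null_setsD2[OF null_sets_surface])
    qed
    have "h -` S \<inter> space surface_measure \<in> sets surface_measure"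
      by (rule measurable_sets[OF borel_measurable_surface[OF h] borel_open[OF S]])
    then have hS: "h -` S \<in> sets surface_measure" by simp
    have "x \<in> f -` S \<longleftrightarrow> x \<in> (h -` S - N) \<union> (f -` S \<inter> N)" for x using eq[of x] by (cases "x \<in> N") simp_all
    then have "f -` S = (h -` S - N) \<union> (f -` S \<inter> N)" by (rule set_eqI)
    also have "\<dots> \<in> sets surface_measure" by (intro sets.Un sets.Diff hS small) auto
    finally show "f -` S \<inter> space surface_measure \<in> sets surface_measure" by simp
  qed
qed

text \<open>
  Some translate of a given hyperplane meets a given null set in a set of surface measure zero; for a set that
  is invariant under translations normal to the hyperplane it does not matter which translate.
\<close>

lemma hausdorff_null_slice:
  fixes n :: "real^'n::finite"
  assumes n: "norm n = 1" and Z: "Z \<in> null_sets lborel"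
  shows "\<exists>t. hausdorff_outer (CARD('n) - 1) {z. z \<bullet> n = 0 \<and> z + t *\<^sub>R n \<in> Z} = 0"
proof -
  have Zm [measurable]: "Z \<in> sets borel" using Z by auto
  interpret H: sigma_finite_measure "hyperplane_measure n" by (rule sigma_finite_hyperplane_measure[OF n])
  interpret pair_sigma_finite "hyperplane_measure n" "lborel :: real measure" by unfold_locales
  have "(\<integral>\<^sup>+t. \<integral>\<^sup>+z. indicator Z (z + t *\<^sub>R n) \<partial>hyperplane_measure n \<partial>lborel) =
      (\<integral>\<^sup>+z. \<integral>\<^sup>+t. indicator Z (z + t *\<^sub>R n) \<partial>lborel \<partial>hyperplane_measure n)"
    by (rule Fubini') simp
  also have "\<dots> = flat_const TYPE('n) * (\<integral>\<^sup>+x. indicator Z x \<partial>lborel)"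
    by (rule nn_integral_hyperplane_slices[OF n]) simp
  also have "\<dots> = 0" using Z by (simp add: null_setsD1)
  finally have "(\<integral>\<^sup>+t. \<integral>\<^sup>+z. indicator Z (z + t *\<^sub>R n) \<partial>hyperplane_measure n \<partial>lborel) = 0" .
  then have ae: "AE t in lborel. (\<integral>\<^sup>+z. indicator Z (z + t *\<^sub>R n) \<partial>hyperplane_measure n) = 0"
    by (subst (asm) nn_integral_0_iff_AE) simp_all
  have "ae_filter (lborel :: real measure) \<noteq> bot" by (simp add: ae_filter_eq_bot_iff)
  from eventually_happens'[OF this ae]
  obtain t where t: "(\<integral>\<^sup>+z. indicator Z (z + t *\<^sub>R n) \<partial>hyperplane_measure n) = 0" by blast
  have S: "{z. z + t *\<^sub>R n \<in> Z} \<in> sets borel" by measurable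
  have "(\<integral>\<^sup>+z. indicator Z (z + t *\<^sub>R n) \<partial>hyperplane_measure n) = (\<integral>\<^sup>+z. indicator {z. z + t *\<^sub>R n \<in> Z} z \<partial>hyperplane_measure n)"
    by (rule nn_integral_cong) (simp add: indicator_def)
  also have "\<dots> = emeasure (hyperplane_measure n) {z. z + t *\<^sub>R n \<in> Z}"
    using S by (intro nn_integral_indicator) simp
  also have "\<dots> = hausdorff_outer (CARD('n) - 1) ({z. z + t *\<^sub>R n \<in> Z} \<inter> {z. z \<bullet> n = 0})"
    by (rule emeasure_hyperplane_measure[OF S])
  also have "{z. z + t *\<^sub>R n \<in> Z} \<inter> {z. z \<bullet> n = 0} = {z. z \<bullet> n = 0 \<and> z + t *\<^sub>R n \<in> Z}" by auto
  finally show ?thesis using t by metis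
qed

context lipschitz_graph
begin

definition nondiff :: "(real^'n) set" where
  "nondiff = {y. y \<bullet> \<nu> = g y \<and> \<not> (g has_derivative (\<lambda>h. slope y \<bullet> h)) (at y)}"

lemma has_derivative_shift_normal:
  assumes "(g has_derivative (\<lambda>h. slope (x + t *\<^sub>R \<nu>) \<bullet> h)) (at (x + t *\<^sub>R \<nu>))"
  shows "(g has_derivative (\<lambda>h. slope x \<bullet> h)) (at x)"
proof -
  have "((\<lambda>x. x + t *\<^sub>R \<nu>) has_derivative (\<lambda>h. h)) (at x)" by (auto intro!: derivative_eq_intros)
  from has_derivative_compose[OF this assms]
  have "((\<lambda>x. g (x + t *\<^sub>R \<nu>)) has_derivative (\<lambda>h. slope (x + t *\<^sub>R \<nu>) \<bullet> h)) (at x)" .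
  moreover have "slope (x + t *\<^sub>R \<nu>) = slope x" by (rule slope_cong) (simp add: hproj_add_normal nu)
  ultimately show ?thesis by (simp only: g_add_normal)
qed

text \<open>
  Where \<open>g\<close> is not differentiable, it is not differentiable along the whole line in the direction \<open>\<nu>\<close>; so these
  points of the graph lie in the Lipschitz image of a slice of a null set.
\<close>

lemma hausdorff_nondiff: "hausdorff_outer (CARD('n) - 1) nondiff = 0"
proof -
  let ?s = "CARD('n) - 1"
  have "\<exists>Z. (\<forall>x. x \<notin> Z \<longrightarrow> (g has_derivative (\<lambda>h. slope x \<bullet> h)) (at x)) \<and> Z \<in> null_sets lborel"
    by (rule AE_E3[OF AE_slope]) auto
  then obtain Z where Z: "\<And>x. x \<notin> Z \<Longrightarrow> (g has_derivative (\<lambda>h. slope x \<bullet> h)) (at x)"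
      "Z \<in> null_sets lborel" by blast
  obtain t where t: "hausdorff_outer ?s {z. z \<bullet> \<nu> = 0 \<and> z + t *\<^sub>R \<nu> \<in> Z} = 0"
    using hausdorff_null_slice[OF nu Z(2)] by blast
  have "nondiff \<subseteq> lift ` {z. z \<bullet> \<nu> = 0 \<and> z + t *\<^sub>R \<nu> \<in> Z}"
  proof
    fix y assume y: "y \<in> nondiff"
    let ?z = "hproj \<nu> y"
    have "\<not> (g has_derivative (\<lambda>h. slope (?z + t *\<^sub>R \<nu>) \<bullet> h)) (at (?z + t *\<^sub>R \<nu>))"
    proof
      assume *: "(g has_derivative (\<lambda>h. slope (?z + t *\<^sub>R \<nu>) \<bullet> h)) (at (?z + t *\<^sub>R \<nu>))"
      have "?z + t *\<^sub>R \<nu> = y + (t - y \<bullet> \<nu>) *\<^sub>R \<nu>" by (simp add: hproj_def algebra_simps)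
      with * have "(g has_derivative (\<lambda>h. slope y \<bullet> h)) (at y)"
        using has_derivative_shift_normal[of y "t - y \<bullet> \<nu>"] by (simp only:)
      then show False using y by (simp add: nondiff_def)
    qed
    then have "?z + t *\<^sub>R \<nu> \<in> Z" using Z(1)[of "?z + t *\<^sub>R \<nu>"] by auto
    moreover have "y = lift ?z" using y by (simp add: nondiff_def lift_hproj lift_graph)
    ultimately show "y \<in> lift ` {z. z \<bullet> \<nu> = 0 \<and> z + t *\<^sub>R \<nu> \<in> Z}"
      by (intro image_eqI[of _ _ ?z]) (simp_all add: hproj_inner nu)
  qed
  then have "hausdorff_outer ?s nondiff \<le> hausdorff_outer ?s (lift ` {z. z \<bullet> \<nu> = 0 \<and> z + t *\<^sub>R \<nu> \<in> Z})"
    by (rule hausdorff_outer_mono)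
  also have "\<dots> \<le> ennreal ((1 + L) ^ ?s) * hausdorff_outer ?s {z. z \<bullet> \<nu> = 0 \<and> z + t *\<^sub>R \<nu> \<in> Z}"
    using lipschitz_on_nonneg[OF lip]
    by (intro hausdorff_outer_lipschitz_image lipschitz_on_subset[OF lift_lipschitz]) auto
  finally show ?thesis using t by simp
qed

lemma density_surface_graph:
  "density surface_borel (indicator {y. y \<bullet> \<nu> = g y}) = lifted_measure"
proof (rule measure_eqI)
  fix B assume "B \<in> sets (density surface_borel (indicator {y. y \<bullet> \<nu> = g y}))"
  then have B [measurable]: "B \<in> sets borel" by simp
  let ?\<Gamma> = "{y. y \<bullet> \<nu> = g y}"
  have "emeasure (density surface_borel (indicator ?\<Gamma>)) B = (\<integral>\<^sup>+z. indicator (?\<Gamma> \<inter> B) z \<partial>surface_borel)"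
    by (subst emeasure_density) (simp_all flip: indicator_inter_arith)
  also have "\<dots> = emeasure surface_borel (?\<Gamma> \<inter> B)"
    by (rule nn_integral_indicator) simp
  also have "\<dots> = (1 / flat_const TYPE('n)) * hausdorff_outer (CARD('n) - 1) (?\<Gamma> \<inter> B)"
    by (rule emeasure_surface_borel) simp
  also have "hausdorff_outer (CARD('n) - 1) (?\<Gamma> \<inter> B) = emeasure graph_measure B"
    by (simp add: emeasure_graph_measure Int_commute)
  also have "\<dots> = flat_const TYPE('n) * emeasure lifted_measure B"
    by (simp add: graph_area_formula)
  also have "(1 / flat_const TYPE('n)) * (flat_const TYPE('n) * emeasure lifted_measure B) = emeasure lifted_measure B"
    using flat_const_pos[where 'n='n] flat_const_finite[where 'n='n]
    by (simp add: mult.assoc[symmetric] ennreal_divide_times mult_divide_eq_ennreal[of _ 1, simplified])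
  finally show "emeasure (density surface_borel (indicator ?\<Gamma>)) B = emeasure lifted_measure B" .
qed simp

lemma surface_integral_graph:
  fixes F :: "real^'n \<Rightarrow> real"
  assumes F [measurable]: "F \<in> borel_measurable borel"
  shows "integrable surface_measure (\<lambda>y. indicator {y. y \<bullet> \<nu> = g y} y * F y) \<longleftrightarrow>
      integrable (slab_measure \<nu>) (\<lambda>x. area x * F (lift x))" (is ?A)
    and "(LINT y|surface_measure. indicator {y. y \<bullet> \<nu> = g y} y * F y) =
      (LINT x|slab_measure \<nu>. area x * F (lift x))" (is ?B)
proof -
  let ?\<Gamma> = "{y. y \<bullet> \<nu> = g y}"
  have dens: "density surface_borel (\<lambda>y. ennreal (indicator ?\<Gamma> y)) = lifted_measure"
    using density_surface_graph by (simp add: ennreal_indicator)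
  have area0: "area x \<ge> 0" for x using area_ge_1[of x] by simp
  have lm: "lift \<in> density (slab_measure \<nu>) (\<lambda>x. ennreal (area x)) \<rightarrow>\<^sub>M borel" by measurable
  have Fm: "(\<lambda>y. indicator ?\<Gamma> y * F y) \<in> borel_measurable borel" by measurable
  have "integrable surface_measure (\<lambda>y. indicator ?\<Gamma> y * F y) \<longleftrightarrow> integrable surface_borel (\<lambda>y. indicator ?\<Gamma> y * F y)"
    unfolding surface_borel_def by (rule integrable_distr_eq[OF id_measurable_surface Fm, symmetric])
  also have "\<dots> \<longleftrightarrow> integrable (density surface_borel (\<lambda>y. ennreal (indicator ?\<Gamma> y))) F"
    by (subst integrable_density) auto
  also have "\<dots> \<longleftrightarrow> integrable (density (slab_measure \<nu>) (\<lambda>x. ennreal (area x))) (\<lambda>x. F (lift x))"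
    unfolding dens lifted_measure_def by (rule integrable_distr_eq[OF lm F])
  also have "\<dots> \<longleftrightarrow> integrable (slab_measure \<nu>) (\<lambda>x. area x * F (lift x))"
    by (subst integrable_density) (auto simp: area0)
  finally show ?A .
  have "(LINT y|surface_measure. indicator ?\<Gamma> y * F y) = (LINT y|surface_borel. indicator ?\<Gamma> y * F y)"
    unfolding surface_borel_def by (rule integral_distr[OF id_measurable_surface Fm, symmetric])
  also have "\<dots> = (LINT y|density surface_borel (\<lambda>y. ennreal (indicator ?\<Gamma> y)). F y)"
    by (subst integral_density) auto
  also have "\<dots> = (LINT x|density (slab_measure \<nu>) (\<lambda>x. ennreal (area x)). F (lift x))"
    unfolding dens lifted_measure_def by (rule integral_distr[OF lm F])
  also have "\<dots> = (LINT x|slab_measure \<nu>. area x * F (lift x))"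
    by (subst integral_density) (auto simp: area0)
  finally show ?B .
qed

text \<open>
  Near \<open>y\<close> the function \<open>z \<bullet> \<nu> - g z\<close> is negative exactly in \<open>G\<close>, and to first order it is
  \<open>(z - y) \<bullet> (\<nu> - a)\<close>.
\<close>

lemma outward_normal_graph:
  assumes a: "(g has_derivative (\<lambda>h. a \<bullet> h)) (at y)" and y: "y \<bullet> \<nu> = g y" and \<rho>: "\<rho> > 0"
    and G: "\<And>z. z \<in> ball y \<rho> \<Longrightarrow> z \<in> G \<longleftrightarrow> z \<bullet> \<nu> < g z"
  shows "outward_normal G y = (1 / sqrt (1 + (norm a)\<^sup>2)) *\<^sub>R (\<nu> - a)"
proof -
  let ?J = "sqrt (1 + (norm a)\<^sup>2)" and ?n = "(1 / sqrt (1 + (norm a)\<^sup>2)) *\<^sub>R (\<nu> - a)"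
  have J: "?J \<ge> 1" by simp
  have pos: "0 < 1 + (norm a)\<^sup>2" by (simp add: add_pos_nonneg)
  have "(norm (\<nu> - a))\<^sup>2 = 1 + (norm a)\<^sup>2"
    using nu_nu gradient_tangential[OF a]
    by (simp add: power2_norm_eq_inner inner_diff_left inner_diff_right inner_commute)
  then have "norm (\<nu> - a) = ?J" by (metis norm_ge_zero real_sqrt_abs abs_of_nonneg)
  then have nJ: "norm (\<nu> - a) = ?J" .
  have "norm ((1 / r) *\<^sub>R (\<nu> - a)) = 1" if "r \<ge> 1" "norm (\<nu> - a) = r" for r using that by simp
  from this[OF J nJ] have n1: "norm ?n = 1" .
  have "is_outward_normal G y ?n"
    unfolding is_outward_normal_def
  proof (intro conjI allI impI)
    show "norm ?n = 1" by (rule n1)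
    fix \<epsilon> :: real assume \<epsilon>: "\<epsilon> > 0"
    obtain d where d: "d > 0" "\<And>z. norm (z - y) < d \<Longrightarrow> norm (g z - g y - a \<bullet> (z - y)) \<le> \<epsilon> * norm (z - y)"
      using a \<epsilon> unfolding has_derivative_at_alt by blast
    show "\<exists>r>0. \<forall>z\<in>ball y r. ((z - y) \<bullet> ?n < - \<epsilon> * norm (z - y) \<longrightarrow> z \<in> G) \<and> ((z - y) \<bullet> ?n > \<epsilon> * norm (z - y) \<longrightarrow> z \<notin> G)"
    proof (intro exI[of _ "min d \<rho>"] conjI ballI impI)
      show "min d \<rho> > 0" using d \<rho> by simp
      fix z assume z: "z \<in> ball y (min d \<rho>)"
      have err: "\<bar>g z - g y - a \<bullet> (z - y)\<bar> \<le> \<epsilon> * norm (z - y)"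
        using d(2)[of z] z by (simp add: dist_norm norm_minus_commute)
      have "v \<bullet> w = r * (v \<bullet> ((1 / r) *\<^sub>R w))" if "r \<ge> 1" for v w :: "real^'n" and r :: real using that by simp
      from this[OF J] have zn: "(z - y) \<bullet> (\<nu> - a) = ?J * ((z - y) \<bullet> ?n)" .
      have s: "z \<bullet> \<nu> - g z = (z - y) \<bullet> (\<nu> - a) - (g z - g y - a \<bullet> (z - y))"
        using y by (simp add: inner_diff_left inner_diff_right inner_commute)
      have Gz: "z \<in> G \<longleftrightarrow> z \<bullet> \<nu> < g z" using G z by simp
      have ge: "\<epsilon> * norm (z - y) \<le> ?J * (\<epsilon> * norm (z - y))"
        using mult_right_mono[OF J, of "\<epsilon> * norm (z - y)"] \<epsilon> by simp
      {
        assume "(z - y) \<bullet> ?n < - \<epsilon> * norm (z - y)"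
        then have "?J * ((z - y) \<bullet> ?n) < ?J * (- (\<epsilon> * norm (z - y)))"
          using pos by (intro mult_strict_left_mono) auto
        then have "z \<bullet> \<nu> - g z < 0" unfolding s zn using ge err by (simp add: abs_le_iff)
        then show "z \<in> G" using Gz by simp
      next
        assume "(z - y) \<bullet> ?n > \<epsilon> * norm (z - y)"
        then have "?J * (\<epsilon> * norm (z - y)) < ?J * ((z - y) \<bullet> ?n)"
          using pos by (intro mult_strict_left_mono) auto
        then have "z \<bullet> \<nu> - g z > 0" unfolding s zn using ge err by (simp add: abs_le_iff)
        then show "z \<notin> G" using Gz by simp
      }
    qed
  qed
  from this is_outward_normal_unique[OF _ this] show ?thesis
    unfolding outward_normal_def by (rule the_equality)
qed

end

section \<open>Weak divergences tested with Lipschitz functions\<close>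

lemma grad_eq:
  fixes f :: "real^'n::finite \<Rightarrow> real"
  assumes "(f has_derivative (\<lambda>h. a \<bullet> h)) (at x)"
  shows "grad f x = a"
  using frechet_derivative_at[OF assms, symmetric] by (simp add: grad_def vec_eq_iff inner_axis)

lemma has_derivative_inner_form:
  fixes f :: "'a::euclidean_space \<Rightarrow> real"
  assumes "(f has_derivative f') (at x)"
  shows "(f has_derivative (\<lambda>h. (\<Sum>b\<in>Basis. f' b *\<^sub>R b) \<bullet> h)) (at x)"
proof -
  have "f' = (\<lambda>h. (\<Sum>b\<in>Basis. f' b *\<^sub>R b) \<bullet> h)"
    using linear_eq_inner_sum[OF has_derivative_linear[OF assms]] by (rule ext)
  then show ?thesis using assms by simp
qed

lemma grad_test_function:
  fixes \<phi> :: "real^'n::finite \<Rightarrow> real"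
  assumes "\<phi> \<in> test_functions \<Omega>"
  shows "(\<phi> has_derivative (\<lambda>h. grad \<phi> x \<bullet> h)) (at x)" and "grad \<phi> x = lip_grad \<phi> x"
    and "continuous_on UNIV (grad \<phi>)"
proof -
  obtain \<phi>' where p: "\<And>x. (\<phi> has_derivative \<phi>' x) (at x)" "\<And>h. continuous_on UNIV (\<lambda>x. \<phi>' x h)"
    using test_function_has_derivative[OF assms] by blast
  note q = has_derivative_inner_form[OF p(1)]
  show "(\<phi> has_derivative (\<lambda>h. grad \<phi> x \<bullet> h)) (at x)" using q[of x] grad_eq[OF q, of x] by simp
  show "grad \<phi> x = lip_grad \<phi> x" using lip_grad_eqI[OF q, of x] grad_eq[OF q, of x] by simp
  have "grad \<phi> = (\<lambda>x. \<Sum>b\<in>Basis. \<phi>' x b *\<^sub>R b)" using grad_eq[OF q] by (rule ext)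
  then show "continuous_on UNIV (grad \<phi>)" using p(2) by (simp add: continuous_on_sum continuous_on_scaleR)
qed

lemma lip_grad_zero_outside:
  fixes f :: "'a::euclidean_space \<Rightarrow> real"
  assumes "closed K" "\<And>x. x \<notin> K \<Longrightarrow> f x = 0" "x \<notin> K"
  shows "lip_grad f x = 0"
proof (rule lip_grad_eqI)
  have "(f has_derivative (\<lambda>h. 0)) (at x)"
  proof (rule has_derivative_transform_within_open)
    show "((\<lambda>y :: 'a. 0 :: real) has_derivative (\<lambda>h. 0)) (at x)" by (rule has_derivative_const)
    show "open (- K)" using assms(1) by (rule open_Compl)
  qed (use assms in auto)
  then show "(f has_derivative (\<lambda>h. 0 \<bullet> h)) (at x)" by simp
qed

lemma zero_extension:
  fixes f :: "'a::euclidean_space \<Rightarrow> 'b::euclidean_space"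
  assumes f: "continuous_on K f" and K: "compact K"
  shows "(\<lambda>x. indicator K x *\<^sub>R f x) \<in> borel_measurable borel" and "\<exists>B. \<forall>x. norm (indicator K x *\<^sub>R f x) \<le> B"
proof -
  show "(\<lambda>x. indicator K x *\<^sub>R f x) \<in> borel_measurable borel"
    by (rule borel_measurable_continuous_on_indicator[OF _ f]) (use compact_imp_closed[OF K] in auto)
  have "bounded (f ` K)" by (intro compact_imp_bounded compact_continuous_image f K)
  then obtain B where B: "\<And>x. x \<in> K \<Longrightarrow> norm (f x) \<le> B" by (auto simp: bounded_iff)
  have "norm (indicator K x *\<^sub>R f x) \<le> \<bar>B\<bar>" for x using B[of x] by (cases "x \<in> K") auto
  then show "\<exists>B. \<forall>x. norm (indicator K x *\<^sub>R f x) \<le> B" by blast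
qed

text \<open>
  The setting of the divergence theorem: continuity of the field up to the boundary gives a meaning to the
  surface integral, integrability of its weak divergence \<open>w\<close> to the volume integral.
\<close>

locale weakly_divergent =
  fixes \<Omega> :: "(real^'n::finite) set" and q :: "real^'n \<Rightarrow> real^'n" and w :: "real^'n \<Rightarrow> real"
  assumes open_\<Omega>: "open \<Omega>" and bounded_\<Omega>: "bounded \<Omega>"
    and cont_q: "continuous_on (closure \<Omega>) q" and int_w: "set_integrable lebesgue \<Omega> w"
    and weak: "\<And>\<phi>. \<phi> \<in> test_functions \<Omega> \<Longrightarrow>
      (LINT x:\<Omega>|lebesgue. q x \<bullet> grad \<phi> x) = - (LINT x:\<Omega>|lebesgue. w x * \<phi> x)"
begin

definition q_ext :: "real^'n \<Rightarrow> real^'n" where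
  "q_ext x = indicator (closure \<Omega>) x *\<^sub>R q x"

lemma q_ext_eq: "x \<in> closure \<Omega> \<Longrightarrow> q_ext x = q x"
  by (simp add: q_ext_def)

lemma compact_closure_\<Omega>: "compact (closure \<Omega>)"
  using bounded_closure[OF bounded_\<Omega>] by (simp add: compact_eq_bounded_closed)

lemma measurable_q_ext [measurable]: "q_ext \<in> borel_measurable borel"
  unfolding q_ext_def[abs_def] by (rule zero_extension(1)[OF cont_q compact_closure_\<Omega>])

lemma q_ext_bounded: "\<exists>B\<ge>0. \<forall>x. norm (q_ext x) \<le> B"
  using zero_extension(2)[OF cont_q compact_closure_\<Omega>] norm_ge_zero order_trans unfolding q_ext_def by blast

lemma measurable_\<Omega> [measurable]: "\<Omega> \<in> sets borel" "\<Omega> \<in> sets lebesgue"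
  using open_\<Omega> by auto

lemma emeasure_\<Omega>: "emeasure lebesgue \<Omega> < \<infinity>"
  using emeasure_bounded_finite[OF bounded_\<Omega>] by simp

lemma integrable_\<Omega>_bound:
  fixes f :: "real^'n \<Rightarrow> real"
  assumes "f \<in> borel_measurable borel" "AE y in lborel. \<bar>f y\<bar> \<le> c * indicator \<Omega> y"
  shows "integrable lborel f"
proof (rule Bochner_Integration.integrable_bound[of _ "\<lambda>y. c * indicator \<Omega> y"])
  show "integrable lborel (\<lambda>y. c * indicator \<Omega> y)"
    using emeasure_bounded_finite[OF bounded_\<Omega>] by (intro integrable_mult_right integrable_real_indicator) auto
  show "AE y in lborel. norm (f y) \<le> norm (c * indicator \<Omega> y)"
    using assms(2) by eventually_elim (simp add: order_trans[OF _ abs_ge_self])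
qed (use assms in simp)

text \<open>
  Mollifications of \<open>\<phi>\<close> are test functions; their gradients are bounded by the Lipschitz constant and converge
  almost everywhere by Rademacher's theorem.
\<close>

lemma lipschitz_test:
  assumes \<phi>: "C-lipschitz_on UNIV \<phi>" and K: "compact K" "K \<subseteq> \<Omega>" and supp: "\<And>x. x \<notin> K \<Longrightarrow> \<phi> x = 0"
  shows "(LINT x:\<Omega>|lebesgue. q x \<bullet> lip_grad \<phi> x) = - (LINT x:\<Omega>|lebesgue. w x * \<phi> x)"
proof -
  let ?N = "real CARD('n)"
  have N: "?N > 0" by simp
  have C0: "C \<ge> 0" using \<phi> by (rule lipschitz_on_nonneg)
  have cont: "continuous_on UNIV \<phi>" using \<phi> by (rule lipschitz_on_continuous_on)
  obtain e where e: "e > 0" "(\<Union>x\<in>K. cball x e) \<subseteq> \<Omega>"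
    using compact_subset_open_imp_cball_epsilon_subset[OF K(1) open_\<Omega> K(2)] by blast
  define \<delta> where "\<delta> = (\<lambda>n. e / ?N * inverse (real (Suc n)))"
  have \<delta>: "\<delta> n > 0" "?N * \<delta> n \<le> e" for n
  proof -
    show "\<delta> n > 0" using e N by (simp add: \<delta>_def)
    have "inverse (real (Suc n)) \<le> 1" by (simp add: inverse_eq_divide)
    then show "?N * \<delta> n \<le> e" using e N mult_left_mono[of "inverse (real (Suc n))" 1 e] by (simp add: \<delta>_def)
  qed
  have \<delta>0: "\<delta> \<longlonglongrightarrow> 0"
    unfolding \<delta>_def using tendsto_mult[OF tendsto_const LIMSEQ_inverse_real_of_nat, of "e / ?N"] by simp
  define \<psi> where "\<psi> = (\<lambda>n. mollify (\<delta> n) \<phi>)"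
  let ?K = "\<Union>x\<in>K. cball x e"
  have cK: "compact ?K"
  proof -
    have "?K = {x + y |x y. x \<in> K \<and> y \<in> cball 0 e}"
      by (auto simp: dist_norm norm_minus_commute) (metis add_diff_cancel_left' diff_add_cancel add.commute)
    then show ?thesis using compact_sums[OF K(1) compact_cball[of 0 e]] by simp
  qed
  have \<psi>0: "\<psi> n x = 0" if "x \<notin> ?K" for n x
  proof -
    have "\<bar>\<psi> n x - 0\<bar> \<le> 0"
      unfolding \<psi>_def
    proof (rule mollify_close[OF \<delta>(1) cont])
      fix z assume "dist x z \<le> ?N * \<delta> n"
      then have "dist z x \<le> e" using \<delta>(2)[of n] by (simp add: dist_commute)
      then have "z \<notin> K" using that by auto
      then show "\<bar>\<phi> z - 0\<bar> \<le> 0" using supp by simp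
    qed
    then show ?thesis by simp
  qed
  have test: "\<psi> n \<in> test_functions \<Omega>" for n
  proof -
    have sub: "closure {x. \<psi> n x \<noteq> 0} \<subseteq> ?K"
      by (intro closure_minimal compact_imp_closed cK) (use \<psi>0 in blast)
    then have "compact (closure {x. \<psi> n x \<noteq> 0})"
      using compact_imp_bounded[OF cK] bounded_subset by (auto simp: compact_eq_bounded_closed)
    then show ?thesis
      unfolding test_functions_def mem_Collect_eq
      using sub e(2) Ck_on_mollify[OF \<delta>(1) cont] by (auto simp: \<psi>_def)
  qed
  have \<psi>_lip: "C-lipschitz_on UNIV (\<psi> n)" for n
    unfolding \<psi>_def by (rule mollify_lipschitz[OF \<delta>(1) \<phi>])
  have grad_le: "norm (grad (\<psi> n) x) \<le> C" for n x
    by (rule norm_gradient_le[OF \<psi>_lip grad_test_function(1)[OF test]])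
  have \<psi>_lim: "(\<lambda>n. \<psi> n x) \<longlonglongrightarrow> \<phi> x" for x
  proof (rule LIMSEQ_offset[of _ 0], rule tendsto_sandwich[of "\<lambda>n. \<phi> x - C * (?N * \<delta> n)" _ _ "\<lambda>n. \<phi> x + C * (?N * \<delta> n)"])
    have b: "\<bar>\<psi> n x - \<phi> x\<bar> \<le> C * (?N * \<delta> n)" for n
      unfolding \<psi>_def
    proof (rule mollify_close[OF \<delta>(1) cont])
      fix z assume z: "dist x z \<le> ?N * \<delta> n"
      have "\<bar>\<phi> z - \<phi> x\<bar> \<le> C * dist x z" using lipschitz_onD[OF \<phi>, of z x] by (simp add: dist_real_def dist_commute)
      also have "\<dots> \<le> C * (?N * \<delta> n)" using z C0 by (rule mult_left_mono)
      finally show "\<bar>\<phi> z - \<phi> x\<bar> \<le> C * (?N * \<delta> n)" .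
    qed
    show "\<forall>\<^sub>F n in sequentially. \<phi> x - C * (?N * \<delta> n) \<le> \<psi> (n + 0) x"
      using b by (intro always_eventually allI) (simp add: abs_le_iff algebra_simps)
    show "\<forall>\<^sub>F n in sequentially. \<psi> (n + 0) x \<le> \<phi> x + C * (?N * \<delta> n)"
      using b by (intro always_eventually allI) (simp add: abs_le_iff algebra_simps)
    show "(\<lambda>n. \<phi> x - C * (?N * \<delta> n)) \<longlonglongrightarrow> \<phi> x"
      using tendsto_diff[OF tendsto_const[of "\<phi> x"] tendsto_mult[OF tendsto_const[of C] tendsto_mult[OF tendsto_const[of ?N] \<delta>0]]] by simp
    show "(\<lambda>n. \<phi> x + C * (?N * \<delta> n)) \<longlonglongrightarrow> \<phi> x"
      using tendsto_add[OF tendsto_const[of "\<phi> x"] tendsto_mult[OF tendsto_const[of C] tendsto_mult[OF tendsto_const[of ?N] \<delta>0]]] by simp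
  qed
  have grad_lim: "AE x in lebesgue. (\<lambda>n. grad (\<psi> n) x) \<longlonglongrightarrow> lip_grad \<phi> x"
  proof (rule AE_completion)
    show "AE x in lborel. (\<lambda>n. grad (\<psi> n) x) \<longlonglongrightarrow> lip_grad \<phi> x"
      using rademacher[OF \<phi>]
    proof eventually_elim
      case (elim x)
      have "filterlim \<delta> (at_right 0) sequentially"
        unfolding filterlim_at using \<delta>0 \<delta>(1) by (simp add: always_eventually less_imp_neq[symmetric])
      then have *: "(\<lambda>n. frechet_derivative (\<psi> n) (at x) h) \<longlonglongrightarrow> lip_grad \<phi> x \<bullet> h" for h
        unfolding \<psi>_def by (rule filterlim_compose[OF mollify_derivative_tendsto[OF cont elim]])
      show ?case
      proof (rule vec_tendstoI)
        fix i
        show "(\<lambda>n. grad (\<psi> n) x $ i) \<longlonglongrightarrow> lip_grad \<phi> x $ i"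
          using *[of "axis i 1"] by (simp add: grad_def inner_axis)
      qed
    qed
  qed
  have bm: "f \<in> borel_measurable lebesgue" if "f \<in> borel_measurable borel" for f :: "real^'n \<Rightarrow> real"
    using that by (intro measurable_completion) simp
  have ind_q: "indicator \<Omega> x *\<^sub>R (q x \<bullet> v) = indicator \<Omega> x * (q_ext x \<bullet> v)" for x v
    using closure_subset[of \<Omega>] by (auto simp: indicator_def q_ext_def)
  obtain B where B: "B \<ge> 0" "\<And>x. norm (q_ext x) \<le> B" using q_ext_bounded by blast
  have lim1: "(\<lambda>n. LINT x:\<Omega>|lebesgue. q x \<bullet> grad (\<psi> n) x) \<longlonglongrightarrow> (LINT x:\<Omega>|lebesgue. q x \<bullet> lip_grad \<phi> x)"
    unfolding set_lebesgue_integral_def ind_q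
  proof (rule integral_dominated_convergence[where w="\<lambda>x. B * C * indicator \<Omega> x"])
    have [measurable]: "\<phi> \<in> borel_measurable borel" using \<phi> by (rule borel_measurable_lipschitz)
    show "(\<lambda>x. indicator \<Omega> x * (q_ext x \<bullet> lip_grad \<phi> x)) \<in> borel_measurable lebesgue"
      by (rule bm) measurable
    show "(\<lambda>x. indicator \<Omega> x * (q_ext x \<bullet> grad (\<psi> n) x)) \<in> borel_measurable lebesgue" for n
    proof (rule bm)
      have [measurable]: "grad (\<psi> n) \<in> borel_measurable borel"
        by (rule borel_measurable_continuous_onI[OF grad_test_function(3)[OF test]])
      show "(\<lambda>x. indicator \<Omega> x * (q_ext x \<bullet> grad (\<psi> n) x)) \<in> borel_measurable borel" by measurable
    qed
    show "integrable lebesgue (\<lambda>x. B * C * indicator \<Omega> x :: real)"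
      using emeasure_\<Omega> by (intro integrable_mult_right integrable_real_indicator) auto
    show "AE x in lebesgue. (\<lambda>n. indicator \<Omega> x * (q_ext x \<bullet> grad (\<psi> n) x)) \<longlonglongrightarrow> indicator \<Omega> x * (q_ext x \<bullet> lip_grad \<phi> x)"
      using grad_lim by eventually_elim (intro tendsto_intros)
    show "AE x in lebesgue. norm (indicator \<Omega> x * (q_ext x \<bullet> grad (\<psi> n) x)) \<le> B * C * indicator \<Omega> x" for n
    proof (rule AE_I2)
      fix x
      have "\<bar>q_ext x \<bullet> grad (\<psi> n) x\<bar> \<le> norm (q_ext x) * norm (grad (\<psi> n) x)" by (rule Cauchy_Schwarz_ineq2)
      also have "\<dots> \<le> B * C" by (intro mult_mono B grad_le) auto
      finally show "norm (indicator \<Omega> x * (q_ext x \<bullet> grad (\<psi> n) x)) \<le> B * C * indicator \<Omega> x"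
        by (auto simp: indicator_def)
    qed
  qed
  have "bounded (\<phi> ` K)" by (intro compact_imp_bounded compact_continuous_image continuous_on_subset[OF cont] K) auto
  then obtain M where M: "\<And>x. x \<in> K \<Longrightarrow> \<bar>\<phi> x\<bar> \<le> M" by (auto simp: bounded_iff)
  have M': "\<bar>\<phi> x\<bar> \<le> \<bar>M\<bar>" for x using M[of x] supp[of x] by (cases "x \<in> K") auto
  have wm: "(\<lambda>x. indicator \<Omega> x *\<^sub>R w x) \<in> borel_measurable lebesgue"
    using int_w unfolding set_integrable_def by (rule borel_measurable_integrable)
  have lim2: "(\<lambda>n. LINT x:\<Omega>|lebesgue. w x * \<psi> n x) \<longlonglongrightarrow> (LINT x:\<Omega>|lebesgue. w x * \<phi> x)"
    unfolding set_lebesgue_integral_def scaleR_conv_of_real mult.assoc[symmetric]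
  proof (rule integral_dominated_convergence[where w="\<lambda>x. \<bar>M\<bar> * norm (indicator \<Omega> x *\<^sub>R w x)"])
    show "(\<lambda>x. of_real (indicator \<Omega> x) * w x * \<phi> x) \<in> borel_measurable lebesgue"
      using borel_measurable_times[OF wm bm[OF borel_measurable_lipschitz[OF \<phi>]]] by simp
    show "(\<lambda>x. of_real (indicator \<Omega> x) * w x * \<psi> n x) \<in> borel_measurable lebesgue" for n
      using borel_measurable_times[OF wm bm[OF borel_measurable_lipschitz[OF \<psi>_lip]]] by simp
    show "integrable lebesgue (\<lambda>x. \<bar>M\<bar> * norm (indicator \<Omega> x *\<^sub>R w x))"
      using int_w unfolding set_integrable_def by (intro integrable_mult_right integrable_norm) simp
    show "AE x in lebesgue. (\<lambda>n. of_real (indicator \<Omega> x) * w x * \<psi> n x) \<longlonglongrightarrow> of_real (indicator \<Omega> x) * w x * \<phi> x"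
      by (intro AE_I2 tendsto_intros \<psi>_lim)
    show "AE x in lebesgue. norm (of_real (indicator \<Omega> x) * w x * \<psi> n x) \<le> \<bar>M\<bar> * norm (indicator \<Omega> x *\<^sub>R w x)" for n
    proof (rule AE_I2)
      fix x
      have "\<bar>\<psi> n x - 0\<bar> \<le> \<bar>M\<bar>"
        unfolding \<psi>_def by (rule mollify_close[OF \<delta>(1) cont]) (simp add: M')
      then show "norm (of_real (indicator \<Omega> x) * w x * \<psi> n x) \<le> \<bar>M\<bar> * norm (indicator \<Omega> x *\<^sub>R w x)"
        using mult_left_mono[of "\<bar>\<psi> n x\<bar>" "\<bar>M\<bar>" "\<bar>w x\<bar>"] by (simp add: indicator_def abs_mult mult.commute)
    qed
  qed
  have "(\<lambda>n. - (LINT x:\<Omega>|lebesgue. w x * \<psi> n x)) \<longlonglongrightarrow> (LINT x:\<Omega>|lebesgue. q x \<bullet> lip_grad \<phi> x)"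
    using lim1 unfolding weak[OF test] .
  from LIMSEQ_unique[OF this tendsto_minus[OF lim2]] show ?thesis .
qed

end

section \<open>The divergence theorem near a boundary point\<close>

definition bounded_lipschitz :: "('a::euclidean_space \<Rightarrow> real) \<Rightarrow> bool" where
  "bounded_lipschitz \<eta> \<longleftrightarrow> (\<exists>M. M-lipschitz_on UNIV \<eta> \<and> (\<forall>x. \<bar>\<eta> x\<bar> \<le> M))"

lemma bounded_lipschitzE:
  assumes "bounded_lipschitz \<eta>"
  obtains M where "M-lipschitz_on UNIV \<eta>" "\<And>x. \<bar>\<eta> x\<bar> \<le> M" "M \<ge> 0"
  using assms lipschitz_on_nonneg unfolding bounded_lipschitz_def by blast

lemma bounded_lipschitzI:
  assumes "A-lipschitz_on UNIV \<eta>" "\<And>x. \<bar>\<eta> x\<bar> \<le> B"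
  shows "bounded_lipschitz \<eta>"
  unfolding bounded_lipschitz_def
proof (intro exI[of _ "max A B"] conjI allI)
  show "(max A B)-lipschitz_on UNIV \<eta>" by (rule lipschitz_on_le[OF assms(1)]) simp
  show "\<bar>\<eta> x\<bar> \<le> max A B" for x using assms(2)[of x] by (simp add: le_max_iff_disj)
qed

lemma bounded_lipschitz_const: "bounded_lipschitz (\<lambda>x. c)"
  by (rule bounded_lipschitzI[where A=0 and B="\<bar>c\<bar>"]) (auto intro: lipschitz_onI)

lemma bounded_lipschitz_diff:
  assumes f: "bounded_lipschitz f" and g: "bounded_lipschitz g"
  shows "bounded_lipschitz (\<lambda>x. f x - g x)"
proof -
  obtain M where M: "M-lipschitz_on UNIV f" "\<And>x. \<bar>f x\<bar> \<le> M" using f by (auto elim: bounded_lipschitzE)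
  obtain N where N: "N-lipschitz_on UNIV g" "\<And>x. \<bar>g x\<bar> \<le> N" using g by (auto elim: bounded_lipschitzE)
  show ?thesis
  proof (rule bounded_lipschitzI)
    show "(M + N)-lipschitz_on UNIV (\<lambda>x. f x - g x)" by (rule lipschitz_on_diff[OF M(1) N(1)])
    show "\<bar>f x - g x\<bar> \<le> M + N" for x using M(2)[of x] N(2)[of x] by linarith
  qed
qed

lemma bounded_lipschitz_mult:
  assumes f: "bounded_lipschitz f" and g: "bounded_lipschitz g"
  shows "bounded_lipschitz (\<lambda>x. f x * g x)"
proof -
  obtain M where M: "M-lipschitz_on UNIV f" "\<And>x. \<bar>f x\<bar> \<le> M" "M \<ge> 0" using f by (auto elim: bounded_lipschitzE)
  obtain N where N: "N-lipschitz_on UNIV g" "\<And>x. \<bar>g x\<bar> \<le> N" "N \<ge> 0" using g by (auto elim: bounded_lipschitzE)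
  show ?thesis
  proof (rule bounded_lipschitzI)
    show "(2 * M * N)-lipschitz_on UNIV (\<lambda>x. f x * g x)"
    proof (rule lipschitz_onI)
      fix x y
      have "f x * g x - f y * g y = f x * (g x - g y) + (f x - f y) * g y" by (simp add: algebra_simps)
      also have "\<bar>\<dots>\<bar> \<le> \<bar>f x\<bar> * \<bar>g x - g y\<bar> + \<bar>f x - f y\<bar> * \<bar>g y\<bar>"
        using abs_triangle_ineq by (simp only: abs_mult[symmetric])
      also have "\<dots> \<le> M * (N * dist x y) + (M * dist x y) * N"
        using lipschitz_onD[OF M(1), of x y] lipschitz_onD[OF N(1), of x y] M N
        by (intro add_mono mult_mono) (auto simp: dist_real_def)
      finally show "dist (f x * g x) (f y * g y) \<le> 2 * M * N * dist x y" by (simp add: dist_real_def)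
    qed (use M N in simp)
    show "\<bar>f x * g x\<bar> \<le> M * N" for x unfolding abs_mult using M N by (intro mult_mono) auto
  qed
qed

text \<open>
  The profile of the cut-off functions below.  It vanishes not only at 0 but up to 1, so that a ramp in the
  depth below a graph has its support away from the graph.
\<close>

definition ramp :: "real \<Rightarrow> real" where
  "ramp t = max 0 (min 1 (t - 1))"

lemma ramp_bounds: "0 \<le> ramp t" "ramp t \<le> 1"
  by (auto simp: ramp_def)

lemma ramp_eq: "t \<le> 1 \<Longrightarrow> ramp t = 0" "t \<ge> 2 \<Longrightarrow> ramp t = 1"
  by (auto simp: ramp_def)

lemma bounded_lipschitz_ramp:
  assumes f: "A-lipschitz_on UNIV f"
  shows "bounded_lipschitz (\<lambda>x. ramp (f x))"
proof (rule bounded_lipschitzI)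
  show "A-lipschitz_on UNIV (\<lambda>x. ramp (f x))"
  proof (rule lipschitz_onI)
    fix x y
    have "dist (ramp (f x)) (ramp (f y)) \<le> dist (f x) (f y)" by (auto simp: ramp_def dist_real_def)
    also have "\<dots> \<le> A * dist x y" using lipschitz_onD[OF f, of x y] by simp
    finally show "dist (ramp (f x)) (ramp (f y)) \<le> A * dist x y" .
  qed (rule lipschitz_on_nonneg[OF f])
  show "\<bar>ramp (f x)\<bar> \<le> 1" for x using ramp_bounds[of "f x"] by simp
qed

lemma has_derivative_ramp:
  fixes f :: "'a::euclidean_space \<Rightarrow> real"
  assumes f: "(f has_derivative (\<lambda>h. a \<bullet> h)) (at x)" and ne: "f x \<noteq> 1" "f x \<noteq> 2"
  shows "((\<lambda>y. ramp (f y)) has_derivative (\<lambda>h. (indicator {1<..<2} (f x) *\<^sub>R a) \<bullet> h)) (at x)"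
proof -
  define a' :: real where "a' = indicator {1<..<2} (f x)"
  have "(ramp has_real_derivative a') (at (f x))"
  proof -
    consider "f x < 1" | "1 < f x" "f x < 2" | "2 < f x" using ne by linarith
    then show ?thesis
    proof cases
      case 1
      have "((\<lambda>t. 0) has_real_derivative a') (at (f x))" using 1 by (simp add: a'_def)
      then show ?thesis
        by (rule has_field_derivative_transform_within_open[where S="{..<1}"]) (use 1 in \<open>auto simp: ramp_eq\<close>)
    next
      case 2
      have "((\<lambda>t. t - 1) has_real_derivative a') (at (f x))" using 2 by (auto simp: a'_def intro!: derivative_eq_intros)
      then show ?thesis
        by (rule has_field_derivative_transform_within_open[where S="{1<..<2}"]) (use 2 in \<open>auto simp: ramp_def\<close>)
    next
      case 3
      have "((\<lambda>t. 1) has_real_derivative a') (at (f x))" using 3 by (simp add: a'_def)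
      then show ?thesis
        by (rule has_field_derivative_transform_within_open[where S="{2<..}"]) (use 3 in \<open>auto simp: ramp_eq\<close>)
    qed
  qed
  then have "(ramp has_derivative times a') (at (f x))" by (simp add: has_field_derivative_def)
  from has_derivative_compose[OF f this] show ?thesis by (simp add: a'_def)
qed

context lipschitz_graph
begin

text \<open>Positive below the graph, that is, on the side of the domain.\<close>

definition depth :: "real^'n \<Rightarrow> real" where
  "depth y = g y - y \<bullet> \<nu>"

lemma depth_lipschitz: "(L + 1)-lipschitz_on UNIV depth"
proof (rule lipschitz_onI)
  fix x y
  have "\<bar>(x - y) \<bullet> \<nu>\<bar> \<le> norm (x - y)" using Cauchy_Schwarz_ineq2[of "x - y" \<nu>] nu by simp
  then have "\<bar>depth x - depth y\<bar> \<le> L * dist x y + dist x y"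
    using lipschitz_onD[OF lip, of x y] by (simp add: depth_def dist_norm inner_diff_left)
  then show "dist (depth x) (depth y) \<le> (L + 1) * dist x y" by (simp add: dist_real_def algebra_simps)
qed (use lipschitz_on_nonneg[OF lip] in simp)

lemma depth_below: "depth (lift x - t *\<^sub>R \<nu>) = t"
proof -
  have "g (lift x - t *\<^sub>R \<nu>) = g x" using g_add_normal[of "lift x" "- t"] by (simp add: g_lift)
  then show ?thesis using lift_in_graph[of x] by (simp add: depth_def inner_diff_left nu_nu g_lift)
qed

lemma hproj_below: "hproj \<nu> (lift x - t *\<^sub>R \<nu>) = hproj \<nu> x"
  using hproj_add_normal[OF nu, of "lift x" "- t"] by (simp add: hproj_lift)

lemma slope_lift: "slope (lift x) = slope x" and slope_below: "slope (lift x - t *\<^sub>R \<nu>) = slope x"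
  by (rule slope_cong, simp add: hproj_lift) (rule slope_cong, simp add: hproj_below)

lemma has_derivative_depth:
  assumes "(g has_derivative (\<lambda>h. slope x \<bullet> h)) (at x)"
  shows "(depth has_derivative (\<lambda>h. (slope x - \<nu>) \<bullet> h)) (at x)"
  unfolding depth_def[abs_def] using assms
  by (auto intro!: derivative_eq_intros simp: inner_diff_right inner_commute)

text \<open>
  Coordinates adapted to the graph: the projection along \<open>\<nu>\<close>, represented by points of the slab, and the depth
  below the graph, measured in units of \<open>\<epsilon>\<close>.
\<close>

lemma nn_integral_depth:
  assumes \<epsilon>: "\<epsilon> > 0" and F [measurable]: "F \<in> borel_measurable (borel :: (real^'n) measure)"
  shows "(\<integral>\<^sup>+y. F y \<partial>lborel) = ennreal \<epsilon> * (\<integral>\<^sup>+z. F (lift (fst z) - (\<epsilon> * snd z) *\<^sub>R \<nu>) \<partial>(slab_measure \<nu> \<Otimes>\<^sub>M lborel))"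
proof -
  have "(\<integral>\<^sup>+y. F y \<partial>lborel) = (\<integral>\<^sup>+x. \<integral>\<^sup>+t. F (hproj \<nu> x + t *\<^sub>R \<nu>) \<partial>lborel \<partial>slab_measure \<nu>)"
    by (rule nn_integral_slices[OF nu F])
  also have "\<dots> = (\<integral>\<^sup>+x. ennreal \<epsilon> * (\<integral>\<^sup>+r. F (lift x - (\<epsilon> * r) *\<^sub>R \<nu>) \<partial>lborel) \<partial>slab_measure \<nu>)"
  proof (rule nn_integral_cong)
    fix x
    have "(\<integral>\<^sup>+t. F (hproj \<nu> x + t *\<^sub>R \<nu>) \<partial>lborel) = ennreal \<bar>- \<epsilon>\<bar> * (\<integral>\<^sup>+r. F (hproj \<nu> x + (g x + - \<epsilon> * r) *\<^sub>R \<nu>) \<partial>lborel)"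
      using \<epsilon> by (intro nn_integral_real_affine) auto
    moreover have "hproj \<nu> x + (g x + - \<epsilon> * r) *\<^sub>R \<nu> = lift x - (\<epsilon> * r) *\<^sub>R \<nu>" for r
      by (simp add: lift_def algebra_simps)
    ultimately show "(\<integral>\<^sup>+t. F (hproj \<nu> x + t *\<^sub>R \<nu>) \<partial>lborel) = ennreal \<epsilon> * (\<integral>\<^sup>+r. F (lift x - (\<epsilon> * r) *\<^sub>R \<nu>) \<partial>lborel)"
      using \<epsilon> by simp
  qed
  also have "\<dots> = ennreal \<epsilon> * (\<integral>\<^sup>+x. (\<integral>\<^sup>+r. F (lift x - (\<epsilon> * r) *\<^sub>R \<nu>) \<partial>lborel) \<partial>slab_measure \<nu>)"
    by (rule nn_integral_cmult) measurable
  also have "(\<integral>\<^sup>+x. (\<integral>\<^sup>+r. F (lift x - (\<epsilon> * r) *\<^sub>R \<nu>) \<partial>lborel) \<partial>slab_measure \<nu>) =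
      (\<integral>\<^sup>+z. F (lift (fst z) - (\<epsilon> * snd z) *\<^sub>R \<nu>) \<partial>(slab_measure \<nu> \<Otimes>\<^sub>M lborel))"
    by (subst lborel.nn_integral_fst[symmetric]) simp_all
  finally show ?thesis .
qed

lemma integral_depth:
  fixes F :: "real^'n \<Rightarrow> real"
  assumes \<epsilon>: "\<epsilon> > 0" and F [measurable]: "F \<in> borel_measurable borel"
  shows "(LINT y|lborel. F y) = (LINT z|(slab_measure \<nu> \<Otimes>\<^sub>M lborel). \<epsilon> * F (lift (fst z) - (\<epsilon> * snd z) *\<^sub>R \<nu>))"
proof -
  let ?P = "slab_measure \<nu> \<Otimes>\<^sub>M (lborel :: real measure)"
  let ?D = "density ?P (\<lambda>z. ennreal \<epsilon>)" and ?h = "\<lambda>z. lift (fst z) - (\<epsilon> * snd z) *\<^sub>R \<nu>"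
  have h: "?h \<in> ?D \<rightarrow>\<^sub>M borel" by measurable
  have "lborel = distr ?D borel ?h"
  proof (rule measure_eqI)
    fix A :: "(real^'n) set" assume "A \<in> sets lborel"
    then have [measurable]: "A \<in> sets borel" by simp
    have "emeasure lborel A = ennreal \<epsilon> * (\<integral>\<^sup>+z. indicator A (?h z) \<partial>?P)"
      using nn_integral_depth[OF \<epsilon>, of "indicator A"] by simp
    also have "\<dots> = (\<integral>\<^sup>+z. indicator A (?h z) \<partial>?D)"
      by (subst nn_integral_density) (auto simp: nn_integral_cmult)
    also have "\<dots> = (\<integral>\<^sup>+y. indicator A y \<partial>distr ?D borel ?h)"
      by (rule nn_integral_distr[OF h, symmetric]) simp
    finally show "emeasure lborel A = emeasure (distr ?D borel ?h) A" by simp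
  qed simp
  then have "(LINT y|lborel. F y) = (LINT y|distr ?D borel ?h. F y)" by simp
  also have "\<dots> = (LINT z|?D. F (?h z))" by (rule integral_distr[OF h F])
  also have "\<dots> = (LINT z|?P. \<epsilon> * F (?h z))"
    using \<epsilon> by (subst integral_density) auto
  finally show ?thesis .
qed

text \<open>
  Every line in the direction \<open>\<nu>\<close> meets a level set of the depth in a single point.
\<close>

lemma AE_depth_ne: "AE y in lborel. depth y \<noteq> c"
proof -
  have m: "{y. depth y = c} \<in> sets borel" unfolding depth_def by measurable
  have "(\<integral>\<^sup>+y. indicator {y. depth y = c} y \<partial>lborel) =
      (\<integral>\<^sup>+x. \<integral>\<^sup>+t. indicator {y. depth y = c} (hproj \<nu> x + t *\<^sub>R \<nu>) \<partial>lborel \<partial>slab_measure \<nu>)"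
    by (rule nn_integral_slices[OF nu]) (use m in simp)
  also have "\<dots> = (\<integral>\<^sup>+x. 0 \<partial>slab_measure \<nu>)"
  proof (rule nn_integral_cong)
    fix x
    have "depth (hproj \<nu> x + t *\<^sub>R \<nu>) = g x - t" for t
      by (simp add: depth_def g_add_normal inv inner_add_left hproj_inner nu nu_nu)
    then have "(\<integral>\<^sup>+t. indicator {y. depth y = c} (hproj \<nu> x + t *\<^sub>R \<nu>) \<partial>lborel) = (\<integral>\<^sup>+t. indicator {g x - c} t \<partial>lborel)"
      by (intro nn_integral_cong) (auto simp: indicator_def)
    also have "\<dots> = 0" by simp
    finally show "(\<integral>\<^sup>+t. indicator {y. depth y = c} (hproj \<nu> x + t *\<^sub>R \<nu>) \<partial>lborel) = 0" .
  qed
  finally have "emeasure lborel {y. depth y = c} = 0" using m by simp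
  then show ?thesis by (intro AE_I[of _ _ "{y. depth y = c}"]) (use m in auto)
qed

text \<open>The measure lives on the slab, and the cylinder meets the slab in a bounded set.\<close>

lemma slab_cylinder_finite: "emeasure (slab_measure \<nu>) {x. norm (hproj \<nu> x) \<le> r} < \<infinity>"
proof -
  let ?S = "{x. norm (hproj \<nu> x) \<le> r}"
  have S [measurable]: "?S \<in> sets borel" by measurable
  have "?S \<inter> {x. 0 < x \<bullet> \<nu> \<and> x \<bullet> \<nu> < 1} \<subseteq> cball 0 (\<bar>r\<bar> + 1)"
  proof
    fix x assume x: "x \<in> ?S \<inter> {x. 0 < x \<bullet> \<nu> \<and> x \<bullet> \<nu> < 1}"
    have "norm x = norm (hproj \<nu> x + (x \<bullet> \<nu>) *\<^sub>R \<nu>)" using hproj_decomp[of x \<nu>] by simp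
    also have "\<dots> \<le> norm (hproj \<nu> x) + \<bar>x \<bullet> \<nu>\<bar>" using norm_triangle_ineq[of "hproj \<nu> x" "(x \<bullet> \<nu>) *\<^sub>R \<nu>"] nu by simp
    also have "\<dots> \<le> \<bar>r\<bar> + 1" using x by (intro add_mono) auto
    finally show "x \<in> cball 0 (\<bar>r\<bar> + 1)" by simp
  qed
  then have b: "bounded (?S \<inter> {x. 0 < x \<bullet> \<nu> \<and> x \<bullet> \<nu> < 1})" by (rule bounded_subset[OF bounded_cball])
  have "emeasure (slab_measure \<nu>) ?S = (\<integral>\<^sup>+x. indicator ?S x \<partial>slab_measure \<nu>)" by (simp add: sets_slab_measure)
  also have "\<dots> = (\<integral>\<^sup>+x. indicator {x. 0 < x \<bullet> \<nu> \<and> x \<bullet> \<nu> < 1} x * indicator ?S x \<partial>lborel)"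
    by (subst nn_integral_slab_measure) (auto simp: indicator_def intro!: nn_integral_cong)
  also have "\<dots> = (\<integral>\<^sup>+x. indicator (?S \<inter> {x. 0 < x \<bullet> \<nu> \<and> x \<bullet> \<nu> < 1}) x \<partial>lborel)"
    by (intro nn_integral_cong) (auto simp: indicator_def)
  also have "\<dots> = emeasure lborel (?S \<inter> {x. 0 < x \<bullet> \<nu> \<and> x \<bullet> \<nu> < 1})" by (intro nn_integral_indicator) measurable
  also have "\<dots> < \<infinity>" by (rule emeasure_bounded_finite[OF b])
  finally show ?thesis .
qed

end


text \<open>
  Near a boundary point the weak identity is applied to a test function times a ramp in the depth below the
  graph.  The part of its gradient coming from the ramp lives in the layer of depth between \<open>\<epsilon>\<close> and
  \<open>2 * \<epsilon>\<close>; as \<open>\<epsilon>\<close> tends to 0 it produces the surface integral.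
\<close>

locale boundary_chart = weakly_divergent \<Omega> q w + lipschitz_graph \<nu> L g
  for \<Omega> :: "(real^'n::finite) set" and q w and \<nu> :: "real^'n" and L g +
  fixes G C :: "(real^'n) set" and p :: "real^'n" and \<rho> :: real
  assumes open_G: "open G" and G_sub: "G \<subseteq> \<Omega>" and open_C: "open C"
    and G_chart: "\<And>y. y \<in> C \<Longrightarrow> y \<in> G \<longleftrightarrow> y \<bullet> \<nu> < g y" and ball_C: "cball p \<rho> \<subseteq> C"
begin

lemma frontier_chart:
  assumes "y \<in> C"
  shows "y \<in> frontier G \<longleftrightarrow> y \<bullet> \<nu> = g y"
proof
  assume y: "y \<in> frontier G"
  then have "\<not> y \<bullet> \<nu> < g y" using G_chart[OF assms] open_G by (simp add: frontier_def interior_open)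
  moreover have "\<not> g y < y \<bullet> \<nu>"
  proof
    assume less: "g y < y \<bullet> \<nu>"
    have "open {z. g z < z \<bullet> \<nu>}" by (intro open_Collect_less continuous_g continuous_intros)
    then have "open (C \<inter> {z. g z < z \<bullet> \<nu>})" using open_C by (intro open_Int)
    moreover have "C \<inter> {z. g z < z \<bullet> \<nu>} \<inter> G = {}" using G_chart by force
    ultimately have "C \<inter> {z. g z < z \<bullet> \<nu>} \<inter> closure G = {}" using open_Int_closure_eq_empty by blast
    then show False using y assms less by (auto simp: frontier_def)
  qed
  ultimately show "y \<bullet> \<nu> = g y" by linarith
next
  assume y: "y \<bullet> \<nu> = g y"
  then have "y \<notin> G" using G_chart[OF assms] by simp
  moreover have "y \<in> closure G"
    unfolding closure_approachable
  proof (intro allI impI)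
    fix e :: real assume e: "e > 0"
    obtain d where d: "d > 0" "ball y d \<subseteq> C" using open_C assms openE by blast
    let ?t = "min e d / 2" and ?z = "y - (min e d / 2) *\<^sub>R \<nu>"
    have t: "0 < ?t" "?t < e" "?t < d" using e d(1) by auto
    have "dist ?z y = ?t" using t nu by (simp add: dist_norm)
    then have "?z \<in> C" using t d(2) by (auto simp: dist_commute)
    moreover have "?z \<bullet> \<nu> < g ?z"
      using y t g_add_normal[of y "- ?t"] by (simp add: inner_diff_left nu_nu)
    ultimately have "?z \<in> G" using G_chart by blast
    then show "\<exists>z\<in>G. dist z y < e" using \<open>dist ?z y = ?t\<close> t(2) by (intro bexI[of _ ?z]) auto
  qed
  ultimately show "y \<in> frontier G" using open_G by (simp add: frontier_def interior_open)
qed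

lemma frontier_in_closure: "y \<in> frontier G \<Longrightarrow> y \<in> closure \<Omega>"
  using closure_mono[OF G_sub] by (auto simp: frontier_def)

text \<open>
  No factor \<open>area x\<close> occurs because \<open>\<nu> - slope x\<close> is the unit normal multiplied by it.
\<close>

definition flux_through_graph :: "(real^'n \<Rightarrow> real) \<Rightarrow> real^'n \<Rightarrow> real" where
  "flux_through_graph \<eta> x = \<eta> (lift x) * (q_ext (lift x) \<bullet> (\<nu> - slope x))"

context
  fixes \<eta> :: "real^'n \<Rightarrow> real" and M :: real
  assumes \<eta>_lip: "M-lipschitz_on UNIV \<eta>" and \<eta>_le: "\<And>x. \<bar>\<eta> x\<bar> \<le> M"
    and \<eta>_supp: "\<And>x. x \<notin> cball p \<rho> \<Longrightarrow> \<eta> x = 0"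
begin

lemma measurable_\<eta> [measurable]: "\<eta> \<in> borel_measurable borel"
  using \<eta>_lip by (rule borel_measurable_lipschitz)

lemma M_nonneg: "M \<ge> 0" using \<eta>_lip by (rule lipschitz_on_nonneg)

lemma surface_flux_graph:
  shows "integrable (slab_measure \<nu>) (flux_through_graph \<eta>) \<Longrightarrow>
      set_integrable surface_measure (frontier G) (\<lambda>y. \<eta> y * (q y \<bullet> outward_normal G y))"
    and "(LINT y:frontier G|surface_measure. \<eta> y * (q y \<bullet> outward_normal G y)) =
      (LINT x|slab_measure \<nu>. flux_through_graph \<eta> x)"
proof -
  let ?\<Gamma> = "{y. y \<bullet> \<nu> = g y}"
  define F where "F y = \<eta> y * (q_ext y \<bullet> ((1 / area y) *\<^sub>R (\<nu> - slope y)))" for y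
  have Fm [measurable]: "F \<in> borel_measurable borel" unfolding F_def[abs_def] by measurable
  have area_lift: "area (lift x) = area x" for x by (simp add: area_def slope_lift)
  have area_F: "area x * F (lift x) = flux_through_graph \<eta> x" for x
    using area_ge_1[of x] by (simp add: F_def area_lift slope_lift flux_through_graph_def)
  have eq: "indicator (frontier G) y *\<^sub>R (\<eta> y * (q y \<bullet> outward_normal G y)) = indicator ?\<Gamma> y * F y"
    if y: "y \<notin> nondiff" for y
  proof (cases "y \<in> cball p \<rho> \<and> y \<in> frontier G")
    case True
    then have yC: "y \<in> C" using ball_C by blast
    then have \<Gamma>: "y \<bullet> \<nu> = g y" using True frontier_chart by blast
    then have d: "(g has_derivative (\<lambda>h. slope y \<bullet> h)) (at y)" using y by (simp add: nondiff_def)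
    obtain e where e: "e > 0" "ball y e \<subseteq> C" using open_C yC openE by blast
    have "outward_normal G y = (1 / area y) *\<^sub>R (\<nu> - slope y)"
      unfolding area_def by (rule outward_normal_graph[OF d \<Gamma> e(1)]) (use e(2) G_chart in blast)
    then show ?thesis
      using True \<Gamma> q_ext_eq[OF frontier_in_closure[of y]] by (simp add: F_def)
  next
    case False
    show ?thesis
    proof (cases "y \<in> cball p \<rho>")
      case True
      then have "y \<in> C" using ball_C by blast
      then have "y \<notin> ?\<Gamma>" using False True frontier_chart by blast
      then show ?thesis using False True by simp
    next
      case False
      then show ?thesis by (simp add: F_def \<eta>_supp)
    qed
  qed
  have hm: "(\<lambda>y. indicator ?\<Gamma> y * F y) \<in> borel_measurable borel" by measurable
  let ?f = "\<lambda>y. indicator (frontier G) y *\<^sub>R (\<eta> y * (q y \<bullet> outward_normal G y))"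
  have fm: "?f \<in> borel_measurable surface_measure" and ae: "AE y in surface_measure. ?f y = indicator ?\<Gamma> y * F y"
    by (rule measurable_surface_AE_eq[OF hm hausdorff_nondiff eq], assumption)+
  have hs: "(\<lambda>y. indicator ?\<Gamma> y * F y) \<in> borel_measurable surface_measure"
    by (rule borel_measurable_surface[OF hm])
  have "(LINT y|surface_measure. ?f y) = (LINT y|surface_measure. indicator ?\<Gamma> y * F y)"
    by (rule integral_cong_AE[OF fm hs ae])
  also have "\<dots> = (LINT x|slab_measure \<nu>. flux_through_graph \<eta> x)"
    using surface_integral_graph(2)[OF Fm] by (simp add: area_F)
  finally show "(LINT y:frontier G|surface_measure. \<eta> y * (q y \<bullet> outward_normal G y)) = (LINT x|slab_measure \<nu>. flux_through_graph \<eta> x)"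
    unfolding set_lebesgue_integral_def .
  have "integrable surface_measure ?f \<longleftrightarrow> integrable surface_measure (\<lambda>y. indicator ?\<Gamma> y * F y)"
    by (rule integrable_cong_AE[OF fm hs ae])
  also have "\<dots> \<longleftrightarrow> integrable (slab_measure \<nu>) (flux_through_graph \<eta>)"
    using surface_integral_graph(1)[OF Fm] by (simp add: area_F)
  finally show "set_integrable surface_measure (frontier G) (\<lambda>y. \<eta> y * (q y \<bullet> outward_normal G y))"
    if "integrable (slab_measure \<nu>) (flux_through_graph \<eta>)"
    unfolding set_integrable_def using that by blast
qed

text \<open>
  Almost every point is a point of differentiability of \<open>\<eta>\<close> and \<open>g\<close> whose depth avoids the two corners of the
  ramp.
\<close>

lemma gradient_cutoff:
  assumes \<epsilon>: "\<epsilon> > 0"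
  shows "AE y in lborel. lip_grad (\<lambda>y. \<eta> y * ramp (depth y / \<epsilon>)) y =
    ramp (depth y / \<epsilon>) *\<^sub>R lip_grad \<eta> y + (\<eta> y / \<epsilon> * indicator {1<..<2} (depth y / \<epsilon>)) *\<^sub>R (slope y - \<nu>)"
  using rademacher[OF \<eta>_lip] AE_slope AE_depth_ne[of \<epsilon>] AE_depth_ne[of "2 * \<epsilon>"]
proof eventually_elim
  case (elim y)
  have "((\<lambda>y. depth y / \<epsilon>) has_derivative (\<lambda>h. ((slope y - \<nu>) \<bullet> h) / \<epsilon>)) (at y)"
    using has_derivative_mult_right[OF has_derivative_depth[OF elim(2)], of "1 / \<epsilon>"] by simp
  moreover have "(\<lambda>h. ((slope y - \<nu>) \<bullet> h) / \<epsilon>) = (\<lambda>h. ((1 / \<epsilon>) *\<^sub>R (slope y - \<nu>)) \<bullet> h)"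
    by (simp add: fun_eq_iff)
  ultimately have d: "((\<lambda>y. depth y / \<epsilon>) has_derivative (\<lambda>h. ((1 / \<epsilon>) *\<^sub>R (slope y - \<nu>)) \<bullet> h)) (at y)" by (simp only:)
  have "depth y / \<epsilon> \<noteq> 1" "depth y / \<epsilon> \<noteq> 2" using elim(3,4) \<epsilon> by (auto simp: field_simps)
  from has_derivative_mult[OF elim(1) has_derivative_ramp[OF d this]]
  have "((\<lambda>y. \<eta> y * ramp (depth y / \<epsilon>)) has_derivative
     (\<lambda>h. \<eta> y * ((indicator {1<..<2} (depth y / \<epsilon>) *\<^sub>R (1 / \<epsilon>) *\<^sub>R (slope y - \<nu>)) \<bullet> h) + lip_grad \<eta> y \<bullet> h * ramp (depth y / \<epsilon>))) (at y)" .
  moreover have "(\<lambda>h. \<eta> y * ((indicator {1<..<2} (depth y / \<epsilon>) *\<^sub>R (1 / \<epsilon>) *\<^sub>R (slope y - \<nu>)) \<bullet> h) + lip_grad \<eta> y \<bullet> h * ramp (depth y / \<epsilon>)) =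
    (\<lambda>h. (ramp (depth y / \<epsilon>) *\<^sub>R lip_grad \<eta> y + (\<eta> y / \<epsilon> * indicator {1<..<2} (depth y / \<epsilon>)) *\<^sub>R (slope y - \<nu>)) \<bullet> h)"
    by (simp add: fun_eq_iff inner_add_left)
  ultimately show ?case by (intro lip_grad_eqI) (simp only:)
qed

lemma cutoff_identity:
  assumes \<epsilon>: "\<epsilon> > 0"
  shows "(LINT y|lborel. indicator \<Omega> y * (q_ext y \<bullet> lip_grad (\<lambda>y. \<eta> y * ramp (depth y / \<epsilon>)) y)) =
     - (LINT y:\<Omega>|lebesgue. w y * (\<eta> y * ramp (depth y / \<epsilon>)))"
proof -
  let ?\<phi> = "\<lambda>y. \<eta> y * ramp (depth y / \<epsilon>)"
  have "((1 / \<epsilon>) * (L + 1))-lipschitz_on UNIV (\<lambda>y. (1 / \<epsilon>) * depth y)"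
    using lipschitz_on_cmult_real[OF depth_lipschitz, of "1 / \<epsilon>"] \<epsilon> by simp
  then have "bounded_lipschitz (\<lambda>y. ramp (depth y / \<epsilon>))" using bounded_lipschitz_ramp by fastforce
  then have "bounded_lipschitz ?\<phi>"
    by (rule bounded_lipschitz_mult[OF bounded_lipschitzI[OF \<eta>_lip \<eta>_le]])
  then obtain A where A: "A-lipschitz_on UNIV ?\<phi>" unfolding bounded_lipschitz_def by blast
  define K where "K = cball p \<rho> \<inter> {y. \<epsilon> \<le> depth y}"
  have "closed {y. \<epsilon> \<le> depth y}"
    by (intro closed_Collect_le continuous_intros lipschitz_on_continuous_on[OF depth_lipschitz])
  then have cK: "compact K" unfolding K_def by (rule compact_Int_closed[OF compact_cball])
  have sub: "K \<subseteq> \<Omega>"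
  proof
    fix y assume y: "y \<in> K"
    then have "y \<in> C" "y \<bullet> \<nu> < g y" using ball_C \<epsilon> by (auto simp: K_def depth_def)
    then show "y \<in> \<Omega>" using G_chart G_sub by blast
  qed
  have supp: "?\<phi> y = 0" if "y \<notin> K" for y
  proof (cases "y \<in> cball p \<rho>")
    case True
    then have "depth y / \<epsilon> \<le> 1" using that \<epsilon> by (simp add: K_def)
    then show ?thesis by (simp add: ramp_eq)
  qed (simp add: \<eta>_supp)
  have "(LINT y|lborel. indicator \<Omega> y * (q_ext y \<bullet> lip_grad ?\<phi> y)) = (LINT y|lebesgue. indicator \<Omega> y * (q_ext y \<bullet> lip_grad ?\<phi> y))"
  proof (rule integral_completion[symmetric])
    have [measurable]: "?\<phi> \<in> borel_measurable borel" by (rule borel_measurable_lipschitz[OF A])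
    show "(\<lambda>y. indicator \<Omega> y * (q_ext y \<bullet> lip_grad ?\<phi> y)) \<in> borel_measurable lborel" by measurable
  qed
  also have "\<dots> = (LINT y:\<Omega>|lebesgue. q y \<bullet> lip_grad ?\<phi> y)"
    unfolding set_lebesgue_integral_def
  proof (rule Bochner_Integration.integral_cong)
    fix y show "indicator \<Omega> y * (q_ext y \<bullet> lip_grad ?\<phi> y) = indicator \<Omega> y *\<^sub>R (q y \<bullet> lip_grad ?\<phi> y)"
      using closure_subset[of \<Omega>] by (auto simp: indicator_def q_ext_def)
  qed simp
  also have "\<dots> = - (LINT y:\<Omega>|lebesgue. w y * ?\<phi> y)" by (rule lipschitz_test[OF A cK sub supp])
  finally show ?thesis .
qed

lemma lip_grad_\<eta>: "norm (lip_grad \<eta> y) \<le> M" if "(\<eta> has_derivative (\<lambda>h. lip_grad \<eta> y \<bullet> h)) (at y)"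
  by (rule norm_gradient_le[OF \<eta>_lip that])

lemma ramp_depth_tendsto:
  assumes e: "\<And>n. e n > 0" "e \<longlonglongrightarrow> (0 :: real)" and y: "y \<in> cball p \<rho>"
  shows "(\<lambda>n. indicator \<Omega> y * ramp (depth y / e n)) \<longlonglongrightarrow> indicator G y"
proof (cases "depth y > 0")
  case True
  then have G: "y \<in> G" using G_chart ball_C y by (auto simp: depth_def)
  have "\<forall>\<^sub>F n in sequentially. e n < depth y / 2" using e(2) True by (intro order_tendstoD) auto
  then have "\<forall>\<^sub>F n in sequentially. indicator \<Omega> y * ramp (depth y / e n) = indicator G y"
  proof eventually_elim
    case (elim n)
    then have "depth y / e n \<ge> 2" using e(1)[of n] by (simp add: field_simps)
    then show ?case using G G_sub by (auto simp: ramp_eq)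
  qed
  then show ?thesis by (rule tendsto_eventually)
next
  case False
  then have "y \<notin> G" using G_chart ball_C y by (auto simp: depth_def)
  moreover have "ramp (depth y / e n) = 0" for n
    using False e(1)[of n] by (intro ramp_eq(1)) (simp add: field_simps)
  ultimately show ?thesis by simp
qed

lemma flux_bound:
  fixes B :: real
  assumes B: "B \<ge> 0" "\<And>y. norm (q_ext y) \<le> B"
  shows "\<bar>\<eta> y * (q_ext y \<bullet> (slope x - \<nu>))\<bar> \<le> M * (B * (L + 1)) * indicator {x. norm (hproj \<nu> x) \<le> norm p + \<rho>} y"
proof (cases "y \<in> cball p \<rho>")
  case True
  have "norm (hproj \<nu> y) \<le> norm y" by (rule norm_hproj_le[OF nu])
  also have "norm y \<le> norm p + \<rho>" using True norm_triangle_ineq2[of y p] by (simp add: dist_norm norm_minus_commute)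
  finally have y: "norm (hproj \<nu> y) \<le> norm p + \<rho>" .
  have "norm (slope x - \<nu>) \<le> L + 1" using norm_triangle_ineq4[of "slope x" \<nu>] norm_slope_le[of x] nu by linarith
  then have "\<bar>q_ext y \<bullet> (slope x - \<nu>)\<bar> \<le> B * (L + 1)"
    using mult_mono[OF B(2)[of y] _ B(1), of "norm (slope x - \<nu>)" "L + 1"]
    by (intro order_trans[OF Cauchy_Schwarz_ineq2]) simp
  then show ?thesis using y \<eta>_le[of y] M_nonneg by (simp add: abs_mult mult_mono)
next
  case False
  have "0 \<le> M * (B * (L + 1))" using M_nonneg B(1) lipschitz_on_nonneg[OF lip] by simp
  then show ?thesis using False by (simp add: \<eta>_supp)
qed

lemma measurable_flux_through_graph [measurable]: "flux_through_graph \<eta> \<in> borel_measurable borel"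
  unfolding flux_through_graph_def[abs_def] by measurable

lemma integrable_flux_through_graph: "integrable (slab_measure \<nu>) (flux_through_graph \<eta>)"
proof -
  obtain B where B: "B \<ge> 0" "\<And>y. norm (q_ext y) \<le> B" using q_ext_bounded by blast
  let ?S = "{x. norm (hproj \<nu> x) \<le> norm p + \<rho>}"
  have S: "?S \<in> sets (slab_measure \<nu>)" unfolding sets_slab_measure by measurable
  show ?thesis
  proof (rule Bochner_Integration.integrable_bound)
    show "integrable (slab_measure \<nu>) (\<lambda>x. M * (B * (L + 1)) * indicator ?S x :: real)"
      using S slab_cylinder_finite by (intro integrable_mult_right integrable_real_indicator)
    show "flux_through_graph \<eta> \<in> borel_measurable (slab_measure \<nu>)" by measurable
    show "AE x in slab_measure \<nu>. norm (flux_through_graph \<eta> x) \<le> norm (M * (B * (L + 1)) * indicator ?S x :: real)"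
    proof (rule AE_I2)
      fix x
      have "flux_through_graph \<eta> x = - (\<eta> (lift x) * (q_ext (lift x) \<bullet> (slope x - \<nu>)))"
        by (simp add: flux_through_graph_def inner_diff_right right_diff_distrib)
      then have "\<bar>flux_through_graph \<eta> x\<bar> \<le> M * (B * (L + 1)) * indicator ?S (lift x)"
        using flux_bound[OF B, of "lift x" x] by simp
      also have "indicator ?S (lift x) = (indicator ?S x :: real)" by (simp add: indicator_def hproj_lift)
      finally show "norm (flux_through_graph \<eta> x) \<le> norm (M * (B * (L + 1)) * indicator ?S x :: real)" by simp
    qed
  qed
qed

text \<open>
  In the coordinates adapted to the graph the layer has a fixed thickness and the factor \<open>1 / e n\<close> is absorbed;
  the integrand converges because \<open>q\<close> is continuous up to the boundary.
\<close>

lemma layer_tendsto: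
  assumes e: "\<And>n. e n > 0" "e \<longlonglongrightarrow> (0 :: real)"
  shows "(\<lambda>n. LINT y|lborel. \<eta> y / e n * indicator {1<..<2} (depth y / e n) * (q_ext y \<bullet> (slope y - \<nu>)))
    \<longlonglongrightarrow> - (LINT x|slab_measure \<nu>. flux_through_graph \<eta> x)"
proof -
  obtain B where B: "B \<ge> 0" "\<And>y. norm (q_ext y) \<le> B" using q_ext_bounded by blast
  let ?P = "slab_measure \<nu> \<Otimes>\<^sub>M (lborel :: real measure)"
  let ?S = "{x. norm (hproj \<nu> x) \<le> norm p + \<rho>}"
  interpret S: sigma_finite_measure "slab_measure \<nu>" by (rule sigma_finite_slab_measure)
  interpret SP: pair_sigma_finite "slab_measure \<nu>" "lborel :: real measure" by unfold_locales
  have S: "?S \<in> sets (slab_measure \<nu>)" unfolding sets_slab_measure by measurable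
  define b where "b z = M * (B * (L + 1)) * indicator (?S \<times> {1<..<2}) z" for z :: "(real^'n) \<times> real"
  define H where "H s z = indicator {1<..<2} (snd z) * (\<eta> (lift (fst z) - (s * snd z) *\<^sub>R \<nu>) *
     (q_ext (lift (fst z) - (s * snd z) *\<^sub>R \<nu>) \<bullet> (slope (fst z) - \<nu>)))" for s and z :: "(real^'n) \<times> real"
  have Hm: "H s \<in> borel_measurable ?P" for s unfolding H_def[abs_def] by measurable
  have Hb: "\<bar>H s z\<bar> \<le> b z" for s z
  proof -
    let ?y = "lift (fst z) - (s * snd z) *\<^sub>R \<nu>"
    have "indicator ?S ?y = (indicator ?S (fst z) :: real)" by (simp add: indicator_def hproj_below)
    then have *: "\<bar>\<eta> ?y * (q_ext ?y \<bullet> (slope (fst z) - \<nu>))\<bar> \<le> M * (B * (L + 1)) * indicator ?S (fst z)"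
      using flux_bound[OF B, of ?y "fst z"] by simp
    show ?thesis
    proof (cases "snd z \<in> {1<..<2}")
      case True
      then have "indicator (?S \<times> {1<..<2}) z = (indicator ?S (fst z) :: real)" by (cases z) (simp add: indicator_def)
      then show ?thesis using True * by (simp add: H_def b_def)
    next
      case False
      then show ?thesis by (cases z) (simp add: H_def b_def)
    qed
  qed
  have b: "integrable ?P b"
  proof -
    have "emeasure ?P (?S \<times> {1<..<2}) = emeasure (slab_measure \<nu>) ?S * emeasure lborel {1<..<2::real}"
      by (rule lborel.emeasure_pair_measure_Times[OF S]) simp
    also have "\<dots> < \<infinity>" using slab_cylinder_finite by simp
    finally have "emeasure ?P (?S \<times> {1<..<2}) < \<infinity>" .
    then show ?thesis unfolding b_def
      using S by (intro integrable_mult_right integrable_real_indicator) auto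
  qed
  have lim: "(\<lambda>n. H (e n) z) \<longlonglongrightarrow> H 0 z" for z
  proof (cases "snd z \<in> {1<..<2}")
    case False
    then show ?thesis by (simp add: H_def)
  next
    case True
    let ?y = "\<lambda>n. lift (fst z) - (e n * snd z) *\<^sub>R \<nu>"
    have yl: "?y \<longlonglongrightarrow> lift (fst z) - (0 * snd z) *\<^sub>R \<nu>"
      by (intro tendsto_intros e(2))
    then have yl': "?y \<longlonglongrightarrow> lift (fst z)" by simp
    have \<eta>l: "(\<lambda>n. \<eta> (?y n)) \<longlonglongrightarrow> \<eta> (lift (fst z))"
      by (rule continuous_on_tendsto_compose[OF lipschitz_on_continuous_on[OF \<eta>_lip] yl']) auto
    show ?thesis
    proof (cases "lift (fst z) \<in> cball p \<rho>")
      case in_ball: True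
      then have C: "lift (fst z) \<in> C" using ball_C by blast
      have cl: "lift (fst z) \<in> closure \<Omega>"
        by (rule frontier_in_closure) (use frontier_chart[OF C] lift_in_graph in blast)
      have "\<forall>\<^sub>F n in sequentially. ?y n \<in> C" by (rule topological_tendstoD[OF yl' open_C C])
      then have ev: "\<forall>\<^sub>F n in sequentially. ?y n \<in> closure \<Omega>"
      proof eventually_elim
        case (elim n)
        have "0 < e n * snd z" using e(1)[of n] True by simp
        then have "0 < depth (?y n)" by (simp add: depth_below)
        then have "?y n \<in> G" using G_chart[OF elim] by (simp add: depth_def)
        then show ?case using G_sub closure_subset by blast
      qed
      have "(\<lambda>n. q (?y n)) \<longlonglongrightarrow> q (lift (fst z))"
        by (rule continuous_on_tendsto_compose[OF cont_q yl' cl ev])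
      moreover have "\<forall>\<^sub>F n in sequentially. q (?y n) = q_ext (?y n)"
        using ev by eventually_elim (simp add: q_ext_eq)
      ultimately have "(\<lambda>n. q_ext (?y n)) \<longlonglongrightarrow> q (lift (fst z))" by (rule Lim_transform_eventually)
      then have "(\<lambda>n. q_ext (?y n)) \<longlonglongrightarrow> q_ext (lift (fst z))" using cl by (simp add: q_ext_eq)
      then have "(\<lambda>n. indicator {1<..<2} (snd z) * (\<eta> (?y n) * (q_ext (?y n) \<bullet> (slope (fst z) - \<nu>)))) \<longlonglongrightarrow>
          indicator {1<..<2} (snd z) * (\<eta> (lift (fst z)) * (q_ext (lift (fst z)) \<bullet> (slope (fst z) - \<nu>)))"
        by (intro tendsto_intros \<eta>l)
      then show ?thesis by (simp add: H_def)
    next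
      case False
      have "(\<lambda>n. H (e n) z) \<longlonglongrightarrow> 0"
      proof (rule Lim_null_comparison)
        have "\<bar>H (e n) z\<bar> \<le> \<bar>\<eta> (?y n)\<bar> * (B * norm (slope (fst z) - \<nu>))" for n
        proof -
          have "\<bar>q_ext (?y n) \<bullet> (slope (fst z) - \<nu>)\<bar> \<le> B * norm (slope (fst z) - \<nu>)"
            using Cauchy_Schwarz_ineq2[of "q_ext (?y n)" "slope (fst z) - \<nu>"] mult_right_mono[OF B(2)[of "?y n"], of "norm (slope (fst z) - \<nu>)"]
            by simp
          from mult_left_mono[OF this, of "\<bar>\<eta> (?y n)\<bar>"] show ?thesis using True by (simp add: H_def abs_mult)
        qed
        then show "\<forall>\<^sub>F n in sequentially. norm (H (e n) z) \<le> \<bar>\<eta> (?y n)\<bar> * (B * norm (slope (fst z) - \<nu>))" by simp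
        have "(\<lambda>n. \<bar>\<eta> (?y n)\<bar> * (B * norm (slope (fst z) - \<nu>))) \<longlonglongrightarrow> \<bar>\<eta> (lift (fst z))\<bar> * (B * norm (slope (fst z) - \<nu>))"
          by (intro tendsto_intros \<eta>l)
        then show "(\<lambda>n. \<bar>\<eta> (?y n)\<bar> * (B * norm (slope (fst z) - \<nu>))) \<longlonglongrightarrow> 0" using False by (simp add: \<eta>_supp)
      qed
      then show ?thesis using False by (simp add: H_def \<eta>_supp)
    qed
  qed
  have "(\<lambda>n. LINT z|?P. H (e n) z) \<longlonglongrightarrow> (LINT z|?P. H 0 z)"
    by (rule integral_dominated_convergence[OF Hm Hm b]) (use lim Hb in auto)
  moreover have "(LINT z|?P. H (e n) z) = (LINT y|lborel. \<eta> y / e n * indicator {1<..<2} (depth y / e n) * (q_ext y \<bullet> (slope y - \<nu>)))" for n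
  proof -
    have en: "e n \<noteq> 0" "e n > 0" using e(1)[of n] by auto
    have "(LINT y|lborel. \<eta> y / e n * indicator {1<..<2} (depth y / e n) * (q_ext y \<bullet> (slope y - \<nu>))) =
      (LINT z|?P. e n * (\<eta> (lift (fst z) - (e n * snd z) *\<^sub>R \<nu>) / e n *
         indicator {1<..<2} (depth (lift (fst z) - (e n * snd z) *\<^sub>R \<nu>) / e n) *
         (q_ext (lift (fst z) - (e n * snd z) *\<^sub>R \<nu>) \<bullet> (slope (lift (fst z) - (e n * snd z) *\<^sub>R \<nu>) - \<nu>))))"
    proof (rule integral_depth[OF en(2)])
      have [measurable]: "depth \<in> borel_measurable borel" by (rule borel_measurable_lipschitz[OF depth_lipschitz])
      show "(\<lambda>y. \<eta> y / e n * indicator {1<..<2} (depth y / e n) * (q_ext y \<bullet> (slope y - \<nu>))) \<in> borel_measurable borel"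
        by measurable
    qed
    also have "\<dots> = (LINT z|?P. H (e n) z)"
      by (rule Bochner_Integration.integral_cong) (simp_all add: H_def depth_below slope_below en(1) mult_ac)
    finally show ?thesis ..
  qed
  moreover have "(LINT z|?P. H 0 z) = - (LINT x|slab_measure \<nu>. flux_through_graph \<eta> x)"
  proof -
    have "integrable ?P (H 0)"
      by (rule Bochner_Integration.integrable_bound[OF b Hm], rule AE_I2, simp, rule order_trans[OF Hb abs_ge_self])
    from SP.integral_fst'[OF this] have "(LINT z|?P. H 0 z) = (LINT x|slab_measure \<nu>. LINT r|lborel. H 0 (x, r))" by simp
    also have "\<dots> = (LINT x|slab_measure \<nu>. - flux_through_graph \<eta> x)"
    proof (rule Bochner_Integration.integral_cong)
      fix x
      have "H 0 (x, r) = - flux_through_graph \<eta> x * indicator {1<..<2} r" for r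
        by (simp add: H_def flux_through_graph_def inner_diff_right algebra_simps)
      then show "(LINT r|lborel. H 0 (x, r)) = - flux_through_graph \<eta> x" by simp
    qed simp
    also have "\<dots> = - (LINT x|slab_measure \<nu>. flux_through_graph \<eta> x)" by (rule Bochner_Integration.integral_minus)
    finally show ?thesis .
  qed
  ultimately show ?thesis by simp
qed

lemma tangential_part:
  fixes B :: real
  assumes B: "B \<ge> 0" "\<And>y. norm (q_ext y) \<le> B" and c: "0 \<le> c" "c \<le> 1"
    and d: "(\<eta> has_derivative (\<lambda>h. lip_grad \<eta> y \<bullet> h)) (at y)"
  shows "\<bar>indicator \<Omega> y * c * (q_ext y \<bullet> lip_grad \<eta> y)\<bar> \<le> B * M * indicator \<Omega> y"
proof -
  have "\<bar>q_ext y \<bullet> lip_grad \<eta> y\<bar> \<le> B * M"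
    by (rule order_trans[OF Cauchy_Schwarz_ineq2]) (intro mult_mono B lip_grad_\<eta>[OF d]; simp)
  then have "c * \<bar>q_ext y \<bullet> lip_grad \<eta> y\<bar> \<le> 1 * (B * M)" using c by (intro mult_mono) auto
  then show ?thesis using c by (simp add: abs_mult indicator_def)
qed

text \<open>
  The limit of the weak identity for \<open>\<eta>\<close> times the ramp: the ramp itself tends to the indicator function of \<open>G\<close>,
  and its gradient contributes the flux through the graph.
\<close>

lemma local_divergence:
  "(LINT y|lborel. indicator G y * (q_ext y \<bullet> lip_grad \<eta> y)) + (LINT y:G|lebesgue. w y * \<eta> y) =
    (LINT x|slab_measure \<nu>. flux_through_graph \<eta> x)"
proof -
  obtain B where B: "B \<ge> 0" "\<And>y. norm (q_ext y) \<le> B" using q_ext_bounded by blast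
  define e where "e n = inverse (real (Suc n))" for n
  have e: "e n > 0" "e \<longlonglongrightarrow> 0" for n
    unfolding e_def[abs_def] using LIMSEQ_inverse_real_of_nat by auto
  have [measurable]: "G \<in> sets borel" using open_G by simp
  have [measurable]: "depth \<in> borel_measurable borel" by (rule borel_measurable_lipschitz[OF depth_lipschitz])
  have [measurable]: "ramp \<in> borel_measurable borel" unfolding ramp_def[abs_def] by measurable
  define A where "A n y = indicator \<Omega> y * ramp (depth y / e n) * (q_ext y \<bullet> lip_grad \<eta> y)" for n y
  define N where "N n y = \<eta> y / e n * indicator {1<..<2} (depth y / e n) * (q_ext y \<bullet> (slope y - \<nu>))" for n y
  have Am: "A n \<in> borel_measurable borel" for n unfolding A_def[abs_def] by measurable
  have Nm: "N n \<in> borel_measurable borel" for n unfolding N_def[abs_def] by measurable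
  have A_le: "AE y in lborel. \<bar>A n y\<bar> \<le> B * M * indicator \<Omega> y" for n
    using rademacher[OF \<eta>_lip] unfolding A_def by eventually_elim (rule tangential_part[OF B ramp_bounds])
  have N_\<Omega>: "N n y = indicator \<Omega> y * N n y" for n y
  proof (cases "y \<in> cball p \<rho> \<and> 1 < depth y / e n")
    case True
    then have "depth y > 0" using e(1)[of n] by (simp add: field_simps)
    moreover have "y \<in> C" using True ball_C by blast
    ultimately have "y \<in> \<Omega>" using G_chart[of y] G_sub by (auto simp: depth_def)
    then show ?thesis by simp
  next
    case False
    then show ?thesis by (auto simp: N_def \<eta>_supp)
  qed
  have iA: "integrable lborel (A n)" for n by (rule integrable_\<Omega>_bound[OF Am A_le])
  have iN: "integrable lborel (N n)" for n
  proof (rule integrable_\<Omega>_bound[OF Nm, of _ "M * (B * (L + 1)) / e n"], rule AE_I2)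
    fix y
    have nn: "0 \<le> M * (B * (L + 1))" using M_nonneg B(1) lipschitz_on_nonneg[OF lip] by simp
    have "\<bar>\<eta> y * (q_ext y \<bullet> (slope y - \<nu>))\<bar> \<le> M * (B * (L + 1)) * 1"
      by (rule order_trans[OF flux_bound[OF B]]) (use nn in \<open>intro mult_left_mono, auto simp: indicator_def\<close>)
    then have "\<bar>\<eta> y * (q_ext y \<bullet> (slope y - \<nu>))\<bar> / e n \<le> M * (B * (L + 1)) / e n"
      using e(1)[of n] by (simp add: divide_right_mono)
    moreover have "\<bar>N n y\<bar> \<le> \<bar>\<eta> y * (q_ext y \<bullet> (slope y - \<nu>))\<bar> / e n"
      using e(1)[of n] by (simp add: N_def abs_mult indicator_def)
    ultimately have "\<bar>N n y\<bar> \<le> M * (B * (L + 1)) / e n" by linarith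
    then show "\<bar>N n y\<bar> \<le> M * (B * (L + 1)) / e n * indicator \<Omega> y"
      using N_\<Omega>[of n y] by (auto simp: indicator_def split: if_splits)
  qed
  have split: "(LINT y|lborel. A n y) + (LINT y|lborel. N n y) = - (LINT y:\<Omega>|lebesgue. w y * (\<eta> y * ramp (depth y / e n)))" for n
  proof -
    have "(LINT y|lborel. A n y) + (LINT y|lborel. N n y) = (LINT y|lborel. A n y + N n y)"
      by (rule Bochner_Integration.integral_add[OF iA iN, symmetric])
    also have "\<dots> = (LINT y|lborel. indicator \<Omega> y * (q_ext y \<bullet> lip_grad (\<lambda>y. \<eta> y * ramp (depth y / e n)) y))"
    proof (rule integral_cong_AE)
      show "(\<lambda>y. A n y + N n y) \<in> borel_measurable lborel" using Am Nm by simp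
      show "(\<lambda>y. indicator \<Omega> y * (q_ext y \<bullet> lip_grad (\<lambda>y. \<eta> y * ramp (depth y / e n)) y)) \<in> borel_measurable lborel" by measurable
      show "AE y in lborel. A n y + N n y = indicator \<Omega> y * (q_ext y \<bullet> lip_grad (\<lambda>y. \<eta> y * ramp (depth y / e n)) y)"
        using gradient_cutoff[OF e(1)[of n]]
      proof eventually_elim
        case (elim y)
        show ?case unfolding elim
          by (subst N_\<Omega>) (simp add: A_def N_def inner_add_right algebra_simps diff_divide_distrib)
      qed
    qed
    also have "\<dots> = - (LINT y:\<Omega>|lebesgue. w y * (\<eta> y * ramp (depth y / e n)))" by (rule cutoff_identity[OF e(1)])
    finally show ?thesis .
  qed
  have grad0: "lip_grad \<eta> y = 0" if "y \<notin> cball p \<rho>" for y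
    by (rule lip_grad_zero_outside[OF closed_cball \<eta>_supp that])
  have limA: "(\<lambda>n. LINT y|lborel. A n y) \<longlonglongrightarrow> (LINT y|lborel. indicator G y * (q_ext y \<bullet> lip_grad \<eta> y))"
  proof (rule integral_dominated_convergence[where w="\<lambda>y. B * M * indicator \<Omega> y"])
    show "integrable lborel (\<lambda>y. B * M * indicator \<Omega> y)"
      using emeasure_bounded_finite[OF bounded_\<Omega>] by (intro integrable_mult_right integrable_real_indicator) auto
    show "AE y in lborel. (\<lambda>n. A n y) \<longlonglongrightarrow> indicator G y * (q_ext y \<bullet> lip_grad \<eta> y)"
    proof (rule AE_I2)
      fix y
      show "(\<lambda>n. A n y) \<longlonglongrightarrow> indicator G y * (q_ext y \<bullet> lip_grad \<eta> y)"
      proof (cases "y \<in> cball p \<rho>")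
        case True
        show ?thesis unfolding A_def by (intro tendsto_intros ramp_depth_tendsto e True)
      qed (simp add: A_def grad0)
    qed
  qed (use Am A_le in simp_all)
  have wm: "integrable lebesgue (\<lambda>y. indicator \<Omega> y * w y)" using int_w by (simp add: set_integrable_def)
  have bm: "f \<in> borel_measurable lebesgue" if "f \<in> borel_measurable borel" for f :: "real^'n \<Rightarrow> real"
    using that by (intro measurable_completion) simp
  have wG: "indicator G y * w y = indicator G y * (indicator \<Omega> y * w y)" for y using G_sub by (auto simp: indicator_def)
  have limW: "(\<lambda>n. LINT y:\<Omega>|lebesgue. w y * (\<eta> y * ramp (depth y / e n))) \<longlonglongrightarrow> (LINT y:G|lebesgue. w y * \<eta> y)"
    unfolding set_lebesgue_integral_def
  proof (rule integral_dominated_convergence[where w="\<lambda>y. M * \<bar>indicator \<Omega> y * w y\<bar>"])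
    show "integrable lebesgue (\<lambda>y. M * \<bar>indicator \<Omega> y * w y\<bar>)" using wm by (intro integrable_mult_right integrable_abs)
    have "(\<lambda>y. indicator \<Omega> y *\<^sub>R (w y * (\<eta> y * ramp (depth y / e n)))) = (\<lambda>y. (indicator \<Omega> y * w y) * (\<eta> y * ramp (depth y / e n)))" for n
      by (simp add: mult.assoc)
    moreover have "(\<lambda>y. (indicator \<Omega> y * w y) * (\<eta> y * ramp (depth y / e n))) \<in> borel_measurable lebesgue" for n
      by (intro borel_measurable_times borel_measurable_integrable[OF wm] bm) measurable
    ultimately show "(\<lambda>y. indicator \<Omega> y *\<^sub>R (w y * (\<eta> y * ramp (depth y / e n)))) \<in> borel_measurable lebesgue" for n by simp
    have "(\<lambda>y. indicator G y *\<^sub>R (w y * \<eta> y)) = (\<lambda>y. (indicator \<Omega> y * w y) * (indicator G y * \<eta> y))"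
      using wG by (auto simp: fun_eq_iff indicator_def)
    moreover have "(\<lambda>y. (indicator \<Omega> y * w y) * (indicator G y * \<eta> y)) \<in> borel_measurable lebesgue"
      by (intro borel_measurable_times[of _ lebesgue] borel_measurable_integrable[OF wm] bm) measurable
    ultimately show "(\<lambda>y. indicator G y *\<^sub>R (w y * \<eta> y)) \<in> borel_measurable lebesgue" by simp
    show "AE y in lebesgue. (\<lambda>n. indicator \<Omega> y *\<^sub>R (w y * (\<eta> y * ramp (depth y / e n)))) \<longlonglongrightarrow> indicator G y *\<^sub>R (w y * \<eta> y)"
    proof (rule AE_I2)
      fix y
      show "(\<lambda>n. indicator \<Omega> y *\<^sub>R (w y * (\<eta> y * ramp (depth y / e n)))) \<longlonglongrightarrow> indicator G y *\<^sub>R (w y * \<eta> y)"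
      proof (cases "y \<in> cball p \<rho>")
        case True
        have "(\<lambda>n. w y * \<eta> y * (indicator \<Omega> y * ramp (depth y / e n))) \<longlonglongrightarrow> w y * \<eta> y * indicator G y"
          by (intro tendsto_intros ramp_depth_tendsto e True)
        then show ?thesis by (simp add: mult_ac)
      qed (simp add: \<eta>_supp)
    qed
    show "AE y in lebesgue. norm (indicator \<Omega> y *\<^sub>R (w y * (\<eta> y * ramp (depth y / e n)))) \<le> M * \<bar>indicator \<Omega> y * w y\<bar>" for n
    proof (rule AE_I2)
      fix y
      have "\<bar>\<eta> y\<bar> * ramp (depth y / e n) \<le> M * 1" using ramp_bounds \<eta>_le[of y] M_nonneg by (intro mult_mono) auto
      from mult_left_mono[OF this, of "\<bar>indicator \<Omega> y * w y\<bar>"]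
      show "norm (indicator \<Omega> y *\<^sub>R (w y * (\<eta> y * ramp (depth y / e n)))) \<le> M * \<bar>indicator \<Omega> y * w y\<bar>"
        using ramp_bounds[of "depth y / e n"] by (simp add: abs_mult mult_ac)
    qed
  qed
  have "(\<lambda>n. (LINT y|lborel. A n y) + (LINT y|lborel. N n y)) \<longlonglongrightarrow>
      (LINT y|lborel. indicator G y * (q_ext y \<bullet> lip_grad \<eta> y)) + - (LINT x|slab_measure \<nu>. flux_through_graph \<eta> x)"
    unfolding N_def by (intro tendsto_add limA layer_tendsto e)
  then have "(\<lambda>n. - (LINT y:\<Omega>|lebesgue. w y * (\<eta> y * ramp (depth y / e n)))) \<longlonglongrightarrow>
      (LINT y|lborel. indicator G y * (q_ext y \<bullet> lip_grad \<eta> y)) + - (LINT x|slab_measure \<nu>. flux_through_graph \<eta> x)"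
    by (simp only: split)
  from LIMSEQ_unique[OF this tendsto_minus[OF limW]] show ?thesis by simp
qed

end

end

section \<open>The divergence theorem on a Lipschitz subdomain\<close>

context weakly_divergent
begin

text \<open>
  The divergence theorem on \<open>G\<close> for the field \<open>\<eta> q\<close>, whose weak divergence is \<open>w \<eta> + q \<bullet> \<nabla>\<eta>\<close>.
\<close>

definition green :: "(real^'n) set \<Rightarrow> (real^'n \<Rightarrow> real) \<Rightarrow> bool" where
  "green G \<eta> \<longleftrightarrow>
     set_integrable surface_measure (frontier G) (\<lambda>y. \<eta> y * (q y \<bullet> outward_normal G y)) \<and>
     (LINT y|lborel. indicator G y * (q_ext y \<bullet> lip_grad \<eta> y)) + (LINT y:G|lebesgue. w y * \<eta> y) =
     (LINT y:frontier G|surface_measure. \<eta> y * (q y \<bullet> outward_normal G y))"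

lemma integrable_q_grad:
  assumes f: "bounded_lipschitz f" and G: "open G" "G \<subseteq> \<Omega>"
  shows "integrable lborel (\<lambda>y. indicator G y * (q_ext y \<bullet> lip_grad f y))"
proof -
  obtain B where B: "B \<ge> 0" "\<And>y. norm (q_ext y) \<le> B" using q_ext_bounded by blast
  obtain M where M: "M-lipschitz_on UNIV f" using f unfolding bounded_lipschitz_def by blast
  have [measurable]: "G \<in> sets borel" "f \<in> borel_measurable borel"
    using G borel_measurable_lipschitz[OF M] by auto
  show ?thesis
  proof (rule integrable_\<Omega>_bound)
    show "AE y in lborel. \<bar>indicator G y * (q_ext y \<bullet> lip_grad f y)\<bar> \<le> B * M * indicator \<Omega> y"
      using rademacher[OF M]
    proof eventually_elim
      case (elim y)
      have "\<bar>q_ext y \<bullet> lip_grad f y\<bar> \<le> B * M"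
        by (rule order_trans[OF Cauchy_Schwarz_ineq2]) (intro mult_mono B norm_gradient_le[OF M elim]; simp)
      then show ?case using G(2) by (auto simp: indicator_def)
    qed
  qed measurable
qed

lemma integrable_w_mult:
  assumes f: "bounded_lipschitz f" and G: "open G" "G \<subseteq> \<Omega>"
  shows "set_integrable lebesgue G (\<lambda>y. w y * f y)"
proof -
  obtain M where M: "M-lipschitz_on UNIV f" "\<And>x. \<bar>f x\<bar> \<le> M" using f by (auto elim: bounded_lipschitzE)
  have wm: "integrable lebesgue (\<lambda>y. indicator \<Omega> y * w y)" using int_w by (simp add: set_integrable_def)
  have "(\<lambda>y. indicator G y *\<^sub>R (w y * f y)) = (\<lambda>y. (indicator \<Omega> y * w y) * (indicator G y * f y))"
    using G(2) by (auto simp: fun_eq_iff indicator_def)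
  moreover have "integrable lebesgue (\<lambda>y. (indicator \<Omega> y * w y) * (indicator G y * f y))"
  proof (rule Bochner_Integration.integrable_bound)
    show "integrable lebesgue (\<lambda>y. M * (indicator \<Omega> y * w y))" using wm by (rule integrable_mult_right)
    have "(\<lambda>y. indicator G y * f y) \<in> borel_measurable lborel"
      using borel_open[OF G(1)] borel_measurable_lipschitz[OF M(1)] by simp
    then show "(\<lambda>y. (indicator \<Omega> y * w y) * (indicator G y * f y)) \<in> borel_measurable lebesgue"
      by (rule borel_measurable_times[OF borel_measurable_integrable[OF wm] measurable_completion])
    show "AE y in lebesgue. norm ((indicator \<Omega> y * w y) * (indicator G y * f y)) \<le> norm (M * (indicator \<Omega> y * w y))"
    proof (rule AE_I2)
      fix y
      have "0 \<le> M" using M(1) by (rule lipschitz_on_nonneg)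
      then have "\<bar>indicator G y * f y\<bar> \<le> \<bar>M\<bar>" using M(2)[of y] by (simp add: indicator_def)
      from mult_right_mono[OF this, of "\<bar>indicator \<Omega> y * w y\<bar>"]
      show "norm ((indicator \<Omega> y * w y) * (indicator G y * f y)) \<le> norm (M * (indicator \<Omega> y * w y))"
        by (simp add: abs_mult mult_ac)
    qed
  qed
  ultimately show ?thesis unfolding set_integrable_def by simp
qed

lemma green_add:
  assumes f: "bounded_lipschitz f" "green G f" and g: "bounded_lipschitz g" "green G g"
    and G: "open G" "G \<subseteq> \<Omega>"
  shows "green G (\<lambda>y. f y + g y)"
proof -
  obtain M where M: "M-lipschitz_on UNIV f" using f unfolding bounded_lipschitz_def by blast
  obtain N where N: "N-lipschitz_on UNIV g" using g unfolding bounded_lipschitz_def by blast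
  have [measurable]: "f \<in> borel_measurable borel" "g \<in> borel_measurable borel" "G \<in> sets borel"
    using borel_measurable_lipschitz[OF M] borel_measurable_lipschitz[OF N] G by auto
  have "(LINT y|lborel. indicator G y * (q_ext y \<bullet> lip_grad (\<lambda>y. f y + g y) y)) =
      (LINT y|lborel. indicator G y * (q_ext y \<bullet> lip_grad f y) + indicator G y * (q_ext y \<bullet> lip_grad g y))"
  proof (rule integral_cong_AE)
    show "AE y in lborel. indicator G y * (q_ext y \<bullet> lip_grad (\<lambda>y. f y + g y) y) =
        indicator G y * (q_ext y \<bullet> lip_grad f y) + indicator G y * (q_ext y \<bullet> lip_grad g y)"
      using rademacher[OF M] rademacher[OF N]
    proof eventually_elim
      case (elim y)
      have "((\<lambda>y. f y + g y) has_derivative (\<lambda>h. (lip_grad f y + lip_grad g y) \<bullet> h)) (at y)"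
        using has_derivative_add[OF elim] by (simp add: inner_add_left)
      from lip_grad_eqI[OF this] show ?case by (simp add: inner_add_right distrib_left)
    qed
  qed measurable
  also have "\<dots> = (LINT y|lborel. indicator G y * (q_ext y \<bullet> lip_grad f y)) + (LINT y|lborel. indicator G y * (q_ext y \<bullet> lip_grad g y))"
    by (intro Bochner_Integration.integral_add integrable_q_grad f g G)
  finally have 1: "(LINT y|lborel. indicator G y * (q_ext y \<bullet> lip_grad (\<lambda>y. f y + g y) y)) =
    (LINT y|lborel. indicator G y * (q_ext y \<bullet> lip_grad f y)) + (LINT y|lborel. indicator G y * (q_ext y \<bullet> lip_grad g y))" .
  have 2: "(LINT y:G|lebesgue. w y * (f y + g y)) = (LINT y:G|lebesgue. w y * f y) + (LINT y:G|lebesgue. w y * g y)"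
    unfolding distrib_left by (intro set_integral_add integrable_w_mult f g G)
  have fs: "set_integrable surface_measure (frontier G) (\<lambda>y. f y * (q y \<bullet> outward_normal G y))"
    and gs: "set_integrable surface_measure (frontier G) (\<lambda>y. g y * (q y \<bullet> outward_normal G y))"
    using f g by (auto simp: green_def)
  show ?thesis
    using f(2) g(2) unfolding green_def 1 2 distrib_right set_integral_add(2)[OF fs gs] by (auto intro: set_integral_add(1))
qed

lemma green_vanishing:
  assumes \<eta>: "\<And>y. y \<in> closure G \<Longrightarrow> \<eta> y = 0" and G: "open G"
  shows "green G \<eta>"
proof -
  have "lip_grad \<eta> y = 0" if "y \<in> G" for y
    by (rule lip_grad_zero_outside[of "- G"]) (use G that \<eta> closure_subset in auto)
  then have 1: "(\<lambda>y. indicator G y * (q_ext y \<bullet> lip_grad \<eta> y)) = (\<lambda>y. 0)"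
    by (auto simp: indicator_def)
  have 2: "(\<lambda>y. indicator G y *\<^sub>R (w y * \<eta> y)) = (\<lambda>y. 0)"
    using \<eta> closure_subset by (auto simp: indicator_def fun_eq_iff)
  have 3: "(\<lambda>y. indicator (frontier G) y *\<^sub>R (\<eta> y * (q y \<bullet> outward_normal G y))) = (\<lambda>y. 0)"
    using \<eta> by (auto simp: indicator_def fun_eq_iff frontier_def)
  show ?thesis unfolding green_def set_lebesgue_integral_def set_integrable_def 1 2 3 by simp
qed

lemma green_interior:
  assumes \<eta>: "bounded_lipschitz \<eta>" "\<And>y. y \<notin> cball p \<rho> \<Longrightarrow> \<eta> y = 0"
    and G: "open G" "G \<subseteq> \<Omega>" and ball: "cball p \<rho> \<subseteq> G"
  shows "green G \<eta>"
proof -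
  obtain M where M: "M-lipschitz_on UNIV \<eta>" using \<eta> unfolding bounded_lipschitz_def by blast
  have grad0: "lip_grad \<eta> y = 0" if "y \<notin> cball p \<rho>" for y
    by (rule lip_grad_zero_outside[OF closed_cball \<eta>(2) that])
  have 1: "(\<lambda>y. indicator (frontier G) y *\<^sub>R (\<eta> y * (q y \<bullet> outward_normal G y))) = (\<lambda>y. 0)"
  proof
    fix y show "indicator (frontier G) y *\<^sub>R (\<eta> y * (q y \<bullet> outward_normal G y)) = 0"
      using \<eta>(2)[of y] ball frontier_disjoint_eq[of G] G(1) by (cases "y \<in> cball p \<rho>") (auto simp: indicator_def)
  qed
  have "(LINT y|lborel. indicator G y * (q_ext y \<bullet> lip_grad \<eta> y)) = (LINT y|lebesgue. indicator G y * (q_ext y \<bullet> lip_grad \<eta> y))"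
    by (rule integral_completion[symmetric]) (rule borel_measurable_integrable[OF integrable_q_grad[OF \<eta>(1) G]])
  also have "\<dots> = (LINT y|lebesgue. indicator \<Omega> y *\<^sub>R (q y \<bullet> lip_grad \<eta> y))"
  proof (rule Bochner_Integration.integral_cong)
    fix y show "indicator G y * (q_ext y \<bullet> lip_grad \<eta> y) = indicator \<Omega> y *\<^sub>R (q y \<bullet> lip_grad \<eta> y)"
      using grad0[of y] ball G(2) closure_subset[of \<Omega>] by (cases "y \<in> cball p \<rho>") (auto simp: indicator_def q_ext_def)
  qed simp
  also have "(LINT y|lebesgue. indicator \<Omega> y *\<^sub>R (q y \<bullet> lip_grad \<eta> y)) = - (LINT y:\<Omega>|lebesgue. w y * \<eta> y)"
    using lipschitz_test[OF M compact_cball _ \<eta>(2)] ball G(2) unfolding set_lebesgue_integral_def by blast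
  also have "(LINT y:\<Omega>|lebesgue. w y * \<eta> y) = (LINT y:G|lebesgue. w y * \<eta> y)"
    unfolding set_lebesgue_integral_def
  proof (rule Bochner_Integration.integral_cong)
    fix y show "indicator \<Omega> y *\<^sub>R (w y * \<eta> y) = indicator G y *\<^sub>R (w y * \<eta> y)"
      using \<eta>(2)[of y] ball G(2) by (cases "y \<in> cball p \<rho>") (auto simp: indicator_def)
  qed simp
  finally show ?thesis unfolding green_def set_integrable_def set_lebesgue_integral_def 1 by simp
qed

text \<open>The chart supplied by the definition of a Lipschitz domain, written as a graph over the whole space.\<close>

lemma green_boundary:
  assumes G: "lipschitz_domain G" "G \<subseteq> \<Omega>" and p: "p \<in> frontier G"
  shows "\<exists>\<rho>>0. \<forall>\<eta>. bounded_lipschitz \<eta> \<longrightarrow> (\<forall>y. y \<notin> cball p \<rho> \<longrightarrow> \<eta> y = 0) \<longrightarrow> green G \<eta>"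
proof -
  obtain \<nu> r h L \<gamma> where \<nu>: "norm \<nu> = 1" and r: "r > 0" and h: "h > 0"
    and \<gamma>: "L-lipschitz_on {z. z \<bullet> \<nu> = 0} \<gamma>"
    and chart: "\<And>z s. z \<bullet> \<nu> = 0 \<Longrightarrow> norm z < r \<Longrightarrow> \<bar>s\<bar> < h \<Longrightarrow> p + z + s *\<^sub>R \<nu> \<in> G \<longleftrightarrow> s < \<gamma> z"
    using G(1) p unfolding lipschitz_domain_def by blast
  define g where "g y = \<gamma> (hproj \<nu> (y - p)) + p \<bullet> \<nu>" for y
  define C where "C = {y. norm (hproj \<nu> (y - p)) < r \<and> \<bar>(y - p) \<bullet> \<nu>\<bar> < h}"
  define \<rho> where "\<rho> = min r h / 2"
  have \<rho>: "\<rho> > 0" "\<rho> < r" "\<rho> < h" using r h by (auto simp: \<rho>_def)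
  interpret boundary_chart \<Omega> q w \<nu> L g G C p \<rho>
  proof
    show "norm \<nu> = 1" by (rule \<nu>)
    show "L-lipschitz_on UNIV g"
    proof (rule lipschitz_onI)
      fix x y
      have "dist (g x) (g y) = dist (\<gamma> (hproj \<nu> (x - p))) (\<gamma> (hproj \<nu> (y - p)))" by (simp add: g_def dist_norm)
      also have "\<dots> \<le> L * dist (hproj \<nu> (x - p)) (hproj \<nu> (y - p))"
        by (rule lipschitz_onD[OF \<gamma>]) (simp_all add: hproj_inner[OF \<nu>])
      also have "dist (hproj \<nu> (x - p)) (hproj \<nu> (y - p)) \<le> dist x y"
        using norm_hproj_le[OF \<nu>, of "x - y"] by (simp add: dist_norm hproj_diff)
      finally show "dist (g x) (g y) \<le> L * dist x y" using lipschitz_on_nonneg[OF \<gamma>] by (simp add: mult_left_mono)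
    qed (rule lipschitz_on_nonneg[OF \<gamma>])
    show "g (hproj \<nu> x) = g x" for x by (simp add: g_def hproj_diff hproj_hproj \<nu>)
    show "open G" using G(1) by (simp add: lipschitz_domain_def)
    show "G \<subseteq> \<Omega>" by (rule G(2))
    show "open C"
      unfolding C_def hproj_def by (intro open_Collect_conj open_Collect_less continuous_intros)
    show "y \<in> G \<longleftrightarrow> y \<bullet> \<nu> < g y" if "y \<in> C" for y
    proof -
      have "p + hproj \<nu> (y - p) + ((y - p) \<bullet> \<nu>) *\<^sub>R \<nu> = y" using hproj_decomp[of "y - p" \<nu>] by (simp add: algebra_simps)
      then have "y \<in> G \<longleftrightarrow> (y - p) \<bullet> \<nu> < \<gamma> (hproj \<nu> (y - p))"
        using chart[of "hproj \<nu> (y - p)" "(y - p) \<bullet> \<nu>"] that by (simp add: C_def hproj_inner[OF \<nu>])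
      then show ?thesis by (auto simp: g_def inner_diff_left)
    qed
    show "cball p \<rho> \<subseteq> C"
    proof
      fix y assume "y \<in> cball p \<rho>"
      then have y: "norm (y - p) \<le> \<rho>" by (simp add: dist_norm norm_minus_commute)
      have "\<bar>(y - p) \<bullet> \<nu>\<bar> \<le> norm (y - p)" using Cauchy_Schwarz_ineq2[of "y - p" \<nu>] \<nu> by simp
      then show "y \<in> C" using norm_hproj_le[OF \<nu>, of "y - p"] y \<rho> by (simp add: C_def)
    qed
  qed
  have "green G \<eta>" if \<eta>: "bounded_lipschitz \<eta>" "\<And>y. y \<notin> cball p \<rho> \<Longrightarrow> \<eta> y = 0" for \<eta>
  proof -
    obtain M where M: "M-lipschitz_on UNIV \<eta>" "\<And>x. \<bar>\<eta> x\<bar> \<le> M" using \<eta>(1) by (auto elim: bounded_lipschitzE)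
    have "(LINT y|lborel. indicator G y * (q_ext y \<bullet> lip_grad \<eta> y)) + (LINT y:G|lebesgue. w y * \<eta> y) =
        (LINT x|slab_measure \<nu>. flux_through_graph \<eta> x)"
      by (rule local_divergence[OF M \<eta>(2)])
    also have "\<dots> = (LINT y:frontier G|surface_measure. \<eta> y * (q y \<bullet> outward_normal G y))"
      by (rule surface_flux_graph(2)[OF M \<eta>(2), symmetric])
    finally show ?thesis
      unfolding green_def
      using surface_flux_graph(1)[OF M \<eta>(2) integrable_flux_through_graph[OF M \<eta>(2)]] by blast
  qed
  then show ?thesis using \<rho>(1) by blast
qed

lemma green_local:
  assumes G: "lipschitz_domain G" "G \<subseteq> \<Omega>" and p: "p \<in> closure G"
  shows "\<exists>\<rho>>0. \<forall>\<eta>. bounded_lipschitz \<eta> \<longrightarrow> (\<forall>y. y \<notin> cball p \<rho> \<longrightarrow> \<eta> y = 0) \<longrightarrow> green G \<eta>"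
proof (cases "p \<in> G")
  case True
  have G': "open G" using G(1) by (simp add: lipschitz_domain_def)
  obtain \<rho> where "\<rho> > 0" "cball p \<rho> \<subseteq> G" using open_contains_cball G' True by blast
  then show ?thesis using green_interior[OF _ _ G' G(2)] by blast
next
  case False
  then have "p \<in> frontier G" using p G(1) by (simp add: frontier_def lipschitz_domain_def interior_open)
  then show ?thesis by (rule green_boundary[OF G])
qed

text \<open>
  Splitting off one bump function after another reduces the identity to test functions supported in a
  single chart.
\<close>

lemma green_covered:
  assumes G: "open G" "G \<subseteq> \<Omega>" and F: "finite F" and \<rho>: "\<And>p. p \<in> F \<Longrightarrow> \<rho> p > 0"
    and loc: "\<And>p \<eta>. p \<in> F \<Longrightarrow> bounded_lipschitz \<eta> \<Longrightarrow> (\<And>y. y \<notin> cball p (\<rho> p) \<Longrightarrow> \<eta> y = 0) \<Longrightarrow> green G \<eta>"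
    and \<eta>: "bounded_lipschitz \<eta>" "\<And>y. y \<in> closure G \<Longrightarrow> y \<notin> (\<Union>p\<in>F. ball p (\<rho> p / 2)) \<Longrightarrow> \<eta> y = 0"
  shows "green G \<eta>"
  using F \<rho> loc \<eta>
proof (induction F arbitrary: \<eta> rule: finite_induct)
  case empty
  then show ?case by (intro green_vanishing G) simp
next
  case (insert p F)
  \<comment> \<open>The argument of the ramp is at least 2 on the ball of half the radius and at most 1 off the ball.\<close>
  define \<psi> where "\<psi> y = ramp (3 - 2 / \<rho> p * dist y p)" for y
  have \<rho>p: "\<rho> p > 0" using insert by simp
  have \<psi>: "bounded_lipschitz \<psi>"
    unfolding \<psi>_def
  proof (rule bounded_lipschitz_ramp, rule lipschitz_onI)
    fix x y
    have "\<bar>dist y p - dist x p\<bar> \<le> dist x y" using abs_dist_diff_le[of x p y] by (simp add: dist_commute abs_minus_commute)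
    then have "2 / \<rho> p * \<bar>dist y p - dist x p\<bar> \<le> 2 / \<rho> p * dist x y" using \<rho>p by (intro mult_left_mono) auto
    moreover have "dist (3 - 2 / \<rho> p * dist x p) (3 - 2 / \<rho> p * dist y p) = 2 / \<rho> p * \<bar>dist y p - dist x p\<bar>"
    proof -
      have "(3 - 2 / \<rho> p * dist x p) - (3 - 2 / \<rho> p * dist y p) = 2 / \<rho> p * (dist y p - dist x p)"
        by (simp add: algebra_simps)
      then show ?thesis unfolding dist_real_def using \<rho>p by (simp only: abs_mult) simp
    qed
    ultimately show "dist (3 - 2 / \<rho> p * dist x p) (3 - 2 / \<rho> p * dist y p) \<le> 2 / \<rho> p * dist x y" by (simp only:)
  qed (use \<rho>p in simp)
  have in0: "\<psi> y = 1" if "y \<in> ball p (\<rho> p / 2)" for y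
    using that \<rho>p by (auto simp: \<psi>_def dist_commute field_simps intro!: ramp_eq(2))
  have out0: "\<psi> y = 0" if "y \<notin> cball p (\<rho> p)" for y
    using that \<rho>p by (auto simp: \<psi>_def dist_commute field_simps intro!: ramp_eq(1))
  have b1: "bounded_lipschitz (\<lambda>y. \<eta> y * \<psi> y)" by (intro bounded_lipschitz_mult insert.prems(3) \<psi>)
  have b2: "bounded_lipschitz (\<lambda>y. \<eta> y * (1 - \<psi> y))"
    by (intro bounded_lipschitz_mult bounded_lipschitz_diff bounded_lipschitz_const insert.prems(3) \<psi>)
  have "green G (\<lambda>y. \<eta> y * \<psi> y)" by (rule insert.prems(2)[OF _ b1]) (use out0 in auto)
  moreover have "green G (\<lambda>y. \<eta> y * (1 - \<psi> y))"
  proof (rule insert.IH[OF _ _ b2])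
    fix y assume "y \<in> closure G" "y \<notin> (\<Union>p\<in>F. ball p (\<rho> p / 2))"
    then show "\<eta> y * (1 - \<psi> y) = 0" using insert.prems(4)[of y] in0[of y] by (cases "y \<in> ball p (\<rho> p / 2)") auto
  qed (use insert.prems in auto)
  ultimately have "green G (\<lambda>y. \<eta> y * \<psi> y + \<eta> y * (1 - \<psi> y))" by (intro green_add b1 b2 G)
  then show ?case by (simp add: algebra_simps)
qed

text \<open>
  By compactness finitely many charts cover the closure of \<open>G\<close>, so the identity holds for \<open>\<eta> = 1\<close>.
\<close>

theorem divergence_theorem:
  assumes G: "lipschitz_domain G" "G \<subseteq> \<Omega>"
  shows "set_integrable surface_measure (frontier G) (\<lambda>y. q y \<bullet> outward_normal G y)"
    and "(LINT y:G|lebesgue. w y) = (LINT y:frontier G|surface_measure. q y \<bullet> outward_normal G y)"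
proof -
  have G': "open G" using G(1) by (simp add: lipschitz_domain_def)
  have "\<forall>p\<in>closure G. \<exists>\<rho>>0. \<forall>\<eta>. bounded_lipschitz \<eta> \<longrightarrow> (\<forall>y. y \<notin> cball p \<rho> \<longrightarrow> \<eta> y = 0) \<longrightarrow> green G \<eta>"
    using green_local[OF G] by blast
  then obtain \<rho> where \<rho>: "\<And>p. p \<in> closure G \<Longrightarrow> \<rho> p > 0"
    and loc: "\<And>p \<eta>. p \<in> closure G \<Longrightarrow> bounded_lipschitz \<eta> \<Longrightarrow> (\<And>y. y \<notin> cball p (\<rho> p) \<Longrightarrow> \<eta> y = 0) \<Longrightarrow> green G \<eta>"
    unfolding bchoice_iff by blast
  have cpt: "compact (closure G)"
    using bounded_closure[OF bounded_subset[OF bounded_\<Omega> G(2)]] by (simp add: compact_eq_bounded_closed)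
  have cov: "closure G \<subseteq> (\<Union>p\<in>closure G. ball p (\<rho> p / 2))"
  proof
    fix p assume "p \<in> closure G"
    then show "p \<in> (\<Union>p\<in>closure G. ball p (\<rho> p / 2))" using \<rho>[of p] by (intro UN_I[of p]) auto
  qed
  obtain F where F: "F \<subseteq> closure G" "finite F" "closure G \<subseteq> (\<Union>p\<in>F. ball p (\<rho> p / 2))"
    by (rule compactE_image[OF cpt _ cov]) auto
  have "green G (\<lambda>y. 1)"
  proof (rule green_covered[OF G' G(2) F(2), of \<rho>])
    show "\<rho> p > 0" if "p \<in> F" for p using \<rho> F(1) that by blast
    show "green G \<eta>" if "p \<in> F" "bounded_lipschitz \<eta>" "\<And>y. y \<notin> cball p (\<rho> p) \<Longrightarrow> \<eta> y = 0" for p \<eta>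
      by (rule loc[OF _ that(2,3)]) (use F(1) that(1) in blast)
    show "bounded_lipschitz (\<lambda>y. 1 :: real)" by (rule bounded_lipschitz_const)
  qed (use F(3) in blast)
  moreover have "lip_grad (\<lambda>y :: real^'n. 1) y = 0" for y by (rule lip_grad_eqI) simp
  ultimately show "set_integrable surface_measure (frontier G) (\<lambda>y. q y \<bullet> outward_normal G y)"
    and "(LINT y:G|lebesgue. w y) = (LINT y:frontier G|surface_measure. q y \<bullet> outward_normal G y)"
    by (simp_all add: green_def)
qed

end

section \<open>Weak divergences and test functions\<close>

lemma set_integrable_inner_bounded:
  fixes f h :: "'a::euclidean_space \<Rightarrow> 'b::euclidean_space"
  assumes f: "set_integrable lebesgue A f" and h: "h \<in> borel_measurable borel" and B: "\<And>x. norm (h x) \<le> B"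
  shows "set_integrable lebesgue A (\<lambda>x. f x \<bullet> h x)"
  unfolding set_integrable_def
proof (rule Bochner_Integration.integrable_bound)
  let ?f = "\<lambda>x. indicator A x *\<^sub>R f x"
  have fi: "integrable lebesgue ?f" using f by (simp add: set_integrable_def)
  show "integrable lebesgue (\<lambda>x. B * norm (?f x))" by (intro integrable_mult_right integrable_norm fi)
  have "h \<in> borel_measurable lebesgue" by (rule measurable_completion) (use h in simp)
  then have "(\<lambda>x. ?f x \<bullet> h x) \<in> borel_measurable lebesgue"
    by (rule borel_measurable_inner[OF borel_measurable_integrable[OF fi]])
  then show "(\<lambda>x. indicator A x *\<^sub>R (f x \<bullet> h x)) \<in> borel_measurable lebesgue" by simp
  show "AE x in lebesgue. norm (indicator A x *\<^sub>R (f x \<bullet> h x)) \<le> norm (B * norm (?f x))"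
  proof (rule AE_I2)
    fix x
    have "\<bar>f x \<bullet> h x\<bar> \<le> norm (f x) * B"
      by (rule order_trans[OF Cauchy_Schwarz_ineq2]) (rule mult_left_mono[OF B norm_ge_zero])
    moreover have "0 \<le> B" using B[of x] norm_ge_zero order_trans by blast
    ultimately show "norm (indicator A x *\<^sub>R (f x \<bullet> h x)) \<le> norm (B * norm (?f x))"
      by (simp add: indicator_def mult.commute)
  qed
qed

lemma set_integral_bound:
  fixes f :: "'a::euclidean_space \<Rightarrow> 'b::euclidean_space"
  assumes A: "A \<in> sets lebesgue" "emeasure lebesgue A < \<infinity>" and c: "c \<ge> 0"
    and f: "\<And>x. x \<in> A \<Longrightarrow> norm (f x) \<le> c"
  shows "norm (LINT x:A|lebesgue. f x) \<le> c * measure lebesgue A"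
proof -
  have "norm (LINT x:A|lebesgue. f x) \<le> (LINT x|lebesgue. norm (indicator A x *\<^sub>R f x))"
    unfolding set_lebesgue_integral_def by (rule integral_norm_bound)
  also have "\<dots> \<le> (LINT x|lebesgue. c * indicator A x)"
  proof (rule integral_mono')
    show "integrable lebesgue (\<lambda>x. c * indicator A x)"
      using A by (intro integrable_mult_right integrable_real_indicator)
  qed (use f c in \<open>auto simp: indicator_def\<close>)
  also have "\<dots> = c * measure lebesgue A" using A by simp
  finally show ?thesis .
qed

lemma test_function_bounded:
  assumes \<phi>: "\<phi> \<in> test_functions \<Omega>"
  obtains B where "\<And>x. \<bar>\<phi> x\<bar> \<le> B" "\<And>x. norm (grad \<phi> x) \<le> B"
proof -
  obtain C where C: "C-lipschitz_on UNIV \<phi>" using test_function_lipschitz[OF \<phi>] by blast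
  let ?K = "closure {x. \<phi> x \<noteq> 0}"
  have "compact ?K" using \<phi> by (simp add: test_functions_def)
  then have "bounded (\<phi> ` ?K)"
    by (intro compact_imp_bounded compact_continuous_image continuous_on_subset[OF lipschitz_on_continuous_on[OF C]]) auto
  then obtain b where b: "\<And>x. x \<in> ?K \<Longrightarrow> \<bar>\<phi> x\<bar> \<le> b" by (auto simp: bounded_iff)
  have b': "\<bar>\<phi> x\<bar> \<le> \<bar>b\<bar>" for x
  proof (cases "\<phi> x = 0")
    case False
    then have "x \<in> ?K" using closure_subset[of "{x. \<phi> x \<noteq> 0}"] by blast
    then show ?thesis using b[of x] by simp
  qed simp
  show ?thesis
  proof (rule that)
    show "\<bar>\<phi> x\<bar> \<le> max \<bar>b\<bar> C" for x using b'[of x] by simp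
    show "norm (grad \<phi> x) \<le> max \<bar>b\<bar> C" for x
      using norm_gradient_le[OF C grad_test_function(1)[OF \<phi>], of x] by simp
  qed
qed

lemma test_function_measurable:
  assumes \<phi>: "\<phi> \<in> test_functions \<Omega>"
  shows "\<phi> \<in> borel_measurable borel" and "grad \<phi> \<in> borel_measurable borel"
proof -
  obtain C where "C-lipschitz_on UNIV \<phi>" using test_function_lipschitz[OF \<phi>] by blast
  then show "\<phi> \<in> borel_measurable borel" by (rule borel_measurable_lipschitz)
  show "grad \<phi> \<in> borel_measurable borel"
    by (rule borel_measurable_continuous_onI[OF grad_test_function(3)[OF \<phi>]])
qed

lemma locally_integrableI:
  "set_integrable lebesgue \<Omega> g \<Longrightarrow> locally_integrable \<Omega> g"
  unfolding locally_integrable_def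
proof (intro allI impI)
  fix K assume g: "set_integrable lebesgue \<Omega> g" and K: "compact K \<and> K \<subseteq> \<Omega>"
  then have "K \<in> sets lebesgue" using fmeasurableD lmeasurable_compact by blast
  then show "set_integrable lebesgue K g" by (rule set_integrable_subset[OF g]) (use K in simp)
qed

lemma set_integrable_test:
  fixes g :: "real^'n::finite \<Rightarrow> real"
  assumes g: "locally_integrable \<Omega> g" and \<phi>: "\<phi> \<in> test_functions \<Omega>"
  shows "set_integrable lebesgue \<Omega> (\<lambda>x. g x * \<phi> x)"
proof -
  let ?K = "closure {x. \<phi> x \<noteq> 0}"
  have K: "compact ?K" "?K \<subseteq> \<Omega>" using \<phi> by (auto simp: test_functions_def)
  obtain B where B: "\<And>x. \<bar>\<phi> x\<bar> \<le> B" using test_function_bounded[OF \<phi>] by blast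
  have "set_integrable lebesgue ?K g" using g K unfolding locally_integrable_def by blast
  then have "set_integrable lebesgue ?K (\<lambda>x. g x \<bullet> \<phi> x)"
    by (rule set_integrable_inner_bounded[OF _ test_function_measurable(1)[OF \<phi>]]) (use B in simp)
  moreover have "(\<lambda>x. indicator ?K x *\<^sub>R (g x \<bullet> \<phi> x)) = (\<lambda>x. indicator \<Omega> x *\<^sub>R (g x * \<phi> x))"
  proof
    fix x
    have "\<phi> x = 0" if "x \<notin> ?K" using that closure_subset[of "{x. \<phi> x \<noteq> 0}"] by blast
    then show "indicator ?K x *\<^sub>R (g x \<bullet> \<phi> x) = indicator \<Omega> x *\<^sub>R (g x * \<phi> x)" using K(2) by (auto simp: indicator_def)
  qed
  ultimately show ?thesis by (simp only: set_integrable_def)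
qed

lemma set_integrable_grad:
  fixes q :: "real^'n::finite \<Rightarrow> real^'n"
  assumes q: "set_integrable lebesgue \<Omega> q" and \<phi>: "\<phi> \<in> test_functions \<Omega>"
  shows "set_integrable lebesgue \<Omega> (\<lambda>x. q x \<bullet> grad \<phi> x)"
proof -
  obtain B where B: "\<And>x. norm (grad \<phi> x) \<le> B" using test_function_bounded[OF \<phi>] by blast
  show ?thesis by (rule set_integrable_inner_bounded[OF q test_function_measurable(2)[OF \<phi>] B])
qed

lemma locally_integrable_add:
  assumes "locally_integrable \<Omega> f" "locally_integrable \<Omega> g"
  shows "locally_integrable \<Omega> (\<lambda>x. f x + g x)"
  using assms unfolding locally_integrable_def by (auto intro: set_integral_add(1))

lemma locally_integrable_diff:
  assumes "locally_integrable \<Omega> f" "locally_integrable \<Omega> g"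
  shows "locally_integrable \<Omega> (\<lambda>x. f x - g x)"
  using assms unfolding locally_integrable_def by (auto intro: set_integral_diff(1))

lemma distr_fun_add:
  fixes f g :: "real^'n::finite \<Rightarrow> real"
  assumes "locally_integrable \<Omega> f" "locally_integrable \<Omega> g" "\<phi> \<in> test_functions \<Omega>"
  shows "distr_fun \<Omega> (\<lambda>x. f x + g x) \<phi> = distr_fun \<Omega> f \<phi> + distr_fun \<Omega> g \<phi>"
  unfolding distr_fun_def distrib_right by (intro set_integral_add set_integrable_test assms)

lemma distr_fun_diff:
  fixes f g :: "real^'n::finite \<Rightarrow> real"
  assumes "locally_integrable \<Omega> f" "locally_integrable \<Omega> g" "\<phi> \<in> test_functions \<Omega>"
  shows "distr_fun \<Omega> (\<lambda>x. f x - g x) \<phi> = distr_fun \<Omega> f \<phi> - distr_fun \<Omega> g \<phi>"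
  unfolding distr_fun_def left_diff_distrib by (intro set_integral_diff set_integrable_test assms)

lemma distr_div_add:
  fixes q r :: "real^'n::finite \<Rightarrow> real^'n"
  assumes "set_integrable lebesgue \<Omega> q" "set_integrable lebesgue \<Omega> r" "\<phi> \<in> test_functions \<Omega>"
  shows "distr_div \<Omega> (\<lambda>x. q x + r x) \<phi> = distr_div \<Omega> q \<phi> + distr_div \<Omega> r \<phi>"
  using set_integral_add(2)[OF set_integrable_grad[OF assms(1,3)] set_integrable_grad[OF assms(2,3)]]
  by (simp add: distr_div_def inner_add_left)

lemma has_weak_div_add:
  fixes q r :: "real^'n::finite \<Rightarrow> real^'n"
  assumes q: "has_weak_div \<Omega> q f" "set_integrable lebesgue \<Omega> q"
    and r: "has_weak_div \<Omega> r g" "set_integrable lebesgue \<Omega> r"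
  shows "has_weak_div \<Omega> (\<lambda>x. q x + r x) (\<lambda>x. f x + g x)"
  using assms by (simp add: has_weak_div_def locally_integrable_add distr_fun_add distr_div_add)

lemma has_weak_div_unique:
  fixes q :: "real^'n::finite \<Rightarrow> real^'n"
  assumes "open \<Omega>" "has_weak_div \<Omega> q f" "has_weak_div \<Omega> q g"
  shows "AE x in lebesgue. x \<in> \<Omega> \<longrightarrow> f x = g x"
proof -
  have "AE x in lebesgue. x \<in> \<Omega> \<longrightarrow> f x - g x = 0"
    using assms by (intro fundamental_lemma) (auto simp: has_weak_div_def locally_integrable_diff distr_fun_diff)
  then show ?thesis by simp
qed

lemma has_weak_div_row_div:
  assumes "has_row_div \<Omega> J"
  shows "has_weak_div \<Omega> (\<lambda>x. J x $ i) (\<lambda>x. row_div \<Omega> J x $ i)"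
  using assms someI_ex[of "has_weak_div \<Omega> (\<lambda>x. J x $ i)"] by (simp add: has_row_div_def row_div_def weak_div_def)

lemma set_integrable_component:
  fixes f :: "'a::euclidean_space \<Rightarrow> ('b::euclidean_space)^'m::finite"
  assumes "set_integrable lebesgue A f"
  shows "set_integrable lebesgue A (\<lambda>x. f x $ i)"
  using integrable_bounded_linear[OF bounded_linear_vec_nth, of lebesgue "\<lambda>x. indicator A x *\<^sub>R f x" i] assms
  by (simp add: set_integrable_def)

section \<open>Regularity in time\<close>

text \<open>A set of full measure in an interval is dense.\<close>

lemma AE_zero_imp_zero:
  fixes f :: "real \<Rightarrow> real"
  assumes f: "continuous_on {0..\<tau>} f" and zero: "AE t in lebesgue. t \<in> {0<..<\<tau>} \<longrightarrow> f t = 0"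
    and \<tau>: "\<tau> > 0" and t: "t \<in> {0..\<tau>}"
  shows "f t = 0"
proof -
  define Z where "Z = {t \<in> {0<..<\<tau>}. f t = 0}"
  have "\<exists>N. (\<forall>t. t \<notin> N \<longrightarrow> t \<in> {0<..<\<tau>} \<longrightarrow> f t = 0) \<and> N \<in> null_sets lebesgue"
    by (rule AE_E3[OF zero]) auto
  then obtain N where N: "\<And>t. t \<notin> N \<Longrightarrow> t \<in> {0<..<\<tau>} \<Longrightarrow> f t = 0" "N \<in> null_sets lebesgue" by blast
  have "{0<..<\<tau>} \<subseteq> closure Z"
  proof
    fix s assume s: "s \<in> {0<..<\<tau>}"
    show "s \<in> closure Z"
      unfolding closure_approachable
    proof (intro allI impI)
      fix e :: real assume e: "e > 0"
      let ?I = "{max 0 (s - e)<..<min \<tau> (s + e)}"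
      have "\<not> ?I \<subseteq> N"
      proof
        assume "?I \<subseteq> N"
        then have "?I \<in> null_sets lebesgue"
          by (rule null_sets_subset[OF N(2), rotated]) auto
        then have "emeasure lebesgue ?I = 0" by (rule null_setsD1)
        moreover have "emeasure lebesgue ?I = emeasure lborel ?I" by simp
        ultimately have "emeasure lborel ?I = 0" by simp
        then show False using s e by auto
      qed
      then obtain r where "r \<in> ?I" "r \<notin> N" by blast
      then show "\<exists>r\<in>Z. dist r s < e" using N(1)[of r] by (intro bexI[of _ r]) (auto simp: Z_def dist_real_def)
    qed
  qed
  then have "closure {0<..<\<tau>} \<subseteq> closure Z" using closure_minimal[OF _ closed_closure] by blast
  then have sup: "{0..\<tau>} \<subseteq> closure Z" using \<tau> by simp
  have sub: "closure Z \<subseteq> {0..\<tau>}" by (rule closure_minimal) (auto simp: Z_def)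
  show ?thesis
    by (rule continuous_constant_on_closure[of Z f 0]) (use f sub sup t in \<open>auto simp: Z_def intro: continuous_on_subset\<close>)
qed

lemma continuous_on_pairing:
  fixes g :: "real \<Rightarrow> 'a::euclidean_space \<Rightarrow> 'b::euclidean_space"
  assumes L1: "L1_continuous \<Omega> \<tau> g" and g: "\<And>t. t \<in> {0..\<tau>} \<Longrightarrow> set_integrable lebesgue \<Omega> (g t)"
    and h: "h \<in> borel_measurable borel" and B: "\<And>x. norm (h x) \<le> B"
  shows "continuous_on {0..\<tau>} (\<lambda>t. LINT x:\<Omega>|lebesgue. g t x \<bullet> h x)"
  unfolding continuous_on_def
proof
  fix t assume t: "t \<in> {0..\<tau>}"
  let ?P = "\<lambda>t. LINT x:\<Omega>|lebesgue. g t x \<bullet> h x"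
  have "((\<lambda>s. ?P s - ?P t) \<longlongrightarrow> 0) (at t within {0..\<tau>})"
  proof (rule Lim_null_comparison)
    have "((\<lambda>s. B * (LINT x:\<Omega>|lebesgue. norm (g s x - g t x))) \<longlongrightarrow> B * 0) (at t within {0..\<tau>})"
      using L1 t unfolding L1_continuous_def by (intro tendsto_mult tendsto_const) blast
    then show "((\<lambda>s. B * (LINT x:\<Omega>|lebesgue. norm (g s x - g t x))) \<longlongrightarrow> 0) (at t within {0..\<tau>})" by simp
    have "norm (?P s - ?P t) \<le> B * (LINT x:\<Omega>|lebesgue. norm (g s x - g t x))" if s: "s \<in> {0..\<tau>}" for s
    proof -
      have "?P s - ?P t = (LINT x:\<Omega>|lebesgue. (g s x - g t x) \<bullet> h x)"
        unfolding inner_diff_left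
        by (rule set_integral_diff(2)[symmetric]) (intro set_integrable_inner_bounded[OF g[OF s] h B] set_integrable_inner_bounded[OF g[OF t] h B])+
      also have "norm \<dots> \<le> (LINT x|lebesgue. norm (indicator \<Omega> x *\<^sub>R ((g s x - g t x) \<bullet> h x)))"
        unfolding set_lebesgue_integral_def by (rule integral_norm_bound)
      also have "\<dots> \<le> (LINT x|lebesgue. B * (indicator \<Omega> x *\<^sub>R norm (g s x - g t x)))"
      proof (rule integral_mono')
        have "set_integrable lebesgue \<Omega> (\<lambda>x. norm (g s x - g t x))"
          by (intro set_integrable_norm set_integral_diff g s t)
        then show "integrable lebesgue (\<lambda>x. B * (indicator \<Omega> x *\<^sub>R norm (g s x - g t x)))"
          unfolding set_integrable_def by (rule integrable_mult_right)
        fix x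
        have "\<bar>(g s x - g t x) \<bullet> h x\<bar> \<le> norm (g s x - g t x) * B"
          by (rule order_trans[OF Cauchy_Schwarz_ineq2]) (rule mult_left_mono[OF B norm_ge_zero])
        then show "norm (indicator \<Omega> x *\<^sub>R ((g s x - g t x) \<bullet> h x)) \<le> B * (indicator \<Omega> x *\<^sub>R norm (g s x - g t x))"
          by (simp add: indicator_def mult.commute)
        have "0 \<le> B" using B[of x] norm_ge_zero order_trans by blast
        then show "0 \<le> B * (indicator \<Omega> x *\<^sub>R norm (g s x - g t x))" by simp
      qed
      also have "\<dots> = B * (LINT x:\<Omega>|lebesgue. norm (g s x - g t x))"
        unfolding set_lebesgue_integral_def by (rule integral_mult_right_zero)
      finally show ?thesis .
    qed
    then show "\<forall>\<^sub>F s in at t within {0..\<tau>}. norm (?P s - ?P t) \<le> B * (LINT x:\<Omega>|lebesgue. norm (g s x - g t x))"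
      unfolding eventually_at by (intro exI[of _ 1]) auto
  qed
  then show "(?P \<longlongrightarrow> ?P t) (at t within {0..\<tau>})" using LIM_zero_iff by blast
qed

lemma small_factor:
  fixes m e :: real
  assumes "m \<ge> 0" "e > 0"
  obtains c where "c > 0" "c * m < e"
proof
  show "e / (m + 1) > 0" using assms by simp
  show "e / (m + 1) * m < e" using assms by (simp add: field_simps)
qed

lemma uniformly_close_in_time:
  fixes v :: "real \<Rightarrow> 'a::euclidean_space \<Rightarrow> 'b::real_normed_vector"
  assumes v: "continuous_on ({0..\<tau>} \<times> K) (\<lambda>(t, x). v t x)" and K: "compact K" and \<epsilon>: "\<epsilon> > 0"
  obtains \<delta> where "\<delta> > 0"
    "\<And>s t x. s \<in> {0..\<tau>} \<Longrightarrow> t \<in> {0..\<tau>} \<Longrightarrow> x \<in> K \<Longrightarrow> \<bar>s - t\<bar> < \<delta> \<Longrightarrow> norm (v s x - v t x) < \<epsilon>"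
proof -
  have "uniformly_continuous_on ({0..\<tau>} \<times> K) (\<lambda>(t, x). v t x)"
    by (intro compact_uniformly_continuous v compact_Times K compact_Icc)
  then obtain \<delta> where \<delta>: "\<delta> > 0" "\<And>z z'. z \<in> {0..\<tau>} \<times> K \<Longrightarrow> z' \<in> {0..\<tau>} \<times> K \<Longrightarrow> dist z' z < \<delta> \<Longrightarrow>
      dist (case z' of (t, x) \<Rightarrow> v t x) (case z of (t, x) \<Rightarrow> v t x) < \<epsilon>"
    using \<epsilon> unfolding uniformly_continuous_on_def by blast
  show ?thesis
  proof (rule that[OF \<delta>(1)])
    fix s t x assume "s \<in> {0..\<tau>}" "t \<in> {0..\<tau>}" "x \<in> K" "\<bar>s - t\<bar> < \<delta>"
    then show "norm (v s x - v t x) < \<epsilon>" using \<delta>(2)[of "(t, x)" "(s, x)"] by (simp add: dist_Pair_Pair dist_norm)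
  qed
qed

lemma set_integrable_slice:
  fixes v :: "real \<Rightarrow> 'a::euclidean_space \<Rightarrow> 'b::euclidean_space"
  assumes v: "continuous_on ({0..\<tau>} \<times> closure \<Omega>) (\<lambda>(t, x). v t x)" and \<Omega>: "open \<Omega>" "bounded \<Omega>" and t: "t \<in> {0..\<tau>}"
  shows "set_integrable lebesgue \<Omega> (v t)"
proof -
  have "continuous_on (closure \<Omega>) (\<lambda>x. case (t, x) of (t, x) \<Rightarrow> v t x)"
    by (rule continuous_on_compose2[OF v]) (use t in \<open>auto intro!: continuous_intros\<close>)
  then have c: "continuous_on (closure \<Omega>) (v t)" by simp
  have K: "compact (closure \<Omega>)" using bounded_closure[OF \<Omega>(2)] by (simp add: compact_eq_bounded_closed)
  have "set_integrable lborel (closure \<Omega>) (v t)" unfolding set_integrable_def by (rule borel_integrable_compact[OF K c])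
  then have "set_integrable lebesgue (closure \<Omega>) (v t)"
    unfolding set_integrable_def by (subst integrable_completion) (auto dest: borel_measurable_integrable)
  then show ?thesis by (rule set_integrable_subset) (use \<Omega>(1) closure_subset in auto)
qed

lemma L1_continuous_of_continuous:
  fixes v :: "real \<Rightarrow> 'a::euclidean_space \<Rightarrow> 'b::euclidean_space"
  assumes v: "continuous_on ({0..\<tau>} \<times> closure \<Omega>) (\<lambda>(t, x). v t x)" and \<Omega>: "open \<Omega>" "bounded \<Omega>"
  shows "L1_continuous \<Omega> \<tau> v"
  unfolding L1_continuous_def
proof
  fix t assume t: "t \<in> {0..\<tau>}"
  have K: "compact (closure \<Omega>)" using bounded_closure[OF \<Omega>(2)] by (simp add: compact_eq_bounded_closed)
  have fin: "\<Omega> \<in> sets lebesgue" "emeasure lebesgue \<Omega> < \<infinity>"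
    using \<Omega>(1) emeasure_bounded_finite[OF \<Omega>(2)] by auto
  show "((\<lambda>s. LINT x:\<Omega>|lebesgue. norm (v s x - v t x)) \<longlongrightarrow> 0) (at t within {0..\<tau>})"
  proof (rule tendstoI)
    fix e :: real assume e: "e > 0"
    obtain c where c: "c > 0" and ce: "c * measure lebesgue \<Omega> < e"
      using small_factor[OF measure_nonneg e] by blast
    obtain \<delta> where \<delta>: "\<delta> > 0" "\<And>s r x. s \<in> {0..\<tau>} \<Longrightarrow> r \<in> {0..\<tau>} \<Longrightarrow> x \<in> closure \<Omega> \<Longrightarrow> \<bar>s - r\<bar> < \<delta> \<Longrightarrow> norm (v s x - v r x) < c"
      using uniformly_close_in_time[OF v K c] by blast
    have "dist (LINT x:\<Omega>|lebesgue. norm (v s x - v t x)) 0 < e" if s: "s \<in> {0..\<tau>}" "\<bar>s - t\<bar> < \<delta>" for s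
    proof -
      have "norm (LINT x:\<Omega>|lebesgue. norm (v s x - v t x)) \<le> c * measure lebesgue \<Omega>"
        using fin c \<delta>(2)[OF s(1) t _ s(2)] closure_subset[of \<Omega>] by (intro set_integral_bound) (auto intro: less_imp_le)
      then show ?thesis using ce by simp
    qed
    then show "\<forall>\<^sub>F s in at t within {0..\<tau>}. dist (LINT x:\<Omega>|lebesgue. norm (v s x - v t x)) 0 < e"
      unfolding eventually_at using \<delta>(1) by (intro exI[of _ \<delta>]) (auto simp: dist_real_def)
  qed
qed

text \<open>
  The difference quotients converge uniformly in \<open>x\<close> by the mean value theorem, also at the end points of
  the time interval, where the integrand is only assumed to be continuous.
\<close>

lemma has_derivative_under_integral:
  fixes k H :: "real \<Rightarrow> 'a::euclidean_space \<Rightarrow> real"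
  assumes G: "G \<in> sets lebesgue" "emeasure lebesgue G < \<infinity>" "G \<subseteq> K" and K: "compact K"
    and k: "\<And>x. x \<in> G \<Longrightarrow> continuous_on {0..\<tau>} (\<lambda>s. k s x)"
    and deriv: "\<And>x s. x \<in> G \<Longrightarrow> s \<in> {0<..<\<tau>} \<Longrightarrow> ((\<lambda>s. k s x) has_real_derivative H s x) (at s)"
    and int: "\<And>s. s \<in> {0..\<tau>} \<Longrightarrow> set_integrable lebesgue G (k s)"
    and H: "continuous_on ({0..\<tau>} \<times> K) (\<lambda>(s, x). H s x)" "set_integrable lebesgue G (H t)" and t: "t \<in> {0..\<tau>}"
  shows "((\<lambda>s. LINT x:G|lebesgue. k s x) has_real_derivative (LINT x:G|lebesgue. H t x)) (at t within {0..\<tau>})"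
  unfolding has_field_derivative_iff
proof (rule tendstoI)
  fix e :: real assume e: "e > 0"
  let ?F = "\<lambda>s. LINT x:G|lebesgue. k s x"
  obtain c where c: "c > 0" and ce: "c * measure lebesgue G < e"
    using small_factor[OF measure_nonneg e] by blast
  obtain \<delta> where \<delta>: "\<delta> > 0" "\<And>s r x. s \<in> {0..\<tau>} \<Longrightarrow> r \<in> {0..\<tau>} \<Longrightarrow> x \<in> K \<Longrightarrow> \<bar>s - r\<bar> < \<delta> \<Longrightarrow> norm (H s x - H r x) < c"
    using uniformly_close_in_time[OF H(1) K c] by blast
  have mvt: "\<exists>z\<in>{0..\<tau>}. \<bar>z - t\<bar> \<le> \<bar>s - t\<bar> \<and> (k s x - k t x) / (s - t) = H z x"
    if s: "s \<in> {0..\<tau>}" "s \<noteq> t" and x: "x \<in> G" for s x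
  proof -
    let ?a = "min s t" and ?b = "max s t"
    have ab: "?a < ?b" "0 \<le> ?a" "?b \<le> \<tau>" using s t by (auto simp: min_def max_def)
    have "\<exists>l z. ?a < z \<and> z < ?b \<and> DERIV (\<lambda>s. k s x) z :> l \<and> k ?b x - k ?a x = (?b - ?a) * l"
    proof (rule MVT[OF ab(1)])
      show "continuous_on {?a..?b} (\<lambda>s. k s x)" by (rule continuous_on_subset[OF k[OF x]]) (use ab in auto)
      show "(\<lambda>s. k s x) differentiable (at z)" if "?a < z" "z < ?b" for z
        using deriv[OF x, of z] that ab real_differentiable_def by force
    qed
    then obtain l z where z: "?a < z" "z < ?b" "DERIV (\<lambda>s. k s x) z :> l" "k ?b x - k ?a x = (?b - ?a) * l" by blast
    have "l = H z x" by (rule DERIV_unique[OF z(3) deriv[OF x]]) (use z ab in auto)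
    moreover have "(k s x - k t x) / (s - t) = l"
    proof (cases "s < t")
      case True
      then have "k s x - k t x = (s - t) * l" using z(4) by (simp add: algebra_simps)
      then show ?thesis using s(2) by simp
    next
      case False
      then have "k s x - k t x = (s - t) * l" using z(4) by (simp add: algebra_simps)
      then show ?thesis using s(2) by simp
    qed
    ultimately show ?thesis using z(1,2) ab by (intro bexI[of _ z]) (auto simp: min_def max_def split: if_splits)
  qed
  have "dist ((?F s - ?F t) / (s - t)) (LINT x:G|lebesgue. H t x) < e" if s: "s \<in> {0..\<tau>}" "s \<noteq> t" "\<bar>s - t\<bar> < \<delta>" for s
  proof -
    have kd: "set_integrable lebesgue G (\<lambda>x. (k s x - k t x) / (s - t))"
      using set_integral_diff(1)[OF int[OF s(1)] int[OF t]] by (intro set_integrable_divide) auto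
    have "(?F s - ?F t) / (s - t) - (LINT x:G|lebesgue. H t x) = (LINT x:G|lebesgue. (k s x - k t x) / (s - t) - H t x)"
      using set_integral_diff(2)[OF kd H(2)] set_integral_diff(2)[OF int[OF s(1)] int[OF t]] by simp
    also have "norm \<dots> \<le> c * measure lebesgue G"
    proof (rule set_integral_bound[OF G(1,2)])
      fix x assume x: "x \<in> G"
      obtain z where z: "z \<in> {0..\<tau>}" "\<bar>z - t\<bar> \<le> \<bar>s - t\<bar>" "(k s x - k t x) / (s - t) = H z x" using mvt[OF s(1,2) x] by blast
      show "norm ((k s x - k t x) / (s - t) - H t x) \<le> c"
        unfolding z(3) using \<delta>(2)[OF z(1) t, of x] x G(3) z(2) s(3) by (auto intro: less_imp_le)
    qed (use c in simp)
    finally show ?thesis using ce by (simp add: dist_norm)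
  qed
  then show "\<forall>\<^sub>F s in at t within {0..\<tau>}. dist ((?F s - ?F t) / (s - t)) (LINT x:G|lebesgue. H t x) < e"
    unfolding eventually_at using \<delta>(1) by (intro exI[of _ \<delta>]) (auto simp: dist_real_def)
qed

section \<open>Storage density and velocity\<close>

text \<open>
  The potential as a function of position and state is needed up to the boundary of \<open>\<Omega>\<close>; there it is the
  continuous extension that \<open>Ck_on\<close> provides.
\<close>

lemma storage_derivative:
  fixes \<psi> :: "real^'d::finite \<Rightarrow> real^'m::finite \<Rightarrow> real"
  assumes C2: "Ck_on 2 (closure \<Omega> \<times> U) (\<lambda>(x, v). \<psi> x v)" and \<Omega>: "open \<Omega>" and U: "open U"
  obtains m where "continuous_on (closure \<Omega> \<times> U) (\<lambda>(x, y). m x y)"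
    "\<And>x y. x \<in> \<Omega> \<Longrightarrow> y \<in> U \<Longrightarrow> (\<psi> x has_derivative (\<lambda>h. m x y \<bullet> h)) (at y)"
proof -
  let ?S = "closure \<Omega> \<times> U" and ?f = "\<lambda>(x, v). \<psi> x v"
  have "Ck_on (Suc (Suc 0)) ?S ?f" using C2 by (simp add: numeral_2_eq_2)
  then obtain f' where d: "\<And>z. z \<in> interior ?S \<Longrightarrow> (?f has_derivative f' z) (at z)"
    and c: "\<And>b. b \<in> Basis \<Longrightarrow> continuous_on ?S (\<lambda>z. f' z b)" by auto
  define m where "m x y = (\<chi> i. f' (x, y) (0, axis i 1))" for x y
  show ?thesis
  proof (rule that)
    have "(0, axis i 1) \<in> (Basis :: ((real^'d) \<times> (real^'m)) set)" for i by (auto simp: Basis_prod_def)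
    then have "continuous_on ?S (\<lambda>z. \<chi> i. f' z (0, axis i 1))" by (intro continuous_on_vec_lambda c)
    then show "continuous_on ?S (\<lambda>(x, y). m x y)" by (simp add: m_def case_prod_unfold)
    fix x y assume xy: "x \<in> \<Omega>" "y \<in> U"
    have "open (\<Omega> \<times> U)" using \<Omega> U by (rule open_Times)
    then have "\<Omega> \<times> U \<subseteq> interior ?S" using closure_subset by (intro interior_maximal) auto
    then have D': "(?f has_derivative f' (x, y)) (at (x, y))" using d xy by blast
    have "((\<lambda>y. (x, y)) has_derivative (\<lambda>h. (0, h))) (at y)"
      by (intro has_derivative_Pair has_derivative_const has_derivative_ident)
    from has_derivative_compose[OF this D']
    have D: "(\<psi> x has_derivative (\<lambda>h. f' (x, y) (0, h))) (at y)" by simp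
    have "f' (x, y) (0, h) = m x y \<bullet> h" for h
    proof -
      interpret linear "\<lambda>h. f' (x, y) (0, h)" by (rule has_derivative_linear[OF D])
      have "f' (x, y) (0, h) = f' (x, y) (0, \<Sum>i\<in>UNIV. h $ i *\<^sub>R axis i 1)"
        using basis_expansion[of h] by (simp add: scalar_mult_eq_scaleR)
      also have "\<dots> = (\<Sum>i\<in>UNIV. h $ i * f' (x, y) (0, axis i 1))"
        by (simp add: sum scale)
      finally show ?thesis by (simp add: m_def inner_vec_def mult.commute)
    qed
    then show "(\<psi> x has_derivative (\<lambda>h. m x y \<bullet> h)) (at y)" using D by simp
  qed
qed

text \<open>
  At the end points and on the boundary \<open>v\<close> is only a continuous extension of the time derivative.
\<close>

lemma velocity:
  fixes u :: "real \<Rightarrow> real^'d::finite \<Rightarrow> real^'m::finite"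
  assumes C1: "Ck_on 1 ({0..\<tau>} \<times> closure \<Omega>) (\<lambda>(t, x). u t x)" and \<Omega>: "open \<Omega>"
  obtains v where "continuous_on ({0..\<tau>} \<times> closure \<Omega>) (\<lambda>(t, x). v t x)"
    "\<And>t x. t \<in> {0<..<\<tau>} \<Longrightarrow> x \<in> \<Omega> \<Longrightarrow> ((\<lambda>s. u s x) has_vector_derivative v t x) (at t)"
proof -
  let ?S = "{0..\<tau>} \<times> closure \<Omega>" and ?f = "\<lambda>(t, x). u t x"
  have "Ck_on (Suc 0) ?S ?f" using C1 by simp
  then obtain f' where d: "\<And>z. z \<in> interior ?S \<Longrightarrow> (?f has_derivative f' z) (at z)"
    and c: "\<And>b. b \<in> Basis \<Longrightarrow> continuous_on ?S (\<lambda>z. f' z b)" by auto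
  show ?thesis
  proof (rule that)
    have "(1, 0) \<in> (Basis :: (real \<times> (real^'d)) set)" by (auto simp: Basis_prod_def)
    then show "continuous_on ?S (\<lambda>(t, x). f' (t, x) (1, 0))" using c by (simp add: case_prod_unfold)
    fix t x assume tx: "t \<in> {0<..<\<tau>}" "x \<in> \<Omega>"
    have "open ({0<..<\<tau>} \<times> \<Omega>)" using \<Omega> by (intro open_Times) auto
    then have "{0<..<\<tau>} \<times> \<Omega> \<subseteq> interior ?S" using closure_subset by (intro interior_maximal) auto
    then have D: "(?f has_derivative f' (t, x)) (at (t, x))" using d tx by blast
    have "((\<lambda>s. (s, x)) has_derivative (\<lambda>h. (h, 0))) (at t)"
      by (intro has_derivative_Pair has_derivative_const has_derivative_ident)
    from has_derivative_compose[OF this D]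
    have "((\<lambda>s. u s x) has_derivative (\<lambda>h. f' (t, x) (h, 0))) (at t)" by simp
    moreover have "(\<lambda>h. f' (t, x) (h, 0)) = (\<lambda>h. h *\<^sub>R f' (t, x) (1, 0))"
    proof
      fix h show "f' (t, x) (h, 0) = h *\<^sub>R f' (t, x) (1, 0)"
        using linear_scale[OF has_derivative_linear[OF D], of h "(1, 0)"] by simp
    qed
    ultimately show "((\<lambda>s. u s x) has_vector_derivative f' (t, x) (1, 0)) (at t)"
      by (simp only: has_vector_derivative_def)
  qed
qed

text \<open>
  Tested with a smooth function, both sides of the evolution equation depend continuously on time, so the
  weak equation carries over from almost all times to all; and it determines the divergence.
\<close>

lemma evolution_equation_everywhere:
  fixes J1 J2 :: "real \<Rightarrow> real^'d::finite \<Rightarrow> real^'d^'m::finite" and R v :: "real \<Rightarrow> real^'d \<Rightarrow> real^'m"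
  assumes \<Omega>: "open \<Omega>" and \<tau>: "\<tau> > 0"
    and J1: "L1_continuous \<Omega> \<tau> J1" "\<And>t. t \<in> {0..\<tau>} \<Longrightarrow> set_integrable lebesgue \<Omega> (J1 t)" "\<And>t. t \<in> {0..\<tau>} \<Longrightarrow> has_row_div \<Omega> (J1 t)"
    and J2: "L1_continuous \<Omega> \<tau> J2" "\<And>t. t \<in> {0..\<tau>} \<Longrightarrow> set_integrable lebesgue \<Omega> (J2 t)" "\<And>t. t \<in> {0..\<tau>} \<Longrightarrow> has_row_div \<Omega> (J2 t)"
    and R: "L1_continuous \<Omega> \<tau> R" "\<And>t. t \<in> {0..\<tau>} \<Longrightarrow> set_integrable lebesgue \<Omega> (R t)"
    and v: "L1_continuous \<Omega> \<tau> v" "\<And>t. t \<in> {0..\<tau>} \<Longrightarrow> set_integrable lebesgue \<Omega> (v t)"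
    and eq: "AE t in lebesgue. t \<in> {0<..<\<tau>} \<longrightarrow> (AE x in lebesgue. x \<in> \<Omega> \<longrightarrow> v t x + row_div \<Omega> (\<lambda>x. J1 t x + J2 t x) x = R t x)"
    and t: "t \<in> {0..\<tau>}"
  shows "AE x in lebesgue. x \<in> \<Omega> \<longrightarrow> row_div \<Omega> (J1 t) x + row_div \<Omega> (J2 t) x = R t x - v t x"
proof -
  define J where "J t x = J1 t x + J2 t x" for t x
  have Jsum: "has_weak_div \<Omega> (\<lambda>x. J s x $ i) (\<lambda>x. row_div \<Omega> (J1 s) x $ i + row_div \<Omega> (J2 s) x $ i)"
    if s: "s \<in> {0..\<tau>}" for s i
    unfolding J_def vector_add_component
    by (intro has_weak_div_add has_weak_div_row_div set_integrable_component J1 J2 s)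
  have Jdiv: "has_weak_div \<Omega> (\<lambda>x. J s x $ i) (\<lambda>x. row_div \<Omega> (J s) x $ i)" if s: "s \<in> {0..\<tau>}" for s i
    by (rule has_weak_div_row_div) (use Jsum[OF s] in \<open>auto simp: has_row_div_def\<close>)
  have iRv: "set_integrable lebesgue \<Omega> (\<lambda>x. (R s x - v s x) $ i)" if s: "s \<in> {0..\<tau>}" for s i
    by (intro set_integrable_component set_integral_diff R v s)
  have iJ: "set_integrable lebesgue \<Omega> (\<lambda>x. J s x $ i)" if s: "s \<in> {0..\<tau>}" for s i
    unfolding J_def by (intro set_integrable_component set_integral_add J1 J2 s)
  have weak: "has_weak_div \<Omega> (\<lambda>x. J t x $ i) (\<lambda>x. (R t x - v t x) $ i)" for i
    unfolding has_weak_div_def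
  proof (intro conjI ballI locally_integrableI iRv t)
    fix \<phi> assume \<phi>: "\<phi> \<in> test_functions \<Omega>"
    note m = test_function_measurable[OF \<phi>]
    obtain B where B: "\<And>x. \<bar>\<phi> x\<bar> \<le> B" "\<And>x. norm (grad \<phi> x) \<le> B" using test_function_bounded[OF \<phi>] by blast
    define h :: "real^'d \<Rightarrow> real^'m" where "h x = \<phi> x *\<^sub>R axis i 1" for x
    define k :: "real^'d \<Rightarrow> real^'d^'m" where "k x = axis i (grad \<phi> x)" for x
    have h: "h \<in> borel_measurable borel" "norm (h x) \<le> B" for x
      unfolding h_def[abs_def] using m(1) B(1)[of x] by (auto simp: norm_axis_1)
    have k: "k \<in> borel_measurable borel" "norm (k x) \<le> B" for x
    proof -
      have "continuous_on UNIV k" unfolding k_def axis_def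
      proof (intro continuous_on_vec_lambda)
        fix j show "continuous_on UNIV (\<lambda>x. if j = i then grad \<phi> x else 0)"
          by (cases "j = i") (simp_all add: grad_test_function(3)[OF \<phi>])
      qed
      then show "k \<in> borel_measurable borel" by (rule borel_measurable_continuous_onI)
      have "norm (k x) = norm (grad \<phi> x)"
        unfolding k_def norm_eq_sqrt_inner inner_axis' by (simp add: axis_def)
      then show "norm (k x) \<le> B" using B(2)[of x] by simp
    qed
    define \<Phi> where "\<Phi> s = (LINT x:\<Omega>|lebesgue. R s x \<bullet> h x) - (LINT x:\<Omega>|lebesgue. v s x \<bullet> h x) +
       ((LINT x:\<Omega>|lebesgue. J1 s x \<bullet> k x) + (LINT x:\<Omega>|lebesgue. J2 s x \<bullet> k x))" for s
    have \<Phi>: "\<Phi> s = distr_fun \<Omega> (\<lambda>x. (R s x - v s x) $ i) \<phi> - distr_div \<Omega> (\<lambda>x. J s x $ i) \<phi>" if s: "s \<in> {0..\<tau>}" for s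
    proof -
      have "(LINT x:\<Omega>|lebesgue. R s x \<bullet> h x) - (LINT x:\<Omega>|lebesgue. v s x \<bullet> h x) = (LINT x:\<Omega>|lebesgue. R s x \<bullet> h x - v s x \<bullet> h x)"
        by (intro set_integral_diff(2)[symmetric] set_integrable_inner_bounded[OF _ h] R v s)
      moreover have "(LINT x:\<Omega>|lebesgue. J1 s x \<bullet> k x) + (LINT x:\<Omega>|lebesgue. J2 s x \<bullet> k x) = (LINT x:\<Omega>|lebesgue. J1 s x \<bullet> k x + J2 s x \<bullet> k x)"
        by (intro set_integral_add(2)[symmetric] set_integrable_inner_bounded[OF _ k] J1 J2 s)
      ultimately show ?thesis
        by (simp add: \<Phi>_def distr_fun_def distr_div_def h_def k_def J_def inner_axis inner_add_left right_diff_distrib mult.commute)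
    qed
    have "\<Phi> t = 0"
    proof (rule AE_zero_imp_zero[OF _ _ \<tau> t])
      show "continuous_on {0..\<tau>} \<Phi>"
        unfolding \<Phi>_def using J1 J2 R v
        by (intro continuous_on_add continuous_on_diff continuous_on_pairing[OF _ _ h] continuous_on_pairing[OF _ _ k])
      show "AE s in lebesgue. s \<in> {0<..<\<tau>} \<longrightarrow> \<Phi> s = 0"
        using eq
      proof eventually_elim
        case (elim s)
        show ?case
        proof
          assume s0: "s \<in> {0<..<\<tau>}"
          then have s: "s \<in> {0..\<tau>}" by simp
          have ae: "AE x in lebesgue. x \<in> \<Omega> \<longrightarrow> row_div \<Omega> (J s) x $ i = (R s x - v s x) $ i"
            using elim[rule_format, OF s0] 
          proof eventually_elim
            case (elim x)
            show ?case
            proof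
              assume "x \<in> \<Omega>"
              then have "R s x = v s x + row_div \<Omega> (J s) x" using elim by (simp add: J_def[abs_def])
              then show "row_div \<Omega> (J s) x $ i = (R s x - v s x) $ i" by simp
            qed
          qed
          have "distr_fun \<Omega> (\<lambda>x. (R s x - v s x) $ i) \<phi> = distr_fun \<Omega> (\<lambda>x. row_div \<Omega> (J s) x $ i) \<phi>"
            unfolding distr_fun_def set_lebesgue_integral_def
          proof (rule integral_cong_AE)
            show "(\<lambda>x. indicator \<Omega> x *\<^sub>R ((R s x - v s x) $ i * \<phi> x)) \<in> borel_measurable lebesgue"
              using set_integrable_test[OF locally_integrableI[OF iRv[OF s]] \<phi>] unfolding set_integrable_def by (rule borel_measurable_integrable)
            have "locally_integrable \<Omega> (\<lambda>x. row_div \<Omega> (J s) x $ i)" using Jdiv[OF s] by (simp add: has_weak_div_def)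
            from set_integrable_test[OF this \<phi>]
            show "(\<lambda>x. indicator \<Omega> x *\<^sub>R (row_div \<Omega> (J s) x $ i * \<phi> x)) \<in> borel_measurable lebesgue"
              unfolding set_integrable_def by (rule borel_measurable_integrable)
            show "AE x in lebesgue. indicator \<Omega> x *\<^sub>R ((R s x - v s x) $ i * \<phi> x) = indicator \<Omega> x *\<^sub>R (row_div \<Omega> (J s) x $ i * \<phi> x)"
              using ae by eventually_elim (auto simp: indicator_def)
          qed
          then show "\<Phi> s = 0" using Jdiv[OF s] \<phi> by (simp add: \<Phi>[OF s] has_weak_div_def)
        qed
      qed
    qed
    then show "distr_div \<Omega> (\<lambda>x. J t x $ i) \<phi> = distr_fun \<Omega> (\<lambda>x. (R t x - v t x) $ i) \<phi>" by (simp add: \<Phi>[OF t])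
  qed
  have "AE x in lebesgue. x \<in> \<Omega> \<longrightarrow> row_div \<Omega> (J1 t) x $ i + row_div \<Omega> (J2 t) x $ i = (R t x - v t x) $ i" for i
    by (rule has_weak_div_unique[OF \<Omega> Jsum[OF t] weak])
  then have "AE x in lebesgue. \<forall>i\<in>UNIV. x \<in> \<Omega> \<longrightarrow> row_div \<Omega> (J1 t) x $ i + row_div \<Omega> (J2 t) x $ i = (R t x - v t x) $ i"
    by (intro AE_finite_allI) auto
  then show ?thesis by eventually_elim (simp add: vec_eq_iff)
qed

section \<open>The local balance\<close>

text \<open>
  Admissibility turns the product of the potential with the evolution equation into an equation between the
  divergence of \<open>q\<close> and an integrable function.  Here \<open>a\<close> is the field at a fixed time and \<open>y\<close> its velocity.
\<close>

lemma q_total_weakly_divergent: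
  fixes T :: "('d::finite, 'm::finite, 'ye::{real_vector,topological_space},
                'yf::{real_vector,topological_space}) ct_system"
    and \<mu> y :: "real^'d \<Rightarrow> real^'m"
  assumes \<Omega>: "open (region T)" "bounded (region T)" and adm: "admissible_with T W"
    and a: "smooth_field T (smoothness W) a"
    and \<mu>: "continuous_on (closure (region T)) \<mu>" "\<And>x. x \<in> region T \<Longrightarrow> potential T a x = \<mu> x"
    and evol: "AE x in lebesgue. x \<in> region T \<longrightarrow>
      row_div (region T) (flux_rev T a) x + row_div (region T) (flux_diss T a) x = source T a x - y x"
    and y: "set_integrable lebesgue (region T) y"
  shows "set_integrable lebesgue (region T) (\<lambda>x. \<mu> x \<bullet> y x)"
    and "weakly_divergent (region T) (q_total W a)
      (\<lambda>x. potential T a x \<bullet> source T a x - \<mu> x \<bullet> y x - prod_density W a x)"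
proof -
  let ?\<Omega> = "region T" and ?\<sigma> = "prod_density W a"
  let ?w = "\<lambda>x. potential T a x \<bullet> source T a x - \<mu> x \<bullet> y x - ?\<sigma> x"
  let ?r = "\<lambda>x. potential T a x \<bullet> row_div ?\<Omega> (flux_rev T a) x" and ?d = "\<lambda>x. potential T a x \<bullet> row_div ?\<Omega> (flux_diss T a) x"
  have af: "a \<in> field_space T" and rd: "has_row_div ?\<Omega> (flux_rev T a)" "has_row_div ?\<Omega> (flux_diss T a)"
    using a by (auto simp: smooth_field_def)
  have K: "compact (closure ?\<Omega>)" using bounded_closure[OF \<Omega>(2)] by (simp add: compact_eq_bounded_closed)
  define \<mu>' where "\<mu>' x = indicator (closure ?\<Omega>) x *\<^sub>R \<mu> x" for x
  have \<mu>'m: "\<mu>' \<in> borel_measurable borel" unfolding \<mu>'_def[abs_def] by (rule zero_extension(1)[OF \<mu>(1) K])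
  obtain B where B: "\<And>x. norm (\<mu>' x) \<le> B" using zero_extension(2)[OF \<mu>(1) K] unfolding \<mu>'_def by blast
  have \<mu>': "\<mu>' x = \<mu> x" "potential T a x = \<mu>' x" if "x \<in> ?\<Omega>" for x
    using that closure_subset[of ?\<Omega>] \<mu>(2)[OF that] by (auto simp: \<mu>'_def)
  have "set_integrable lebesgue ?\<Omega> (\<lambda>x. y x \<bullet> \<mu>' x)" by (rule set_integrable_inner_bounded[OF y \<mu>'m B])
  then show iy: "set_integrable lebesgue ?\<Omega> (\<lambda>x. \<mu> x \<bullet> y x)"
    by (rule set_integrable_cong[THEN iffD1, rotated 3]) (auto simp: \<mu>' inner_commute)
  note adm' = adm[unfolded admissible_with_def]
  have L1: "set_integrable lebesgue ?\<Omega> (q_rev W a)" "set_integrable lebesgue ?\<Omega> (q_diss W a)" "set_integrable lebesgue ?\<Omega> ?\<sigma>"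
    using adm' af by (auto simp: L1_map_def)
  have cont: "continuous_on (closure ?\<Omega>) (q_rev W a)" "continuous_on (closure ?\<Omega>) (q_diss W a)"
    and src: "set_integrable lebesgue ?\<Omega> (\<lambda>x. potential T a x \<bullet> source T a x)"
    and w1: "\<And>\<phi>. \<phi> \<in> test_functions ?\<Omega> \<Longrightarrow> distr_fun ?\<Omega> ?r \<phi> = distr_div ?\<Omega> (q_rev W a) \<phi>"
    and w2: "\<And>\<phi>. \<phi> \<in> test_functions ?\<Omega> \<Longrightarrow> distr_fun ?\<Omega> ?d \<phi> = distr_div ?\<Omega> (q_diss W a) \<phi> + distr_fun ?\<Omega> ?\<sigma> \<phi>"
    using adm' a by blast+
  have iw: "set_integrable lebesgue ?\<Omega> ?w" by (intro set_integral_diff src iy L1)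
  have lr: "locally_integrable ?\<Omega> (\<lambda>x. potential T a x \<bullet> row_div ?\<Omega> J x)" if J: "has_row_div ?\<Omega> J" for J
    unfolding locally_integrable_def
  proof (intro allI impI)
    fix C assume C: "compact C \<and> C \<subseteq> ?\<Omega>"
    have "locally_integrable ?\<Omega> (\<lambda>x. row_div ?\<Omega> J x $ i)" for i
      using has_weak_div_row_div[OF J] by (simp add: has_weak_div_def)
    then have ci: "set_integrable lebesgue C (\<lambda>x. row_div ?\<Omega> J x $ i)" for i
      using C unfolding locally_integrable_def by blast
    have "set_integrable lebesgue C (\<lambda>x. row_div ?\<Omega> J x $ i \<bullet> \<mu>' x $ i)" for i
    proof (rule set_integrable_inner_bounded[OF ci])
      show "(\<lambda>x. \<mu>' x $ i) \<in> borel_measurable borel"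
      proof -
        have "(\<lambda>x. \<mu>' x \<bullet> axis i 1) \<in> borel_measurable borel" using \<mu>'m by measurable
        then show ?thesis by (simp add: inner_axis)
      qed
      show "norm (\<mu>' x $ i) \<le> B" for x using component_le_norm_cart[of "\<mu>' x" i] B[of x] by simp
    qed
    then have "set_integrable lebesgue C (\<lambda>x. \<Sum>i\<in>UNIV. row_div ?\<Omega> J x $ i \<bullet> \<mu>' x $ i)"
      unfolding set_integrable_def scaleR_sum_right by (intro Bochner_Integration.integrable_sum)
    moreover have "C \<in> sets lebesgue" using C fmeasurableD lmeasurable_compact by blast
    ultimately show "set_integrable lebesgue C (\<lambda>x. potential T a x \<bullet> row_div ?\<Omega> J x)"
      using C \<mu>'(2) by (subst set_integrable_cong[of _ lebesgue _ C _ "\<lambda>x. \<Sum>i\<in>UNIV. row_div ?\<Omega> J x $ i \<bullet> \<mu>' x $ i"])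
         (auto simp: inner_vec_def mult.commute subset_iff)
  qed
  have weak: "distr_fun ?\<Omega> ?w \<phi> = distr_div ?\<Omega> (q_total W a) \<phi>" if \<phi>: "\<phi> \<in> test_functions ?\<Omega>" for \<phi>
  proof -
    have "distr_fun ?\<Omega> ?w \<phi> = distr_fun ?\<Omega> (\<lambda>x. ?r x + ?d x - ?\<sigma> x) \<phi>"
      unfolding distr_fun_def set_lebesgue_integral_def
    proof (rule integral_cong_AE)
      show "(\<lambda>x. indicator ?\<Omega> x *\<^sub>R (?w x * \<phi> x)) \<in> borel_measurable lebesgue"
        using set_integrable_test[OF locally_integrableI[OF iw] \<phi>] unfolding set_integrable_def by (rule borel_measurable_integrable)
      have "locally_integrable ?\<Omega> (\<lambda>x. ?r x + ?d x - ?\<sigma> x)"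
        by (intro locally_integrable_add locally_integrable_diff lr rd locally_integrableI[OF L1(3)])
      from set_integrable_test[OF this \<phi>]
      show "(\<lambda>x. indicator ?\<Omega> x *\<^sub>R ((?r x + ?d x - ?\<sigma> x) * \<phi> x)) \<in> borel_measurable lebesgue"
        unfolding set_integrable_def by (rule borel_measurable_integrable)
      show "AE x in lebesgue. indicator ?\<Omega> x *\<^sub>R (?w x * \<phi> x) = indicator ?\<Omega> x *\<^sub>R ((?r x + ?d x - ?\<sigma> x) * \<phi> x)"
        using evol
      proof eventually_elim
        case (elim x)
        show ?case
        proof (cases "x \<in> ?\<Omega>")
          case True
          then have "?r x + ?d x = potential T a x \<bullet> source T a x - \<mu> x \<bullet> y x"
            using elim \<mu>(2)[OF True] by (simp add: inner_add_right[symmetric] inner_diff_right)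
          then show ?thesis by simp
        qed simp
      qed
    qed
    also have "\<dots> = distr_fun ?\<Omega> ?r \<phi> + distr_fun ?\<Omega> ?d \<phi> - distr_fun ?\<Omega> ?\<sigma> \<phi>"
      by (simp add: distr_fun_diff distr_fun_add locally_integrable_add lr rd locally_integrableI[OF L1(3)] \<phi>)
    also have "\<dots> = distr_div ?\<Omega> (q_rev W a) \<phi> + distr_div ?\<Omega> (q_diss W a) \<phi>" by (simp add: w1[OF \<phi>] w2[OF \<phi>])
    also have "\<dots> = distr_div ?\<Omega> (q_total W a) \<phi>"
      using distr_div_add[OF L1(1,2) \<phi>] by (simp add: q_total_def[abs_def])
    finally show ?thesis .
  qed
  show "weakly_divergent ?\<Omega> (q_total W a) ?w"
  proof
    show "open ?\<Omega>" "bounded ?\<Omega>" by (fact \<Omega>)+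
    show "continuous_on (closure ?\<Omega>) (q_total W a)"
      unfolding q_total_def[abs_def] by (intro continuous_on_add cont)
    show "set_integrable lebesgue ?\<Omega> ?w" by (rule iw)
    show "(LINT x:?\<Omega>|lebesgue. q_total W a x \<bullet> grad \<phi> x) = - (LINT x:?\<Omega>|lebesgue. ?w x * \<phi> x)"
      if "\<phi> \<in> test_functions ?\<Omega>" for \<phi>
      using weak[OF that] by (simp add: distr_fun_def distr_div_def)
  qed
qed

lemma frontier_integral_split:
  fixes f :: "real^'n::finite \<Rightarrow> real"
  assumes \<Omega>: "open \<Omega>" and G: "open G" "G \<subseteq> \<Omega>" and f: "set_integrable surface_measure (frontier G) f"
  shows "(LINT y:frontier G|surface_measure. f y) =
    (LINT y:frontier G \<inter> frontier \<Omega>|surface_measure. f y) + (LINT y:frontier G \<inter> \<Omega>|surface_measure. f y)"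
proof -
  have "frontier G \<subseteq> frontier \<Omega> \<union> \<Omega>"
    using closure_mono[OF G(2)] by (auto simp: frontier_def interior_open \<Omega>)
  then have eq: "frontier G = (frontier G \<inter> frontier \<Omega>) \<union> (frontier G \<inter> \<Omega>)" by blast
  have disj: "(frontier G \<inter> frontier \<Omega>) \<inter> (frontier G \<inter> \<Omega>) = {}" using \<Omega> by (auto simp: frontier_def interior_open)
  have "frontier G \<in> sets borel" "frontier \<Omega> \<in> sets borel" "\<Omega> \<in> sets borel" using \<Omega> by auto
  then have m: "frontier G \<inter> frontier \<Omega> \<in> sets surface_measure" "frontier G \<inter> \<Omega> \<in> sets surface_measure"
    using sets_borel_subset_surface by blast+
  have "set_integrable surface_measure (frontier G \<inter> frontier \<Omega>) f" "set_integrable surface_measure (frontier G \<inter> \<Omega>) f"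
    by (rule set_integrable_subset[OF f]; use m in blast)+
  from set_integral_Un[OF disj this] show ?thesis using eq by simp
qed

theorem theorem4p5:
  fixes T :: "('d::finite, 'm::finite, 'ye::{real_vector,topological_space},
                'yf::{real_vector,topological_space}) ct_system"
    and W :: "('d, 'm) ct_witness"
    and u :: "real \<Rightarrow> real^'d \<Rightarrow> real^'m"
    and G :: "(real^'d) set"
  assumes "open_ct_system T"
    and "admissible_with T W"
    and "consistent T W"
    and "smooth_trajectory T W \<tau> u"
    and "lipschitz_domain G" and "G \<subseteq> region T"
    and "t \<in> {0..\<tau>}"
  shows "((\<lambda>s. free_energy_on T G (u s)) has_real_derivative
            - dissipation_on W G (u t) + exchange_ext T W G (u t) + exchange_int T W G (u t)
            + source_on T G (u t)) (at t within {0..\<tau>})"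
proof -
  let ?\<Omega> = "region T" and ?U = "states T"
  note adm = assms(2) and G = assms(5,6) and t = assms(7)
  have \<Omega>: "open ?\<Omega>" "bounded ?\<Omega>" and U: "open ?U"
    and C2: "Ck_on 2 (closure ?\<Omega> \<times> ?U) (\<lambda>(x, v). storage T x v)"
    and L1: "L1_map T (flux_rev T)" "L1_map T (flux_diss T)" "L1_map T (source T)"
    using assms(1) by (simp_all add: open_ct_system_def lipschitz_domain_def)
  have \<tau>: "\<tau> > 0" and sf: "\<And>s. s \<in> {0..\<tau>} \<Longrightarrow> smooth_field T (smoothness W) (u s)"
    and C1: "Ck_on 1 ({0..\<tau>} \<times> closure ?\<Omega>) (\<lambda>(t, x). u t x)"
    and L1c: "L1_continuous ?\<Omega> \<tau> (\<lambda>t. flux_rev T (u t))" "L1_continuous ?\<Omega> \<tau> (\<lambda>t. flux_diss T (u t))"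
      "L1_continuous ?\<Omega> \<tau> (\<lambda>t. source T (u t))"
    and evol: "AE t in lebesgue. t \<in> {0<..<\<tau>} \<longrightarrow> (AE x in lebesgue. x \<in> ?\<Omega> \<longrightarrow>
        vector_derivative (\<lambda>s. u s x) (at t) +
        row_div ?\<Omega> (\<lambda>x. flux_rev T (u t) x + flux_diss T (u t) x) x = source T (u t) x)"
    using assms(4) by (auto simp: smooth_trajectory_def)
  have G': "open G" "bounded G" using G bounded_subset[OF \<Omega>(2)] by (auto simp: lipschitz_domain_def)
  have Gm: "G \<in> sets lebesgue" "emeasure lebesgue G < \<infinity>" using G' emeasure_bounded_finite[OF G'(2)] by auto
  have K: "compact (closure ?\<Omega>)" using bounded_closure[OF \<Omega>(2)] by (simp add: compact_eq_bounded_closed)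
  have fld: "u s \<in> field_space T" and inU: "\<And>x. x \<in> closure ?\<Omega> \<Longrightarrow> u s x \<in> ?U"
    and rd: "has_row_div ?\<Omega> (flux_rev T (u s))" "has_row_div ?\<Omega> (flux_diss T (u s))" if "s \<in> {0..\<tau>}" for s
    using sf[OF that] by (auto simp: smooth_field_def)
  have cu: "continuous_on ({0..\<tau>} \<times> closure ?\<Omega>) (\<lambda>(t, x). u t x)" using C1 by simp
  obtain m where m: "continuous_on (closure ?\<Omega> \<times> ?U) (\<lambda>(x, y). m x y)"
    "\<And>x y. x \<in> ?\<Omega> \<Longrightarrow> y \<in> ?U \<Longrightarrow> (storage T x has_derivative (\<lambda>h. m x y \<bullet> h)) (at y)"
    using storage_derivative[OF C2 \<Omega>(1) U] by blast
  obtain v where v: "continuous_on ({0..\<tau>} \<times> closure ?\<Omega>) (\<lambda>(t, x). v t x)"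
    "\<And>t x. t \<in> {0<..<\<tau>} \<Longrightarrow> x \<in> ?\<Omega> \<Longrightarrow> ((\<lambda>s. u s x) has_vector_derivative v t x) (at t)"
    using velocity[OF C1 \<Omega>(1)] by blast
  have pot: "potential T (u s) x = m x (u s x)" if "s \<in> {0..\<tau>}" "x \<in> ?\<Omega>" for s x
    unfolding potential_def using that inU closure_subset by (intro grad_eq m(2)) auto
  have c\<mu>: "continuous_on ({0..\<tau>} \<times> closure ?\<Omega>) (\<lambda>(s, x). m x (u s x))"
  proof -
    have "continuous_on ({0..\<tau>} \<times> closure ?\<Omega>) (\<lambda>z. (snd z, u (fst z) (snd z)))"
      using cu by (intro continuous_intros) (simp add: case_prod_unfold)
    from continuous_on_compose2[OF m(1) this] show ?thesis using inU by (force simp: case_prod_unfold)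
  qed
  have slice: "continuous_on (closure ?\<Omega>) (\<lambda>x. m x (u t x))"
  proof -
    have "continuous_on (closure ?\<Omega>) (\<lambda>x. (t, x))" by (intro continuous_intros)
    moreover have "(\<lambda>x. (t, x)) ` closure ?\<Omega> \<subseteq> {0..\<tau>} \<times> closure ?\<Omega>" using t by auto
    ultimately have "continuous_on (closure ?\<Omega>) (\<lambda>x. case (t, x) of (s, x) \<Rightarrow> m x (u s x))"
      by (rule continuous_on_compose2[OF c\<mu>])
    then show ?thesis by simp
  qed
  have iv: "set_integrable lebesgue ?\<Omega> (v s)" if "s \<in> {0..\<tau>}" for s by (rule set_integrable_slice[OF v(1) \<Omega> that])
  have evol_t: "AE x in lebesgue. x \<in> ?\<Omega> \<longrightarrow>
      row_div ?\<Omega> (flux_rev T (u t)) x + row_div ?\<Omega> (flux_diss T (u t)) x = source T (u t) x - v t x"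
  proof (rule evolution_equation_everywhere[OF \<Omega>(1) \<tau> L1c(1) _ rd(1) L1c(2) _ rd(2) L1c(3) _ L1_continuous_of_continuous[OF v(1) \<Omega>] iv _ t])
    show "AE t in lebesgue. t \<in> {0<..<\<tau>} \<longrightarrow> (AE x in lebesgue. x \<in> ?\<Omega> \<longrightarrow>
        v t x + row_div ?\<Omega> (\<lambda>x. flux_rev T (u t) x + flux_diss T (u t) x) x = source T (u t) x)"
      using evol
    proof eventually_elim
      case (elim s)
      show ?case
      proof
        assume s: "s \<in> {0<..<\<tau>}"
        show "AE x in lebesgue. x \<in> ?\<Omega> \<longrightarrow>
          v s x + row_div ?\<Omega> (\<lambda>x. flux_rev T (u s) x + flux_diss T (u s) x) x = source T (u s) x"
          using elim[rule_format, OF s] by eventually_elim (simp add: vector_derivative_at[OF v(2)[OF s]])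
      qed
    qed
  qed (use L1 fld in \<open>auto simp: L1_map_def\<close>)
  note wd = q_total_weakly_divergent[OF \<Omega> adm sf[OF t] slice pot[OF t] evol_t iv[OF t]]
  interpret weakly_divergent ?\<Omega> "q_total W (u t)"
    "\<lambda>x. potential T (u t) x \<bullet> source T (u t) x - m x (u t x) \<bullet> v t x - prod_density W (u t) x"
    by (rule wd(2))
  \<comment> \<open>The energy balance at time \<open>t\<close>, integrated over \<open>G\<close>.\<close>
  note div = divergence_theorem[OF G]
  have iG: "set_integrable lebesgue G f" if "set_integrable lebesgue ?\<Omega> f" for f :: "real^'d \<Rightarrow> real"
    by (rule set_integrable_subset[OF that Gm(1) G(2)])
  have src: "set_integrable lebesgue G (\<lambda>x. potential T (u t) x \<bullet> source T (u t) x)"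
    and prd: "set_integrable lebesgue G (prod_density W (u t))"
    using adm sf[OF t] fld[OF t] by (auto intro!: iG simp: admissible_with_def L1_map_def)
  have "(LINT x:G|lebesgue. potential T (u t) x \<bullet> source T (u t) x - m x (u t x) \<bullet> v t x - prod_density W (u t) x) =
      source_on T G (u t) - (LINT x:G|lebesgue. m x (u t x) \<bullet> v t x) - dissipation_on W G (u t)"
    unfolding source_on_def dissipation_on_def
    using set_integral_diff[OF src iG[OF wd(1)]] set_integral_diff(2)[OF _ prd] by simp
  moreover have "\<dots> = - exchange_ext T W G (u t) - exchange_int T W G (u t)"
    unfolding calculation[symmetric] div(2) frontier_integral_split[OF \<Omega>(1) G'(1) G(2) div(1)]
    by (simp add: exchange_ext_def exchange_int_def)
  ultimately have balance: "(LINT x:G|lebesgue. m x (u t x) \<bullet> v t x) =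
      - dissipation_on W G (u t) + exchange_ext T W G (u t) + exchange_int T W G (u t) + source_on T G (u t)"
    by simp
  have "((\<lambda>s. LINT x:G|lebesgue. storage T x (u s x)) has_real_derivative (LINT x:G|lebesgue. m x (u t x) \<bullet> v t x))
      (at t within {0..\<tau>})"
  proof (rule has_derivative_under_integral[where k="\<lambda>s x. storage T x (u s x)" and H="\<lambda>s x. m x (u s x) \<bullet> v s x", OF Gm _ K])
    show "G \<subseteq> closure ?\<Omega>" using G(2) closure_subset by blast
    show "continuous_on {0..\<tau>} (\<lambda>s. storage T x (u s x))" if x: "x \<in> G" for x
    proof -
      have x': "x \<in> ?\<Omega>" "x \<in> closure ?\<Omega>" using x G(2) closure_subset by auto
      have "continuous_on ?U (storage T x)"
        using m(2)[OF x'(1)] has_derivative_continuous continuous_at_imp_continuous_on by blast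
      moreover have "continuous_on {0..\<tau>} (\<lambda>s. u s x)"
      proof -
        have "continuous_on {0..\<tau>} (\<lambda>s. (s, x))" by (intro continuous_intros)
        moreover have "(\<lambda>s. (s, x)) ` {0..\<tau>} \<subseteq> {0..\<tau>} \<times> closure ?\<Omega>" using x'(2) by auto
        ultimately have "continuous_on {0..\<tau>} (\<lambda>s. case (s, x) of (s, x) \<Rightarrow> u s x)"
          by (rule continuous_on_compose2[OF cu])
        then show ?thesis by simp
      qed
      ultimately show ?thesis by (rule continuous_on_compose2) (use inU x'(2) in auto)
    qed
    show "((\<lambda>s. storage T x (u s x)) has_real_derivative m x (u s x) \<bullet> v s x) (at s)"
      if x: "x \<in> G" and s: "s \<in> {0<..<\<tau>}" for x s
    proof -
      have x': "x \<in> ?\<Omega>" "x \<in> closure ?\<Omega>" using x G(2) closure_subset by auto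
      have "(storage T x has_derivative (\<lambda>h. m x (u s x) \<bullet> h)) (at (u s x))"
        using s by (intro m(2) x' inU) auto
      from has_derivative_compose[OF v(2)[OF s x'(1), unfolded has_vector_derivative_def] this]
      show ?thesis by (simp add: has_field_derivative_def mult.commute[of _ "m x (u s x) \<bullet> v s x"])
    qed
    show "set_integrable lebesgue G (\<lambda>x. storage T x (u s x))" if "s \<in> {0..\<tau>}" for s
      using fld[OF that] by (intro iG) (simp add: field_space_def)
    show "continuous_on ({0..\<tau>} \<times> closure ?\<Omega>) (\<lambda>(s, x). m x (u s x) \<bullet> v s x)"
      using continuous_on_inner[OF c\<mu> v(1)] by (simp add: case_prod_unfold)
    show "set_integrable lebesgue G (\<lambda>x. m x (u t x) \<bullet> v t x)" by (rule iG) (rule wd(1))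
  qed (rule t)
  then show ?thesis unfolding balance free_energy_on_def .
qed

end
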